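(* Let $a\in\widetilde S^d_{1,1}(\mathbb R^n\times\mathbb R^n)$. Then $D(a(x,D))=\mathcal S'(\mathbb R^n)$, $a(x,D)\colon\mathcal S'(\mathbb R^n)\to\mathcal S'(\mathbb R^n)$ is continuous with adjoint in $\mathrm{OP}(S^d_{1,1})$, and for every modulation function $\psi$ and every $u\in\mathcal S'(\mathbb R^n)$ the three series $$\sum_{k=h}^\infty a^{k-h}(x,D)u_k,\quad \sum_{k=0}^\infty\big((a^k-a^{k-h})(x,D)u_k+a_k(x,D)(u^{k-1}-u^{k-h})\big),\quad \sum_{j=h}^\infty a_j(x,D)u^{j-h}$$ converge rapidly in $\mathcal S'(\mathbb R^n)$, equal $a^{(1)}(x,D)u$, $a^{(2)}(x,D)u$, $a^{(3)}(x,D)u$ respectively, and sum to $a(x,D)u$.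
   Context: $S^d_{1,1}$: smooth $a$ with $|D^\alpha_\eta D^\beta_xa(x,\eta)|\le C_{\alpha\beta}(1+|\eta|)^{d-|\alpha|+|\beta|}$; $a^*(x,\eta)=e^{iD_x\cdot D_\eta}\overline{a(x,\eta)}$ is the adjoint symbol; $\widetilde S^d_{1,1}=\{a\in S^d_{1,1}:a^*\in S^d_{1,1}\}$. $\hat a=\mathcal F_{x\to\xi}a$. Type $1,1$-operators: $u\in\mathcal S'$ is in $D(b(x,D))$ iff for every $\Psi\in C_0^\infty(\mathbb R^n)$ equal to $1$ near $0$ the limit $\lim_{m\to\infty}\mathrm{OP}(\Psi(2^{-m}D_x)b(x,\eta)\Psi(2^{-m}\eta))u$ exists in $\mathcal D'$ and is independent of $\Psi$; $b(x,D)u$ is this limit ($\mathrm{OP}(c)u=(2\pi)^{-n}\int e^{ix\cdot\eta}c(x,\eta)\hat u(\eta)d\eta$, $\Psi(2^{-m}D_x)b$ has partial Fourier transform $\Psi(2^{-m}\xi)\hat b(\xi,\eta)$). Setup: modulation function $\psi\in C_0^\infty(\mathbb R^n)$ with $\psi(\xi)=1$ for $|\xi|\le r$, $\psi(\xi)=0$ for $|\xi|\ge R$, $R>r>0$, $R\ge1$; $h\in\mathbb N$ with $2R<r2^h$; $\varphi=\psi-\psi(2\cdot)$. For $j\ge1$: $u_j=\varphi(2^{-j}D)u$, $u^j=\psi(2^{-j}D)u$; $a_j,a^j$ symbols with partial Fourier transforms $\varphi(2^{-j}\xi)\hat a$, $\psi(2^{-j}\xi)\hat a$; $u_0=u^0=\psi(D)u$,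 $a_0=a^0=\psi(D_x)a$; all $0$ for negative index. Symbols: $a^{(1)}=\sum_{k\ge h}a^{k-h}(x,\eta)\varphi(2^{-k}\eta)$, $a^{(3)}=\sum_{j\ge h}a_j(x,\eta)\psi(2^{-(j-h)}\eta)$, $a^{(2)}=a-a^{(1)}-a^{(3)}$. Rapid convergence: $\sum_{j\ge k}\langle u_j,\phi\rangle=O(2^{-kN})$ for all $N>0$, $\phi\in\mathcal S$. *)

theory Defs
  imports "HOL-Analysis.Analysis"
begin

text \<open>Iterated directional (Frechet) derivatives along a list of directions.
  For directions taken from Basis these are the partial derivatives; a
  multi-index corresponds to a list of basis vectors (order irrelevant for
  smooth functions).\<close>

primrec Dlist :: "'a::euclidean_space list \<Rightarrow> ('a \<Rightarrow> complex) \<Rightarrow> 'a \<Rightarrow> complex" where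
  "Dlist [] f = f"
| "Dlist (v # vs) f = (\<lambda>x. frechet_derivative (Dlist vs f) (at x) v)"

definition smooth :: "('a::euclidean_space \<Rightarrow> complex) \<Rightarrow> bool" where
  "smooth f \<longleftrightarrow> (\<forall>vs\<in>lists Basis. \<forall>x. Dlist vs f differentiable (at x))"

definition Schwartz :: "('a::euclidean_space \<Rightarrow> complex) set" where
  "Schwartz = {f. smooth f \<and>
     (\<forall>vs\<in>lists Basis. \<forall>k::nat. \<exists>C. \<forall>x. (1 + norm x) ^ k * norm (Dlist vs f x) \<le> C)}"

definition snorm :: "nat \<Rightarrow> ('a::euclidean_space \<Rightarrow> complex) \<Rightarrow> real" where
  "snorm N f = (SUP p \<in> UNIV \<times> {vs \<in> lists Basis. length vs \<le> N}.
                  (1 + norm (fst p)) ^ N * norm (Dlist (snd p) f (fst p)))"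

definition test :: "('a::euclidean_space \<Rightarrow> complex) set" where
  "test = {f. smooth f \<and> compact (closure {x. f x \<noteq> 0})}"

text \<open>A tempered distribution is a continuous linear functional on the Schwartz
  space, normalised to be 0 outside the Schwartz space.  Elements of D' are
  represented as functionals on test functions (normalised to be 0 elsewhere).\<close>

definition tempered :: "(('a::euclidean_space \<Rightarrow> complex) \<Rightarrow> complex) \<Rightarrow> bool" where
  "tempered T \<longleftrightarrow>
     (\<forall>\<phi>. \<phi> \<notin> Schwartz \<longrightarrow> T \<phi> = 0) \<and>
     (\<forall>\<phi>\<in>Schwartz. \<forall>g\<in>Schwartz. T (\<lambda>x. \<phi> x + g x) = T \<phi> + T g) \<and>
     (\<forall>\<phi>\<in>Schwartz. \<forall>c. T (\<lambda>x. c * \<phi> x) = c * T \<phi>) \<and>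
     (\<exists>N C. \<forall>\<phi>\<in>Schwartz. norm (T \<phi>) \<le> C * snorm N \<phi>)"

definition extends_to :: "(('a::euclidean_space \<Rightarrow> complex) \<Rightarrow> complex) \<Rightarrow> (('a \<Rightarrow> complex) \<Rightarrow> complex) \<Rightarrow> bool" where
  "extends_to T S \<longleftrightarrow> tempered S \<and> (\<forall>\<phi>\<in>test. S \<phi> = T \<phi>)"

definition text_ext :: "(('a::euclidean_space \<Rightarrow> complex) \<Rightarrow> complex) \<Rightarrow> (('a \<Rightarrow> complex) \<Rightarrow> complex)" where
  "text_ext T = (THE S. extends_to T S)"

definition fdist :: "('a::euclidean_space \<Rightarrow> complex) \<Rightarrow> (('a \<Rightarrow> complex) \<Rightarrow> complex)" where
  "fdist f = (\<lambda>\<phi>. if \<phi> \<in> Schwartz then (\<integral>x. f x * \<phi> x \<partial>lborel) else 0)"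

definition dzero :: "('a::euclidean_space \<Rightarrow> complex) \<Rightarrow> complex" where
  "dzero = (\<lambda>\<phi>. 0)"

definition dadd :: "(('a::euclidean_space \<Rightarrow> complex) \<Rightarrow> complex) \<Rightarrow> (('a \<Rightarrow> complex) \<Rightarrow> complex) \<Rightarrow> (('a \<Rightarrow> complex) \<Rightarrow> complex)" where
  "dadd S T = (\<lambda>\<phi>. S \<phi> + T \<phi>)"

definition ddiff :: "(('a::euclidean_space \<Rightarrow> complex) \<Rightarrow> complex) \<Rightarrow> (('a \<Rightarrow> complex) \<Rightarrow> complex) \<Rightarrow> (('a \<Rightarrow> complex) \<Rightarrow> complex)" where
  "ddiff S T = (\<lambda>\<phi>. S \<phi> - T \<phi>)"

definition Four :: "('a::euclidean_space \<Rightarrow> complex) \<Rightarrow> 'a \<Rightarrow> complex" where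
  "Four \<phi> \<xi> = (\<integral>x. cis (- (x \<bullet> \<xi>)) * \<phi> x \<partial>lborel)"

definition Finv :: "('a::euclidean_space \<Rightarrow> complex) \<Rightarrow> 'a \<Rightarrow> complex" where
  "Finv \<phi> x = complex_of_real ((2 * pi) powr (- real DIM('a))) * (\<integral>\<xi>. cis (x \<bullet> \<xi>) * \<phi> \<xi> \<partial>lborel)"

definition Four_dist :: "(('a::euclidean_space \<Rightarrow> complex) \<Rightarrow> complex) \<Rightarrow> (('a \<Rightarrow> complex) \<Rightarrow> complex)" where
  "Four_dist u = (\<lambda>\<phi>. if \<phi> \<in> Schwartz then u (Four \<phi>) else 0)"

definition Finv_dist :: "(('a::euclidean_space \<Rightarrow> complex) \<Rightarrow> complex) \<Rightarrow> (('a \<Rightarrow> complex) \<Rightarrow> complex)" where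
  "Finv_dist u = (\<lambda>\<phi>. if \<phi> \<in> Schwartz then u (Finv \<phi>) else 0)"

definition mult_dist :: "('a::euclidean_space \<Rightarrow> complex) \<Rightarrow> (('a \<Rightarrow> complex) \<Rightarrow> complex) \<Rightarrow> (('a \<Rightarrow> complex) \<Rightarrow> complex)" where
  "mult_dist m u = (\<lambda>\<phi>. if \<phi> \<in> Schwartz then u (\<lambda>x. m x * \<phi> x) else 0)"

definition fmult :: "('a::euclidean_space \<Rightarrow> complex) \<Rightarrow> (('a \<Rightarrow> complex) \<Rightarrow> complex) \<Rightarrow> (('a \<Rightarrow> complex) \<Rightarrow> complex)" where
  "fmult m u = Finv_dist (mult_dist m (Four_dist u))"

text \<open>\<open>m(D_x) b\<close> for a symbol \<open>b(x,\<eta>)\<close>: the partial Fourier transform of the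
  result is \<open>m(\<xi>) \<hat>b(\<xi>,\<eta>)\<close>, i.e. convolution in \<open>x\<close> with \<open>F^{-1} m\<close>.\<close>
definition xmult :: "('a::euclidean_space \<Rightarrow> complex) \<Rightarrow> ('a \<times> 'a \<Rightarrow> complex) \<Rightarrow> ('a \<times> 'a \<Rightarrow> complex)" where
  "xmult m b = (\<lambda>z. \<integral>y. Finv m y * b (fst z - y, snd z) \<partial>lborel)"

definition dilate :: "real \<Rightarrow> ('a::euclidean_space \<Rightarrow> complex) \<Rightarrow> ('a \<Rightarrow> complex)" where
  "dilate t f = (\<lambda>\<xi>. f (t *\<^sub>R \<xi>))"

definition nx :: "('a::euclidean_space \<times> 'a) list \<Rightarrow> nat" where
  "nx vs = length (filter (\<lambda>v. snd v = 0) vs)"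

definition neta :: "('a::euclidean_space \<times> 'a) list \<Rightarrow> nat" where
  "neta vs = length (filter (\<lambda>v. fst v = 0) vs)"

definition S11 :: "real \<Rightarrow> ('a::euclidean_space \<times> 'a \<Rightarrow> complex) set" where
  "S11 d = {a. smooth a \<and>
     (\<forall>vs\<in>lists Basis. \<exists>C. \<forall>x \<eta>.
        norm (Dlist vs a (x, \<eta>)) \<le> C * (1 + norm \<eta>) powr (d - real (neta vs) + real (nx vs)))}"

text \<open>Adjoint symbol \<open>a^* = e^{iD_x\<cdot>D_\<eta>} \<bar>a\<close>, computed in \<open>S'(R^n \<times> R^n)\<close> as the
  Fourier multiplier with symbol \<open>e^{i \<xi>\<cdot>\<theta>}\<close> applied to \<open>\<bar>a\<close>;
  \<open>is_adjoint_symbol a c\<close> says that this distribution is the function \<open>c\<close>.\<close>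
definition is_adjoint_symbol :: "('a::euclidean_space \<times> 'a \<Rightarrow> complex) \<Rightarrow> ('a \<times> 'a \<Rightarrow> complex) \<Rightarrow> bool" where
  "is_adjoint_symbol a c \<longleftrightarrow>
     fdist c = fmult (\<lambda>w. cis (fst w \<bullet> snd w)) (fdist (\<lambda>z. cnj (a z)))"

definition tS11 :: "real \<Rightarrow> ('a::euclidean_space \<times> 'a \<Rightarrow> complex) set" where
  "tS11 d = {a. a \<in> S11 d \<and> (\<exists>c \<in> S11 d. is_adjoint_symbol a c)}"

text \<open>\<open>OP(c)u(x) = (2\<pi>)^{-n} \<langle>\<hat>u, e^{ix\<cdot>\<eta>} c(x,\<eta>)\<rangle>\<close> for symbols with compact
  support in \<open>\<eta>\<close>, viewed as an element of D'.\<close>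
definition OPfun :: "('a::euclidean_space \<times> 'a \<Rightarrow> complex) \<Rightarrow> (('a \<Rightarrow> complex) \<Rightarrow> complex) \<Rightarrow> 'a \<Rightarrow> complex" where
  "OPfun c u x = complex_of_real ((2 * pi) powr (- real DIM('a))) *
       Four_dist u (\<lambda>\<eta>. cis (x \<bullet> \<eta>) * c (x, \<eta>))"

definition OP :: "('a::euclidean_space \<times> 'a \<Rightarrow> complex) \<Rightarrow> (('a \<Rightarrow> complex) \<Rightarrow> complex) \<Rightarrow> (('a \<Rightarrow> complex) \<Rightarrow> complex)" where
  "OP c u = (\<lambda>\<phi>. if \<phi> \<in> test then (\<integral>x. OPfun c u x * \<phi> x \<partial>lborel) else 0)"

definition cutoffs :: "('a::euclidean_space \<Rightarrow> complex) set" where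
  "cutoffs = {\<Psi>. \<Psi> \<in> test \<and> (\<exists>\<epsilon>>0. \<forall>\<xi>. norm \<xi> < \<epsilon> \<longrightarrow> \<Psi> \<xi> = 1)}"

definition regsym :: "('a::euclidean_space \<Rightarrow> complex) \<Rightarrow> nat \<Rightarrow> ('a \<times> 'a \<Rightarrow> complex) \<Rightarrow> ('a \<times> 'a \<Rightarrow> complex)" where
  "regsym \<Psi> m b = (\<lambda>z. xmult (dilate (2 powr - real m) \<Psi>) b z * \<Psi> ((2 powr - real m) *\<^sub>R snd z))"

definition dom11 :: "('a::euclidean_space \<times> 'a \<Rightarrow> complex) \<Rightarrow> (('a \<Rightarrow> complex) \<Rightarrow> complex) set" where
  "dom11 b = {u. tempered u \<and> (\<exists>T. \<forall>\<Psi>\<in>cutoffs. \<forall>\<phi>\<in>test.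
                   (\<lambda>m. OP (regsym \<Psi> m b) u \<phi>) \<longlonglongrightarrow> T \<phi>)}"

definition typ11 :: "('a::euclidean_space \<times> 'a \<Rightarrow> complex) \<Rightarrow> (('a \<Rightarrow> complex) \<Rightarrow> complex) \<Rightarrow> (('a \<Rightarrow> complex) \<Rightarrow> complex)" where
  "typ11 b u = (THE T. (\<forall>\<phi>. \<phi> \<notin> test \<longrightarrow> T \<phi> = 0) \<and>
                 (\<forall>\<Psi>\<in>cutoffs. \<forall>\<phi>\<in>test. (\<lambda>m. OP (regsym \<Psi> m b) u \<phi>) \<longlonglongrightarrow> T \<phi>))"

definition rapid_conv :: "(nat \<Rightarrow> ('a::euclidean_space \<Rightarrow> complex) \<Rightarrow> complex) \<Rightarrow> (('a \<Rightarrow> complex) \<Rightarrow> complex) \<Rightarrow> bool" where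
  "rapid_conv Ts T \<longleftrightarrow>
     (\<forall>k. \<exists>S. extends_to (Ts k) S) \<and> (\<exists>S. extends_to T S) \<and>
     (\<forall>\<phi>\<in>Schwartz. (\<lambda>k. text_ext (Ts k) \<phi>) sums (text_ext T \<phi>) \<and>
        (\<forall>N>0::real. \<exists>C. \<forall>k::nat.
            norm (\<Sum>j. text_ext (Ts (j + k)) \<phi>) \<le> C * 2 powr (- (real k * N))))"

definition modulation :: "('a::euclidean_space \<Rightarrow> complex) \<Rightarrow> real \<Rightarrow> real \<Rightarrow> bool" where
  "modulation \<psi> r R \<longleftrightarrow> \<psi> \<in> test \<and> 0 < r \<and> r < R \<and> 1 \<le> R \<and>
     (\<forall>\<xi>. norm \<xi> \<le> r \<longrightarrow> \<psi> \<xi> = 1) \<and> (\<forall>\<xi>. norm \<xi> \<ge> R \<longrightarrow> \<psi> \<xi> = 0)"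

definition phi :: "('a::euclidean_space \<Rightarrow> complex) \<Rightarrow> 'a \<Rightarrow> complex" where
  "phi \<psi> = (\<lambda>\<xi>. \<psi> \<xi> - \<psi> (2 *\<^sub>R \<xi>))"

definition sym_up :: "('a::euclidean_space \<Rightarrow> complex) \<Rightarrow> ('a \<times> 'a \<Rightarrow> complex) \<Rightarrow> int \<Rightarrow> ('a \<times> 'a \<Rightarrow> complex)" where
  "sym_up \<psi> a j = (if j < 0 then (\<lambda>z. 0) else xmult (dilate (2 powr - real_of_int j) \<psi>) a)"

definition sym_low :: "('a::euclidean_space \<Rightarrow> complex) \<Rightarrow> ('a \<times> 'a \<Rightarrow> complex) \<Rightarrow> int \<Rightarrow> ('a \<times> 'a \<Rightarrow> complex)" where
  "sym_low \<psi> a j = (if j < 0 then (\<lambda>z. 0) else if j = 0 then xmult \<psi> a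
                     else xmult (dilate (2 powr - real_of_int j) (phi \<psi>)) a)"

definition dist_up :: "('a::euclidean_space \<Rightarrow> complex) \<Rightarrow> (('a \<Rightarrow> complex) \<Rightarrow> complex) \<Rightarrow> int \<Rightarrow> (('a \<Rightarrow> complex) \<Rightarrow> complex)" where
  "dist_up \<psi> u j = (if j < 0 then dzero else fmult (dilate (2 powr - real_of_int j) \<psi>) u)"

definition dist_low :: "('a::euclidean_space \<Rightarrow> complex) \<Rightarrow> (('a \<Rightarrow> complex) \<Rightarrow> complex) \<Rightarrow> int \<Rightarrow> (('a \<Rightarrow> complex) \<Rightarrow> complex)" where
  "dist_low \<psi> u j = (if j < 0 then dzero else if j = 0 then fmult \<psi> u
                      else fmult (dilate (2 powr - real_of_int j) (phi \<psi>)) u)"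

definition sym_diff :: "('a \<Rightarrow> complex) \<Rightarrow> ('a \<Rightarrow> complex) \<Rightarrow> ('a \<Rightarrow> complex)" where
  "sym_diff f g = (\<lambda>z. f z - g z)"

definition sym1 :: "('a::euclidean_space \<Rightarrow> complex) \<Rightarrow> nat \<Rightarrow> ('a \<times> 'a \<Rightarrow> complex) \<Rightarrow> ('a \<times> 'a \<Rightarrow> complex)" where
  "sym1 \<psi> h a = (\<lambda>z. \<Sum>k. if h \<le> k then sym_up \<psi> a (int k - int h) z * phi \<psi> ((2 powr - real k) *\<^sub>R snd z) else 0)"

definition sym3 :: "('a::euclidean_space \<Rightarrow> complex) \<Rightarrow> nat \<Rightarrow> ('a \<times> 'a \<Rightarrow> complex) \<Rightarrow> ('a \<times> 'a \<Rightarrow> complex)" where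
  "sym3 \<psi> h a = (\<lambda>z. \<Sum>j. if h \<le> j then sym_low \<psi> a (int j) z * \<psi> ((2 powr - real (j - h)) *\<^sub>R snd z) else 0)"

definition sym2 :: "('a::euclidean_space \<Rightarrow> complex) \<Rightarrow> nat \<Rightarrow> ('a \<times> 'a \<Rightarrow> complex) \<Rightarrow> ('a \<times> 'a \<Rightarrow> complex)" where
  "sym2 \<psi> h a = (\<lambda>z. a z - sym1 \<psi> h a z - sym3 \<psi> h a z)"

definition series1 :: "('a::euclidean_space \<Rightarrow> complex) \<Rightarrow> nat \<Rightarrow> ('a \<times> 'a \<Rightarrow> complex) \<Rightarrow> (('a \<Rightarrow> complex) \<Rightarrow> complex) \<Rightarrow> nat \<Rightarrow> (('a \<Rightarrow> complex) \<Rightarrow> complex)" where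
  "series1 \<psi> h a u k = (if k < h then dzero
      else typ11 (sym_up \<psi> a (int k - int h)) (dist_low \<psi> u (int k)))"

definition series2 :: "('a::euclidean_space \<Rightarrow> complex) \<Rightarrow> nat \<Rightarrow> ('a \<times> 'a \<Rightarrow> complex) \<Rightarrow> (('a \<Rightarrow> complex) \<Rightarrow> complex) \<Rightarrow> nat \<Rightarrow> (('a \<Rightarrow> complex) \<Rightarrow> complex)" where
  "series2 \<psi> h a u k = dadd
      (typ11 (sym_diff (sym_up \<psi> a (int k)) (sym_up \<psi> a (int k - int h))) (dist_low \<psi> u (int k)))
      (typ11 (sym_low \<psi> a (int k)) (ddiff (dist_up \<psi> u (int k - 1)) (dist_up \<psi> u (int k - int h))))"

definition series3 :: "('a::euclidean_space \<Rightarrow> complex) \<Rightarrow> nat \<Rightarrow> ('a \<times> 'a \<Rightarrow> complex) \<Rightarrow> (('a \<Rightarrow> complex) \<Rightarrow> complex) \<Rightarrow> nat \<Rightarrow> (('a \<Rightarrow> complex) \<Rightarrow> complex)" where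
  "series3 \<psi> h a u j = (if j < h then dzero
      else typ11 (sym_low \<psi> a (int j)) (dist_up \<psi> u (int j - int h)))"

definition series_terms_defined :: "('a::euclidean_space \<Rightarrow> complex) \<Rightarrow> nat \<Rightarrow> ('a \<times> 'a \<Rightarrow> complex) \<Rightarrow> (('a \<Rightarrow> complex) \<Rightarrow> complex) \<Rightarrow> bool" where
  "series_terms_defined \<psi> h a u \<longleftrightarrow>
     (\<forall>k\<ge>h. dist_low \<psi> u (int k) \<in> dom11 (sym_up \<psi> a (int k - int h))) \<and>
     (\<forall>k. dist_low \<psi> u (int k) \<in> dom11 (sym_diff (sym_up \<psi> a (int k)) (sym_up \<psi> a (int k - int h))) \<and>
          ddiff (dist_up \<psi> u (int k - 1)) (dist_up \<psi> u (int k - int h)) \<in> dom11 (sym_low \<psi> a (int k))) \<and>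
     (\<forall>j\<ge>h. dist_up \<psi> u (int j - int h) \<in> dom11 (sym_low \<psi> a (int j)))"

end

theory Submission
  imports Defs "HOL-Probability.Probability"
begin

text \<open>If \<open>a\<close> has an adjoint symbol of type \<open>1,1\<close>, then the transpose of \<open>a(x,D)\<close> maps Schwartz functions to Schwartz
  functions: it is given by an oscillatory integral with symbol \<open>c(x,\<eta>)\<close>, the conjugate of \<open>a\<^sup>*\<close>, and oscillatory
  integrals preserve bounded families.  Averaging the duality over translations in \<open>x\<close> shows that \<open>m(D\<^sub>x)a\<close> is dual to
  \<open>m(D\<^sub>x)c\<close>.  Hence \<open>OP(m(D\<^sub>x)a(x,\<eta>)w(\<eta>))u\<close> tested against \<open>\<phi>\<close> is \<open>u\<close> tested against \<open>w(D)\<close> of the transpose with symbol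
  \<open>m(D\<^sub>x)c\<close> applied to \<open>\<phi>\<close>, a bilinear expression in \<open>(m,w)\<close> that is continuous under regularisation, which gives
  the domain, the continuity and the adjoint.

  In the three series every term contains a dyadic block \<open>\<phi>(2\<^sup>-\<^sup>k\<cdot>)\<close> in \<open>m\<close> or in \<open>w\<close>.  Since \<open>\<phi>\<close> vanishes near the origin, the
  block is \<open>O(2\<^sup>-\<^sup>k\<^sup>N)\<close> as a multiplier of polynomial growth, and so is the average of a fixed symbol against its inverse
  transform.  This gives rapid convergence and, by dominated convergence (Tannery), the limits defining the operators of
  \<open>a\<^sup>(\<^sup>1\<^sup>)\<close> and \<open>a\<^sup>(\<^sup>3\<^sup>)\<close>; the sum of all three series telescopes to \<open>a(x,D)u\<close>.\<close>

text \<open>Distributions occur here as bare functionals, and limits in m, sums over k and integrals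
  over x all have to pass through them. The device is the bounded family. A bound by some
  \<open>snorm\<close> means exactly that bounded families of Schwartz functions have bounded
  images. So a limit is proved by showing that 2^m times the error is a bounded family, and a rapid
  series by showing the same for 2^(kN) times its terms. Moving u out of the integral over x in
  \<open>OP\<close> follows the pattern with dyadic Riemann sums, whose errors multiplied by 2^l
  stay bounded.

  Type 1,1 estimates lose a power of eta with every x-derivative, which rules out the usual
  asymptotic calculus. Polynomial growth in eta, uniform in x, absorbs that loss and is stable under
  translation and averaging in x; against a rapidly decreasing function of eta it suffices for an
  oscillatory integral to be a Schwartz function. For a alone this gives an action on Schwartz
  functions. To act on all of S' the transpose must have the same form, which is why the adjoint
  symbol has to be of type 1,1 as well.\<close>

definition pd :: "'a::euclidean_space \<Rightarrow> ('a \<Rightarrow> complex) \<Rightarrow> 'a \<Rightarrow> complex" where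
  "pd v f = (\<lambda>x. frechet_derivative f (at x) v)"

lemma Dlist_Cons_pd [simp]: "Dlist (v # vs) f = pd v (Dlist vs f)"
  by (simp add: pd_def)

declare Dlist.simps(2) [simp del]

lemma Dlist_append: "Dlist (us @ vs) f = Dlist us (Dlist vs f)"
  by (induction us) auto

lemma pd_eqI: "(\<And>x. (f has_derivative f' x) (at x)) \<Longrightarrow> pd v f = (\<lambda>x. f' x v)"
  unfolding pd_def using frechet_derivative_at by metis

text \<open>Only derivatives along \<open>Basis\<close> are controlled by \<open>smooth\<close> and
  by the families below, so the full derivative is rebuilt from them by linearity.\<close>

lemma has_derivative_pd:
  assumes "f differentiable (at x)"
  shows "(f has_derivative (\<lambda>v. \<Sum>b\<in>Basis. complex_of_real (v \<bullet> b) * pd b f x)) (at x)"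
proof -
  let ?F = "frechet_derivative f (at x)"
  have F: "(f has_derivative ?F) (at x)"
    using assms frechet_derivative_works by blast
  interpret F: bounded_linear ?F using F has_derivative_bounded_linear by blast
  have "?F v = (\<Sum>b\<in>Basis. complex_of_real (v \<bullet> b) * pd b f x)" for v
  proof -
    have "?F v = ?F (\<Sum>b\<in>Basis. (v \<bullet> b) *\<^sub>R b)" by (simp add: euclidean_representation)
    also have "\<dots> = (\<Sum>b\<in>Basis. (v \<bullet> b) *\<^sub>R ?F b)" by (simp add: F.sum F.scaleR)
    finally show ?thesis by (simp add: pd_def scaleR_conv_of_real)
  qed
  then have "?F = (\<lambda>v. \<Sum>b\<in>Basis. complex_of_real (v \<bullet> b) * pd b f x)" by blast
  with F show ?thesis by simp
qed

lemma pd_has_derivative: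
  assumes "f differentiable (at x)"
  shows "(f has_derivative (\<lambda>v. pd v f x)) (at x)"
  unfolding pd_def using assms frechet_derivative_works by (metis eta_contract_eq)

lemma pd_add:
  assumes "\<And>x. f differentiable (at x)" "\<And>x. g differentiable (at x)"
  shows "pd v (\<lambda>x. f x + g x) = (\<lambda>x. pd v f x + pd v g x)"
  by (rule pd_eqI) (intro has_derivative_add pd_has_derivative assms)

lemma pd_mult:
  assumes "\<And>x. f differentiable (at x)" "\<And>x. g differentiable (at x)"
  shows "pd v (\<lambda>x. f x * g x) = (\<lambda>x. f x * pd v g x + pd v f x * g x)"
  by (rule pd_eqI) (intro has_derivative_mult pd_has_derivative assms)

lemma pd_cmult:
  assumes "\<And>x. f differentiable (at x)"
  shows "pd v (\<lambda>x. c * f x) = (\<lambda>x. c * pd v f x)"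
  by (rule pd_eqI) (intro has_derivative_mult_right pd_has_derivative assms)

lemma pd_const [simp]: "pd v (\<lambda>x. c) = (\<lambda>x. 0)"
  by (rule pd_eqI) (rule has_derivative_const)

lemma pd_linear:
  assumes "bounded_linear L"
  shows "pd v L = (\<lambda>x. L v)"
  by (rule pd_eqI) (rule bounded_linear_imp_has_derivative[OF assms])

lemma pd_cnj:
  assumes "\<And>x. f differentiable (at x)"
  shows "pd v (\<lambda>x. cnj (f x)) = (\<lambda>x. cnj (pd v f x))"
  by (rule pd_eqI) (intro has_derivative_cnj pd_has_derivative assms)

lemma has_derivative_affine:
  fixes f :: "'b::euclidean_space \<Rightarrow> complex" and L :: "'a::euclidean_space \<Rightarrow> 'b"
  assumes "linear L" "f differentiable (at (c + L x))"
  shows "((\<lambda>x. f (c + L x)) has_derivative (\<lambda>v. pd (L v) f (c + L x))) (at x)"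
proof -
  have bl: "bounded_linear L" using assms(1) by (simp add: linear_conv_bounded_linear)
  have 1: "((\<lambda>x. c + L x) has_derivative L) (at x)"
    using has_derivative_add[OF has_derivative_const[of c] bounded_linear_imp_has_derivative[OF bl]] by simp
  show ?thesis
    by (rule has_derivative_compose[OF 1 pd_has_derivative[OF assms(2)]])
qed

text \<open>The direction \<open>L v\<close> is in general not a basis vector; expanding it in
  \<open>Basis\<close> keeps all iterated derivatives within \<open>lists Basis\<close>.\<close>

lemma pd_affine:
  fixes f :: "'b::euclidean_space \<Rightarrow> complex"
  assumes "linear L" "\<And>x. f differentiable (at x)"
  shows "pd v (\<lambda>x. f (c + L x)) = (\<lambda>x. \<Sum>b\<in>Basis. complex_of_real (L v \<bullet> b) * pd b f (c + L x))"
proof -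
  have 1: "pd v (\<lambda>x. f (c + L x)) = (\<lambda>x. pd (L v) f (c + L x))"
    by (rule pd_eqI) (rule has_derivative_affine[OF assms])
  have "pd w f y = (\<Sum>b\<in>Basis. complex_of_real (w \<bullet> b) * pd b f y)" for w y
    using pd_eqI[OF has_derivative_pd[OF assms(2)]] by metis
  then show ?thesis unfolding 1 by (intro ext)
qed

section \<open>Bounded families of smooth functions\<close>

text \<open>\<open>Q\<close> is an estimate on the indexed family as a whole and is imposed on each
  derivative separately, so constants hidden in \<open>Q\<close> may depend on \<open>vs\<close> but
  not on the index.\<close>

definition fam :: "(('i \<Rightarrow> 'a::euclidean_space \<Rightarrow> complex) \<Rightarrow> bool) \<Rightarrow> ('i \<Rightarrow> 'a \<Rightarrow> complex) \<Rightarrow> bool" where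
  "fam Q f \<longleftrightarrow> (\<forall>i. smooth (f i)) \<and> (\<forall>vs\<in>lists Basis. Q (\<lambda>i. Dlist vs (f i)))"

text \<open>Induction on \<open>vs\<close> keeps every iterated derivative inside the class
  \<open>X\<close>. It is therefore enough to find a class closed under one derivative at a time,
  and Leibniz or higher chain rules never have to be written out.\<close>

lemma fam_coinduct:
  assumes "X f"
    and "\<And>f. X f \<Longrightarrow> Q f"
    and "\<And>f i x. X f \<Longrightarrow> f i differentiable (at x)"
    and "\<And>f v. X f \<Longrightarrow> v \<in> Basis \<Longrightarrow> X (\<lambda>i. pd v (f i))"
  shows "fam Q f"
proof -
  have *: "X (\<lambda>i. Dlist vs (f i))" if "vs \<in> lists Basis" for vs
    using that
  proof (induction vs)
    case Nil then show ?case using assms(1) by (simp add: eta_contract_eq)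
  next
    case (Cons v vs)
    then show ?case using assms(4)[of "\<lambda>i. Dlist vs (f i)" v] by simp
  qed
  then show ?thesis unfolding fam_def smooth_def using assms(2,3) by blast
qed

lemma fam_Q: "fam Q f \<Longrightarrow> Q f"
proof -
  assume "fam Q f"
  then have "Q (\<lambda>i. Dlist [] (f i))" unfolding fam_def by (blast intro: lists.Nil)
  then show ?thesis by simp
qed

lemma smooth_differentiable: "smooth f \<Longrightarrow> f differentiable (at x)"
proof -
  assume "smooth f"
  then have "Dlist [] f differentiable (at x)" unfolding smooth_def by (blast intro: lists.Nil)
  then show ?thesis by simp
qed

lemma fam_smooth: "fam Q f \<Longrightarrow> smooth (f i)"
  unfolding fam_def by blast

lemma fam_differentiable: "fam Q f \<Longrightarrow> f i differentiable (at x)"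
  unfolding fam_def using smooth_differentiable by blast

lemma fam_continuous: "fam Q f \<Longrightarrow> continuous_on S (f i)"
  by (meson continuous_at_imp_continuous_on differentiable_imp_continuous_within fam_differentiable)

lemma smooth_pd: "smooth f \<Longrightarrow> v \<in> Basis \<Longrightarrow> smooth (pd v f)"
  unfolding smooth_def
proof (intro ballI allI)
  fix vs :: "'a list" and x
  assume a: "\<forall>vs\<in>lists Basis. \<forall>x. Dlist vs f differentiable at x" "v \<in> Basis" "vs \<in> lists Basis"
  then have "vs @ [v] \<in> lists Basis" by auto
  with a(1) have "Dlist (vs @ [v]) f differentiable at x" by blast
  then show "Dlist vs (pd v f) differentiable at x" by (simp add: Dlist_append)
qed

lemma fam_pd: "fam Q f \<Longrightarrow> v \<in> Basis \<Longrightarrow> fam Q (\<lambda>i. pd v (f i))"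
  unfolding fam_def
proof (intro conjI ballI allI)
  fix vs :: "'b list"
  assume a: "(\<forall>i. smooth (f i)) \<and> (\<forall>vs\<in>lists Basis. Q (\<lambda>i. Dlist vs (f i)))"  "v \<in> Basis" "vs \<in> lists Basis"
  then have "vs @ [v] \<in> lists Basis" by auto
  with a(1) have "Q (\<lambda>i. Dlist (vs @ [v]) (f i))" by blast
  then show "Q (\<lambda>i. Dlist vs (pd v (f i)))" by (simp add: Dlist_append)
qed (simp add: smooth_pd)

lemma fam_mono:
  assumes "fam Q f" "\<And>f. Q f \<Longrightarrow> Q' f"
  shows "fam Q' f"
  using assms unfolding fam_def by blast

lemma fam_reindex:
  assumes "fam Q f" "\<And>f. Q f \<Longrightarrow> Q' (\<lambda>i. f (r i))"
  shows "fam Q' (\<lambda>i. f (r i))"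
  using assms unfolding fam_def by auto

lemma fam_add:
  assumes "fam Q f" "fam Q g" "\<And>f g. Q f \<Longrightarrow> Q g \<Longrightarrow> Q (\<lambda>i x. f i x + g i x)"
  shows "fam Q (\<lambda>i x. f i x + g i x)"
proof (rule fam_coinduct[where X = "\<lambda>h. \<exists>f g. fam Q f \<and> fam Q g \<and> h = (\<lambda>i x. f i x + g i x)"])
  fix h v assume "\<exists>f g. fam Q f \<and> fam Q g \<and> h = (\<lambda>i x. f i x + g i x)" and v: "(v::'b) \<in> Basis"
  then obtain f g where h: "fam Q f" "fam Q g" "h = (\<lambda>i x. f i x + g i x)" by blast
  have "(\<lambda>i. pd v (h i)) = (\<lambda>i x. pd v (f i) x + pd v (g i) x)"
    unfolding h(3) using pd_add[OF fam_differentiable[OF h(1)] fam_differentiable[OF h(2)]] by (simp add: fun_eq_iff)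
  then show "\<exists>f g. fam Q f \<and> fam Q g \<and> (\<lambda>i. pd v (h i)) = (\<lambda>i x. f i x + g i x)"
    by (intro exI conjI) (rule fam_pd[OF h(1) v], rule fam_pd[OF h(2) v], assumption)
next
  fix h assume "\<exists>f g. fam Q f \<and> fam Q g \<and> h = (\<lambda>i x. f i x + g i x)"
  then obtain f g where h: "fam Q f" "fam Q g" "h = (\<lambda>i x. f i x + g i x)" by blast
  show "Q h" unfolding h(3) by (rule assms(3)[OF fam_Q[OF h(1)] fam_Q[OF h(2)]])
  show "h i differentiable at x" for i x
    unfolding h(3) by (rule differentiable_add; rule fam_differentiable; rule h)
qed (intro exI conjI, rule assms(1), rule assms(2), rule refl)

text \<open>By the product rule, sums of products are closed under differentiation while single
  products are not; this is the class for the coinduction in \<open>fam_mult\<close>.\<close>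

inductive prodsum :: "(('i \<Rightarrow> 'a::euclidean_space \<Rightarrow> complex) \<Rightarrow> bool) \<Rightarrow> (('i \<Rightarrow> 'a \<Rightarrow> complex) \<Rightarrow> bool) \<Rightarrow> ('i \<Rightarrow> 'a \<Rightarrow> complex) \<Rightarrow> bool"
  for Q1 Q2 where
  prod: "fam Q1 f \<Longrightarrow> fam Q2 g \<Longrightarrow> prodsum Q1 Q2 (\<lambda>i x. f i x * g i x)"
| add: "prodsum Q1 Q2 f \<Longrightarrow> prodsum Q1 Q2 g \<Longrightarrow> prodsum Q1 Q2 (\<lambda>i x. f i x + g i x)"

lemma prodsum_differentiable: "prodsum Q1 Q2 h \<Longrightarrow> h i differentiable (at x)"
proof (induction arbitrary: i x rule: prodsum.induct)
  case (prod f g)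
  then show ?case by (intro differentiable_mult fam_differentiable)
next
  case (add f g)
  then show ?case by (intro differentiable_add)
qed

lemma fam_mult:
  assumes "fam Q1 f" "fam Q2 g"
    and "\<And>f g. Q1 f \<Longrightarrow> Q2 g \<Longrightarrow> Q3 (\<lambda>i x. f i x * g i x)"
    and "\<And>f g. Q3 f \<Longrightarrow> Q3 g \<Longrightarrow> Q3 (\<lambda>i x. f i x + g i x)"
  shows "fam Q3 (\<lambda>i x. f i x * g i x)"
proof (rule fam_coinduct[where X = "prodsum Q1 Q2"])
  show "prodsum Q1 Q2 (\<lambda>i x. f i x * g i x)" by (rule prodsum.prod[OF assms(1,2)])
  show "Q3 h" if "prodsum Q1 Q2 h" for h
    using that
  proof (induction rule: prodsum.induct)
    case (prod f g)
    show ?case by (rule assms(3)[OF fam_Q[OF prod(1)] fam_Q[OF prod(2)]])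
  next
    case (add f g)
    show ?case by (rule assms(4)[OF add.IH])
  qed
  show "h i differentiable at x" if "prodsum Q1 Q2 h" for h i x
    using prodsum_differentiable that .
  show "prodsum Q1 Q2 (\<lambda>i. pd v (h i))" if "prodsum Q1 Q2 h" "v \<in> Basis" for h v
    using that(1)
  proof (induction rule: prodsum.induct)
    case (prod f g)
    have "(\<lambda>i. pd v (\<lambda>x. f i x * g i x)) = (\<lambda>i x. f i x * pd v (g i) x + pd v (f i) x * g i x)"
      using pd_mult[OF fam_differentiable[OF prod(1)] fam_differentiable[OF prod(2)]] by (simp add: fun_eq_iff)
    moreover have "prodsum Q1 Q2 (\<lambda>i x. f i x * pd v (g i) x + pd v (f i) x * g i x)"
      by (intro prodsum.add prodsum.prod fam_pd prod that(2))
    ultimately show ?case by simp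
  next
    case (add f g)
    have "(\<lambda>i. pd v (\<lambda>x. f i x + g i x)) = (\<lambda>i x. pd v (f i) x + pd v (g i) x)"
      using pd_add[OF prodsum_differentiable[OF add.hyps(1)] prodsum_differentiable[OF add.hyps(2)]] by (simp add: fun_eq_iff)
    moreover have "prodsum Q1 Q2 (\<lambda>i x. pd v (f i) x + pd v (g i) x)"
      by (rule prodsum.add) (rule add.IH)+
    ultimately show ?case by simp
  qed
qed

text \<open>The chain rule along \<open>L i\<close> produces coefficients such as
  \<open>L i v \<bullet> b\<close>. The bounded real factor \<open>s i\<close> absorbs them, and
  \<open>zero\<close> starts the sums over \<open>Basis\<close>.\<close>

inductive affsum :: "(('i \<Rightarrow> 'b::euclidean_space \<Rightarrow> complex) \<Rightarrow> bool) \<Rightarrow> ('i \<Rightarrow> 'b) \<Rightarrow> ('i \<Rightarrow> 'a::euclidean_space \<Rightarrow> 'b) \<Rightarrow> ('i \<Rightarrow> 'a \<Rightarrow> complex) \<Rightarrow> bool"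
  for Q c L where
  zero: "affsum Q c L (\<lambda>i x. 0)"
| comp: "fam Q f \<Longrightarrow> (\<And>i. \<bar>s i\<bar> \<le> M) \<Longrightarrow> affsum Q c L (\<lambda>i x. complex_of_real (s i) * f i (c i + L i x))"
| add: "affsum Q c L f \<Longrightarrow> affsum Q c L g \<Longrightarrow> affsum Q c L (\<lambda>i x. f i x + g i x)"

lemma affsum_sum:
  assumes "finite S" "\<And>b. b \<in> S \<Longrightarrow> affsum Q c L (f b)"
  shows "affsum Q c L (\<lambda>i x. \<Sum>b\<in>S. f b i x)"
  using assms
proof (induction S rule: finite_induct)
  case empty
  show ?case using affsum.zero by simp
next
  case (insert b S)
  have "affsum Q c L (\<lambda>i x. f b i x + (\<Sum>b\<in>S. f b i x))"
    by (rule affsum.add[OF insert.prems[OF insertI1] insert.IH[OF insert.prems[OF insertI2]]])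
  then show ?case using insert.hyps by simp
qed

lemma fam_affine:
  fixes f :: "'i \<Rightarrow> 'b::euclidean_space \<Rightarrow> complex" and L :: "'i \<Rightarrow> 'a::euclidean_space \<Rightarrow> 'b"
  assumes "fam Q f" "\<And>i. linear (L i)" "\<And>i v. v \<in> Basis \<Longrightarrow> norm (L i v) \<le> M"
    and Q1: "\<And>f s M. Q f \<Longrightarrow> (\<And>i. \<bar>s i\<bar> \<le> M) \<Longrightarrow> Q' (\<lambda>i x. complex_of_real (s i) * f i (c i + L i x))"
    and Q0: "Q' (\<lambda>i x. 0)"
    and Q2: "\<And>f g. Q' f \<Longrightarrow> Q' g \<Longrightarrow> Q' (\<lambda>i x. f i x + g i x)"
  shows "fam Q' (\<lambda>i x. f i (c i + L i x))"
proof (rule fam_coinduct[where X = "affsum Q c L"])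
  have "affsum Q c L (\<lambda>i x. complex_of_real 1 * f i (c i + L i x))"
    by (rule affsum.comp[OF assms(1), of _ 1]) simp
  then show "affsum Q c L (\<lambda>i x. f i (c i + L i x))" by simp
  show "Q' h" if "affsum Q c L h" for h
    using that
  proof (induction rule: affsum.induct)
    case (comp f s M)
    show ?case by (rule Q1[OF fam_Q[OF comp(1)] comp(2)])
  next
    case (add f g)
    show ?case by (rule Q2[OF add.IH])
  qed (rule Q0)
  have diff1: "(\<lambda>x. f i (c i + L i x)) differentiable at x" if "fam Q f" for f i x
    using has_derivative_affine[OF assms(2) fam_differentiable[OF that]] differentiable_def by blast
  show d: "h i differentiable at x" if "affsum Q c L h" for h i x
    using that
  proof (induction arbitrary: i x rule: affsum.induct)
    case (comp f s M)
    show ?case by (intro differentiable_mult diff1[OF comp(1)] differentiable_const)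
  next
    case (add f g)
    then show ?case by (intro differentiable_add)
  qed simp
  show "affsum Q c L (\<lambda>i. pd v (h i))" if "affsum Q c L h" "v \<in> Basis" for h v
    using that(1)
  proof (induction rule: affsum.induct)
    case zero show ?case using affsum.zero by simp
  next
    case (comp f s M')
    have eq: "(\<lambda>i. pd v (\<lambda>x. complex_of_real (s i) * f i (c i + L i x))) =
      (\<lambda>i x. \<Sum>b\<in>Basis. complex_of_real (s i * (L i v \<bullet> b)) * pd b (f i) (c i + L i x))"
    proof (intro ext)
      fix i x
      have "pd v (\<lambda>x. complex_of_real (s i) * f i (c i + L i x)) = (\<lambda>x. complex_of_real (s i) * pd v (\<lambda>x. f i (c i + L i x)) x)"
        by (rule pd_cmult) (rule diff1[OF comp(1)])
      also have "pd v (\<lambda>x. f i (c i + L i x)) = (\<lambda>x. \<Sum>b\<in>Basis. complex_of_real (L i v \<bullet> b) * pd b (f i) (c i + L i x))"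
        by (rule pd_affine[OF assms(2)]) (rule fam_differentiable[OF comp(1)])
      finally show "pd v (\<lambda>x. complex_of_real (s i) * f i (c i + L i x)) x =
        (\<Sum>b\<in>Basis. complex_of_real (s i * (L i v \<bullet> b)) * pd b (f i) (c i + L i x))"
        by (simp add: sum_distrib_left mult.assoc)
    qed
    show ?case unfolding eq
    proof (rule affsum_sum[OF finite_Basis])
      fix b :: 'b assume b: "b \<in> Basis"
      show "affsum Q c L (\<lambda>i x. complex_of_real (s i * (L i v \<bullet> b)) * pd b (f i) (c i + L i x))"
      proof (rule affsum.comp[OF fam_pd[OF comp(1) b]])
        fix i
        have "\<bar>L i v \<bullet> b\<bar> \<le> M" using Basis_le_norm[OF b, of "L i v"] assms(3)[OF that(2), of i] by linarith
        then show "\<bar>s i * (L i v \<bullet> b)\<bar> \<le> M' * M"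
          unfolding abs_mult using comp(2)[of i] by (intro mult_mono) auto
      qed
    qed
  next
    case (add f g)
    have "(\<lambda>i. pd v (\<lambda>x. f i x + g i x)) = (\<lambda>i x. pd v (f i) x + pd v (g i) x)"
      using pd_add[OF d[OF add.hyps(1)] d[OF add.hyps(2)]] by (simp add: fun_eq_iff)
    moreover have "affsum Q c L (\<lambda>i x. pd v (f i) x + pd v (g i) x)"
      by (rule affsum.add) (rule add.IH)+
    ultimately show ?case by simp
  qed
qed

section \<open>Polynomial growth and rapid decay, uniformly in the index\<close>

definition OMq :: "('a \<Rightarrow> real) \<Rightarrow> ('i \<Rightarrow> 'a \<Rightarrow> complex) \<Rightarrow> bool" where
  "OMq p f \<longleftrightarrow> (\<exists>N C. \<forall>i x. norm (f i x) \<le> C * p x ^ N)"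

definition RDq :: "('a \<Rightarrow> real) \<Rightarrow> ('i \<Rightarrow> 'a \<Rightarrow> complex) \<Rightarrow> bool" where
  "RDq p f \<longleftrightarrow> (\<forall>k. \<exists>C. \<forall>i x. p x ^ k * norm (f i x) \<le> C)"

text \<open>The index of a family records uniformity: \<open>OM\<close> (after the space \<open>O\<^sub>M\<close> of multipliers) bounds each derivative by one
  polynomial in the weight \<open>p\<close>, \<open>RD\<close> makes each derivative decay rapidly.  The weight \<open>wt2\<close> sees only the frequency
  variable of a symbol.\<close>

abbreviation OM :: "('a::euclidean_space \<Rightarrow> real) \<Rightarrow> ('i \<Rightarrow> 'a \<Rightarrow> complex) \<Rightarrow> bool" where
  "OM p \<equiv> fam (OMq p)"

abbreviation RD :: "('a::euclidean_space \<Rightarrow> real) \<Rightarrow> ('i \<Rightarrow> 'a \<Rightarrow> complex) \<Rightarrow> bool" where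
  "RD p \<equiv> fam (RDq p)"

abbreviation wt :: "'a::real_normed_vector \<Rightarrow> real" where "wt x \<equiv> 1 + norm x"

abbreviation wt2 :: "'a::real_normed_vector \<times> 'b::real_normed_vector \<Rightarrow> real" where "wt2 z \<equiv> 1 + norm (snd z)"

lemma OMqI: "(\<And>i x. norm (f i x) \<le> C * p x ^ N) \<Longrightarrow> OMq p f"
  unfolding OMq_def by blast

lemma RDqI: "(\<And>k. \<exists>C. \<forall>i x. p x ^ k * norm (f i x) \<le> C) \<Longrightarrow> RDq p f"
  unfolding RDq_def by blast

text \<open>Since the weight is at least 1, the exponent may be raised and the constant made
  nonnegative. Two families can then be compared at a common exponent.\<close>

lemma OMqE:
  assumes "OMq p f" "\<And>x. 1 \<le> p x"
  obtains N0 C where "C \<ge> 0" "\<And>N i x. N \<ge> N0 \<Longrightarrow> norm (f i x) \<le> C * p x ^ N"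
proof -
  obtain N0 C where *: "\<And>i x. norm (f i x) \<le> C * p x ^ N0" using assms(1) unfolding OMq_def by blast
  have "norm (f i x) \<le> max C 0 * p x ^ N" if "N \<ge> N0" for N i x
  proof -
    have "C * p x ^ N0 \<le> max C 0 * p x ^ N"
    proof -
      have "C * p x ^ N0 \<le> max C 0 * p x ^ N0"
        by (intro mult_right_mono) (use assms(2)[of x] in auto)
      also have "\<dots> \<le> max C 0 * p x ^ N"
        using that assms(2) by (intro mult_left_mono power_increasing) auto
      finally show ?thesis .
    qed
    with *[of i x] show ?thesis by linarith
  qed
  then show ?thesis by (intro that[of "max C 0" N0]) auto
qed

lemma RDqE:
  assumes "RDq p f"
  obtains C where "C \<ge> 0" "\<And>i x. p x ^ k * norm (f i x) \<le> C"
proof -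
  obtain C where "\<And>i x. p x ^ k * norm (f i x) \<le> C" using assms unfolding RDq_def by blast
  then have "\<And>i x. p x ^ k * norm (f i x) \<le> max C 0" by (meson max.coboundedI1)
  with that[of "max C 0"] show ?thesis by auto
qed

lemma OMq_add:
  assumes "\<And>x. 1 \<le> p x" "OMq p f" "OMq p g"
  shows "OMq p (\<lambda>i x. f i x + g i x)"
proof -
  obtain C N0 where f: "C \<ge> 0" "\<And>N i x. N \<ge> N0 \<Longrightarrow> norm (f i x) \<le> C * p x ^ N"
    using OMqE[OF assms(2,1)] by metis
  obtain C' N0' where g: "C' \<ge> 0" "\<And>N i x. N \<ge> N0' \<Longrightarrow> norm (g i x) \<le> C' * p x ^ N"
    using OMqE[OF assms(3,1)] by metis
  show ?thesis
  proof (rule OMqI[where N = "max N0 N0'"])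
    fix i x
    have "norm (f i x + g i x) \<le> norm (f i x) + norm (g i x)" by (rule norm_triangle_ineq)
    also have "\<dots> \<le> C * p x ^ (max N0 N0') + C' * p x ^ (max N0 N0')"
      by (intro add_mono f g) auto
    finally show "norm (f i x + g i x) \<le> (C + C') * p x ^ (max N0 N0')" by (simp add: algebra_simps)
  qed
qed

lemma OMq_mult:
  assumes "\<And>x. 1 \<le> p x" "OMq p f" "OMq p g"
  shows "OMq p (\<lambda>i x. f i x * g i x)"
proof -
  obtain C N where f: "C \<ge> 0" "\<And>N' i x. N' \<ge> N \<Longrightarrow> norm (f i x) \<le> C * p x ^ N'"
    using OMqE[OF assms(2,1)] by metis
  obtain C' N' where g: "C' \<ge> 0" "\<And>N i x. N \<ge> N' \<Longrightarrow> norm (g i x) \<le> C' * p x ^ N"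
    using OMqE[OF assms(3,1)] by metis
  show ?thesis
  proof (rule OMqI[where N = "N + N'"])
    fix i x
    have "norm (f i x * g i x) = norm (f i x) * norm (g i x)" by (rule norm_mult)
    also have "\<dots> \<le> (C * p x ^ N) * (C' * p x ^ N')"
      using f(2)[of N i x] g(2)[of N' i x] by (intro mult_mono) (auto intro: order_trans[OF norm_ge_zero])
    finally show "norm (f i x * g i x) \<le> (C * C') * p x ^ (N + N')" by (simp add: power_add mult_ac)
  qed
qed

lemma RDq_add:
  assumes "\<And>x. 1 \<le> p x" "RDq p f" "RDq p g"
  shows "RDq p (\<lambda>i x. f i x + g i x)"
proof (rule RDqI)
  fix k
  obtain C where f: "\<And>i x. p x ^ k * norm (f i x) \<le> C" using RDqE[OF assms(2)] by metis
  obtain C' where g: "\<And>i x. p x ^ k * norm (g i x) \<le> C'" using RDqE[OF assms(3)] by metis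
  have "p x ^ k * norm (f i x + g i x) \<le> C + C'" for i x
  proof -
    have "p x ^ k * norm (f i x + g i x) \<le> p x ^ k * (norm (f i x) + norm (g i x))"
      using assms(1)[of x] by (intro mult_left_mono norm_triangle_ineq) auto
    with f[of x i] g[of x i] show ?thesis by (simp add: distrib_left)
  qed
  then show "\<exists>C. \<forall>i x. p x ^ k * norm (f i x + g i x) \<le> C" by blast
qed

lemma RDq_mult:
  assumes "\<And>x. 1 \<le> p x" "OMq p f" "RDq p g"
  shows "RDq p (\<lambda>i x. f i x * g i x)"
proof (rule RDqI)
  fix k
  obtain C N where f: "C \<ge> 0" "\<And>N' i x. N' \<ge> N \<Longrightarrow> norm (f i x) \<le> C * p x ^ N'"
    using OMqE[OF assms(2,1)] by metis
  obtain C' where g: "\<And>i x. p x ^ (k + N) * norm (g i x) \<le> C'" using RDqE[OF assms(3)] by metis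
  have "p x ^ k * norm (f i x * g i x) \<le> C * C'" for i x
  proof -
    have "p x ^ k * norm (f i x * g i x) \<le> p x ^ k * (C * p x ^ N * norm (g i x))"
      unfolding norm_mult using assms(1)[of x] f(2)[of N i x] by (intro mult_left_mono mult_right_mono) auto
    also have "\<dots> = C * (p x ^ (k + N) * norm (g i x))" by (simp add: power_add mult_ac)
    also have "\<dots> \<le> C * C'" using f(1) g by (intro mult_left_mono) auto
    finally show ?thesis .
  qed
  then show "\<exists>C. \<forall>i x. p x ^ k * norm (f i x * g i x) \<le> C" by blast
qed

lemma RDq_imp_OMq: "RDq p f \<Longrightarrow> OMq p f"
proof -
  assume "RDq p f"
  then obtain C where "\<And>i x. p x ^ 0 * norm (f i x) \<le> C" using RDqE by metis
  then show ?thesis by (intro OMqI[where N = 0 and C = C]) auto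
qed

lemma OM_add:
  assumes "OM p f" "OM p g" "\<And>x. 1 \<le> p x"
  shows "OM p (\<lambda>i x. f i x + g i x)"
  by (rule fam_add[OF assms(1,2) OMq_add[OF assms(3)]])

lemma RD_add:
  assumes "RD p f" "RD p g" "\<And>x. 1 \<le> p x"
  shows "RD p (\<lambda>i x. f i x + g i x)"
  by (rule fam_add[OF assms(1,2) RDq_add[OF assms(3)]])

lemma OM_mult:
  assumes "OM p f" "OM p g" "\<And>x. 1 \<le> p x"
  shows "OM p (\<lambda>i x. f i x * g i x)"
  by (rule fam_mult[OF assms(1,2) OMq_mult[OF assms(3)] OMq_add[OF assms(3)]])

lemma RD_mult:
  assumes "OM p f" "RD p g" "\<And>x. 1 \<le> p x"
  shows "RD p (\<lambda>i x. f i x * g i x)"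
  by (rule fam_mult[OF assms(1,2) RDq_mult[OF assms(3)] RDq_add[OF assms(3)]])

lemma RD_imp_OM: "RD p f \<Longrightarrow> OM p f"
  by (rule fam_mono[OF _ RDq_imp_OMq])

lemma fam_zero: "Q (\<lambda>i x. 0) \<Longrightarrow> fam Q (\<lambda>i x. 0)"
  by (rule fam_coinduct[where X = "\<lambda>h. h = (\<lambda>i x. 0)"]) auto

lemma OMq_zero: "OMq p (\<lambda>i x. 0)"
  by (rule OMqI[where C = 0]) auto

lemma RDq_zero: "RDq p (\<lambda>i x. 0)"
  by (rule RDqI) auto

lemma OM_const:
  assumes "\<And>i. norm (s i) \<le> M" "\<And>x. 1 \<le> p x"
  shows "OM p (\<lambda>i x. s i)"
proof (rule fam_coinduct[where X = "\<lambda>h. h = (\<lambda>i x. s i) \<or> h = (\<lambda>i x. 0)"])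
  fix h assume "h = (\<lambda>i (x::'b). s i) \<or> h = (\<lambda>i x. 0)"
  then show "OMq p h"
    using OMqI[of "\<lambda>i x. s i" M p 0] assms(1) OMq_zero by auto
qed auto

lemma OM_cmult:
  assumes "OM p f" "\<And>i. norm (s i) \<le> M" "\<And>x. 1 \<le> p x"
  shows "OM p (\<lambda>i x. s i * f i x)"
  by (rule OM_mult[OF OM_const[OF assms(2,3)] assms(1,3)])

lemma RD_cmult:
  assumes "RD p f" "\<And>i. norm (s i) \<le> M" "\<And>x. 1 \<le> p x"
  shows "RD p (\<lambda>i x. s i * f i x)"
  by (rule RD_mult[OF OM_const[OF assms(2,3)] assms(1,3)])

lemma OM_diff:
  assumes "OM p f" "OM p g" "\<And>x. 1 \<le> p x"
  shows "OM p (\<lambda>i x. f i x - g i x)"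
  using OM_add[OF assms(1) OM_cmult[OF assms(2), of "\<lambda>_. -1" 1] assms(3)] assms(3) by simp

lemma RD_diff:
  assumes "RD p f" "RD p g" "\<And>x. 1 \<le> p x"
  shows "RD p (\<lambda>i x. f i x - g i x)"
  using RD_add[OF assms(1) RD_cmult[OF assms(2), of "\<lambda>_. -1" 1] assms(3)] assms(3) by simp

lemma OM_sum:
  assumes "finite S" "\<And>b. b \<in> S \<Longrightarrow> OM p (f b)" "\<And>x. 1 \<le> p x"
  shows "OM p (\<lambda>i x. \<Sum>b\<in>S. f b i x)"
  using assms(1,2)
proof (induction S rule: finite_induct)
  case empty
  show ?case using fam_zero[of "OMq p", OF OMq_zero] by simp
next
  case (insert b S)
  have "OM p (\<lambda>i x. f b i x + (\<Sum>b\<in>S. f b i x))"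
    by (rule OM_add[OF insert.prems[OF insertI1] insert.IH[OF insert.prems[OF insertI2]] assms(3)])
  then show ?case using insert.hyps by simp
qed

text \<open>The shifts enter only through the comparison of weights, so \<open>c i\<close> may range
  over an unbounded set. In particular translations in the first variable cost nothing for
  \<open>wt2\<close>.\<close>

lemma OM_affine:
  fixes f :: "'i \<Rightarrow> 'b::euclidean_space \<Rightarrow> complex" and L :: "'i \<Rightarrow> 'a::euclidean_space \<Rightarrow> 'b"
  assumes "OM q f" "\<And>i. linear (L i)" "\<And>i v. v \<in> Basis \<Longrightarrow> norm (L i v) \<le> M"
    and p: "\<And>x. 1 \<le> p x" and q: "\<And>x. 1 \<le> q x" and K: "\<And>i x. q (c i + L i x) \<le> K * p x"
  shows "OM p (\<lambda>i x. f i (c i + L i x))"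
proof (rule fam_affine[OF assms(1-3) _ OMq_zero OMq_add[OF p]])
  fix f :: "'i \<Rightarrow> 'b \<Rightarrow> complex" and s :: "'i \<Rightarrow> real" and M assume f: "OMq q f" and s: "\<And>i. \<bar>s i\<bar> \<le> M"
  obtain C N where f: "C \<ge> 0" "\<And>N' i x. N' \<ge> N \<Longrightarrow> norm (f i x) \<le> C * q x ^ N'"
    using OMqE[OF f q] by metis
  show "OMq p (\<lambda>i x. complex_of_real (s i) * f i (c i + L i x))"
  proof (rule OMqI)
    fix i x
    have "norm (complex_of_real (s i) * f i (c i + L i x)) \<le> M * (C * q (c i + L i x) ^ N)"
      unfolding norm_mult using s[of i] f(2)[of N i "c i + L i x"] by (intro mult_mono) auto
    also have "\<dots> \<le> M * (C * (K * p x) ^ N)"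
      using s[of i] f(1) q[of "c i + L i x"] by (intro mult_left_mono power_mono K) auto
    finally show "norm (complex_of_real (s i) * f i (c i + L i x)) \<le> (M * C * K ^ N) * p x ^ N"
      by (simp add: power_mult_distrib mult_ac)
  qed
qed

lemma RD_affine:
  fixes f :: "'i \<Rightarrow> 'b::euclidean_space \<Rightarrow> complex" and L :: "'i \<Rightarrow> 'a::euclidean_space \<Rightarrow> 'b"
  assumes "RD q f" "\<And>i. linear (L i)" "\<And>i v. v \<in> Basis \<Longrightarrow> norm (L i v) \<le> M"
    and p: "\<And>x. 1 \<le> p x" and q: "\<And>x. 1 \<le> q x" and K: "\<And>i x. p x \<le> K * q (c i + L i x)"
  shows "RD p (\<lambda>i x. f i (c i + L i x))"
proof (rule fam_affine[OF assms(1-3) _ RDq_zero RDq_add[OF p]])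
  fix f :: "'i \<Rightarrow> 'b \<Rightarrow> complex" and s :: "'i \<Rightarrow> real" and M assume f: "RDq q f" and s: "\<And>i. \<bar>s i\<bar> \<le> M"
  show "RDq p (\<lambda>i x. complex_of_real (s i) * f i (c i + L i x))"
  proof (rule RDqI)
    fix k
    obtain C where C: "C \<ge> 0" "\<And>i x. q x ^ k * norm (f i x) \<le> C" using RDqE[OF f] by metis
    have "p x ^ k * norm (complex_of_real (s i) * f i (c i + L i x)) \<le> M * (K ^ k * C)" for i x
    proof -
      have "0 \<le> K * q (c i + L i x)" using K[of x i] p[of x] by linarith
      then have K1: "0 \<le> K" using q[of "c i + L i x"] by (simp add: zero_le_mult_iff)
      have "p x ^ k * norm (complex_of_real (s i) * f i (c i + L i x)) =
        \<bar>s i\<bar> * (p x ^ k * norm (f i (c i + L i x)))" by (simp add: norm_mult)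
      also have "\<dots> \<le> M * ((K * q (c i + L i x)) ^ k * norm (f i (c i + L i x)))"
        using s[of i] p[of x] K[of x i] by (intro mult_mono power_mono) auto
      also have "\<dots> = M * (K ^ k * (q (c i + L i x) ^ k * norm (f i (c i + L i x))))"
        by (simp add: power_mult_distrib mult_ac)
      also have "\<dots> \<le> M * (K ^ k * C)"
        using s[of i] K1 C by (intro mult_left_mono) auto
      finally show ?thesis .
    qed
    then show "\<exists>C. \<forall>i x. p x ^ k * norm (complex_of_real (s i) * f i (c i + L i x)) \<le> C" by blast
  qed
qed

lemma OM_reindex: "OM p f \<Longrightarrow> OM p (\<lambda>i. f (r i))"
  by (erule fam_reindex) (auto simp: OMq_def)

lemma RD_reindex: "RD p f \<Longrightarrow> RD p (\<lambda>i. f (r i))"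
  by (erule fam_reindex) (force simp: RDq_def)

lemma fam_if:
  assumes "fam Q f" "fam Q g" "\<And>f g. Q f \<Longrightarrow> Q g \<Longrightarrow> Q (\<lambda>i. if P i then f i else g i)"
  shows "fam Q (\<lambda>i. if P i then f i else g i)"
proof -
  have "(\<lambda>i. Dlist vs (if P i then f i else g i)) = (\<lambda>i. if P i then Dlist vs (f i) else Dlist vs (g i))" for vs
    by auto
  with assms show ?thesis unfolding fam_def by simp
qed

lemma OM_if:
  assumes "OM p f" "OM p g" "\<And>x. 1 \<le> p x"
  shows "OM p (\<lambda>i. if P i then f i else g i)"
proof (rule fam_if[OF assms(1,2)])
  fix f g :: "'a \<Rightarrow> 'b \<Rightarrow> complex" assume fg: "OMq p f" "OMq p g"
  obtain C N where f: "C \<ge> 0" "\<And>N' i x. N' \<ge> N \<Longrightarrow> norm (f i x) \<le> C * p x ^ N'"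
    using OMqE[OF fg(1) assms(3)] by metis
  obtain C' N' where g: "C' \<ge> 0" "\<And>N i x. N \<ge> N' \<Longrightarrow> norm (g i x) \<le> C' * p x ^ N"
    using OMqE[OF fg(2) assms(3)] by metis
  show "OMq p (\<lambda>i. if P i then f i else g i)"
  proof (rule OMqI)
    fix i x
    have "0 \<le> C * p x ^ max N N'" "0 \<le> C' * p x ^ max N N'"
      using f(1) g(1) assms(3)[of x] by auto
    then show "norm ((if P i then f i else g i) x) \<le> (C + C') * p x ^ max N N'"
      using f(2)[of "max N N'" i x] g(2)[of "max N N'" i x] by (simp add: distrib_right split: if_split)
  qed
qed

lemma fam_cnj:
  assumes "fam Q f" "\<And>f. Q f \<Longrightarrow> Q (\<lambda>i x. cnj (f i x))"
  shows "fam Q (\<lambda>i x. cnj (f i x))"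
proof (rule fam_coinduct[where X = "\<lambda>h. \<exists>f. fam Q f \<and> h = (\<lambda>i x. cnj (f i x))"])
  fix h assume "\<exists>f. fam Q f \<and> h = (\<lambda>i x. cnj (f i x))"
  then obtain f where h: "fam Q f" "h = (\<lambda>i x. cnj (f i x))" by blast
  show "Q h" unfolding h(2) by (rule assms(2)[OF fam_Q[OF h(1)]])
  show "h i differentiable at x" for i x
    unfolding h(2) differentiable_def
    using has_derivative_cnj[OF pd_has_derivative[OF fam_differentiable[OF h(1)]]] by blast
next
  fix h v assume "\<exists>f. fam Q f \<and> h = (\<lambda>i x. cnj (f i x))" and v: "(v::'b) \<in> Basis"
  then obtain f where h: "fam Q f" "h = (\<lambda>i x. cnj (f i x))" by blast
  have "(\<lambda>i. pd v (h i)) = (\<lambda>i x. cnj (pd v (f i) x))"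
    unfolding h(2) using pd_cnj[OF fam_differentiable[OF h(1)]] by (simp add: fun_eq_iff)
  then show "\<exists>f. fam Q f \<and> (\<lambda>i. pd v (h i)) = (\<lambda>i x. cnj (f i x))"
    by (intro exI conjI) (rule fam_pd[OF h(1) v], assumption)
qed (intro exI conjI, rule assms(1), rule refl)

lemma OM_cnj: "OM p f \<Longrightarrow> OM p (\<lambda>i x. cnj (f i x))"
  by (erule fam_cnj) (simp add: OMq_def)

lemma RD_cnj: "RD p f \<Longrightarrow> RD p (\<lambda>i x. cnj (f i x))"
  by (erule fam_cnj) (simp add: RDq_def)

lemma RD_weight:
  assumes "RD q f" "\<And>x. 1 \<le> p x" "\<And>x. 1 \<le> q x" "\<And>x. p x \<le> K * q x"
  shows "RD p f"
proof -
  have "RD p (\<lambda>i x. f i (0 + x))"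
    by (rule RD_affine[where L = "\<lambda>_ x. x" and M = 1 and K = K, OF assms(1) _ _ assms(2,3)])
       (use assms(4) in \<open>auto simp: linear_ident\<close>)
  then show ?thesis by simp
qed

lemma OM_weight:
  assumes "OM q f" "\<And>x. 1 \<le> p x" "\<And>x. 1 \<le> q x" "\<And>x. q x \<le> K * p x"
  shows "OM p f"
proof -
  have "OM p (\<lambda>i x. f i (0 + x))"
    by (rule OM_affine[where L = "\<lambda>_ x. x" and M = 1 and K = K, OF assms(1) _ _ assms(2,3)])
       (use assms(4) in \<open>auto simp: linear_ident\<close>)
  then show ?thesis by simp
qed

text \<open>For p, q >= 1 one has p^k q^k <= p^(2k) + q^(2k), so decay in each of two weights yields
  decay in their product.\<close>

lemma RD_combine_weights:
  assumes "RD p f" "RD q f" "\<And>x. 1 \<le> p x" "\<And>x. 1 \<le> q x"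
  shows "RD (\<lambda>x. p x * q x) f"
proof (rule fam_coinduct[where X = "\<lambda>h. RD p h \<and> RD q h"])
  fix h assume h: "RD p h \<and> RD q h"
  show "h i differentiable at x" for i x by (rule fam_differentiable[OF conjunct1[OF h]])
  show "RDq (\<lambda>x. p x * q x) h"
  proof (rule RDqI)
    fix k
    obtain C where C: "C \<ge> 0" "\<And>i x. p x ^ (k + k) * norm (h i x) \<le> C"
      using RDqE[OF fam_Q[OF conjunct1[OF h]]] by metis
    obtain C' where C': "C' \<ge> 0" "\<And>i x. q x ^ (k + k) * norm (h i x) \<le> C'"
      using RDqE[OF fam_Q[OF conjunct2[OF h]]] by metis
    have "(p x * q x) ^ k * norm (h i x) \<le> C + C'" for i x
    proof -
      have "p x ^ k * q x ^ k \<le> p x ^ (k + k) + q x ^ (k + k)"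
      proof -
        have "0 \<le> (p x ^ k - q x ^ k)\<^sup>2" "0 \<le> p x ^ k" "0 \<le> q x ^ k" using assms(3,4)[of x] by auto
        then have "0 \<le> p x ^ k * q x ^ k" "2 * (p x ^ k * q x ^ k) \<le> p x ^ (k + k) + q x ^ (k + k)"
          by (auto simp: power2_eq_square algebra_simps power_add)
        then show ?thesis by linarith
      qed
      then have "(p x * q x) ^ k * norm (h i x) \<le> (p x ^ (k + k) + q x ^ (k + k)) * norm (h i x)"
        unfolding power_mult_distrib by (rule mult_right_mono) simp
      with C(2)[of x i] C'(2)[of x i] show ?thesis by (simp add: distrib_right)
    qed
    then show "\<exists>C. \<forall>i x. (p x * q x) ^ k * norm (h i x) \<le> C" by blast
  qed
next
  fix h v assume h: "RD p h \<and> RD q h" and v: "(v::'b) \<in> Basis"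
  show "RD p (\<lambda>i. pd v (h i)) \<and> RD q (\<lambda>i. pd v (h i))"
    by (intro conjI fam_pd[OF conjunct1[OF h] v] fam_pd[OF conjunct2[OF h] v])
qed (intro conjI assms(1,2))

text \<open>One derivative turns the linear function into a bounded constant, so the coinduction
  class consists of this family together with everything already known to be
  \<open>OM\<close>.\<close>

lemma OM_inner:
  fixes c :: "'i \<Rightarrow> 'a::euclidean_space"
  assumes "\<And>i. norm (c i) \<le> K"
  shows "OM wt (\<lambda>i x. complex_of_real (x \<bullet> c i))"
proof (rule fam_coinduct[where X = "\<lambda>h. h = (\<lambda>i x. complex_of_real (x \<bullet> c i)) \<or> OM wt h"])
  have bl: "bounded_linear (\<lambda>x. complex_of_real (x \<bullet> c i))" for i
    by (rule bounded_linear_compose[OF bounded_linear_of_real bounded_linear_inner_left])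
  fix h assume h: "h = (\<lambda>i x. complex_of_real (x \<bullet> c i)) \<or> OM wt h"
  have *: "OMq wt (\<lambda>i x. complex_of_real (x \<bullet> c i))"
  proof (rule OMqI[where N = 1])
    fix i and x :: 'a
    have "\<bar>x \<bullet> c i\<bar> \<le> norm x * norm (c i)" by (rule Cauchy_Schwarz_ineq2)
    also have "\<dots> \<le> (1 + norm x) * K" using assms[of i] by (intro mult_mono) auto
    finally show "norm (complex_of_real (x \<bullet> c i)) \<le> K * wt x ^ 1" by (simp add: mult_ac)
  qed
  with h show "OMq wt h" using fam_Q by blast
  show "h i differentiable at x" for i x
    using h
  proof
    assume "h = (\<lambda>i x. complex_of_real (x \<bullet> c i))"
    then show ?thesis using bl[of i] bounded_linear_imp_differentiable by blast
  qed (rule fam_differentiable)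
  fix v :: 'a assume v: "v \<in> Basis"
  show "(\<lambda>i. pd v (h i)) = (\<lambda>i x. complex_of_real (x \<bullet> c i)) \<or> OM wt (\<lambda>i. pd v (h i))"
    using h
  proof
    assume "h = (\<lambda>i x. complex_of_real (x \<bullet> c i))"
    then have "(\<lambda>i. pd v (h i)) = (\<lambda>i x. complex_of_real (v \<bullet> c i))"
      by (simp only: pd_linear[OF bl])
    moreover have "OM wt (\<lambda>i (x::'a). complex_of_real (v \<bullet> c i))"
    proof (rule OM_const)
      fix i
      show "norm (complex_of_real (v \<bullet> c i)) \<le> K"
        using Cauchy_Schwarz_ineq2[of v "c i"] assms[of i] v by simp
    qed simp
    ultimately show ?thesis by simp
  qed (use v fam_pd in blast)
qed simp

text \<open>Differentiation reproduces the factor \<open>cis\<close> and replaces the amplitude by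
  one that is again polynomially bounded; hence the coinduction runs over all amplitudes
  \<open>P\<close>.\<close>

lemma OM_cis:
  fixes \<theta> :: "'i \<Rightarrow> 'a::euclidean_space \<Rightarrow> real"
  assumes "OM p P" "OM p (\<lambda>i x. complex_of_real (\<theta> i x))" and p: "\<And>x. 1 \<le> p x"
  shows "OM p (\<lambda>i x. P i x * cis (\<theta> i x))"
proof (rule fam_coinduct[where X = "\<lambda>h. \<exists>P. OM p P \<and> h = (\<lambda>i x. P i x * cis (\<theta> i x))"])
  have cis_eq: "cis (\<theta> i x) = exp (\<i> * complex_of_real (\<theta> i x))" for i x by (simp add: cis_conv_exp)
  have hd: "((\<lambda>x. cis (\<theta> i x)) has_derivative (\<lambda>v. \<i> * pd v (\<lambda>x. complex_of_real (\<theta> i x)) x * cis (\<theta> i x))) (at x)" for i x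
    unfolding cis_eq
    using has_derivative_compose[OF has_derivative_mult_right[OF pd_has_derivative[OF fam_differentiable[OF assms(2), of i x]]]
        DERIV_exp[unfolded has_field_derivative_def], of \<i>]
    by (simp add: mult.commute)
  fix h assume "\<exists>P. OM p P \<and> h = (\<lambda>i x. P i x * cis (\<theta> i x))"
  then obtain P where h: "OM p P" "h = (\<lambda>i x. P i x * cis (\<theta> i x))" by blast
  show "OMq p h" using fam_Q[OF h(1)] unfolding h(2) OMq_def by (simp add: norm_mult)
  show "h i differentiable at x" for i x
    unfolding h(2) by (rule differentiable_mult[OF fam_differentiable[OF h(1)]]) (use hd differentiable_def in blast)
  fix v :: 'a assume v: "v \<in> Basis"
  have "pd v (h i) = (\<lambda>x. (P i x * (\<i> * pd v (\<lambda>x. complex_of_real (\<theta> i x)) x) + pd v (P i) x) * cis (\<theta> i x))" for i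
  proof -
    have "pd v (h i) = (\<lambda>x. P i x * (\<i> * pd v (\<lambda>x. complex_of_real (\<theta> i x)) x * cis (\<theta> i x)) + pd v (P i) x * cis (\<theta> i x))"
      unfolding h(2) by (rule pd_eqI) (rule has_derivative_mult[OF pd_has_derivative[OF fam_differentiable[OF h(1)]] hd])
    then show ?thesis by (simp add: algebra_simps)
  qed
  then have eq: "(\<lambda>i. pd v (h i)) = (\<lambda>i x. (P i x * (\<i> * pd v (\<lambda>x. complex_of_real (\<theta> i x)) x) + pd v (P i) x) * cis (\<theta> i x))"
    by simp
  show "\<exists>P. OM p P \<and> (\<lambda>i. pd v (h i)) = (\<lambda>i x. P i x * cis (\<theta> i x))"
    unfolding eq
    by (intro exI conjI, rule OM_add[OF OM_mult[OF h(1) OM_cmult[OF fam_pd[OF assms(2) v]]] fam_pd[OF h(1) v]])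
       (use p in auto)
qed (intro exI conjI, rule assms(1), rule refl)

section \<open>Schwartz functions and tempered distributions\<close>

text \<open>A single function is a family over \<open>unit\<close>. Through this equivalence the
  Schwartz class inherits every closure rule proved for families.\<close>

lemma Schwartz_RD: "f \<in> Schwartz \<longleftrightarrow> RD wt (\<lambda>_::unit. f)"
  unfolding Schwartz_def fam_def RDq_def by auto

lemma RD_const_index: "RD p (\<lambda>_::unit. f) \<Longrightarrow> RD p (\<lambda>_. f)"
  by (rule RD_reindex[where f = "\<lambda>_::unit. f"])

lemma OM_const_index: "OM p (\<lambda>_::unit. f) \<Longrightarrow> OM p (\<lambda>_. f)"
  by (rule OM_reindex[where f = "\<lambda>_::unit. f"])

lemma Schwartz_RD_const: "f \<in> Schwartz \<Longrightarrow> RD wt (\<lambda>_. f)"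
  using Schwartz_RD RD_const_index by blast

lemma RD_Schwartz: "RD wt f \<Longrightarrow> f i \<in> Schwartz"
  using RD_reindex[of wt f "\<lambda>_::unit. i"] Schwartz_RD by blast

lemma snorm_le:
  fixes f :: "'a::euclidean_space \<Rightarrow> complex"
  assumes "\<And>x vs. vs \<in> lists Basis \<Longrightarrow> length vs \<le> N \<Longrightarrow> wt x ^ N * norm (Dlist vs f x) \<le> C"
  shows "snorm N f \<le> C"
  unfolding snorm_def
proof (rule cSUP_least)
  have "[] \<in> {vs \<in> lists Basis. length vs \<le> N}" by simp
  then show "UNIV \<times> {vs \<in> lists Basis. length vs \<le> N} \<noteq> {}" by blast
next
  fix p assume "p \<in> (UNIV :: 'a set) \<times> {vs \<in> lists (Basis :: 'a set). length vs \<le> N}"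
  then have "snd p \<in> lists Basis" "length (snd p) \<le> N" by auto
  from assms[OF this] show "wt (fst p) ^ N * norm (Dlist (snd p) f (fst p)) \<le> C" by blast
qed

text \<open>There are only finitely many lists over \<open>Basis\<close> of length at most
  \<open>N\<close>, so the constants for the separate derivatives have a maximum.\<close>

lemma RD_bound:
  assumes "RD wt f"
  obtains C where "\<And>i x vs. vs \<in> lists Basis \<Longrightarrow> length vs \<le> N \<Longrightarrow> wt x ^ k * norm (Dlist vs (f i) x) \<le> C"
proof -
  let ?V = "{vs. set vs \<subseteq> (Basis :: 'b set) \<and> length vs \<le> N}"
  have fin: "finite ?V" by (rule finite_lists_length_le) simp
  have "\<exists>C. \<forall>i x. wt x ^ k * norm (Dlist vs (f i) x) \<le> C" if "vs \<in> ?V" for vs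
    using assms that unfolding fam_def RDq_def by (auto simp: lists_eq_set)
  then obtain C where C: "\<And>vs i x. vs \<in> ?V \<Longrightarrow> wt x ^ k * norm (Dlist vs (f i) x) \<le> C vs" by metis
  have "wt x ^ k * norm (Dlist vs (f i) x) \<le> Max (C ` ?V)" if "vs \<in> lists Basis" "length vs \<le> N" for i x vs
  proof -
    have v: "vs \<in> ?V" using that by (auto simp: lists_eq_set)
    from C[OF v] show ?thesis using Max_ge[of "C ` ?V" "C vs"] fin v order_trans by blast
  qed
  then show ?thesis using that by blast
qed

lemma snorm_upper:
  fixes f :: "'a::euclidean_space \<Rightarrow> complex"
  assumes "f \<in> Schwartz" "vs \<in> lists Basis" "length vs \<le> N"
  shows "wt x ^ N * norm (Dlist vs f x) \<le> snorm N f"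
proof -
  obtain C where C: "\<And>x vs. vs \<in> lists Basis \<Longrightarrow> length vs \<le> N \<Longrightarrow> wt x ^ N * norm (Dlist vs f x) \<le> C"
    using RD_bound[OF Schwartz_RD[THEN iffD1, OF assms(1)], of N N] by metis
  have "(\<lambda>p. wt (fst p) ^ N * norm (Dlist (snd p) f (fst p))) (x, vs) \<le> snorm N f"
    unfolding snorm_def
  proof (rule cSUP_upper)
    show "bdd_above ((\<lambda>p. wt (fst p) ^ N * norm (Dlist (snd p) f (fst p))) ` (UNIV \<times> {vs \<in> lists Basis. length vs \<le> N}))"
    proof (rule bdd_aboveI2)
      fix p assume "p \<in> (UNIV :: 'a set) \<times> {vs \<in> lists (Basis :: 'a set). length vs \<le> N}"
      then have "snd p \<in> lists Basis" "length (snd p) \<le> N" by auto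
      from C[OF this] show "wt (fst p) ^ N * norm (Dlist (snd p) f (fst p)) \<le> C" by blast
    qed
  qed (use assms(2,3) in simp)
  then show ?thesis by simp
qed

text \<open>This is the form in which continuity of a functional is used throughout: boundedness on
  bounded families.\<close>

lemma tempered_bounded:
  fixes f :: "'i \<Rightarrow> 'b::euclidean_space \<Rightarrow> complex"
  assumes "tempered T" "RD wt f"
  obtains C where "\<And>i. norm (T (f i)) \<le> C"
proof -
  obtain N C where C: "\<And>\<phi>. \<phi> \<in> Schwartz \<Longrightarrow> norm (T \<phi>) \<le> C * snorm N \<phi>"
    using assms(1) unfolding tempered_def by blast
  obtain B where B: "\<And>i x vs. vs \<in> lists Basis \<Longrightarrow> length vs \<le> N \<Longrightarrow> wt x ^ N * norm (Dlist vs (f i) x) \<le> B"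
    using RD_bound[OF assms(2), of N N] by metis
  \<comment> \<open>The constant \<open>C\<close> may be negative, so the nonnegativity of
    \<open>snorm\<close> is needed before passing to its absolute value.\<close>
  have "norm (T (f i)) \<le> \<bar>C\<bar> * B" for i
  proof -
    have s: "snorm N (f i) \<le> B" using snorm_le B by metis
    have "0 \<le> wt (0::'b) ^ N * norm (Dlist [] (f i) 0)" by simp
    also have "\<dots> \<le> snorm N (f i)" by (rule snorm_upper) (use RD_Schwartz[OF assms(2)] in auto)
    finally have s0: "0 \<le> snorm N (f i)" .
    have "norm (T (f i)) \<le> C * snorm N (f i)" using C RD_Schwartz[OF assms(2)] by blast
    also have "\<dots> \<le> \<bar>C\<bar> * B" using s s0 by (intro mult_mono) auto
    finally show ?thesis .
  qed
  then show ?thesis using that by blast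
qed

lemma Schwartz_cmult: "f \<in> Schwartz \<Longrightarrow> (\<lambda>x. c * f x) \<in> Schwartz"
  using RD_cmult[of wt "\<lambda>_::unit. f" "\<lambda>_. c" "norm c"] by (simp add: Schwartz_RD)

lemma Schwartz_add: "f \<in> Schwartz \<Longrightarrow> g \<in> Schwartz \<Longrightarrow> (\<lambda>x. f x + g x) \<in> Schwartz"
  using RD_add[of wt "\<lambda>_::unit. f" "\<lambda>_. g"] by (simp add: Schwartz_RD)

lemma Schwartz_diff: "f \<in> Schwartz \<Longrightarrow> g \<in> Schwartz \<Longrightarrow> (\<lambda>x. f x - g x) \<in> Schwartz"
  using RD_diff[of wt "\<lambda>_::unit. f" "\<lambda>_. g"] by (simp add: Schwartz_RD)

lemma Schwartz_cnj: "f \<in> Schwartz \<Longrightarrow> (\<lambda>x. cnj (f x)) \<in> Schwartz"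
  using RD_cnj[of wt "\<lambda>_::unit. f"] by (simp add: Schwartz_RD)

lemma Schwartz_zero: "(\<lambda>x. 0) \<in> Schwartz"
  unfolding Schwartz_RD by (rule fam_zero, rule RDq_zero)

lemma Dlist_cmult:
  assumes "f \<in> Schwartz" "vs \<in> lists Basis"
  shows "Dlist vs (\<lambda>x. c * f x) = (\<lambda>x. c * Dlist vs f x)"
  using assms(2)
proof (induction vs)
  case (Cons v vs)
  then have "\<And>x. Dlist vs f differentiable at x" using assms unfolding Schwartz_def smooth_def by auto
  then show ?case using Cons by (simp add: pd_cmult)
qed simp

text \<open>The converse of \<open>tempered_bounded\<close>. If no estimate holds, then for each N
  some function violates the one with constant N and seminorm N; dividing it by that seminorm gives
  a sequence that is bounded in the Schwartz space while its images are not bounded.\<close>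

lemma temperedI:
  fixes T :: "('a::euclidean_space \<Rightarrow> complex) \<Rightarrow> complex"
  assumes off: "\<And>\<phi>. \<phi> \<notin> Schwartz \<Longrightarrow> T \<phi> = 0"
    and add: "\<And>\<phi> g. \<phi> \<in> Schwartz \<Longrightarrow> g \<in> Schwartz \<Longrightarrow> T (\<lambda>x. \<phi> x + g x) = T \<phi> + T g"
    and scale: "\<And>\<phi> c. \<phi> \<in> Schwartz \<Longrightarrow> T (\<lambda>x. c * \<phi> x) = c * T \<phi>"
    and bdd: "\<And>f :: nat \<Rightarrow> 'a \<Rightarrow> complex. RD wt f \<Longrightarrow> \<exists>C. \<forall>i. norm (T (f i)) \<le> C"
  shows "tempered T"
proof -
  have "\<exists>N C. \<forall>\<phi>\<in>Schwartz. norm (T \<phi>) \<le> C * snorm N \<phi>"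
  proof (rule ccontr)
    assume "\<not> ?thesis"
    then have "\<forall>N::nat. \<exists>\<phi>\<in>Schwartz. norm (T \<phi>) > real N * snorm N \<phi>" by (meson not_le)
    then obtain g where g: "\<And>N. g N \<in> Schwartz" "\<And>N. norm (T (g N)) > real N * snorm N (g N)" by metis
    \<comment> \<open>A vanishing seminorm would make \<open>g N\<close> zero and the strict
      violation impossible, so the normalisation below is legitimate.\<close>
    have pos: "snorm N (g N) > 0" for N
    proof (rule ccontr)
      assume np: "\<not> snorm N (g N) > 0"
      have "g N = (\<lambda>x. 0)"
      proof
        fix x
        have "wt x ^ N * norm (Dlist [] (g N) x) \<le> snorm N (g N)"
          by (rule snorm_upper[OF g(1)]) auto
        with np have "wt x ^ N * norm (g N x) \<le> 0" by simp
        moreover have "0 < wt x ^ N" by (simp add: add_pos_nonneg)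
        ultimately show "g N x = 0" by (simp add: mult_le_0_iff)
      qed
      then have "T (g N) = 0" using scale[OF Schwartz_zero, of 0] by simp
      moreover have "snorm N (g N) \<ge> 0" 
      proof -
        have "0 \<le> wt (0::'a) ^ N * norm (Dlist [] (g N) 0)" by simp
        also have "\<dots> \<le> snorm N (g N)" by (rule snorm_upper[OF g(1)]) auto
        finally show ?thesis .
      qed
      ultimately have "0 \<le> real N * snorm N (g N)" "norm (T (g N)) = 0" by auto
      then show False using g(2)[of N] by linarith
    qed
    define h where "h N = (\<lambda>x. complex_of_real (1 / snorm N (g N)) * g N x)" for N
    have hS: "h N \<in> Schwartz" for N unfolding h_def by (rule Schwartz_cmult[OF g(1)])
    have "RD wt h"
      unfolding fam_def
    proof (intro conjI allI ballI)
      show "smooth (h N)" for N using hS unfolding Schwartz_def by blast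
      fix vs :: "'a list" assume vs: "vs \<in> lists Basis"
      show "RDq wt (\<lambda>N. Dlist vs (h N))"
      proof (rule RDqI)
        fix k
        \<comment> \<open>From index \<open>K\<close> on, the normalising seminorm dominates both
          the weight exponent \<open>k\<close> and the derivative \<open>vs\<close>, which gives the
          bound 1. The finitely many earlier functions contribute their own constants.\<close>
        define K where "K = max k (length vs)"
        have "\<forall>N. \<exists>C. \<forall>x. wt x ^ k * norm (Dlist vs (h N) x) \<le> C"
          using hS vs unfolding Schwartz_def by blast
        then obtain B where B: "\<And>N x. wt x ^ k * norm (Dlist vs (h N) x) \<le> B N" by metis
        have le: "wt x ^ k * norm (Dlist vs (h N) x) \<le> 1" if N: "N \<ge> K" for N x
        proof -
          have "wt x ^ k * norm (Dlist vs (h N) x) = wt x ^ k * norm (Dlist vs (g N) x) / snorm N (g N)"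
            unfolding h_def Dlist_cmult[OF g(1) vs] using pos[of N] by (simp add: norm_mult norm_divide)
          also have "\<dots> \<le> wt x ^ N * norm (Dlist vs (g N) x) / snorm N (g N)"
            using N pos[of N] by (intro divide_right_mono mult_right_mono power_increasing) (auto simp: K_def)
          also have "\<dots> \<le> 1"
          proof -
            have "length vs \<le> N" using N by (simp add: K_def)
            from snorm_upper[OF g(1)[of N] vs this, of x] show ?thesis using pos[of N] by simp
          qed
          finally show ?thesis .
        qed
        have "wt x ^ k * norm (Dlist vs (h N) x) \<le> 1 + (\<Sum>j<K. \<bar>B j\<bar>)" for N x
        proof (cases "N \<ge> K")
          case True
          have "0 \<le> (\<Sum>j<K. \<bar>B j\<bar>)" by (intro sum_nonneg) simp
          with le[OF True, of x] show ?thesis by linarith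
        next
          case False
          then have "\<bar>B N\<bar> \<le> (\<Sum>j<K. \<bar>B j\<bar>)" by (intro member_le_sum) auto
          then show ?thesis using B[where x = x and N = N] by linarith
        qed
        then show "\<exists>C. \<forall>i x. wt x ^ k * norm (Dlist vs (h i) x) \<le> C" by blast
      qed
    qed
    from bdd[OF this] obtain C where C: "\<And>N. norm (T (h N)) \<le> C" by blast
    obtain N :: nat where N: "real N > C" using reals_Archimedean2 by blast
    have "T (h N) = complex_of_real (1 / snorm N (g N)) * T (g N)"
      unfolding h_def by (rule scale[OF g(1)])
    then have "norm (T (h N)) = norm (T (g N)) / snorm N (g N)"
      using pos[of N] by (simp add: norm_mult norm_divide)
    also have "\<dots> > real N" using g(2)[of N] pos[of N] by (simp add: pos_less_divide_eq)
    finally show False using C[of N] N by simp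
  qed
  then show ?thesis unfolding tempered_def using off add scale by blast
qed

lemma tempered_add: "tempered T \<Longrightarrow> f \<in> Schwartz \<Longrightarrow> g \<in> Schwartz \<Longrightarrow> T (\<lambda>x. f x + g x) = T f + T g"
  unfolding tempered_def by blast

lemma tempered_cmult: "tempered T \<Longrightarrow> f \<in> Schwartz \<Longrightarrow> T (\<lambda>x. c * f x) = c * T f"
  unfolding tempered_def by blast

lemma tempered_off: "tempered T \<Longrightarrow> f \<notin> Schwartz \<Longrightarrow> T f = 0"
  unfolding tempered_def by blast

lemma tempered_zero: "tempered T \<Longrightarrow> T (\<lambda>x. 0) = 0"
  using tempered_cmult[OF _ Schwartz_zero, of T 0] by simp

lemma tempered_diff:
  assumes "tempered T" "f \<in> Schwartz" "g \<in> Schwartz"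
  shows "T (\<lambda>x. f x - g x) = T f - T g"
  using tempered_add[OF assms(1,2) Schwartz_cmult[OF assms(3), of "-1"]] tempered_cmult[OF assms(1,3), of "-1"]
  by simp

lemma tempered_sum:
  assumes "tempered T" "finite S" "\<And>s. s \<in> S \<Longrightarrow> f s \<in> Schwartz"
  shows "(\<lambda>x. \<Sum>s\<in>S. f s x) \<in> Schwartz \<and> T (\<lambda>x. \<Sum>s\<in>S. f s x) = (\<Sum>s\<in>S. T (f s))"
  using assms(2,3)
proof (induction S rule: finite_induct)
  case empty
  show ?case using Schwartz_zero tempered_zero[OF assms(1)] by simp
next
  case (insert s S)
  then show ?case
    using Schwartz_add[of "f s" "\<lambda>x. \<Sum>s\<in>S. f s x"] tempered_add[OF assms(1), of "f s" "\<lambda>x. \<Sum>s\<in>S. f s x"]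
    by simp
qed

section \<open>Integrals depending on a parameter\<close>

text \<open>Each factor \<open>1 + (x \<bullet> b)\<^sup>2\<close> is at most
  \<open>(wt x)\<^sup>2\<close>, and Tonelli reduces the product over \<open>Basis\<close> to the
  integral of 1/(1+t^2) on the line. This is the origin of the exponent
  \<open>2 * DIM('a)\<close>.\<close>

lemma integrable_inverse_wt:
  "integrable lborel (\<lambda>x::'a::euclidean_space. C * inverse (wt x ^ (2 * DIM('a))))"
proof (rule integrable_mult_right)
  let ?g = "\<lambda>x::'a. (\<Prod>b\<in>Basis. inverse (1 + (x \<bullet> b)\<^sup>2))"
  have 1: "integrable lborel (\<lambda>t::real. inverse (1 + t\<^sup>2))"
    using integrable_inverse_1_plus_square by (simp add: set_integrable_def einterval_def)
  have "(\<integral>\<^sup>+x. ennreal (?g x) \<partial>lborel) = (\<integral>\<^sup>+x. (\<Prod>b\<in>Basis. ennreal (inverse (1 + (x \<bullet> b)\<^sup>2))) \<partial>(lborel :: 'a measure))"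
    by (simp add: prod_ennreal)
  also have "\<dots> = (\<Prod>b\<in>(Basis :: 'a set). \<integral>\<^sup>+t. ennreal (inverse (1 + t\<^sup>2)) \<partial>lborel)"
    by (rule nn_integral_lborel_prod[where f = "\<lambda>_ t. ennreal (inverse (1 + t\<^sup>2))"]) auto
  also have "\<dots> < \<infinity>"
  proof -
    have "(\<integral>\<^sup>+t. ennreal (inverse (1 + t\<^sup>2)) \<partial>lborel) < \<infinity>"
      using 1 by (simp add: integrable_iff_bounded)
    then obtain r where "0 \<le> r" "(\<integral>\<^sup>+t. ennreal (inverse (1 + t\<^sup>2)) \<partial>lborel) = ennreal r"
      by (cases "\<integral>\<^sup>+t. ennreal (inverse (1 + t\<^sup>2)) \<partial>lborel" rule: ennreal_cases) auto
    then show ?thesis by (simp add: ennreal_power)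
  qed
  finally have "integrable lborel ?g"
    by (subst integrable_iff_bounded) (auto simp: abs_prod)
  then show "integrable lborel (\<lambda>x::'a. inverse (wt x ^ (2 * DIM('a))))"
  proof (rule Bochner_Integration.integrable_bound)
    show "AE x in lborel. norm (inverse (wt (x::'a) ^ (2 * DIM('a)))) \<le> norm (?g x)"
    proof (rule AE_I2)
      fix x :: 'a
      have "(\<Prod>b\<in>Basis. 1 + (x \<bullet> b)\<^sup>2) \<le> (\<Prod>b\<in>(Basis::'a set). (wt x)\<^sup>2)"
      proof (rule prod_mono)
        fix b :: 'a assume b: "b \<in> Basis"
        have "(x \<bullet> b)\<^sup>2 \<le> (norm x)\<^sup>2" using Basis_le_norm[OF b, of x] by (rule power2_le_iff_abs_le[THEN iffD2, rotated]) simp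
        then show "0 \<le> 1 + (x \<bullet> b)\<^sup>2 \<and> 1 + (x \<bullet> b)\<^sup>2 \<le> (wt x)\<^sup>2" 
          unfolding power2_sum power_one using norm_ge_zero[of x] zero_le_power2[of "x \<bullet> b"] by (intro conjI; linarith)
      qed
      also have "\<dots> = wt x ^ (2 * DIM('a))" by (simp add: power_mult)
      finally have 2: "(\<Prod>b\<in>Basis. 1 + (x \<bullet> b)\<^sup>2) \<le> wt x ^ (2 * DIM('a))" .
      have 3: "0 < (\<Prod>b\<in>Basis. 1 + (x \<bullet> b)\<^sup>2)" by (intro prod_pos) (simp add: add_pos_nonneg)
      have eq: "?g x = inverse (\<Prod>b\<in>Basis. 1 + (x \<bullet> b)\<^sup>2)"
        using prod_inversef[of "\<lambda>b. 1 + (x \<bullet> b)\<^sup>2" Basis] by (simp add: o_def)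
      show "norm (inverse (wt x ^ (2 * DIM('a)))) \<le> norm (?g x)"
        unfolding eq using le_imp_inverse_le[OF 2 3] 3 by simp
    qed
  qed simp
qed

lemma integrable_dominated:
  fixes f :: "'a::euclidean_space \<Rightarrow> complex"
  assumes "f \<in> borel_measurable lborel" "\<And>x. wt x ^ (2 * DIM('a)) * norm (f x) \<le> C"
  shows "integrable lborel f" "norm (\<integral>x. f x \<partial>lborel) \<le> C * (\<integral>x. inverse (wt (x::'a) ^ (2 * DIM('a))) \<partial>lborel)"
proof -
  have le: "norm (f x) \<le> C * inverse (wt x ^ (2 * DIM('a)))" for x
  proof -
    have "0 < wt x ^ (2 * DIM('a))" by (simp add: add_pos_nonneg)
    then show ?thesis using assms(2)[of x] by (simp add: field_simps)
  qed
  show "integrable lborel f"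
    by (rule Bochner_Integration.integrable_bound[OF integrable_inverse_wt[of C]])
       (use assms(1) le in \<open>auto intro!: AE_I2 order_trans[OF le]\<close>)
  have "norm (\<integral>x. f x \<partial>lborel) \<le> (\<integral>x. norm (f x) \<partial>lborel)" by (rule integral_norm_bound)
  also have "\<dots> \<le> (\<integral>x. C * inverse (wt (x::'a) ^ (2 * DIM('a))) \<partial>lborel)"
    by (rule integral_mono) (use \<open>integrable lborel f\<close> integrable_inverse_wt[of C] le in auto)
  finally show "norm (\<integral>x. f x \<partial>lborel) \<le> C * (\<integral>x. inverse (wt (x::'a) ^ (2 * DIM('a))) \<partial>lborel)" by simp
qed

lemma continuous_measurable: "continuous_on UNIV f \<Longrightarrow> f \<in> borel_measurable lborel"
  using borel_measurable_continuous_onI by simp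

lemma Schwartz_smooth: "f \<in> Schwartz \<Longrightarrow> smooth f"
  unfolding Schwartz_def by blast

lemma Schwartz_differentiable: "f \<in> Schwartz \<Longrightarrow> f differentiable (at x)"
  using Schwartz_smooth smooth_differentiable by blast

lemma Schwartz_continuous: "f \<in> Schwartz \<Longrightarrow> continuous_on S f"
  using fam_continuous[of _ "\<lambda>_. f"] Schwartz_RD by blast

lemma Schwartz_measurable: "f \<in> Schwartz \<Longrightarrow> f \<in> borel_measurable lborel"
  by (rule continuous_measurable[OF Schwartz_continuous])

lemma Schwartz_pd: "f \<in> Schwartz \<Longrightarrow> v \<in> Basis \<Longrightarrow> pd v f \<in> Schwartz"
  unfolding Schwartz_RD using fam_pd by blast

lemma Schwartz_integrable: "f \<in> Schwartz \<Longrightarrow> integrable lborel f"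
proof -
  assume f: "f \<in> Schwartz"
  then obtain C where "\<And>x. wt x ^ (2 * DIM('a)) * norm (f x) \<le> C"
    using RDqE[OF fam_Q[OF Schwartz_RD[THEN iffD1, OF f]]] by metis
  then show ?thesis by (rule integrable_dominated(1)[OF Schwartz_measurable[OF f]])
qed

lemma frechet_bound:
  fixes f :: "'a::euclidean_space \<Rightarrow> complex"
  assumes "f differentiable (at x)" "\<And>b. b \<in> Basis \<Longrightarrow> norm (pd b f x) \<le> B"
  shows "norm (pd v f x) \<le> real DIM('a) * B * norm v"
proof -
  have "pd v f x = (\<Sum>b\<in>Basis. complex_of_real (v \<bullet> b) * pd b f x)"
    using has_derivative_unique[OF pd_has_derivative[OF assms(1)] has_derivative_pd[OF assms(1)]] by (rule fun_cong)
  also have "norm \<dots> \<le> (\<Sum>b\<in>(Basis::'a set). norm v * B)"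
  proof (rule sum_norm_le)
    fix b :: 'a assume b: "b \<in> Basis"
    show "norm (complex_of_real (v \<bullet> b) * pd b f x) \<le> norm v * B"
      unfolding norm_mult using assms(2)[OF b] Basis_le_norm[OF b, of v] by (intro mult_mono) auto
  qed
  finally show ?thesis by (simp add: mult_ac)
qed

lemma lipschitz_pd:
  fixes f :: "'a::euclidean_space \<Rightarrow> complex"
  assumes "convex S" "\<And>x. f differentiable (at x)" "\<And>x b. x \<in> S \<Longrightarrow> b \<in> Basis \<Longrightarrow> norm (pd b f x) \<le> B"
    and "x \<in> S" "y \<in> S"
  shows "norm (f x - f y) \<le> real DIM('a) * B * norm (x - y)"
proof (rule differentiable_bound[OF assms(1) _ _ assms(4,5)])
  fix z assume z: "z \<in> S"
  show "(f has_derivative (\<lambda>v. pd v f z)) (at z within S)"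
    by (rule has_derivative_at_withinI[OF pd_has_derivative[OF assms(2)]])
  show "onorm (\<lambda>v. pd v f z) \<le> real DIM('a) * B"
    by (rule onorm_le) (rule frechet_bound[OF assms(2) assms(3)[OF z]])
qed

text \<open>Along any sequence tending to 0 the remainder quotients are bounded by
  \<open>2 * B y\<close>, once by the mean value inequality and once by the bound on the derivative,
  so dominated convergence applies.\<close>

lemma has_derivative_integral:
  fixes g :: "'b \<Rightarrow> 'a::euclidean_space \<Rightarrow> complex"
  assumes der: "\<And>y x. x \<in> ball x0 1 \<Longrightarrow> (g y has_derivative g' y x) (at x)"
    and int: "\<And>x. integrable M (\<lambda>y. g y x)"
    and dom: "\<And>y x v. x \<in> ball x0 1 \<Longrightarrow> norm (g' y x v) \<le> B y * norm v"
    and B: "integrable M B"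
    and meas: "\<And>v. (\<lambda>y. g' y x0 v) \<in> borel_measurable M"
  shows "((\<lambda>x. \<integral>y. g y x \<partial>M) has_derivative (\<lambda>v. \<integral>y. g' y x0 v \<partial>M)) (at x0)"
proof -
  have x0: "x0 \<in> ball x0 1" by simp
  have int': "integrable M (\<lambda>y. g' y x0 v)" for v
    by (rule Bochner_Integration.integrable_bound[OF integrable_mult_left[OF B, of "norm v"] meas])
       (use dom[OF x0] in \<open>auto intro!: AE_I2 order_trans[OF dom[OF x0]]\<close>)
  have lin: "bounded_linear (g' y x0)" for y using der[OF x0] has_derivative_bounded_linear by blast
  have bl: "bounded_linear (\<lambda>v. \<integral>y. g' y x0 v \<partial>M)"
  proof (rule bounded_linear_intro[where K = "\<integral>y. B y \<partial>M"])
    fix v w :: 'a and r :: real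
    show "(\<integral>y. g' y x0 (v + w) \<partial>M) = (\<integral>y. g' y x0 v \<partial>M) + (\<integral>y. g' y x0 w \<partial>M)"
      using int' by (simp add: linear_simps(1)[OF lin])
    show "(\<integral>y. g' y x0 (r *\<^sub>R v) \<partial>M) = r *\<^sub>R (\<integral>y. g' y x0 v \<partial>M)"
      by (simp add: linear_simps(5)[OF lin])
    have "norm (\<integral>y. g' y x0 v \<partial>M) \<le> (\<integral>y. norm (g' y x0 v) \<partial>M)" by (rule integral_norm_bound)
    also have "\<dots> \<le> (\<integral>y. B y * norm v \<partial>M)"
      by (rule integral_mono) (use int' B dom[OF x0] in auto)
    finally show "norm (\<integral>y. g' y x0 v \<partial>M) \<le> norm v * (\<integral>y. B y \<partial>M)" by (simp add: mult_ac)
  qed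
  let ?q = "\<lambda>h. (\<integral>y. g y (x0 + h) \<partial>M) - (\<integral>y. g y x0 \<partial>M) - (\<integral>y. g' y x0 h \<partial>M)"
  have "(\<lambda>h. norm (?q h) / norm h) \<midarrow>0\<rightarrow> 0"
    unfolding LIMSEQ_SEQ_conv[symmetric]
  proof (intro allI impI, elim conjE)
    fix S :: "nat \<Rightarrow> 'a" assume S0: "\<forall>n. S n \<noteq> 0" and S: "S \<longlonglongrightarrow> 0"
    \<comment> \<open>The domination is only known on the unit ball around \<open>x0\<close>; an
      initial segment of the sequence is dropped in order to stay inside it.\<close>
    then obtain n0 where n0: "\<And>n. n \<ge> n0 \<Longrightarrow> norm (S n) < 1"
      using LIMSEQ_D[OF S, of 1] by auto
    define T where "T n = S (n + n0)" for n
    have T: "T \<longlonglongrightarrow> 0" "\<And>n. T n \<noteq> 0" "\<And>n. norm (T n) < 1"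
      using LIMSEQ_ignore_initial_segment[OF S, of n0] S0 n0 unfolding T_def by auto
    let ?f = "\<lambda>n y. (g y (x0 + T n) - g y x0 - g' y x0 (T n)) /\<^sub>R norm (T n)"
    have mf: "?f n \<in> borel_measurable M" for n
      using int int' by (intro borel_measurable_scaleR borel_measurable_diff) (auto intro: borel_measurable_integrable)
    have "(\<lambda>n. \<integral>y. ?f n y \<partial>M) \<longlonglongrightarrow> (\<integral>y. 0 \<partial>M)"
    proof (rule integral_dominated_convergence[where w = "\<lambda>y. 2 * B y"])
      show "AE y in M. (\<lambda>n. ?f n y) \<longlonglongrightarrow> 0"
      proof (rule AE_I2)
        fix y
        have "(\<lambda>h. norm (g y (x0 + h) - g y x0 - g' y x0 h) / norm h) \<midarrow>0\<rightarrow> 0"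
          using der[OF x0, of y] unfolding has_derivative_at by blast
        then have "(\<lambda>n. norm (g y (x0 + T n) - g y x0 - g' y x0 (T n)) / norm (T n)) \<longlonglongrightarrow> 0"
          using T unfolding LIMSEQ_SEQ_conv[symmetric] by blast
        then show "(\<lambda>n. ?f n y) \<longlonglongrightarrow> 0"
          by (intro tendsto_norm_zero_cancel[where f = "\<lambda>n. ?f n y"]) (simp add: divide_inverse mult.commute)
      qed
      show "AE y in M. norm (?f n y) \<le> 2 * B y" for n
      proof (rule AE_I2)
        fix y
        have xT: "x0 + T n \<in> ball x0 1" using T(3)[of n] by (simp add: dist_norm)
        have "norm (g y (x0 + T n) - g y x0) \<le> B y * norm (x0 + T n - x0)"
        proof (rule differentiable_bound[OF convex_ball _ _ xT x0])
          fix z assume z: "z \<in> ball x0 1"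
          show "(g y has_derivative g' y z) (at z within ball x0 1)"
            by (rule has_derivative_at_withinI[OF der[OF z]])
          show "onorm (g' y z) \<le> B y" by (rule onorm_le) (rule dom[OF z])
        qed
        with dom[OF x0, of y "T n"] have "norm (g y (x0 + T n) - g y x0 - g' y x0 (T n)) \<le> 2 * B y * norm (T n)"
          using norm_triangle_ineq4[of "g y (x0 + T n) - g y x0" "g' y x0 (T n)"] by simp
        then have "norm (g y (x0 + T n) - g y x0 - g' y x0 (T n)) / norm (T n) \<le> 2 * B y"
          using T(2)[of n] by (simp add: pos_divide_le_eq)
        then show "norm (?f n y) \<le> 2 * B y" by (simp add: divide_inverse mult.commute)
      qed
    qed (use B mf in auto)
    then have lim: "(\<lambda>n. norm (\<integral>y. ?f n y \<partial>M)) \<longlonglongrightarrow> 0" 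
      using tendsto_norm by (fastforce simp only: Bochner_Integration.integral_zero norm_zero)
    have "norm (\<integral>y. ?f n y \<partial>M) = norm (?q (T n)) / norm (T n)" for n
      using int int' by (simp add: divide_inverse mult.commute)
    with lim have "(\<lambda>n. norm (?q (T n)) / norm (T n)) \<longlonglongrightarrow> 0" by simp
    then show "(\<lambda>n. norm (?q (S n)) / norm (S n)) \<longlonglongrightarrow> 0"
      unfolding T_def by (rule LIMSEQ_offset)
  qed
  with bl show ?thesis unfolding has_derivative_at by blast
qed

lemma pd_integral:
  fixes g :: "'b \<Rightarrow> 'a::euclidean_space \<Rightarrow> complex"
  assumes diff: "\<And>y x. g y differentiable (at x)"
    and int: "\<And>x. integrable M (\<lambda>y. g y x)"
    and meas: "\<And>x b. b \<in> Basis \<Longrightarrow> (\<lambda>y. pd b (g y) x) \<in> borel_measurable M"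
    and dom: "\<And>x0. \<exists>B. integrable M B \<and> (\<forall>y. \<forall>x\<in>ball x0 1. \<forall>b\<in>Basis. norm (pd b (g y) x) \<le> B y)"
  shows "(\<lambda>x. \<integral>y. g y x \<partial>M) differentiable (at x)"
    and "pd v (\<lambda>x. \<integral>y. g y x \<partial>M) = (\<lambda>x. \<integral>y. pd v (g y) x \<partial>M)"
proof -
  have main: "((\<lambda>x. \<integral>y. g y x \<partial>M) has_derivative (\<lambda>v. \<integral>y. pd v (g y) x0 \<partial>M)) (at x0)" for x0
  proof -
    obtain B where B: "integrable M B" "\<And>y x b. x \<in> ball x0 1 \<Longrightarrow> b \<in> Basis \<Longrightarrow> norm (pd b (g y) x) \<le> B y"
      using dom[of x0] by blast
    have eq: "pd v (g y) x0 = (\<Sum>b\<in>Basis. complex_of_real (v \<bullet> b) * pd b (g y) x0)" for v y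
      using has_derivative_unique[OF pd_has_derivative[OF diff] has_derivative_pd[OF diff]] by (rule fun_cong)
    show ?thesis
    proof (rule has_derivative_integral[where B = "\<lambda>y. real DIM('a) * B y" and g' = "\<lambda>y x v. pd v (g y) x"])
      show "norm (pd v (g y) x) \<le> real DIM('a) * B y * norm v" if "x \<in> ball x0 1" for y x v
        by (rule frechet_bound[OF diff B(2)[OF that]])
      show "(\<lambda>y. pd v (g y) x0) \<in> borel_measurable M" for v
      proof -
        have "(\<lambda>y. pd v (g y) x0) = (\<lambda>y. \<Sum>b\<in>Basis. complex_of_real (v \<bullet> b) * pd b (g y) x0)"
          by (intro ext eq)
        then show ?thesis
          by (simp only:) (intro borel_measurable_sum borel_measurable_times borel_measurable_const meas)
      qed
    qed (use B int pd_has_derivative[OF diff] in auto)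
  qed
  then show "(\<lambda>x. \<integral>y. g y x \<partial>M) differentiable (at x)" unfolding differentiable_def by blast
  show "pd v (\<lambda>x. \<integral>y. g y x \<partial>M) = (\<lambda>x. \<integral>y. pd v (g y) x \<partial>M)"
    by (rule pd_eqI[OF main])
qed

text \<open>Differentiation under the integral sign replaces \<open>g\<close> by its derivative and
  leaves the kernel alone, so integrals of this shape form a class for coinduction. The two
  estimates \<open>Q\<close> and \<open>Q'\<close> leave room for both growth and decay.\<close>

lemma fam_integral:
  fixes g :: "'i \<times> 'b \<Rightarrow> 'a::euclidean_space \<Rightarrow> complex" and \<kappa> :: "'i \<Rightarrow> 'b \<Rightarrow> complex"
  assumes g: "fam Q g"
    and \<kappa>: "\<And>i. integrable M (\<kappa> i)"
    and meas: "\<And>i vs x. vs \<in> lists Basis \<Longrightarrow> (\<lambda>y. Dlist vs (g (i, y)) x) \<in> borel_measurable M"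
    and QO: "\<And>f :: 'i \<times> 'b \<Rightarrow> 'a \<Rightarrow> complex. Q f \<Longrightarrow> OMq p f"
    and Qint: "\<And>g. Q g \<Longrightarrow> (\<And>i x. integrable M (\<lambda>y. \<kappa> i y * g (i, y) x)) \<Longrightarrow> Q' (\<lambda>i x. \<integral>y. \<kappa> i y * g (i, y) x \<partial>M)"
    and p: "\<And>x. 1 \<le> p x" "\<And>x0. \<exists>K. \<forall>x\<in>ball x0 1. p x \<le> K"
  shows "fam Q' (\<lambda>i x. \<integral>y. \<kappa> i y * g (i, y) x \<partial>M)"
proof -
  \<comment> \<open>\<open>fam Q g\<close> says nothing about how \<open>g (i, y)\<close> depends on
    \<open>y\<close>; measurability in \<open>y\<close> of all derivatives has to be carried along
    to survive the coinduction.\<close>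
  define good where "good g \<longleftrightarrow> fam Q g \<and> (\<forall>i. \<forall>vs\<in>lists Basis. \<forall>x. (\<lambda>y. Dlist vs (g (i, y)) x) \<in> borel_measurable M)" for g
  have good_meas: "(\<lambda>y. g (i, y) x) \<in> borel_measurable M" if "good g" for g i x
  proof -
    have "(\<lambda>y. Dlist [] (g (i, y)) x) \<in> borel_measurable M" using that unfolding good_def by blast
    then show ?thesis by simp
  qed
  have good_pd: "good (\<lambda>j. pd v (g j))" if "good g" "v \<in> Basis" for g v
    unfolding good_def
  proof (intro conjI allI ballI)
    have "fam Q g" using that(1) unfolding good_def by blast
    then show "fam Q (\<lambda>j. pd v (g j))" using that(2) by (rule fam_pd)
    fix i x and vs :: "'a list" assume "vs \<in> lists Basis"
    then have "vs @ [v] \<in> lists Basis" using that(2) by auto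
    then have "(\<lambda>y. Dlist (vs @ [v]) (g (i, y)) x) \<in> borel_measurable M" using that(1) unfolding good_def by blast
    then show "(\<lambda>y. Dlist vs (pd v (g (i, y))) x) \<in> borel_measurable M" by (simp add: Dlist_append)
  qed
  have locb: "\<exists>C. \<forall>y. \<forall>x\<in>ball x0 1. norm (g (i, y) x) \<le> C" if "good g" for g i x0
  proof -
    have "fam Q g" using that unfolding good_def by blast
    then have Og: "OMq p g" by (rule QO[OF fam_Q])
    obtain N C where C: "0 \<le> C" "\<And>N' j x. N \<le> N' \<Longrightarrow> norm (g j x) \<le> C * p x ^ N'"
      by (rule OMqE[OF Og p(1)], rule that)
    obtain K where K: "\<And>x. x \<in> ball x0 1 \<Longrightarrow> p x \<le> K" using p(2) by blast
    have "norm (g (i, y) x) \<le> C * K ^ N" if "x \<in> ball x0 1" for y x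
    proof -
      have "norm (g (i, y) x) \<le> C * p x ^ N" using C(2) by blast
      also have "\<dots> \<le> C * K ^ N" using C(1) K[OF that] p(1)[of x] by (intro mult_left_mono power_mono) auto
      finally show ?thesis .
    qed
    then show ?thesis by blast
  qed
  have ig: "integrable M (\<lambda>y. \<kappa> i y * g (i, y) x)" if gg: "good g" for g i x
  proof -
    obtain C where C: "\<And>y z. z \<in> ball x 1 \<Longrightarrow> norm (g (i, y) z) \<le> C" using locb[OF gg] by metis
    have "integrable M (\<lambda>y. norm (\<kappa> i y) * C)" using \<kappa>[of i] by simp
    then show ?thesis
    proof (rule Bochner_Integration.integrable_bound)
      show "(\<lambda>y. \<kappa> i y * g (i, y) x) \<in> borel_measurable M"
        using \<kappa>[of i] good_meas[OF gg] by (intro borel_measurable_times) auto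
      show "AE y in M. norm (\<kappa> i y * g (i, y) x) \<le> norm (norm (\<kappa> i y) * C)"
      proof (rule AE_I2)
        fix y
        have "norm (g (i, y) x) \<le> \<bar>C\<bar>" using C[of x y] by simp
        then show "norm (\<kappa> i y * g (i, y) x) \<le> norm (norm (\<kappa> i y) * C)"
          by (simp add: norm_mult abs_mult mult_left_mono)
      qed
    qed
  qed
  have goodg: "good g" using g meas unfolding good_def by blast
  have pdi: "(\<lambda>x. \<integral>y. \<kappa> i y * g (i, y) x \<partial>M) differentiable (at x) \<and>
      pd v (\<lambda>x. \<integral>y. \<kappa> i y * g (i, y) x \<partial>M) = (\<lambda>x. \<integral>y. \<kappa> i y * pd v (g (i, y)) x \<partial>M)" if gg: "good g" for g i x v
  proof -
    have "fam Q g" using gg unfolding good_def by blast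
    then have d: "g j differentiable (at x)" for j x by (rule fam_differentiable)
    have pm: "pd v (\<lambda>x. \<kappa> i y * g (i, y) x) = (\<lambda>x. \<kappa> i y * pd v (g (i, y)) x)" for v y
      by (rule pd_cmult[OF d])
    have d': "(\<lambda>x. \<kappa> i y * g (i, y) x) differentiable (at x)" for y x
      by (intro differentiable_mult d differentiable_const)
    have m: "(\<lambda>y. pd b (\<lambda>x. \<kappa> i y * g (i, y) x) x) \<in> borel_measurable M" if b: "b \<in> Basis" for x b
      unfolding pm using \<kappa>[of i] good_meas[OF good_pd[OF gg b]] by (intro borel_measurable_times) auto
    have dom: "\<exists>B. integrable M B \<and> (\<forall>y. \<forall>x\<in>ball x0 1. \<forall>b\<in>Basis. norm (pd b (\<lambda>x. \<kappa> i y * g (i, y) x) x) \<le> B y)" for x0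
    proof -
      have "\<forall>b\<in>Basis. \<exists>C. \<forall>y. \<forall>x\<in>ball x0 1. norm (pd b (g (i, y)) x) \<le> C"
        using locb[OF good_pd[OF gg]] by blast
      then obtain C where C: "\<And>b y x. b \<in> Basis \<Longrightarrow> x \<in> ball x0 1 \<Longrightarrow> norm (pd b (g (i, y)) x) \<le> C b" by metis
      have "norm (pd b (\<lambda>x. \<kappa> i y * g (i, y) x) x) \<le> norm (\<kappa> i y) * (\<Sum>b\<in>Basis. \<bar>C b\<bar>)"
        if "x \<in> ball x0 1" "b \<in> Basis" for x b y
      proof -
        have "norm (pd b (g (i, y)) x) \<le> \<bar>C b\<bar>" using C[OF that(2,1)] by (rule order_trans) simp
        also have "\<dots> \<le> (\<Sum>b\<in>Basis. \<bar>C b\<bar>)" using that(2) by (intro member_le_sum) auto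
        finally show ?thesis unfolding pm norm_mult by (rule mult_left_mono) simp
      qed
      moreover have "integrable M (\<lambda>y. norm (\<kappa> i y) * (\<Sum>b\<in>Basis. \<bar>C b\<bar>))" using \<kappa>[of i] by simp
      ultimately show ?thesis by blast
    qed
    show ?thesis
      using pd_integral[where M = M and g = "\<lambda>y x. \<kappa> i y * g (i, y) x", OF d' ig[OF gg] m dom]
      unfolding pm by (intro conjI)
  qed
  show ?thesis
  proof (rule fam_coinduct[where X = "\<lambda>h. \<exists>g. good g \<and> h = (\<lambda>i x. \<integral>y. \<kappa> i y * g (i, y) x \<partial>M)"])
    show "\<exists>g'. good g' \<and> (\<lambda>i x. \<integral>y. \<kappa> i y * g (i, y) x \<partial>M) = (\<lambda>i x. \<integral>y. \<kappa> i y * g' (i, y) x \<partial>M)"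
      by (intro exI conjI) (rule goodg, rule refl)
  next
    fix h assume "\<exists>g. good g \<and> h = (\<lambda>i x. \<integral>y. \<kappa> i y * g (i, y) x \<partial>M)"
    then obtain g where h: "good g" "h = (\<lambda>i x. \<integral>y. \<kappa> i y * g (i, y) x \<partial>M)" by blast
    have "fam Q g" using h(1) unfolding good_def by blast
    then have "Q g" by (rule fam_Q)
    then show "Q' h" unfolding h(2) by (rule Qint) (rule ig[OF h(1)])
    show "h i differentiable at x" for i x unfolding h(2) by (rule conjunct1[OF pdi[OF h(1)]])
  next
    fix h v assume "\<exists>g. good g \<and> h = (\<lambda>i x. \<integral>y. \<kappa> i y * g (i, y) x \<partial>M)" and v: "(v::'a) \<in> Basis"
    then obtain g where h: "good g" "h = (\<lambda>i x. \<integral>y. \<kappa> i y * g (i, y) x \<partial>M)" by blast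
    have "(\<lambda>i. pd v (h i)) = (\<lambda>i x. \<integral>y. \<kappa> i y * pd v (g (i, y)) x \<partial>M)"
      unfolding h(2) by (intro ext fun_cong[OF conjunct2[OF pdi[OF h(1)]]])
    then show "\<exists>g. good g \<and> (\<lambda>i. pd v (h i)) = (\<lambda>i x. \<integral>y. \<kappa> i y * g (i, y) x \<partial>M)"
      by (intro exI[of _ "\<lambda>j. pd v (g j)"] conjI) (rule good_pd[OF h(1) v], simp)
  qed
qed

lemma norm_integral_mult_le:
  fixes \<kappa> f :: "'b \<Rightarrow> complex"
  assumes "integrable M \<kappa>" "integrable M (\<lambda>y. \<kappa> y * f y)" "\<And>y. norm (f y) \<le> B" "(\<integral>y. norm (\<kappa> y) \<partial>M) \<le> C" "0 \<le> B"
  shows "norm (\<integral>y. \<kappa> y * f y \<partial>M) \<le> C * B"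
proof -
  have "norm (\<integral>y. \<kappa> y * f y \<partial>M) \<le> (\<integral>y. norm (\<kappa> y * f y) \<partial>M)" by (rule integral_norm_bound)
  also have "\<dots> \<le> (\<integral>y. norm (\<kappa> y) * B \<partial>M)"
  proof (rule integral_mono)
    show "integrable M (\<lambda>y. norm (\<kappa> y * f y))" using assms(2) by (rule integrable_norm)
    show "integrable M (\<lambda>y. norm (\<kappa> y) * B)" using assms(1) by simp
    show "norm (\<kappa> y * f y) \<le> norm (\<kappa> y) * B" for y
      unfolding norm_mult by (rule mult_left_mono[OF assms(3)]) simp
  qed
  also have "\<dots> = (\<integral>y. norm (\<kappa> y) \<partial>M) * B" by simp
  also have "\<dots> \<le> C * B" using assms by (intro mult_right_mono) auto
  finally show ?thesis .
qed

lemma OM_integral: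
  fixes g :: "'i \<times> 'b \<Rightarrow> 'a::euclidean_space \<Rightarrow> complex" and \<kappa> :: "'i \<Rightarrow> 'b \<Rightarrow> complex"
  assumes "OM p g" and \<kappa>: "\<And>i. integrable M (\<kappa> i)" "\<And>i. (\<integral>y. norm (\<kappa> i y) \<partial>M) \<le> C"
    and meas: "\<And>i vs x. vs \<in> lists Basis \<Longrightarrow> (\<lambda>y. Dlist vs (g (i, y)) x) \<in> borel_measurable M"
    and p: "\<And>x. 1 \<le> p x" "\<And>x0. \<exists>K. \<forall>x\<in>ball x0 1. p x \<le> K"
  shows "OM p (\<lambda>i x. \<integral>y. \<kappa> i y * g (i, y) x \<partial>M)"
proof (rule fam_integral[OF assms(1) \<kappa>(1) meas _ _ p])
  fix g :: "'i \<times> 'b \<Rightarrow> 'a \<Rightarrow> complex"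
  assume g: "OMq p g" and ig: "\<And>i x. integrable M (\<lambda>y. \<kappa> i y * g (i, y) x)"
  obtain C' N where C: "C' \<ge> 0" "\<And>N' j x. N' \<ge> N \<Longrightarrow> norm (g j x) \<le> C' * p x ^ N'"
    using OMqE[OF g p(1)] by metis
  show "OMq p (\<lambda>i x. \<integral>y. \<kappa> i y * g (i, y) x \<partial>M)"
  proof (rule OMqI)
    fix i x
    have "norm (\<integral>y. \<kappa> i y * g (i, y) x \<partial>M) \<le> C * (C' * p x ^ N)"
      by (rule norm_integral_mult_le[OF \<kappa>(1) ig _ \<kappa>(2)]) (use C p(1)[of x] in auto)
    then show "norm (\<integral>y. \<kappa> i y * g (i, y) x \<partial>M) \<le> (C * C') * p x ^ N" by (simp add: mult.assoc)
  qed
qed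

lemma RD_integral:
  fixes g :: "'i \<times> 'b \<Rightarrow> 'a::euclidean_space \<Rightarrow> complex" and \<kappa> :: "'i \<Rightarrow> 'b \<Rightarrow> complex"
  assumes "RD p g" and \<kappa>: "\<And>i. integrable M (\<kappa> i)" "\<And>i. (\<integral>y. norm (\<kappa> i y) \<partial>M) \<le> C"
    and meas: "\<And>i vs x. vs \<in> lists Basis \<Longrightarrow> (\<lambda>y. Dlist vs (g (i, y)) x) \<in> borel_measurable M"
    and p: "\<And>x. 1 \<le> p x" "\<And>x0. \<exists>K. \<forall>x\<in>ball x0 1. p x \<le> K"
  shows "RD p (\<lambda>i x. \<integral>y. \<kappa> i y * g (i, y) x \<partial>M)"
proof (rule fam_integral[OF assms(1) \<kappa>(1) meas RDq_imp_OMq _ p])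
  fix g :: "'i \<times> 'b \<Rightarrow> 'a \<Rightarrow> complex"
  assume g: "RDq p g" and ig: "\<And>i x. integrable M (\<lambda>y. \<kappa> i y * g (i, y) x)"
  show "RDq p (\<lambda>i x. \<integral>y. \<kappa> i y * g (i, y) x \<partial>M)"
  proof (rule RDqI)
    fix k
    obtain C' where C: "C' \<ge> 0" "\<And>j x. p x ^ k * norm (g j x) \<le> C'" using RDqE[OF g] by metis
    have "p x ^ k * norm (\<integral>y. \<kappa> i y * g (i, y) x \<partial>M) \<le> C * C'" for i x
    proof -
      have pos: "0 < p x ^ k" using p(1)[of x] by auto
      have "norm (\<integral>y. \<kappa> i y * g (i, y) x \<partial>M) \<le> C * (C' / p x ^ k)"
      proof (rule norm_integral_mult_le[OF \<kappa>(1) ig _ \<kappa>(2)])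
        show "norm (g (i, y) x) \<le> C' / p x ^ k" for y
          using C(2)[of x "(i, y)"] pos by (simp add: field_simps)
      qed (use C(1) pos in auto)
      then show ?thesis using pos by (simp add: field_simps)
    qed
    then show "\<exists>C. \<forall>i x. p x ^ k * norm (\<integral>y. \<kappa> i y * g (i, y) x \<partial>M) \<le> C" by blast
  qed
qed

lemma wt_local: "\<exists>K. \<forall>x\<in>ball x0 1. wt x \<le> K"
proof (intro exI ballI)
  fix x assume "x \<in> ball x0 1"
  then show "wt x \<le> 2 + norm x0" using norm_triangle_sub[of x x0] by (simp add: dist_norm norm_minus_commute)
qed

lemma wt2_local: "\<exists>K. \<forall>x\<in>ball x0 1. wt2 x \<le> K"
proof -
  obtain K where K: "\<And>x. x \<in> ball x0 1 \<Longrightarrow> wt x \<le> K" using wt_local by blast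
  have "wt2 x \<le> K" if "x \<in> ball x0 1" for x
    using K[OF that] norm_snd_le[of "snd x" "fst x"] by simp
  then show ?thesis by blast
qed

section \<open>Test functions and dilations\<close>

lemma pd_eq_0_on_open:
  fixes f :: "'a::euclidean_space \<Rightarrow> complex"
  assumes "open S" "\<And>x. x \<in> S \<Longrightarrow> f x = 0" "x \<in> S"
  shows "pd v f x = 0"
proof -
  have "(f has_derivative (\<lambda>_. 0)) (at x)"
    by (rule has_derivative_transform_within_open[OF has_derivative_const[of 0] assms(1,3)]) (simp add: assms(2))
  then have "frechet_derivative f (at x) = (\<lambda>_. 0)" using frechet_derivative_at by metis
  then show ?thesis by (simp add: pd_def)
qed

lemma open_norm_greater: "open {x::'a::real_normed_vector. r < norm x}"
  by (intro open_Collect_less continuous_intros)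

lemma test_support:
  assumes "f \<in> test"
  obtains r where "r > 0" "\<And>x. r < norm x \<Longrightarrow> f x = 0"
proof -
  have "bounded (closure {x. f x \<noteq> 0})" using assms compact_imp_bounded unfolding test_def by blast
  then obtain r where r: "r > 0" "\<And>x. x \<in> closure {x. f x \<noteq> 0} \<Longrightarrow> norm x \<le> r"
    unfolding bounded_pos by blast
  have "f x = 0" if "r < norm x" for x
    using r(2)[of x] that closure_subset[of "{x. f x \<noteq> 0}"] by fastforce
  with r(1) show ?thesis using that by blast
qed

lemma testI:
  fixes f :: "'a::euclidean_space \<Rightarrow> complex"
  assumes "smooth f" "\<And>x. r < norm x \<Longrightarrow> f x = 0"
  shows "f \<in> test"
proof -
  have "{x. f x \<noteq> 0} \<subseteq> cball 0 r" using assms(2) by (force simp: not_less)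
  then have "bounded {x. f x \<noteq> 0}" using bounded_subset bounded_cball by blast
  then show ?thesis using assms(1) unfolding test_def by (simp add: compact_closure)
qed

text \<open>The vanishing outside a fixed ball passes to derivatives, and on the ball continuity and
  compactness bound everything.\<close>

lemma supp_Schwartz:
  fixes f :: "'a::euclidean_space \<Rightarrow> complex"
  assumes "smooth f" "\<And>x. r < norm x \<Longrightarrow> f x = 0"
  shows "f \<in> Schwartz"
  unfolding Schwartz_RD
proof (rule fam_coinduct[where X = "\<lambda>h. smooth (h ()) \<and> (\<forall>x. r < norm x \<longrightarrow> h () x = 0)"])
  fix h :: "unit \<Rightarrow> 'a \<Rightarrow> complex" assume h: "smooth (h ()) \<and> (\<forall>x. r < norm x \<longrightarrow> h () x = 0)"
  show d: "h i differentiable at x" for i x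
    using smooth_differentiable[OF conjunct1[OF h]] by simp
  show "smooth (pd v (h ())) \<and> (\<forall>x. r < norm x \<longrightarrow> pd v (h ()) x = 0)" if v: "v \<in> Basis" for v
  proof (intro conjI allI impI)
    show "smooth (pd v (h ()))" using h v smooth_pd by blast
    show "pd v (h ()) x = 0" if "r < norm x" for x
      using that h by (intro pd_eq_0_on_open[OF open_norm_greater[of r]]) auto
  qed
  show "RDq wt h"
  proof (rule RDqI)
    fix k
    have "continuous_on (cball 0 r) (h ())"
      by (meson continuous_at_imp_continuous_on differentiable_imp_continuous_within d)
    then have "compact (h () ` cball 0 r)" by (rule compact_continuous_image) simp
    then have "bounded (h () ` cball 0 r)" by (rule compact_imp_bounded)
    then obtain C where C: "C > 0" "\<And>x. norm x \<le> r \<Longrightarrow> norm (h () x) \<le> C"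
      unfolding bounded_pos by auto
    have "wt x ^ k * norm (h i x) \<le> (1 + \<bar>r\<bar>) ^ k * C" for i x
    proof (cases "r < norm x")
      case True
      then show ?thesis using h C(1) by simp
    next
      case False
      then show ?thesis using C(2)[of x] C(1) by (intro mult_mono power_mono) auto
    qed
    then show "\<exists>C. \<forall>i x. wt x ^ k * norm (h i x) \<le> C" by blast
  qed
qed (use assms in simp)

lemma test_Schwartz: "f \<in> test \<Longrightarrow> f \<in> Schwartz"
proof -
  assume f: "f \<in> test"
  obtain r where "r > 0" and r: "\<And>x. r < norm x \<Longrightarrow> f x = 0"
    by (rule test_support[OF f], rule that)
  from f have "smooth f" unfolding test_def by blast
  then show ?thesis by (rule supp_Schwartz[OF _ r])
qed

text \<open>With the trivial estimate the family calculus specialises to closure rules for smooth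
  functions.\<close>

lemma smooth_iff_fam: "smooth f \<longleftrightarrow> fam (\<lambda>_. True) (\<lambda>_::unit. f)"
  unfolding fam_def by simp

lemma smooth_add: "smooth f \<Longrightarrow> smooth g \<Longrightarrow> smooth (\<lambda>x. f x + g x)"
  unfolding smooth_iff_fam by (rule fam_add) auto

lemma smooth_mult: "smooth f \<Longrightarrow> smooth g \<Longrightarrow> smooth (\<lambda>x. f x * g x)"
  unfolding smooth_iff_fam by (rule fam_mult) auto

lemma OM_smooth: "OM p (\<lambda>_::unit. f) \<Longrightarrow> smooth f"
  by (rule fam_smooth)

lemma smooth_const: "smooth (\<lambda>x. c)"
  by (rule OM_smooth[of "\<lambda>_. 1"]) (rule OM_const[where M = "norm c"], auto)

lemma smooth_norm_sq: "smooth (\<lambda>x::'a::euclidean_space. complex_of_real ((norm x)\<^sup>2))"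
proof -
  have "OM wt (\<lambda>_::unit. \<lambda>x::'a. \<Sum>b\<in>Basis. complex_of_real (x \<bullet> b) * complex_of_real (x \<bullet> b))"
  proof (rule OM_sum[OF finite_Basis])
    fix b :: 'a assume b: "b \<in> Basis"
    have "OM wt (\<lambda>_::unit. \<lambda>x. complex_of_real (x \<bullet> b))" by (rule OM_inner[where K = 1]) (simp add: b)
    from OM_mult[OF this this] show "OM wt (\<lambda>_::unit. \<lambda>x. complex_of_real (x \<bullet> b) * complex_of_real (x \<bullet> b))" by simp
  qed simp
  moreover have "(\<Sum>b\<in>Basis. complex_of_real (x \<bullet> b) * complex_of_real (x \<bullet> b)) = complex_of_real ((norm x)\<^sup>2)" for x :: 'a
    by (simp add: power2_norm_eq_inner euclidean_inner[of x x])
  ultimately show ?thesis using OM_smooth by simp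
qed

text \<open>Quotients by arbitrary powers of \<open>g\<close> are closed under the quotient rule,
  whereas quotients by \<open>g\<close> itself are not.\<close>

lemma smooth_divide:
  assumes f: "smooth f" and g: "smooth g" and nz: "\<And>x. g x \<noteq> 0"
  shows "smooth (\<lambda>x. f x / g x)"
  unfolding smooth_iff_fam
proof (rule fam_coinduct[where X = "\<lambda>h. \<exists>P k. smooth P \<and> h = (\<lambda>_ x. P x / g x ^ k)"])
  show "\<exists>P k. smooth P \<and> (\<lambda>_::unit. \<lambda>x. f x / g x) = (\<lambda>_ x. P x / g x ^ k)"
    by (intro exI[of _ f] exI[of _ 1] conjI f) simp
  have hd: "((\<lambda>x. P x / g x ^ k) has_derivative
      (\<lambda>v. (pd v P x * g x - of_nat k * P x * pd v g x) / g x ^ Suc k)) (at x)" if P: "smooth P" for P k x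
  proof -
    have "((\<lambda>x. P x / g x ^ k) has_derivative
      (\<lambda>v. - P x * (inverse (g x ^ k) * (of_nat k * pd v g x * g x ^ (k - 1)) * inverse (g x ^ k)) + pd v P x / g x ^ k)) (at x)"
      using nz[of x] by (intro has_derivative_divide pd_has_derivative has_derivative_power smooth_differentiable P g) auto
    moreover have "- P x * (inverse (g x ^ k) * (of_nat k * pd v g x * g x ^ (k - 1)) * inverse (g x ^ k)) + pd v P x / g x ^ k
      = (pd v P x * g x - of_nat k * P x * pd v g x) / g x ^ Suc k" for v
      using nz[of x] by (cases k) (auto simp: field_simps)
    ultimately show ?thesis by simp
  qed
  fix h :: "unit \<Rightarrow> 'a \<Rightarrow> complex" assume "\<exists>P k. smooth P \<and> h = (\<lambda>_ x. P x / g x ^ k)"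
  then obtain P k where P: "smooth P" and h: "h = (\<lambda>_ x. P x / g x ^ k)" by blast
  show "h i differentiable at x" for i x
    unfolding h differentiable_def by (rule exI, rule hd[OF P])
  fix v :: 'a assume v: "v \<in> Basis"
  have eq: "(\<lambda>i. pd v (h i)) = (\<lambda>_ x. (pd v P x * g x + (- of_nat k) * (P x * pd v g x)) / g x ^ Suc k)"
    unfolding h pd_eqI[OF hd[OF P]] by (simp add: mult.assoc)
  show "\<exists>P k. smooth P \<and> (\<lambda>i. pd v (h i)) = (\<lambda>_ x. P x / g x ^ k)"
    unfolding eq
    by (intro exI conjI) (rule smooth_add[OF smooth_mult[OF smooth_pd[OF P v] g] smooth_mult[OF smooth_const smooth_mult[OF P smooth_pd[OF g v]]]], rule refl)
qed simp

section \<open>Flat functions and smooth cutoffs\<close>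

lemma pow_le_exp:
  assumes "0 \<le> (s::real)"
  shows "s ^ n \<le> fact n * exp s"
proof -
  have "(\<Sum>k\<in>{n}. inverse (fact k) * s ^ k) \<le> (\<Sum>k. inverse (fact k) * s ^ k)"
    by (rule sum_le_suminf[OF summable_exp]) (use assms in auto)
  then have "inverse (fact n) * s ^ n \<le> exp s" by (simp add: exp_def divide_inverse mult.commute)
  then show ?thesis by (simp add: field_simps)
qed

text \<open>For k = 0 this is the standard smooth function vanishing on a half line. The powers of
  1/t are included because differentiation of \<open>flat k\<close> leads to
  \<open>flat (k + 2)\<close> and \<open>flat (k + 1)\<close>.\<close>

definition flat :: "nat \<Rightarrow> real \<Rightarrow> real" where
  "flat k t = (if t > 0 then exp (- (1/t)) * (1/t) ^ k else 0)"

text \<open>The exponential series gives (1/t)^(k+2) <= (k+2)! exp(1/t). The exponent 2 on the right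
  is what makes the difference quotient at t = 0 tend to 0.\<close>

lemma flat_bound: "\<bar>flat k t\<bar> \<le> fact (k + 2) * t\<^sup>2"
proof (cases "t > 0")
  case True
  have "(1/t) ^ (k + 2) \<le> fact (k + 2) * exp (1/t)" by (rule pow_le_exp) (use True in simp)
  then have "exp (- (1/t)) * (1/t) ^ (k + 2) \<le> exp (- (1/t)) * (fact (k + 2) * exp (1/t))"
    by (rule mult_left_mono) simp
  also have "\<dots> = fact (k + 2)" by (simp add: exp_minus field_simps)
  finally have "(exp (- (1/t)) * (1/t) ^ k) * (1/t)\<^sup>2 \<le> fact (k + 2)" unfolding power_add mult.assoc .
  then have "exp (- (1/t)) * (1/t) ^ k \<le> fact (k + 2) * t\<^sup>2" using True by (simp add: power_divide field_simps)
  then show ?thesis using True by (simp add: flat_def)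
qed (simp add: flat_def)

lemma DERIV_flat: "(flat k has_real_derivative (flat (k + 2) t - real k * flat (k + 1) t)) (at t)"
proof -
  consider "t > 0" | "t < 0" | "t = 0" by linarith
  then show ?thesis
  proof cases
    case 1
    have "((\<lambda>t. exp (- (1/t)) * (1/t) ^ k) has_real_derivative
       (exp (- (1/t)) * (1/t^2) * (1/t) ^ k + exp (- (1/t)) * (real k * (1/t) ^ (k - 1) * (- (1/t^2))))) (at t)"
    proof -
      have e: "((\<lambda>t. exp (- (1/t))) has_real_derivative exp (- (1/t)) * (1/t^2)) (at t)"
        and i: "((\<lambda>t. 1/t) has_real_derivative - (1/t^2)) (at t)"
        using 1 by (auto intro!: derivative_eq_intros simp: power2_eq_square)
      from DERIV_mult[OF e DERIV_power[OF i, of k]] show ?thesis by (simp add: mult_ac)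
    qed
    moreover have "exp (- (1/t)) * (1/t^2) * (1/t) ^ k + exp (- (1/t)) * (real k * (1/t) ^ (k - 1) * (- (1/t^2)))
      = flat (k + 2) t - real k * flat (k + 1) t"
      using 1 by (cases k) (auto simp: flat_def power2_eq_square field_simps)
    ultimately have "((\<lambda>t. exp (- (1/t)) * (1/t) ^ k) has_real_derivative (flat (k + 2) t - real k * flat (k + 1) t)) (at t)"
      by simp
    then show ?thesis
      by (rule has_field_derivative_transform_within_open[of _ _ _ "{0<..}"]) (use 1 in \<open>auto simp: flat_def\<close>)
  next
    case 2
    have "((\<lambda>t. 0) has_real_derivative (flat (k + 2) t - real k * flat (k + 1) t)) (at t)"
      using 2 by (simp add: flat_def)
    then show ?thesis
      by (rule has_field_derivative_transform_within_open[of _ _ _ "{..<0}"]) (use 2 in \<open>auto simp: flat_def\<close>)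
  next
    case 3
    have "(\<lambda>h. (flat k (0 + h) - flat k 0) / h) \<midarrow>0\<rightarrow> 0"
    proof (rule Lim_null_comparison[where g = "\<lambda>h. fact (k + 2) * \<bar>h\<bar>"])
      show "\<forall>\<^sub>F h in at 0. norm ((flat k (0 + h) - flat k 0) / h) \<le> fact (k + 2) * \<bar>h\<bar>"
      proof (intro always_eventually allI)
        fix h :: real
        show "norm ((flat k (0 + h) - flat k 0) / h) \<le> fact (k + 2) * \<bar>h\<bar>"
        proof (cases "h = 0")
          case False
          have "\<bar>flat k h\<bar> \<le> fact (k + 2) * \<bar>h\<bar> * \<bar>h\<bar>"
            using flat_bound[of k h] by (simp add: power2_eq_square mult.assoc)
          with False show ?thesis by (simp add: flat_def[of k 0] pos_divide_le_eq)
        qed simp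
      qed
      have "((\<lambda>h::real. fact (k + 2) * \<bar>h\<bar>) \<longlongrightarrow> fact (k + 2) * \<bar>0\<bar>) (at 0)" by (intro tendsto_intros)
      then show "((\<lambda>h::real. fact (k + 2) * \<bar>h\<bar>) \<longlongrightarrow> 0) (at 0)" by simp
    qed
    then show ?thesis using 3 by (simp add: DERIV_def flat_def)
  qed
qed

inductive flatsum :: "('a::euclidean_space \<Rightarrow> real) \<Rightarrow> (unit \<Rightarrow> 'a \<Rightarrow> complex) \<Rightarrow> bool" for q where
  prod: "smooth P \<Longrightarrow> flatsum q (\<lambda>_ x. P x * complex_of_real (flat k (q x)))"
| add: "flatsum q f \<Longrightarrow> flatsum q g \<Longrightarrow> flatsum q (\<lambda>i x. f i x + g i x)"

text \<open>The chain rule keeps finite sums of smooth multiples of \<open>flat k\<close> along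
  \<open>q\<close> inside one class, by the derivative formula for \<open>flat\<close>.\<close>

lemma smooth_flat:
  fixes q :: "'a::euclidean_space \<Rightarrow> real"
  assumes q: "smooth (\<lambda>x. complex_of_real (q x))"
  shows "smooth (\<lambda>x. complex_of_real (flat k (q x)))"
  unfolding smooth_iff_fam
proof (rule fam_coinduct[where X = "flatsum q"])
  let ?Q = "\<lambda>x. complex_of_real (q x)"
  show "flatsum q (\<lambda>_ x. complex_of_real (flat k (q x)))"
    using flatsum.prod[OF smooth_const[of 1], of q k] by simp
  have qd: "(q has_derivative (\<lambda>v. Re (pd v ?Q x))) (at x)" for x
    using has_derivative_Re[OF pd_has_derivative[OF smooth_differentiable[OF q, of x]]] by simp
  \<comment> \<open>As \<open>q\<close> is real valued, its complex partial derivatives are real;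
    this links the real derivative of \<open>flat\<close> to \<open>pd\<close>.\<close>
  have pdq: "pd v ?Q = (\<lambda>x. complex_of_real (Re (pd v ?Q x)))" for v
    by (rule pd_eqI) (rule has_derivative_of_real[OF qd])
  have fd: "((\<lambda>x. complex_of_real (flat k (q x))) has_derivative
     (\<lambda>v. pd v ?Q x * complex_of_real (flat (k + 2) (q x) - real k * flat (k + 1) (q x)))) (at x)" for k x
  proof -
    have "((\<lambda>x. complex_of_real (flat k (q x))) has_derivative
     (\<lambda>v. complex_of_real (Re (pd v ?Q x) * (flat (k + 2) (q x) - real k * flat (k + 1) (q x))))) (at x)"
      by (rule has_derivative_of_real[OF DERIV_compose_FDERIV[OF DERIV_flat qd]])
    moreover have "complex_of_real (Re (pd v ?Q x)) = pd v ?Q x" for v by (rule fun_cong[OF pdq, symmetric])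
    ultimately show ?thesis unfolding of_real_mult by simp
  qed
  have Pd: "((\<lambda>x. P x * complex_of_real (flat k (q x))) has_derivative (\<lambda>v. 
       P x * (pd v ?Q x * complex_of_real (flat (k + 2) (q x) - real k * flat (k + 1) (q x))) + pd v P x * complex_of_real (flat k (q x)))) (at x)"
    if "smooth P" for P k x
    by (rule has_derivative_mult[OF pd_has_derivative[OF smooth_differentiable[OF that]] fd])
  show d: "h i differentiable at x" if "flatsum q h" for h i x
    using that
  proof (induction arbitrary: i x rule: flatsum.induct)
    case (prod P k)
    show ?case unfolding differentiable_def by (rule exI, rule Pd[OF prod])
  next
    case (add f g)
    show ?case by (rule differentiable_add[OF add.IH])
  qed
  show "flatsum q (\<lambda>i. pd v (h i))" if "flatsum q h" "v \<in> Basis" for h v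
    using that(1)
  proof (induction rule: flatsum.induct)
    case (prod P k)
    have sQ: "smooth (pd v ?Q)" by (rule smooth_pd[OF q that(2)])
    have eq: "(\<lambda>i::unit. pd v (\<lambda>x. P x * complex_of_real (flat k (q x)))) =
      (\<lambda>i x. ((P x * pd v ?Q x) * complex_of_real (flat (k + 2) (q x)) + 
        (- of_nat k * (P x * pd v ?Q x)) * complex_of_real (flat (k + 1) (q x))) + pd v P x * complex_of_real (flat k (q x)))"
      unfolding pd_eqI[OF Pd[OF prod]] by (simp add: algebra_simps)
    show ?case unfolding eq
      by (intro flatsum.add flatsum.prod smooth_mult prod sQ smooth_const smooth_pd[OF prod that(2)])
  next
    case (add f g)
    have eq: "(\<lambda>i. pd v (\<lambda>x. f i x + g i x)) = (\<lambda>i x. pd v (f i) x + pd v (g i) x)"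
      using pd_add[OF d[OF add.hyps(1)] d[OF add.hyps(2)]] by (simp add: fun_eq_iff)
    show ?case unfolding eq by (rule flatsum.add[OF add.IH])
  qed
qed simp

text \<open>A quotient f1 / (f1 + f2), where f1 is positive inside radius 2\<epsilon> and f2 outside
  radius \<epsilon>; at least one of the two is positive at every point.\<close>

lemma cutoff_exists:
  assumes "0 < \<epsilon>"
  obtains \<rho> :: "'a::euclidean_space \<Rightarrow> real" where "smooth (\<lambda>x. complex_of_real (\<rho> x))"
    "\<And>x. norm x \<le> \<epsilon> \<Longrightarrow> \<rho> x = 1" "\<And>x. 2 * \<epsilon> \<le> norm x \<Longrightarrow> \<rho> x = 0" "\<And>x. 0 \<le> \<rho> x"
proof -
  let ?q1 = "\<lambda>x::'a. 4 * \<epsilon>\<^sup>2 - (norm x)\<^sup>2" and ?q2 = "\<lambda>x::'a. (norm x)\<^sup>2 - \<epsilon>\<^sup>2"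
  let ?f1 = "\<lambda>x. flat 0 (?q1 x)" and ?f2 = "\<lambda>x. flat 0 (?q2 x)"
  have s1: "smooth (\<lambda>x::'a. complex_of_real (?q1 x))"
    using smooth_add[OF smooth_const[of "complex_of_real (4 * \<epsilon>\<^sup>2)"] smooth_mult[OF smooth_const[of "-1"] smooth_norm_sq]]
    by simp
  have s2: "smooth (\<lambda>x::'a. complex_of_real (?q2 x))"
    using smooth_add[OF smooth_norm_sq smooth_const[of "- complex_of_real (\<epsilon>\<^sup>2)"]] by simp
  have nn: "flat 0 t \<ge> 0" for t by (simp add: flat_def)
  have pos: "flat 0 t > 0" if "t > 0" for t using that by (simp add: flat_def)
  have den: "?f1 x + ?f2 x > 0" for x
  proof (cases "?q1 x > 0")
    case True then show ?thesis using pos[of "?q1 x"] nn[of "?q2 x"] by linarith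
  next
    case False
    then have "?q2 x > 0" using assms zero_less_power[OF assms, of 2] by linarith
    then show ?thesis using pos[of "?q2 x"] nn[of "?q1 x"] by linarith
  qed
  define \<rho> where "\<rho> x = ?f1 x / (?f1 x + ?f2 x)" for x
  show ?thesis
  proof (rule that[of \<rho>])
    have "smooth (\<lambda>x::'a. complex_of_real (?f1 x) / (complex_of_real (?f1 x) + complex_of_real (?f2 x)))"
    proof (rule smooth_divide[OF smooth_flat[OF s1] smooth_add[OF smooth_flat[OF s1] smooth_flat[OF s2]]])
      fix x :: 'a
      show "complex_of_real (?f1 x) + complex_of_real (?f2 x) \<noteq> 0"
        using den[of x] unfolding of_real_add[symmetric] of_real_eq_0_iff by linarith
    qed
    then show "smooth (\<lambda>x. complex_of_real (\<rho> x))" by (simp add: \<rho>_def)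
    show "\<rho> x = 1" if "norm x \<le> \<epsilon>" for x
    proof -
      have "(norm x)\<^sup>2 \<le> \<epsilon>\<^sup>2" using that by (intro power_mono) auto
      then have "?f2 x = 0" by (simp add: flat_def)
      then show ?thesis using den[of x] by (simp add: \<rho>_def)
    qed
    show "\<rho> x = 0" if "2 * \<epsilon> \<le> norm x" for x
    proof -
      have "(2 * \<epsilon>)\<^sup>2 \<le> (norm x)\<^sup>2" using that assms by (intro power_mono) auto
      then have "?f1 x = 0" by (simp add: flat_def power_mult_distrib)
      then show ?thesis by (simp add: \<rho>_def)
    qed
    show "0 \<le> \<rho> x" for x unfolding \<rho>_def using den[of x] nn[of "?q1 x"] by simp
  qed
qed

lemma cutoffs_nonempty: "\<exists>\<Psi>::'a::euclidean_space \<Rightarrow> complex. \<Psi> \<in> cutoffs"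
proof -
  obtain \<rho> :: "'a \<Rightarrow> real" where r: "smooth (\<lambda>x. complex_of_real (\<rho> x))"
    "\<And>x. norm x \<le> 1 \<Longrightarrow> \<rho> x = 1" "\<And>x. 2 * 1 \<le> norm x \<Longrightarrow> \<rho> x = 0"
    using cutoff_exists[of 1] by (metis zero_less_one)
  have "(\<lambda>x. complex_of_real (\<rho> x)) \<in> test" by (rule testI[OF r(1), of 2]) (use r in auto)
  moreover have "\<exists>\<epsilon>>0. \<forall>\<xi>::'a. norm \<xi> < \<epsilon> \<longrightarrow> complex_of_real (\<rho> \<xi>) = 1" using r(2) by (intro exI[of _ 1]) auto
  ultimately show ?thesis unfolding cutoffs_def by blast
qed

section \<open>Dilated multipliers\<close>

lemma Schwartz_OM: "f \<in> Schwartz \<Longrightarrow> OM wt (\<lambda>_. f)"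
  by (rule RD_imp_OM[OF Schwartz_RD_const])

lemma OM_dilate:
  assumes "OM wt f" "\<And>i. \<bar>t i\<bar> \<le> 1"
  shows "OM wt (\<lambda>i x. f i (t i *\<^sub>R x))"
proof -
  have "OM wt (\<lambda>i x. f i (0 + t i *\<^sub>R x))"
  proof (rule OM_affine[OF assms(1), where L = "\<lambda>i x. t i *\<^sub>R x" and M = 1 and K = 1])
    show "linear (\<lambda>x. t i *\<^sub>R x)" for i by (simp add: linear_iff scaleR_add_right)
    show "wt (0 + t i *\<^sub>R x) \<le> 1 * wt x" for i x
      using mult_right_mono[OF assms(2), of "norm x" i] by simp
  qed (use assms(2) in auto)
  then show ?thesis by simp
qed

lemma smooth_dilate:
  assumes "smooth f"
  shows "smooth (\<lambda>x. f (t *\<^sub>R x))"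
proof -
  have "fam (\<lambda>_. True) (\<lambda>i::unit. \<lambda>x. f (0 + t *\<^sub>R x))"
    by (rule fam_affine[where f = "\<lambda>_. f" and c = "\<lambda>_. 0" and L = "\<lambda>_ x. t *\<^sub>R x" and M = "\<bar>t\<bar>", OF assms[unfolded smooth_iff_fam]])
       (auto simp: linear_iff scaleR_add_right)
  then show ?thesis by (simp add: smooth_iff_fam)
qed

lemma pd_dilate:
  assumes "\<And>x. f differentiable (at x)"
  shows "pd v (\<lambda>x. f (t *\<^sub>R x)) = (\<lambda>x. complex_of_real t * pd v f (t *\<^sub>R x))"
proof (rule pd_eqI)
  fix x
  have lin: "linear (\<lambda>x::'a. t *\<^sub>R x)" by (simp add: linear_iff scaleR_add_right)
  have "((\<lambda>x. f (0 + t *\<^sub>R x)) has_derivative (\<lambda>v. pd (t *\<^sub>R v) f (0 + t *\<^sub>R x))) (at x)"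
    by (rule has_derivative_affine[OF lin assms])
  moreover have "pd (t *\<^sub>R v) f y = complex_of_real t * pd v f y" for v y
    using linear_simps(5)[OF has_derivative_bounded_linear[OF pd_has_derivative[OF assms]]] by (simp add: scaleR_conv_of_real)
  ultimately show "((\<lambda>x. f (t *\<^sub>R x)) has_derivative (\<lambda>v. complex_of_real t * pd v f (t *\<^sub>R x))) (at x)" by simp
qed

lemma two_powr_minus_le1: "\<bar>2 powr - real m\<bar> \<le> 1"
  using powr_mono[of "- real m" 0 2] by simp

text \<open>A convergence rate written as boundedness: the mean value inequality gives \<Psi>(2^-m
  \<xi>) - 1 = O(2^-m |\<xi>|), and every derivative gains a factor 2^-m by the chain rule. Applied
  to bounded families, the factor 2^m turns into convergence at the rate 2^-m.\<close>

lemma OM_dilate_diff: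
  assumes "\<Psi> \<in> Schwartz" "\<Psi> 0 = 1"
  shows "OM wt (\<lambda>m \<xi>. complex_of_real (2 powr real m) * (\<Psi> ((2 powr - real m) *\<^sub>R \<xi>) - 1))"
    (is "OM wt ?F")
proof (rule fam_coinduct[where X = "\<lambda>h. h = ?F \<or> OM wt h"])
  have d: "\<Psi> differentiable (at x)" for x by (rule Schwartz_differentiable[OF assms(1)])
  have d': "(\<lambda>\<xi>. \<Psi> (t *\<^sub>R \<xi>)) differentiable (at x)" for t x
    by (rule smooth_differentiable[OF smooth_dilate[OF Schwartz_smooth[OF assms(1)]]])
  have d'': "(\<lambda>\<xi>. \<Psi> (t *\<^sub>R \<xi>) - 1) differentiable (at x)" for t x by (intro differentiable_diff d' differentiable_const)
  have "OMq wt ?F"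
  proof -
    have "\<exists>C. \<forall>x. norm (pd b \<Psi> x) \<le> C" if bB: "b \<in> Basis" for b
    proof -
      obtain C where "\<And>i x. wt x ^ 0 * norm (pd b \<Psi> x) \<le> C"
        using RDqE[OF fam_Q[OF Schwartz_RD[THEN iffD1, OF Schwartz_pd[OF assms(1) bB]]]] by metis
      then show ?thesis by auto
    qed
    then obtain C where C: "\<And>b x. b \<in> Basis \<Longrightarrow> norm (pd b \<Psi> x) \<le> C b" by metis
    define B where "B = (\<Sum>b\<in>Basis. \<bar>C b\<bar>)"
    have B: "norm (pd b \<Psi> x) \<le> B" if "b \<in> Basis" for b x
    proof -
      have "\<bar>C b\<bar> \<le> B" unfolding B_def using that by (intro member_le_sum) auto
      with C[OF that, of x] show ?thesis by linarith
    qed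
    show ?thesis
    proof (rule OMqI[where N = 1])
      fix m and \<xi> :: 'a
      have "norm (\<Psi> ((2 powr - real m) *\<^sub>R \<xi>) - \<Psi> 0) \<le> real DIM('a) * B * norm ((2 powr - real m) *\<^sub>R \<xi> - 0)"
        by (rule lipschitz_pd[OF convex_UNIV d B]) auto
      also have "\<dots> = real DIM('a) * B * norm \<xi> * (2 powr - real m)" by simp
      finally have "norm (?F m \<xi>) \<le> (2 powr real m) * (real DIM('a) * B * norm \<xi> * (2 powr - real m))"
        unfolding assms(2) norm_mult by (intro mult_mono) auto
      also have "\<dots> = real DIM('a) * B * norm \<xi>" by (simp add: powr_minus field_simps)
      also have "\<dots> \<le> real DIM('a) * B * wt \<xi> ^ 1"
        by (intro mult_left_mono) (auto simp: B_def sum_nonneg)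
      finally show "norm (?F m \<xi>) \<le> real DIM('a) * B * wt \<xi> ^ 1" .
    qed
  qed
  moreover fix h assume h: "h = ?F \<or> OM wt h"
  ultimately show "OMq wt h" using fam_Q by blast
  show "h i differentiable at x" for i x
    using h
  proof
    assume "h = ?F"
    then show ?thesis by (simp only:) (intro differentiable_mult d'' differentiable_const)
  qed (rule fam_differentiable)
  fix v :: 'a assume v: "v \<in> Basis"
  have "pd v (?F m) = (\<lambda>\<xi>. pd v \<Psi> ((2 powr - real m) *\<^sub>R \<xi>))" for m
  proof -
    have "pd v (\<lambda>\<xi>. \<Psi> ((2 powr - real m) *\<^sub>R \<xi>) + (-1)) = (\<lambda>\<xi>. complex_of_real (2 powr - real m) * pd v \<Psi> ((2 powr - real m) *\<^sub>R \<xi>) + 0)"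
      by (subst pd_add[OF d']) (simp_all add: pd_dilate[OF d])
    then have "pd v (\<lambda>\<xi>. \<Psi> ((2 powr - real m) *\<^sub>R \<xi>) - 1) = (\<lambda>\<xi>. complex_of_real (2 powr - real m) * pd v \<Psi> ((2 powr - real m) *\<^sub>R \<xi>))"
      by simp
    moreover have "pd v (?F m) = (\<lambda>\<xi>. complex_of_real (2 powr real m) * pd v (\<lambda>\<xi>. \<Psi> ((2 powr - real m) *\<^sub>R \<xi>) - 1) \<xi>)"
      by (rule pd_cmult[OF d''])
    moreover have "complex_of_real (2 powr real m) * complex_of_real (2 powr - real m) = 1"
      unfolding of_real_mult[symmetric] powr_add[symmetric] by simp
    ultimately show ?thesis by (simp only: mult.assoc[symmetric] mult_1)
  qed
  moreover have "OM wt (\<lambda>m \<xi>. pd v \<Psi> ((2 powr - real m) *\<^sub>R \<xi>))"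
    by (rule OM_dilate[OF Schwartz_OM[OF Schwartz_pd[OF assms(1) v]]]) (rule two_powr_minus_le1)
  ultimately have "OM wt (\<lambda>i. pd v (?F i))" by simp
  then show "(\<lambda>i. pd v (h i)) = ?F \<or> OM wt (\<lambda>i. pd v (h i))"
    using h fam_pd[OF _ v, of "OMq wt" h] by auto
qed simp

text \<open>Where \<omega>(2^-k \<xi>) does not vanish, 2^k <= |\<xi>| / \<epsilon>. Any power of
  2^k is thus paid for by polynomial growth in \<xi>, which is the source of all rapid convergence
  in the frequency variable.\<close>

lemma OM_dilate_rapid:
  fixes \<omega> :: "'a::euclidean_space \<Rightarrow> complex"
  assumes "smooth \<omega>" "\<And>x. r < norm x \<Longrightarrow> \<omega> x = 0" "\<And>x. norm x < \<epsilon> \<Longrightarrow> \<omega> x = 0" "0 < \<epsilon>"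
  shows "OM wt (\<lambda>k \<xi>. complex_of_real (2 powr (real k * real N)) * \<omega> ((2 powr - real k) *\<^sub>R \<xi>))"
proof -
  define P where "P \<omega> \<longleftrightarrow> smooth \<omega> \<and> (\<forall>x. r < norm x \<longrightarrow> \<omega> x = 0) \<and> (\<forall>x. norm x < \<epsilon> \<longrightarrow> \<omega> x = 0)" for \<omega> :: "'a \<Rightarrow> complex"
  have Ppd: "P (pd v \<omega>)" if "P \<omega>" "v \<in> Basis" for \<omega> v
    unfolding P_def
  proof (intro conjI allI impI)
    show "smooth (pd v \<omega>)" using that smooth_pd unfolding P_def by blast
    show "pd v \<omega> x = 0" if "r < norm x" for x
      by (rule pd_eq_0_on_open[OF open_norm_greater[of r]]) (use that \<open>P \<omega>\<close> in \<open>auto simp: P_def\<close>)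
    show "pd v \<omega> x = 0" if "norm x < \<epsilon>" for x
      by (rule pd_eq_0_on_open[OF open_ball[of 0 \<epsilon>]]) (use that \<open>P \<omega>\<close> in \<open>auto simp: P_def\<close>)
  qed
  \<comment> \<open>The scalars \<open>s k\<close> collect the factors 2^-k that each
    differentiation of the dilated function releases.\<close>
  let ?X = "\<lambda>h. \<exists>\<omega> s. P \<omega> \<and> (\<forall>k. norm (s k) \<le> 1) \<and> h = (\<lambda>k \<xi>. s k * (complex_of_real (2 powr (real k * real N)) * \<omega> ((2 powr - real k) *\<^sub>R \<xi>)))"
  show ?thesis
  proof (rule fam_coinduct[where X = ?X])
    show "?X (\<lambda>k \<xi>. complex_of_real (2 powr (real k * real N)) * \<omega> ((2 powr - real k) *\<^sub>R \<xi>))"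
      by (intro exI[of _ \<omega>] exI[of _ "\<lambda>_. 1"]) (use assms in \<open>auto simp: P_def\<close>)
  next
    fix h assume "?X h"
    then obtain \<omega> s where \<omega>: "P \<omega>" and s: "\<And>k. norm (s k) \<le> 1"
      and h: "h = (\<lambda>k \<xi>. s k * (complex_of_real (2 powr (real k * real N)) * \<omega> ((2 powr - real k) *\<^sub>R \<xi>)))" by blast
    have sm: "smooth \<omega>" using \<omega> unfolding P_def by blast
    have d: "(\<lambda>\<xi>. \<omega> (t *\<^sub>R \<xi>)) differentiable (at x)" for t x
      by (rule smooth_differentiable[OF smooth_dilate[OF sm]])
    show "h k differentiable at x" for k x
      unfolding h by (intro differentiable_mult d differentiable_const)
    have "\<omega> \<in> Schwartz" using \<omega> supp_Schwartz[of \<omega> r] unfolding P_def by blast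
    then obtain C where C: "C \<ge> 0" "\<And>i x. wt x ^ 0 * norm (\<omega> x) \<le> C"
      using RDqE[OF fam_Q[OF Schwartz_RD[THEN iffD1]]] by metis
    show "OMq wt h"
    proof (rule OMqI)
      fix k \<xi>
      let ?t = "2 powr - real k"
      show "norm (h k \<xi>) \<le> (C / \<epsilon> ^ N) * wt \<xi> ^ N"
      proof (cases "norm (?t *\<^sub>R \<xi>) < \<epsilon>")
        case True
        then have "\<omega> (?t *\<^sub>R \<xi>) = 0" using \<omega> unfolding P_def by blast
        then show ?thesis using C(1) assms(4) by (simp add: h)
      next
        case False
        then have "\<epsilon> \<le> ?t * norm \<xi>" by simp
        then have "2 powr real k \<le> norm \<xi> / \<epsilon>" using assms(4) by (simp add: powr_minus field_simps)
        then have "(2 powr real k) ^ N \<le> (wt \<xi> / \<epsilon>) ^ N"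
          using assms(4) by (intro power_mono) (auto intro: order_trans[OF _ divide_right_mono])
        then have *: "2 powr (real k * real N) \<le> wt \<xi> ^ N / \<epsilon> ^ N" by (simp add: powr_power[symmetric] power_divide powr_powr[symmetric] powr_realpow[symmetric])
        have "norm (h k \<xi>) \<le> 1 * (2 powr (real k * real N) * norm (\<omega> (?t *\<^sub>R \<xi>)))"
          unfolding h norm_mult using s[of k] by (intro mult_mono) auto
        also have "\<dots> \<le> (wt \<xi> ^ N / \<epsilon> ^ N) * C"
          unfolding mult_1 by (rule mult_mono[OF * _ _ norm_ge_zero]) (use C(2)[of "?t *\<^sub>R \<xi>"] assms(4) in auto)
        finally show ?thesis by (simp add: field_simps)
      qed
    qed
    fix v :: 'a assume v: "v \<in> Basis"
    have "pd v (h k) = (\<lambda>\<xi>. (s k * complex_of_real (2 powr - real k)) * (complex_of_real (2 powr (real k * real N)) * pd v \<omega> ((2 powr - real k) *\<^sub>R \<xi>)))" for k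
    proof -
      have "pd v (h k) = (\<lambda>\<xi>. s k * (complex_of_real (2 powr (real k * real N)) * (complex_of_real (2 powr - real k) * pd v \<omega> ((2 powr - real k) *\<^sub>R \<xi>))))"
        unfolding h by (simp add: pd_cmult d pd_dilate[OF smooth_differentiable[OF sm]] differentiable_mult)
      then show ?thesis by (simp add: mult_ac)
    qed
    moreover have "norm (s k * complex_of_real (2 powr - real k)) \<le> 1" for k
      unfolding norm_mult norm_of_real using s[of k] two_powr_minus_le1[of k] by (intro mult_le_one) auto
    ultimately show "?X (\<lambda>k. pd v (h k))"
      by (intro exI[of _ "pd v \<omega>"] exI[of _ "\<lambda>k. s k * complex_of_real (2 powr - real k)"] conjI Ppd[OF \<omega> v]) auto
  qed
qed

section \<open>Oscillatory integrals and Fourier inversion\<close>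

lemma integral_affine:
  fixes f :: "'a::euclidean_space \<Rightarrow> complex"
  assumes "f \<in> borel_measurable lborel" "t \<noteq> 0"
  shows "(\<integral>x. f x \<partial>lborel) = complex_of_real (\<bar>t\<bar> ^ DIM('a)) * (\<integral>x. f (c + t *\<^sub>R x) \<partial>lborel)"
proof -
  have T: "(\<lambda>x::'a. c + t *\<^sub>R x) \<in> measurable lborel borel" by simp
  have m: "f \<in> borel_measurable borel" using assms(1) by simp
  have "(\<integral>x. f x \<partial>lborel) = (\<integral>x. f x \<partial>(density (distr lborel borel (\<lambda>x. c + t *\<^sub>R x)) (\<lambda>_. ennreal (\<bar>t\<bar> ^ DIM('a)))))"
    using lborel_affine[OF assms(2), of c] by simp
  also have "\<dots> = (\<integral>x. (\<bar>t\<bar> ^ DIM('a)) *\<^sub>R f x \<partial>(distr lborel borel (\<lambda>x. c + t *\<^sub>R x)))"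
    by (rule integral_density) (use m in auto)
  also have "\<dots> = (\<integral>x. (\<bar>t\<bar> ^ DIM('a)) *\<^sub>R f (c + t *\<^sub>R x) \<partial>lborel)"
    by (rule integral_distr[OF T]) (use m in measurable)
  finally show ?thesis by (simp add: scaleR_conv_of_real)
qed

lemma integral_translate:
  fixes f :: "'a::euclidean_space \<Rightarrow> complex"
  assumes "f \<in> borel_measurable lborel"
  shows "(\<integral>x. f (c + x) \<partial>lborel) = (\<integral>x. f x \<partial>lborel)"
  using integral_affine[OF assms, of 1 c] by simp

text \<open>The product of the two inverse weights is an integrable majorant, so one pointwise decay
  estimate justifies both orders of integration.\<close>

lemma Fubini_decay:
  fixes H :: "'a::euclidean_space \<times> 'b::euclidean_space \<Rightarrow> complex"
  assumes m: "H \<in> borel_measurable lborel"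
    and b: "\<And>x y. wt x ^ (2 * DIM('a)) * (wt y ^ (2 * DIM('b)) * norm (H (x, y))) \<le> C"
  shows "integrable lborel H"
    and "(\<integral>x. \<integral>y. H (x, y) \<partial>lborel \<partial>lborel) = (\<integral>z. H z \<partial>lborel)"
    and "(\<integral>y. \<integral>x. H (x, y) \<partial>lborel \<partial>lborel) = (\<integral>z. H z \<partial>lborel)"
    and "(\<integral>x. \<integral>y. H (x, y) \<partial>lborel \<partial>lborel) = (\<integral>y. \<integral>x. H (x, y) \<partial>lborel \<partial>lborel)"
proof -
  let ?f = "\<lambda>x::'a. inverse (wt x ^ (2 * DIM('a)))" and ?g = "\<lambda>y::'b. inverse (wt y ^ (2 * DIM('b)))"
  have f: "integrable lborel ?f" and g: "integrable lborel ?g"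
    using integrable_inverse_wt[of 1] by auto
  have nn: "0 \<le> ?f x" "0 \<le> ?g y" for x y by (simp_all add: add_nonneg_nonneg)
  have fg: "integrable (lborel \<Otimes>\<^sub>M lborel) (\<lambda>z. C * (?f (fst z) * ?g (snd z)))"
  proof (rule integrable_mult_right, rule lborel_pair.Fubini_integrable)
    show "(\<lambda>z. ?f (fst z) * ?g (snd z)) \<in> borel_measurable (lborel \<Otimes>\<^sub>M lborel)" by measurable
    have "(\<lambda>x. \<integral>y. norm (?f (fst (x, y)) * ?g (snd (x, y))) \<partial>lborel) = (\<lambda>x. ?f x * (\<integral>y. ?g y \<partial>lborel))"
      using nn by (simp add: norm_mult abs_of_nonneg)
    then show "integrable lborel (\<lambda>x. \<integral>y. norm (?f (fst (x, y)) * ?g (snd (x, y))) \<partial>lborel)"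
      using f by simp
    show "AE x in lborel. integrable lborel (\<lambda>y. ?f (fst (x, y)) * ?g (snd (x, y)))" using g by simp
  qed
  have le: "norm (H z) \<le> norm (C * (?f (fst z) * ?g (snd z)))" for z
  proof -
    obtain x y where z: "z = (x, y)" by fastforce
    have px: "0 < wt x ^ (2 * DIM('a))" and py: "0 < wt y ^ (2 * DIM('b))" by (simp_all add: add_pos_nonneg)
    have "norm (H (x, y)) \<le> C * (?f x * ?g y)" using b[of x y] px py by (simp add: field_simps)
    then show ?thesis unfolding z by simp
  qed
  have int: "integrable (lborel \<Otimes>\<^sub>M lborel) H"
    by (rule Bochner_Integration.integrable_bound[OF fg]) (use m le in \<open>auto simp: lborel_prod\<close>)
  then show "integrable lborel H" by (simp add: lborel_prod)
  have 1: "(\<integral>x. \<integral>y. H (x, y) \<partial>lborel \<partial>lborel) = (\<integral>z. H z \<partial>lborel)"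
    using lborel_pair.integral_fst'[OF int] by (simp add: lborel_prod)
  have 2: "(\<integral>y. \<integral>x. H (x, y) \<partial>lborel \<partial>lborel) = (\<integral>z. H z \<partial>lborel)"
    using lborel_pair.integral_snd[of "\<lambda>x y. H (x, y)"] int by (simp add: lborel_prod)
  show "(\<integral>x. \<integral>y. H (x, y) \<partial>lborel \<partial>lborel) = (\<integral>z. H z \<partial>lborel)"
    and "(\<integral>y. \<integral>x. H (x, y) \<partial>lborel \<partial>lborel) = (\<integral>z. H z \<partial>lborel)"
    and "(\<integral>x. \<integral>y. H (x, y) \<partial>lborel \<partial>lborel) = (\<integral>y. \<integral>x. H (x, y) \<partial>lborel \<partial>lborel)"
    using 1 2 by auto
qed

text \<open>The integral of the translate of \<open>h\<close> by x does not depend on x;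
  differentiating it under the integral sign gives the claim. This supplies all integrations by
  parts.\<close>

lemma integral_pd_zero:
  fixes h :: "'a::euclidean_space \<Rightarrow> complex"
  assumes h: "h \<in> Schwartz" and b: "b \<in> Basis"
  shows "(\<integral>x. pd b h x \<partial>lborel) = 0"
proof -
  have d: "(\<lambda>x. h (y + x)) differentiable (at x)" for y x
    using has_derivative_affine[OF linear_ident Schwartz_differentiable[OF h]] unfolding differentiable_def by blast
  have p: "pd v (\<lambda>x. h (y + x)) = (\<lambda>x. pd v h (y + x))" for v y
    by (rule pd_eqI) (rule has_derivative_affine[OF linear_ident Schwartz_differentiable[OF h]])
  have c: "continuous_on UNIV (\<lambda>y. f (y + x))" if "f \<in> Schwartz" for f and x :: 'a
    by (rule continuous_on_compose2[OF Schwartz_continuous[OF that, of UNIV]]) (auto intro!: continuous_intros)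
  have i: "integrable lborel (\<lambda>y. f (y + x))" if f: "f \<in> Schwartz" for f x
  proof -
    have "RD wt (\<lambda>_::unit. \<lambda>y. f (x + y))"
      proof (rule RD_affine[where L = "\<lambda>_ y. y" and c = "\<lambda>_. x" and M = 1 and K = "wt x" and q = wt, OF Schwartz_RD[THEN iffD1, OF f]])
        show "wt y \<le> wt x * wt (x + y)" for y
        proof -
          have "norm y \<le> norm x + norm (x + y)" using norm_triangle_ineq4[of "x + y" x] by simp
          moreover have "0 \<le> norm x * norm (x + y)" by simp
          moreover have "wt x * wt (x + y) = 1 + norm x + norm (x + y) + norm x * norm (x + y)" by (simp add: algebra_simps)
          ultimately show ?thesis by linarith
        qed
      qed (auto simp: linear_ident)
    then have "integrable lborel (\<lambda>y. f (x + y))" by (intro Schwartz_integrable Schwartz_RD[THEN iffD2])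
    then show ?thesis by (simp add: add.commute)
  qed
  have "pd b (\<lambda>x. \<integral>y. h (y + x) \<partial>lborel) = (\<lambda>x. \<integral>y. pd b (\<lambda>x. h (y + x)) x \<partial>lborel)"
  proof (rule pd_integral(2)[OF d i[OF h]])
    show "(\<lambda>y. pd v (\<lambda>x. h (y + x)) x) \<in> borel_measurable lborel" if "v \<in> Basis" for x v
      unfolding p by (rule continuous_measurable[OF c[OF Schwartz_pd[OF h that]]])
    fix x0 :: 'a
    let ?n = "2 * DIM('a)"
    have "\<exists>C. \<forall>x. wt x ^ ?n * norm (pd v h x) \<le> C" if "v \<in> Basis" for v
      using RDqE[OF fam_Q[OF Schwartz_RD[THEN iffD1, OF Schwartz_pd[OF h that]]]] by metis
    then obtain C where C: "\<And>v x. v \<in> Basis \<Longrightarrow> wt x ^ ?n * norm (pd v h x) \<le> C v" by metis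
    define K where "K = (\<Sum>v\<in>Basis. \<bar>C v\<bar>)"
    have K: "wt x ^ ?n * norm (pd v h x) \<le> K" if "v \<in> Basis" for v x
    proof -
      have "\<bar>C v\<bar> \<le> K" unfolding K_def using that by (intro member_le_sum) auto
      with C[OF that, of x] show ?thesis by linarith
    qed
    have "norm (pd v (\<lambda>x. h (y + x)) x) \<le> ((2 + norm x0) ^ ?n * K) * inverse (wt y ^ ?n)"
      if "x \<in> ball x0 1" "v \<in> Basis" for x y v
    proof -
      have "norm x \<le> 1 + norm x0" using that(1) norm_triangle_sub[of x x0] by (simp add: dist_norm norm_minus_commute)
      moreover have "norm y \<le> norm (y + x) + norm x" using norm_triangle_ineq4[of "y + x" x] by simp
      moreover have "0 \<le> norm (y + x)" "0 \<le> norm x0 * norm (y + x)" by simp_all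
      moreover have "(2 + norm x0) * wt (y + x) = 2 + norm x0 + 2 * norm (y + x) + norm x0 * norm (y + x)"
        by (simp add: algebra_simps)
      ultimately have w: "wt y \<le> (2 + norm x0) * wt (y + x)" by linarith
      have "wt y ^ ?n * norm (pd v h (y + x)) \<le> ((2 + norm x0) * wt (y + x)) ^ ?n * norm (pd v h (y + x))"
        by (intro mult_right_mono power_mono w) auto
      also have "\<dots> = (2 + norm x0) ^ ?n * (wt (y + x) ^ ?n * norm (pd v h (y + x)))"
        by (simp add: power_mult_distrib)
      also have "\<dots> \<le> (2 + norm x0) ^ ?n * K"
        by (intro mult_left_mono K that(2)) (simp add: add_nonneg_nonneg)
      finally show ?thesis unfolding p
        by (simp add: field_simps add_pos_nonneg)
    qed
    then show "\<exists>B. integrable lborel B \<and> (\<forall>y. \<forall>x\<in>ball x0 1. \<forall>b\<in>Basis. norm (pd b (\<lambda>x. h (y + x)) x) \<le> B y)"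
      using integrable_inverse_wt[where 'a = 'a] by blast
  qed
  moreover have "(\<lambda>x. \<integral>y. h (y + x) \<partial>lborel) = (\<lambda>x. \<integral>y. h y \<partial>lborel)"
    using integral_translate[OF Schwartz_measurable[OF h]] by (simp add: add.commute)
  ultimately have "(\<lambda>x. \<integral>y. pd b h (y + x) \<partial>lborel) = (\<lambda>x. 0)" by (simp add: p)
  then have "(\<integral>y. pd b h (y + 0) \<partial>lborel) = 0" by (rule fun_cong)
  then show ?thesis by simp
qed

text \<open>Up to constants, \<open>osc 1\<close> and \<open>osc (-1)\<close> are pseudo-differential operators (including both Fourier transforms)
  with the transformed function merged into \<open>F\<close>.\<close>

definition osc :: "real \<Rightarrow> ('a::euclidean_space \<times> 'a \<Rightarrow> complex) \<Rightarrow> 'a \<Rightarrow> complex" where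
  "osc s F x = (\<integral>\<zeta>. cis (s * (x \<bullet> \<zeta>)) * F (x, \<zeta>) \<partial>lborel)"

lemma linear_Pair0: "linear (\<lambda>x. (x, 0))" "linear (\<lambda>y. (0, y))"
  by (simp_all add: linear_iff)

lemma OM_cis_inner:
  fixes c :: "'i \<Rightarrow> 'a::euclidean_space"
  assumes "\<And>i. norm (c i) \<le> K"
  shows "OM wt (\<lambda>i x. cis (x \<bullet> c i))"
  using OM_cis[OF OM_const[of "\<lambda>_. 1" 1] OM_inner[OF assms]] by simp

text \<open>The weight \<open>wt2\<close> does not see x, so the sections decay uniformly in x,
  which therefore joins the index.\<close>

lemma RD_section:
  fixes F :: "'i \<Rightarrow> 'a::euclidean_space \<times> 'a \<Rightarrow> complex"
  assumes "RD wt2 F"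
  shows "RD wt (\<lambda>(i, x) \<zeta>. F i (x, \<zeta>))"
proof -
  have "RD wt (\<lambda>ix \<zeta>. F (fst ix) ((snd ix, 0) + (0, \<zeta>)))"
    by (rule RD_affine[where c = "\<lambda>ix. (snd ix, 0)" and L = "\<lambda>_ \<zeta>. (0, \<zeta>)" and M = 1 and K = 1, OF RD_reindex[OF assms, of fst]])
       (auto simp: linear_Pair0)
  then show ?thesis by (simp add: case_prod_unfold)
qed

lemma Schwartz_section:
  fixes F :: "'i \<Rightarrow> 'a::euclidean_space \<times> 'a \<Rightarrow> complex"
  assumes "RD wt2 F"
  shows "(\<lambda>\<zeta>. F i (x, \<zeta>)) \<in> Schwartz"
  using RD_Schwartz[OF RD_section[OF assms], of "(i, x)"] by simp

lemma Schwartz_cis_mult: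
  fixes f :: "'a::euclidean_space \<Rightarrow> complex"
  assumes "f \<in> Schwartz"
  shows "(\<lambda>\<zeta>. cis (s * (x \<bullet> \<zeta>)) * f \<zeta>) \<in> Schwartz"
proof -
  have "RD wt (\<lambda>_::unit. \<lambda>\<zeta>. cis (\<zeta> \<bullet> (s *\<^sub>R x)) * f \<zeta>)"
    by (rule RD_mult[OF OM_cis_inner[where K = "norm (s *\<^sub>R x)"] Schwartz_RD_const[OF assms]]) auto
  then show ?thesis by (simp add: Schwartz_RD inner_commute)
qed

lemma osc_bounded:
  fixes F :: "'i \<Rightarrow> 'a::euclidean_space \<times> 'a \<Rightarrow> complex"
  assumes "RD wt2 F"
  shows "\<exists>C. \<forall>i x. norm (osc s (F i) x) \<le> C"
proof -
  obtain C where C: "\<And>i z. wt2 z ^ (2 * DIM('a)) * norm (F i z) \<le> C" using RDqE[OF fam_Q[OF assms]] by metis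
  have "norm (osc s (F i) x) \<le> C * (\<integral>x. inverse (wt (x::'a) ^ (2 * DIM('a))) \<partial>lborel)" for i x
    unfolding osc_def
    by (rule integrable_dominated(2)[OF Schwartz_measurable[OF Schwartz_cis_mult[OF Schwartz_section[OF assms]]]])
       (use C[of "(x, _)"] in \<open>simp add: norm_mult\<close>)
  then show ?thesis by blast
qed

lemma osc_integrable:
  fixes F :: "'i \<Rightarrow> 'a::euclidean_space \<times> 'a \<Rightarrow> complex"
  assumes "RD wt2 F"
  shows "integrable lborel (\<lambda>\<zeta>. cis (s * (x \<bullet> \<zeta>)) * F i (x, \<zeta>))"
  by (rule Schwartz_integrable[OF Schwartz_cis_mult[OF Schwartz_section[OF assms]]])

lemma OM_snd_inner: "OM wt2 (\<lambda>_ z. complex_of_real (v \<bullet> snd z))" for v :: "'a::euclidean_space"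
proof -
  have "OM wt2 (\<lambda>_ z. complex_of_real ((0 + snd z) \<bullet> v))"
    by (rule OM_affine[where c = "\<lambda>_. 0" and L = "\<lambda>_ z. snd z" and M = 1 and K = 1 and q = wt and f = "\<lambda>_ y. complex_of_real (y \<bullet> v)", OF OM_inner[where K = "norm v"]])
       (auto simp: linear_iff Basis_prod_def)
  then show ?thesis by (simp add: inner_commute)
qed

text \<open>An x-derivative falls either on the phase, giving a factor linear in \<zeta>, or on
  \<open>F\<close>. Both new symbols decay rapidly in \<zeta>, so the result is again an oscillatory
  integral of the same kind.\<close>

lemma pd_osc:
  fixes F :: "'i \<Rightarrow> 'a::euclidean_space \<times> 'a \<Rightarrow> complex"
  assumes F: "RD wt2 F"
  shows "osc s (F i) differentiable (at x)"
    and "v \<in> Basis \<Longrightarrow> pd v (osc s (F i)) = osc s (\<lambda>z. (\<i> * complex_of_real s) * (complex_of_real (v \<bullet> snd z) * F i z) + pd (v, 0) (F i) z)"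
    and "v \<in> Basis \<Longrightarrow> RD wt2 (\<lambda>i z. (\<i> * complex_of_real s) * (complex_of_real (v \<bullet> snd z) * F i z) + pd (v, 0) (F i) z)"
proof -
  let ?G = "\<lambda>v i z. (\<i> * complex_of_real s) * (complex_of_real (v \<bullet> snd z) * F i z) + pd (v, 0) (F i) z"
  have G: "RD wt2 (?G v)" if v: "v \<in> Basis" for v
    by (rule RD_add[OF RD_cmult[OF RD_mult[OF OM_snd_inner F]] fam_pd[OF F]])
       (use v in \<open>auto simp: Basis_prod_def\<close>)
  then show "v \<in> Basis \<Longrightarrow> RD wt2 (?G v)" by blast
  have hd: "((\<lambda>x. cis (s * (x \<bullet> \<zeta>)) * F i (x, \<zeta>)) has_derivative (\<lambda>v. cis (s * (x \<bullet> \<zeta>)) * ?G v i (x, \<zeta>))) (at x)" for x \<zeta>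
  proof -
    have 1: "((\<lambda>x. F i ((0, \<zeta>) + (x, 0))) has_derivative (\<lambda>v. pd (v, 0) (F i) ((0, \<zeta>) + (x, 0)))) (at x)"
      by (rule has_derivative_affine[OF linear_Pair0(1) fam_differentiable[OF F]])
    have bl: "bounded_linear (\<lambda>x. complex_of_real (s * (x \<bullet> \<zeta>)))"
      by (rule bounded_linear_compose[OF bounded_linear_of_real bounded_linear_const_mult[OF bounded_linear_inner_left]])
    have 2: "((\<lambda>x. exp (\<i> * complex_of_real (s * (x \<bullet> \<zeta>)))) has_derivative (\<lambda>v. exp (\<i> * complex_of_real (s * (x \<bullet> \<zeta>))) * (\<i> * complex_of_real (s * (v \<bullet> \<zeta>))))) (at x)"
      by (rule has_derivative_compose[OF has_derivative_mult_right[OF bounded_linear_imp_has_derivative[OF bl]] DERIV_exp[unfolded has_field_derivative_def]])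
    show ?thesis using has_derivative_mult[OF 2 1] by (simp add: cis_conv_exp algebra_simps)
  qed
  have d: "(\<lambda>x. cis (s * (x \<bullet> \<zeta>)) * F i (x, \<zeta>)) differentiable (at x)" for x \<zeta>
    unfolding differentiable_def by (rule exI, rule hd)
  have p: "pd v (\<lambda>x. cis (s * (x \<bullet> \<zeta>)) * F i (x, \<zeta>)) = (\<lambda>x. cis (s * (x \<bullet> \<zeta>)) * ?G v i (x, \<zeta>))" for v \<zeta>
    by (rule pd_eqI) (rule hd)
  have m: "(\<lambda>\<zeta>. pd b (\<lambda>x. cis (s * (x \<bullet> \<zeta>)) * F i (x, \<zeta>)) x) \<in> borel_measurable lborel" if "b \<in> Basis" for x b
    unfolding p using osc_integrable[OF G[OF that], of s x i] by (rule borel_measurable_integrable)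
  let ?n = "2 * DIM('a)"
  have "\<exists>C. \<forall>i z. wt2 z ^ ?n * norm (?G v i z) \<le> C" if "v \<in> Basis" for v
    using fam_Q[OF G[OF that]] unfolding RDq_def by blast
  then obtain C where C: "\<And>v i z. v \<in> Basis \<Longrightarrow> wt2 z ^ ?n * norm (?G v i z) \<le> C v" by metis
  have dom: "\<exists>B. integrable lborel B \<and> (\<forall>\<zeta>. \<forall>x\<in>ball x0 1. \<forall>b\<in>Basis. norm (pd b (\<lambda>x. cis (s * (x \<bullet> \<zeta>)) * F i (x, \<zeta>)) x) \<le> B \<zeta>)" for x0 :: 'a
  proof -
    have "norm (pd b (\<lambda>x. cis (s * (x \<bullet> \<zeta>)) * F i (x, \<zeta>)) x) \<le> (\<Sum>v\<in>Basis. \<bar>C v\<bar>) * inverse (wt \<zeta> ^ ?n)" if "b \<in> Basis" for b x \<zeta>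
    proof -
      have "\<bar>C b\<bar> \<le> (\<Sum>v\<in>Basis. \<bar>C v\<bar>)" using that by (intro member_le_sum) auto
      with C[OF that, of "(x, \<zeta>)" i] have "wt \<zeta> ^ ?n * norm (?G b i (x, \<zeta>)) \<le> (\<Sum>v\<in>Basis. \<bar>C v\<bar>)" by simp
      moreover have "0 < wt \<zeta> ^ ?n" by (simp add: add_pos_nonneg)
      ultimately show ?thesis unfolding p norm_mult norm_cis mult_1 by (simp add: pos_le_divide_eq divide_inverse[symmetric] mult.commute)
    qed
    then show ?thesis using integrable_inverse_wt[where 'a = 'a] by blast
  qed
  have e: "osc s (F i) = (\<lambda>x. \<integral>\<zeta>. cis (s * (x \<bullet> \<zeta>)) * F i (x, \<zeta>) \<partial>lborel)" by (simp add: osc_def fun_eq_iff)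
  show "osc s (F i) differentiable (at x)"
    unfolding e by (rule pd_integral(1)[OF d osc_integrable[OF F] m dom])
  show "pd v (osc s (F i)) = osc s (?G v i)"
    unfolding e by (subst pd_integral(2)[OF d osc_integrable[OF F] m dom]) (simp_all add: p osc_def fun_eq_iff)
qed

text \<open>Multiplication by a coordinate of x is a \<zeta>-derivative of the phase. Integrating by
  parts gives i s (x \<bullet> b) osc F = - osc (derivative of F), whence the constant i/s.\<close>

lemma osc_coord:
  fixes F :: "'i \<Rightarrow> 'a::euclidean_space \<times> 'a \<Rightarrow> complex"
  assumes F: "RD wt2 F" and s: "s \<noteq> 0" and b: "b \<in> Basis"
  shows "complex_of_real (x \<bullet> b) * osc s (F i) x = osc s (\<lambda>z. (\<i> / complex_of_real s) * pd (0, b) (F i) z) x"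
proof -
  let ?h = "\<lambda>\<zeta>. cis (s * (x \<bullet> \<zeta>)) * F i (x, \<zeta>)"
  have hS: "?h \<in> Schwartz" by (rule Schwartz_cis_mult[OF Schwartz_section[OF F]])
  have b0: "(0, b) \<in> Basis" using b by (simp add: Basis_prod_def)
  have pF: "RD wt2 (\<lambda>i. pd (0, b) (F i))" by (rule fam_pd[OF F b0])
  have "(?h has_derivative (\<lambda>v. (\<i> * complex_of_real (s * (x \<bullet> v))) * ?h \<zeta> + cis (s * (x \<bullet> \<zeta>)) * pd (0, v) (F i) (x, \<zeta>))) (at \<zeta>)" for \<zeta>
  proof -
    have 1: "((\<lambda>\<zeta>. F i ((x, 0) + (0, \<zeta>))) has_derivative (\<lambda>v. pd (0, v) (F i) ((x, 0) + (0, \<zeta>)))) (at \<zeta>)"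
      by (rule has_derivative_affine[OF linear_Pair0(2) fam_differentiable[OF F]])
    have bl: "bounded_linear (\<lambda>\<zeta>. complex_of_real (s * (x \<bullet> \<zeta>)))"
      by (rule bounded_linear_compose[OF bounded_linear_of_real bounded_linear_const_mult[OF bounded_linear_inner_right]])
    have 2: "((\<lambda>\<zeta>. exp (\<i> * complex_of_real (s * (x \<bullet> \<zeta>)))) has_derivative (\<lambda>v. exp (\<i> * complex_of_real (s * (x \<bullet> \<zeta>))) * (\<i> * complex_of_real (s * (x \<bullet> v))))) (at \<zeta>)"
      by (rule has_derivative_compose[OF has_derivative_mult_right[OF bounded_linear_imp_has_derivative[OF bl]] DERIV_exp[unfolded has_field_derivative_def]])
    show ?thesis using has_derivative_mult[OF 2 1] by (simp add: cis_conv_exp algebra_simps)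
  qed
  then have "pd b ?h = (\<lambda>\<zeta>. (\<i> * complex_of_real (s * (x \<bullet> b))) * ?h \<zeta> + cis (s * (x \<bullet> \<zeta>)) * pd (0, b) (F i) (x, \<zeta>))"
    by (rule pd_eqI)
  with integral_pd_zero[OF hS b] have "0 = (\<integral>\<zeta>. (\<i> * complex_of_real (s * (x \<bullet> b))) * ?h \<zeta> + cis (s * (x \<bullet> \<zeta>)) * pd (0, b) (F i) (x, \<zeta>) \<partial>lborel)"
    by simp
  also have "\<dots> = (\<integral>\<zeta>. (\<i> * complex_of_real (s * (x \<bullet> b))) * ?h \<zeta> \<partial>lborel) + (\<integral>\<zeta>. cis (s * (x \<bullet> \<zeta>)) * pd (0, b) (F i) (x, \<zeta>) \<partial>lborel)"
    by (rule Bochner_Integration.integral_add[OF integrable_mult_right[OF osc_integrable[OF F]] osc_integrable[OF pF]])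
  also have "\<dots> = \<i> * complex_of_real (s * (x \<bullet> b)) * osc s (F i) x + osc s (pd (0, b) (F i)) x"
    by (simp add: osc_def)
  finally have 0: "\<i> * complex_of_real (s * (x \<bullet> b)) * osc s (F i) x = - osc s (pd (0, b) (F i)) x"
    by (simp add: add_eq_0_iff)
  have "osc s (\<lambda>z. (\<i> / complex_of_real s) * pd (0, b) (F i) z) x = (\<integral>\<zeta>. (\<i> / complex_of_real s) * (cis (s * (x \<bullet> \<zeta>)) * pd (0, b) (F i) (x, \<zeta>)) \<partial>lborel)"
    unfolding osc_def by (simp add: mult.left_commute)
  also have "\<dots> = (\<i> / complex_of_real s) * osc s (pd (0, b) (F i)) x"
    unfolding osc_def by (rule integral_mult_right_zero)
  also have "\<dots> = - (\<i> / complex_of_real s) * (\<i> * complex_of_real (s * (x \<bullet> b)) * osc s (F i) x)"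
    unfolding 0 by simp
  also have "\<dots> = complex_of_real (x \<bullet> b) * osc s (F i) x" using s by (simp add: field_simps)
  finally show ?thesis by simp
qed

text \<open>Rapid decay needs only plain boundedness on a class closed under derivatives and under
  multiplication by coordinates: each further power of the weight is gained from |x| <= sum of |x
  \<bullet> b|.\<close>

lemma RD_coinduct:
  fixes f :: "'i \<Rightarrow> 'a::euclidean_space \<Rightarrow> complex"
  assumes f: "X f"
    and bnd: "\<And>f. X f \<Longrightarrow> \<exists>C. \<forall>i x. norm (f i x) \<le> C"
    and dif: "\<And>f i x. X f \<Longrightarrow> f i differentiable (at x)"
    and pdc: "\<And>f v. X f \<Longrightarrow> v \<in> Basis \<Longrightarrow> X (\<lambda>i. pd v (f i))"
    and mul: "\<And>f v. X f \<Longrightarrow> v \<in> Basis \<Longrightarrow> X (\<lambda>i x. complex_of_real (x \<bullet> v) * f i x)"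
  shows "RD wt f"
proof (rule fam_coinduct[where X = X and f = f and Q = "RDq wt"])
  show "X f" by (rule f)
  show "h i differentiable at x" if "X h" for h i x by (rule dif[OF that])
  show "X (\<lambda>i. pd v (h i))" if "X h" "v \<in> Basis" for h v by (rule pdc[OF that])
  fix f assume "X f"
  show "RDq wt f"
  proof (rule RDqI)
    fix k show "\<exists>C. \<forall>i x. wt x ^ k * norm (f i x) \<le> C"
      using \<open>X f\<close>
    proof (induction k arbitrary: f)
      case 0
      from bnd[OF this] show ?case by simp
    next
      case (Suc k)
      obtain C where C: "\<And>i x. wt x ^ k * norm (f i x) \<le> C" using Suc.IH[OF Suc.prems] by blast
      have "\<forall>v\<in>Basis. \<exists>C. \<forall>i x. wt x ^ k * norm (complex_of_real (x \<bullet> v) * f i x) \<le> C"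
        by (intro ballI Suc.IH mul[OF Suc.prems])
      then obtain D where D: "\<And>v i x. v \<in> Basis \<Longrightarrow> wt x ^ k * norm (complex_of_real (x \<bullet> v) * f i x) \<le> D v" by metis
      have "wt x ^ Suc k * norm (f i x) \<le> C + (\<Sum>v\<in>Basis. D v)" for i x
      proof -
        have "wt x ^ Suc k * norm (f i x) = wt x ^ k * norm (f i x) + wt x ^ k * norm (f i x) * norm x"
          by (simp add: algebra_simps)
        also have "\<dots> \<le> wt x ^ k * norm (f i x) + wt x ^ k * norm (f i x) * (\<Sum>v\<in>Basis. \<bar>x \<bullet> v\<bar>)"
          by (intro add_left_mono mult_left_mono norm_le_l1) simp
        also have "\<dots> = wt x ^ k * norm (f i x) + (\<Sum>v\<in>Basis. wt x ^ k * norm (complex_of_real (x \<bullet> v) * f i x))"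
          by (simp add: sum_distrib_left norm_mult mult_ac)
        also have "\<dots> \<le> C + (\<Sum>v\<in>Basis. D v)" by (intro add_mono sum_mono C D)
        finally show ?thesis .
      qed
      then show ?case by blast
    qed
  qed
qed

text \<open>By \<open>pd_osc\<close> and \<open>osc_coord\<close> the oscillatory integrals form a
  class as required by \<open>RD_coinduct\<close>; decay in \<zeta> of the symbol, with no decay in
  x, becomes decay in x of the integral.\<close>

lemma RD_osc:
  fixes F :: "'i \<Rightarrow> 'a::euclidean_space \<times> 'a \<Rightarrow> complex"
  assumes F: "RD wt2 F" and s: "s \<noteq> 0"
  shows "RD wt (\<lambda>i. osc s (F i))"
proof (rule RD_coinduct[where X = "\<lambda>h. \<exists>F. RD wt2 F \<and> h = (\<lambda>i. osc s (F i))"])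
  show "\<exists>F'. RD wt2 F' \<and> (\<lambda>i. osc s (F i)) = (\<lambda>i. osc s (F' i))" by (intro exI conjI, rule F, rule refl)
  fix h assume "\<exists>F. RD wt2 F \<and> h = (\<lambda>i. osc s ((F :: 'i \<Rightarrow> 'a \<times> 'a \<Rightarrow> complex) i))"
  then obtain F :: "'i \<Rightarrow> 'a \<times> 'a \<Rightarrow> complex" where F: "RD wt2 F" and h: "h = (\<lambda>i. osc s (F i))" by blast
  show "\<exists>C. \<forall>i x. norm (h i x) \<le> C" unfolding h by (rule osc_bounded[OF F])
  show "h i differentiable at x" for i x unfolding h by (rule pd_osc(1)[OF F])
  fix v :: 'a assume v: "v \<in> Basis"
  show "\<exists>F. RD wt2 F \<and> (\<lambda>i. pd v (h i)) = (\<lambda>i. osc s (F i))"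
    unfolding h by (intro exI conjI, rule pd_osc(3)[OF F v, where s = s], intro ext fun_cong[OF pd_osc(2)[OF F v]])
  have v0: "(0, v) \<in> Basis" using v by (simp add: Basis_prod_def)
  have "RD wt2 (\<lambda>i z. (\<i> / complex_of_real s) * pd (0, v) (F i) z)"
    by (rule RD_cmult[OF fam_pd[OF F v0], where M = "norm (\<i> / complex_of_real s)"]) auto
  then show "\<exists>F. RD wt2 F \<and> (\<lambda>i x. complex_of_real (x \<bullet> v) * h i x) = (\<lambda>i. osc s (F i))"
    unfolding h by (intro exI conjI, assumption, intro ext osc_coord[OF F s v])
qed

abbreviation fconst :: "'a::euclidean_space itself \<Rightarrow> complex" where
  "fconst _ \<equiv> complex_of_real ((2 * pi) powr (- real DIM('a)))"

lemma RD_snd: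
  fixes f :: "'i \<Rightarrow> 'a::euclidean_space \<Rightarrow> complex"
  assumes "RD wt f"
  shows "RD (wt2 :: 'a \<times> 'a \<Rightarrow> real) (\<lambda>i z. f i (snd z))"
proof -
  have "RD (wt2 :: 'a \<times> 'a \<Rightarrow> real) (\<lambda>i z. f i (0 + snd z))"
    by (rule RD_affine[where c = "\<lambda>_. 0" and L = "\<lambda>_ z. snd z" and M = 1 and K = 1, OF assms])
       (auto simp: linear_iff Basis_prod_def)
  then show ?thesis by simp
qed

lemma OM_snd:
  fixes f :: "'i \<Rightarrow> 'a::euclidean_space \<Rightarrow> complex"
  assumes "OM wt f"
  shows "OM (wt2 :: 'a \<times> 'a \<Rightarrow> real) (\<lambda>i z. f i (snd z))"
proof -
  have "OM (wt2 :: 'a \<times> 'a \<Rightarrow> real) (\<lambda>i z. f i (0 + snd z))"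
    by (rule OM_affine[where c = "\<lambda>_. 0" and L = "\<lambda>_ z. snd z" and M = 1 and K = 1, OF assms])
       (auto simp: linear_iff Basis_prod_def)
  then show ?thesis by simp
qed

section \<open>The Fourier transform as an oscillatory integral\<close>

lemma Four_osc: "Four f = osc (-1) (\<lambda>z. f (snd z))"
  by (simp add: Four_def osc_def fun_eq_iff inner_commute)

lemma Finv_osc: "Finv f = (\<lambda>x::'a::euclidean_space. fconst TYPE('a) * osc 1 (\<lambda>z. f (snd z)) x)"
  by (simp add: Finv_def osc_def fun_eq_iff)

lemma Finv_Four: "Finv f x = fconst TYPE('a) * Four f (- x)" for x :: "'a::euclidean_space"
  by (simp add: Finv_def Four_def inner_commute)

lemma RD_Four: "RD wt f \<Longrightarrow> RD wt (\<lambda>i. Four (f i))"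
  unfolding Four_osc by (rule RD_osc[OF RD_snd]) auto

lemma RD_Finv:
  fixes f :: "'i \<Rightarrow> 'a::euclidean_space \<Rightarrow> complex"
  assumes "RD wt f"
  shows "RD wt (\<lambda>i. Finv (f i))"
  unfolding Finv_osc
  by (rule RD_cmult[OF RD_osc[OF RD_snd[OF assms]], where M = "norm (fconst TYPE('a))"]) auto

lemma Four_Schwartz: "f \<in> Schwartz \<Longrightarrow> Four f \<in> Schwartz"
  unfolding Schwartz_RD by (rule RD_Four)

lemma Finv_Schwartz: "f \<in> Schwartz \<Longrightarrow> Finv f \<in> Schwartz"
  unfolding Schwartz_RD by (rule RD_Finv)

lemma Schwartz_cis: "f \<in> Schwartz \<Longrightarrow> (\<lambda>\<zeta>. cis (x \<bullet> \<zeta>) * f \<zeta>) \<in> Schwartz"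
  using Schwartz_cis_mult[of f 1 x] by simp

lemma Schwartz_cis_neg: "f \<in> Schwartz \<Longrightarrow> (\<lambda>\<zeta>. cis (- (x \<bullet> \<zeta>)) * f \<zeta>) \<in> Schwartz"
  using Schwartz_cis_mult[of f "-1" x] by simp

lemma Four_integrable: "f \<in> Schwartz \<Longrightarrow> integrable lborel (\<lambda>x. cis (- (x \<bullet> \<xi>)) * f x)"
  using Schwartz_integrable[OF Schwartz_cis_neg[of f \<xi>]] by (simp add: inner_commute)

lemma Four_add: "f \<in> Schwartz \<Longrightarrow> g \<in> Schwartz \<Longrightarrow> Four (\<lambda>x. f x + g x) = (\<lambda>\<xi>. Four f \<xi> + Four g \<xi>)"
  unfolding Four_def fun_eq_iff
  by (simp only: distrib_left Bochner_Integration.integral_add[OF Four_integrable Four_integrable]) simp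

lemma Four_cmult: "Four (\<lambda>x. c * f x) = (\<lambda>\<xi>. c * Four f \<xi>)"
  unfolding Four_def fun_eq_iff by (simp add: mult.left_commute)

lemma Four_diff: "f \<in> Schwartz \<Longrightarrow> g \<in> Schwartz \<Longrightarrow> Four (\<lambda>x. f x - g x) = (\<lambda>\<xi>. Four f \<xi> - Four g \<xi>)"
  using Four_add[of f "\<lambda>x. -1 * g x"] Schwartz_cmult[of g "-1"] Four_cmult[of "-1" g] by simp

lemma Finv_add: "f \<in> Schwartz \<Longrightarrow> g \<in> Schwartz \<Longrightarrow> Finv (\<lambda>x. f x + g x) = (\<lambda>\<xi>. Finv f \<xi> + Finv g \<xi>)"
  unfolding Finv_Four fun_eq_iff by (simp add: Four_add distrib_left)

lemma Finv_cmult: "Finv (\<lambda>x. c * f x) = (\<lambda>\<xi>. c * Finv f \<xi>)"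
  unfolding Finv_Four fun_eq_iff by (simp add: Four_cmult)

lemma Finv_diff: "f \<in> Schwartz \<Longrightarrow> g \<in> Schwartz \<Longrightarrow> Finv (\<lambda>x. f x - g x) = (\<lambda>\<xi>. Finv f \<xi> - Finv g \<xi>)"
  unfolding Finv_Four fun_eq_iff by (simp add: Four_diff right_diff_distrib)

lemma Schwartz_RDq_bound:
  assumes "f \<in> Schwartz"
  obtains C where "C \<ge> 0" "\<And>x. wt x ^ k * norm (f x) \<le> C"
proof -
  obtain C where C: "C \<ge> 0" "\<And>i x. wt x ^ k * norm (f x) \<le> C"
    using RDqE[OF fam_Q[OF Schwartz_RD[THEN iffD1, OF assms]]] by metis
  then show ?thesis using that by blast
qed

lemma Four_mult_formula:
  fixes f g :: "'a::euclidean_space \<Rightarrow> complex"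
  assumes f: "f \<in> Schwartz" and g: "g \<in> Schwartz"
  shows "(\<integral>\<xi>. Four f \<xi> * g \<xi> \<partial>lborel) = (\<integral>x. f x * Four g x \<partial>lborel)"
proof -
  let ?n = "2 * DIM('a)"
  let ?H = "\<lambda>z. cis (- (fst z \<bullet> snd z)) * (f (fst z) * g (snd z))"
  obtain C where C: "C \<ge> 0" "\<And>x. wt x ^ ?n * norm (f x) \<le> C" using Schwartz_RDq_bound[OF f] by blast
  obtain D where D: "D \<ge> 0" "\<And>x. wt x ^ ?n * norm (g x) \<le> D" using Schwartz_RDq_bound[OF g] by blast
  have cont: "continuous_on UNIV ?H"
    by (intro continuous_intros continuous_on_compose2[OF Schwartz_continuous[OF f, of UNIV]]
        continuous_on_compose2[OF Schwartz_continuous[OF g, of UNIV]] continuous_on_cis) auto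
  have b: "wt x ^ ?n * (wt y ^ ?n * norm (?H (x, y))) \<le> C * D" for x y
  proof -
    have "wt x ^ ?n * (wt y ^ ?n * norm (?H (x, y))) = (wt x ^ ?n * norm (f x)) * (wt y ^ ?n * norm (g y))"
      by (simp add: norm_mult mult_ac)
    also have "\<dots> \<le> C * D" using C D by (intro mult_mono) auto
    finally show ?thesis .
  qed
  have "(\<integral>\<xi>. Four f \<xi> * g \<xi> \<partial>lborel) = (\<integral>y. \<integral>x. ?H (x, y) \<partial>lborel \<partial>lborel)"
    unfolding Four_def by (simp add: mult.assoc[symmetric])
  also have "\<dots> = (\<integral>x. \<integral>y. ?H (x, y) \<partial>lborel \<partial>lborel)"
    using Fubini_decay(4)[OF continuous_measurable[OF cont] b] by simp
  also have "\<dots> = (\<integral>x. f x * Four g x \<partial>lborel)"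
    unfolding Four_def by (simp add: inner_commute mult.left_commute)
  finally show ?thesis .
qed

section \<open>The Gaussian and the inversion formula\<close>

definition gauss :: "'a::euclidean_space \<Rightarrow> complex" where
  "gauss x = complex_of_real (exp (- ((norm x)\<^sup>2 / 2)))"

lemma has_derivative_gauss:
  "(gauss has_derivative (\<lambda>v. - complex_of_real (x \<bullet> v) * gauss x)) (at x)" for x :: "'a::euclidean_space"
proof -
  have g: "gauss = (\<lambda>x::'a. complex_of_real (exp (- ((x \<bullet> x) / 2))))"
    by (simp add: gauss_def fun_eq_iff power2_norm_eq_inner)
  show ?thesis unfolding g
    by (auto intro!: derivative_eq_intros simp: inner_commute fun_eq_iff)
qed

text \<open>Differentiation multiplies the Gaussian by a linear function, so the coinduction class
  consists of all polynomially bounded amplitudes times the Gaussian.\<close>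

lemma gauss_Schwartz: "gauss \<in> Schwartz"
  unfolding Schwartz_RD
proof (rule fam_coinduct[where X = "\<lambda>h. \<exists>P. OM wt P \<and> h = (\<lambda>i x. P i x * gauss x)"])
  show "\<exists>P. OM wt P \<and> (\<lambda>_::unit. gauss) = (\<lambda>i x. P i x * gauss x)"
    by (intro exI[of _ "\<lambda>_ _. 1"] conjI OM_const[of "\<lambda>_. 1" 1]) auto
  fix h assume "\<exists>P. OM wt P \<and> h = (\<lambda>(i::unit) (x::'a). P i x * gauss x)"
  then obtain P :: "unit \<Rightarrow> 'a \<Rightarrow> complex" where P: "OM wt P" and h: "h = (\<lambda>i x. P i x * gauss x)" by blast
  have hd: "((\<lambda>x. P i x * gauss x) has_derivative (\<lambda>v. P i x * (- complex_of_real (x \<bullet> v) * gauss x) + pd v (P i) x * gauss x)) (at x)" for i x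
    by (rule has_derivative_mult[OF pd_has_derivative[OF fam_differentiable[OF P]] has_derivative_gauss])
  show "h i differentiable at x" for i x unfolding h differentiable_def by (rule exI, rule hd)
  show "RDq wt h"
  proof (rule RDqI)
    fix k
    obtain C N where C: "C \<ge> 0" "\<And>N' i x. N' \<ge> N \<Longrightarrow> norm (P i x) \<le> C * wt x ^ N'"
      by (rule OMqE[OF fam_Q[OF P]], simp, rule that)
    have "wt x ^ k * norm (h i x) \<le> C * (fact (k + N) * exp (3/2))" for i x
    proof -
      have w0: "0 \<le> wt x" by simp
      have "wt x ^ (k + N) \<le> fact (k + N) * exp (wt x)" by (rule pow_le_exp[OF w0])
      then have "wt x ^ (k + N) * exp (- ((norm x)\<^sup>2 / 2)) \<le> fact (k + N) * exp (wt x) * exp (- ((norm x)\<^sup>2 / 2))"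
        by (rule mult_right_mono) simp
      also have "\<dots> = fact (k + N) * exp (wt x - (norm x)\<^sup>2 / 2)" 
        unfolding mult.assoc exp_add[symmetric] by simp
      \<comment> \<open>Completing the square: 1 + t - t^2/2 = 3/2 - (t-1)^2/2.\<close>
      also have "\<dots> \<le> fact (k + N) * exp (3/2)"
      proof -
        have "0 \<le> (norm x - 1)\<^sup>2" by simp
        then have "wt x - (norm x)\<^sup>2 / 2 \<le> 3/2" by (simp add: power2_diff)
        then show ?thesis by (intro mult_left_mono) auto
      qed
      finally have e: "wt x ^ (k + N) * exp (- ((norm x)\<^sup>2 / 2)) \<le> fact (k + N) * exp (3/2)" .
      have "wt x ^ k * norm (h i x) = wt x ^ k * (norm (P i x) * exp (- ((norm x)\<^sup>2 / 2)))"
        by (simp add: h norm_mult gauss_def)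
      also have "\<dots> \<le> wt x ^ k * ((C * wt x ^ N) * exp (- ((norm x)\<^sup>2 / 2)))"
        by (intro mult_left_mono mult_right_mono C(2)) auto
      also have "\<dots> = C * (wt x ^ (k + N) * exp (- ((norm x)\<^sup>2 / 2)))" by (simp add: power_add mult_ac)
      also have "\<dots> \<le> C * (fact (k + N) * exp (3/2))" using e C(1) by (rule mult_left_mono)
      finally show ?thesis .
    qed
    then show "\<exists>C. \<forall>i x. wt x ^ k * norm (h i x) \<le> C" by blast
  qed
  fix v :: 'a assume v: "v \<in> Basis"
  have "OM wt (\<lambda>i x. (-1) * (P i x * complex_of_real (x \<bullet> v)) + pd v (P i) x)"
  proof (rule OM_add[OF OM_cmult[OF OM_mult[OF P OM_inner[where K = "norm v"]], where M = 1] fam_pd[OF P v]])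
  qed auto
  moreover have "(\<lambda>i. pd v (h i)) = (\<lambda>i x. ((-1) * (P i x * complex_of_real (x \<bullet> v)) + pd v (P i) x) * gauss x)"
    unfolding h pd_eqI[OF hd] by (simp add: algebra_simps)
  ultimately show "\<exists>P. OM wt P \<and> (\<lambda>i. pd v (h i)) = (\<lambda>i x. P i x * gauss x)"
    by blast
qed

lemma integral_gauss: "(\<integral>x. gauss (x::'a::euclidean_space) \<partial>lborel) = complex_of_real (sqrt (2 * pi) ^ DIM('a))"
proof -
  have i1: "integrable lborel (\<lambda>t::real. exp (- (t\<^sup>2 / 2)))" and e1: "(\<integral>t. exp (- (t\<^sup>2 / 2)) \<partial>lborel) = sqrt (2 * pi)"
  proof -
    have eq: "(\<lambda>t::real. exp (- (t\<^sup>2 / 2))) = (\<lambda>t. sqrt (2 * pi) * std_normal_density t)"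
      by (simp add: std_normal_density_def fun_eq_iff)
    show "integrable lborel (\<lambda>t::real. exp (- (t\<^sup>2 / 2)))" unfolding eq by simp
    show "(\<integral>t. exp (- (t\<^sup>2 / 2)) \<partial>lborel) = sqrt (2 * pi)" unfolding eq by simp
  qed
  have n1: "(\<integral>\<^sup>+t. ennreal (exp (- (t\<^sup>2 / 2))) \<partial>lborel) = ennreal (sqrt (2 * pi))"
    using nn_integral_eq_integral[OF i1] e1 by simp
  have "(\<integral>\<^sup>+x. ennreal (exp (- ((norm (x::'a))\<^sup>2 / 2))) \<partial>lborel) = (\<integral>\<^sup>+x. (\<Prod>b\<in>Basis. ennreal (exp (- ((x \<bullet> b)\<^sup>2 / 2)))) \<partial>(lborel :: 'a measure))"
  proof (rule nn_integral_cong)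
    fix x :: 'a
    have "exp (- ((norm x)\<^sup>2 / 2)) = exp (\<Sum>b\<in>Basis. - ((x \<bullet> b)\<^sup>2 / 2))"
    proof -
      have "(norm x)\<^sup>2 = (\<Sum>b\<in>Basis. (x \<bullet> b)\<^sup>2)"
        unfolding power2_norm_eq_inner by (subst euclidean_inner) (simp only: power2_eq_square)
      then show ?thesis by (simp only: sum_divide_distrib sum_negf)
    qed
    also have "\<dots> = (\<Prod>b\<in>Basis. exp (- ((x \<bullet> b)\<^sup>2 / 2)))" by (simp add: exp_sum)
    finally show "ennreal (exp (- ((norm x)\<^sup>2 / 2))) = (\<Prod>b\<in>Basis. ennreal (exp (- ((x \<bullet> b)\<^sup>2 / 2))))"
      by (simp add: prod_ennreal)
  qed
  also have "\<dots> = (\<Prod>b\<in>(Basis :: 'a set). \<integral>\<^sup>+t. ennreal (exp (- (t\<^sup>2 / 2))) \<partial>lborel)"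
    by (rule nn_integral_lborel_prod[where f = "\<lambda>_ t. ennreal (exp (- (t\<^sup>2 / 2)))"]) auto
  also have "\<dots> = ennreal (sqrt (2 * pi) ^ DIM('a))" unfolding n1 by (simp add: ennreal_power)
  finally have n: "(\<integral>\<^sup>+x. ennreal (exp (- ((norm (x::'a))\<^sup>2 / 2))) \<partial>lborel) = ennreal (sqrt (2 * pi) ^ DIM('a))" .
  have "(\<integral>x. exp (- ((norm (x::'a))\<^sup>2 / 2)) \<partial>lborel) = enn2real (\<integral>\<^sup>+x. ennreal (exp (- ((norm (x::'a))\<^sup>2 / 2))) \<partial>lborel)"
    by (rule integral_eq_nn_integral) auto
  then have "(\<integral>x. exp (- ((norm (x::'a))\<^sup>2 / 2)) \<partial>lborel) = sqrt (2 * pi) ^ DIM('a)" unfolding n by simp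
  then show ?thesis unfolding gauss_def by simp
qed

lemma osc_cmult: "osc s (\<lambda>z. c * F z) x = c * osc s F x"
  by (simp add: osc_def mult.left_commute)

text \<open>The transform satisfies the same first-order equation as the Gaussian, by
  \<open>pd_osc\<close> and \<open>osc_coord\<close>. Its product with exp(|x|^2/2) thus has
  derivative 0 and is a constant, computed at the origin.\<close>

lemma Four_gauss: "Four gauss \<xi> = complex_of_real (sqrt (2 * pi) ^ DIM('a)) * gauss \<xi>" for \<xi> :: "'a::euclidean_space"
proof -
  let ?F = "\<lambda>_::unit. \<lambda>z::'a \<times> 'a. gauss (snd z)"
  have F: "RD wt2 ?F" by (rule RD_snd[OF Schwartz_RD_const[OF gauss_Schwartz]])
  have pdF: "pd v (\<lambda>z::'a \<times> 'a. gauss (snd z)) = (\<lambda>z. - complex_of_real (snd z \<bullet> snd v) * gauss (snd z))" for v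
    by (rule pd_eqI) (rule has_derivative_compose[OF has_derivative_snd[OF has_derivative_ident] has_derivative_gauss])
  have Fo: "Four gauss = osc (-1) (?F ())" by (rule Four_osc)
  have pdb: "pd b (Four gauss) x = - complex_of_real (x \<bullet> b) * Four gauss x" if b: "b \<in> Basis" for b x :: 'a
  proof -
    let ?G = "\<lambda>z::'a \<times> 'a. complex_of_real (snd z \<bullet> b) * gauss (snd z)"
    have "pd b (Four gauss) = osc (-1) (\<lambda>z. (- \<i>) * ?G z)"
      unfolding Fo pd_osc(2)[OF F b] pdF by (simp add: inner_commute)
    then have 1: "pd b (Four gauss) x = - \<i> * osc (-1) ?G x" by (simp only: osc_cmult)
    have "complex_of_real (x \<bullet> b) * Four gauss x = osc (-1) (\<lambda>z. \<i> * ?G z) x"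
      unfolding Fo using osc_coord[OF F _ b, where s = "-1" and x = x] unfolding pdF by simp
    then have 2: "complex_of_real (x \<bullet> b) * Four gauss x = \<i> * osc (-1) ?G x" by (simp only: osc_cmult)
    show ?thesis using 1 2 by simp
  qed
  have hF: "(Four gauss has_derivative (\<lambda>v. - complex_of_real (x \<bullet> v) * Four gauss x)) (at x)" for x :: 'a
  proof -
    have "(\<Sum>b\<in>Basis. complex_of_real (v \<bullet> b) * pd b (Four gauss) x) = - complex_of_real (x \<bullet> v) * Four gauss x" for v
    proof -
      have "(\<Sum>b\<in>Basis. complex_of_real (v \<bullet> b) * pd b (Four gauss) x) = (\<Sum>b\<in>Basis. complex_of_real ((x \<bullet> b) * (v \<bullet> b)) * (- Four gauss x))"
        by (rule sum.cong) (auto simp: pdb)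
      also have "\<dots> = complex_of_real (x \<bullet> v) * (- Four gauss x)"
        unfolding euclidean_inner[of x v] of_real_sum by (rule sum_distrib_right[symmetric])
      finally show ?thesis by simp
    qed
    then show ?thesis
      using has_derivative_pd[OF Schwartz_differentiable[OF Four_Schwartz[OF gauss_Schwartz]], of x] by simp
  qed
  let ?E = "\<lambda>x::'a. complex_of_real (exp ((x \<bullet> x) / 2))"
  have hE: "(?E has_derivative (\<lambda>v. complex_of_real (x \<bullet> v) * ?E x)) (at x)" for x
    by (auto intro!: derivative_eq_intros simp: inner_commute fun_eq_iff)
  have "((\<lambda>x. Four gauss x * ?E x) has_derivative (\<lambda>v. 0)) (at x within UNIV)" for x
    using has_derivative_mult[OF hF hE, of x] by (simp add: algebra_simps)
  then obtain c where c: "\<And>x. Four gauss x * ?E x = c"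
    using has_derivative_zero_constant[OF convex_UNIV, of "\<lambda>x. Four gauss x * ?E x"] by auto
  have "Four gauss (0::'a) = complex_of_real (sqrt (2 * pi) ^ DIM('a))"
    using integral_gauss[where 'a = 'a] by (simp add: Four_def cis_zero)
  with c[of 0] have "c = complex_of_real (sqrt (2 * pi) ^ DIM('a))" by simp
  with c[of \<xi>] have "Four gauss \<xi> * ?E \<xi> = complex_of_real (sqrt (2 * pi) ^ DIM('a))" by simp
  then have "Four gauss \<xi> * (?E \<xi> * gauss \<xi>) = complex_of_real (sqrt (2 * pi) ^ DIM('a)) * gauss \<xi>"
    by (simp add: mult.assoc[symmetric])
  moreover have "?E \<xi> * gauss \<xi> = 1"
    unfolding gauss_def of_real_mult[symmetric] by (simp add: power2_norm_eq_inner exp_minus)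
  ultimately show ?thesis by simp
qed

lemma fconst_gauss: "fconst TYPE('a::euclidean_space) * (complex_of_real (sqrt (2 * pi) ^ DIM('a)) * complex_of_real (sqrt (2 * pi) ^ DIM('a))) = 1"
proof -
  have "sqrt (2 * pi) ^ DIM('a) * sqrt (2 * pi) ^ DIM('a) = (2 * pi) ^ DIM('a)"
    unfolding power_mult_distrib[symmetric] by simp
  moreover have "(2 * pi) powr (- real DIM('a)) * (2 * pi) ^ DIM('a) = 1"
  proof -
    have "(2 * pi) ^ DIM('a) = (2 * pi) powr (real DIM('a))" by (simp add: powr_realpow)
    then show ?thesis by (simp only: powr_add[symmetric]) simp
  qed
  ultimately show ?thesis unfolding of_real_mult[symmetric] by simp
qed

lemma Schwartz_dilate:
  fixes f :: "'a::euclidean_space \<Rightarrow> complex"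
  assumes f: "f \<in> Schwartz" and t: "t \<noteq> 0"
  shows "(\<lambda>x. f (c + t *\<^sub>R x)) \<in> Schwartz"
  unfolding Schwartz_RD
proof (rule RD_affine[where L = "\<lambda>_ x. t *\<^sub>R x" and c = "\<lambda>_. c" and M = "\<bar>t\<bar>" and K = "(1 + norm c) * (1 + 1 / \<bar>t\<bar>)", OF Schwartz_RD[THEN iffD1, OF f]])
  show "linear (\<lambda>x::'a. t *\<^sub>R x)" by (simp add: linear_iff scaleR_add_right)
  show "wt x \<le> (1 + norm c) * (1 + 1 / \<bar>t\<bar>) * wt (c + t *\<^sub>R x)" for x
  proof -
    have "\<bar>t\<bar> * norm x \<le> norm c + norm (c + t *\<^sub>R x)" using norm_triangle_ineq4[of "c + t *\<^sub>R x" c] by simp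
    then have "norm x \<le> (norm c + norm (c + t *\<^sub>R x)) * (1 / \<bar>t\<bar>)" using t by (simp add: field_simps)
    moreover have "norm c + norm (c + t *\<^sub>R x) \<le> (1 + norm c) * wt (c + t *\<^sub>R x)"
      using mult_nonneg_nonneg[OF norm_ge_zero[of c] norm_ge_zero[of "c + t *\<^sub>R x"]] by (simp add: distrib_left distrib_right)
    then have "(norm c + norm (c + t *\<^sub>R x)) * (1 / \<bar>t\<bar>) \<le> (1 + norm c) * wt (c + t *\<^sub>R x) * (1 / \<bar>t\<bar>)"
      by (rule mult_right_mono) simp
    moreover have "1 \<le> (1 + norm c) * wt (c + t *\<^sub>R x)"
      by (rule order_trans[OF _ mult_mono[of 1 _ 1]]) auto
    ultimately have "wt x \<le> (1 + norm c) * wt (c + t *\<^sub>R x) + (1 + norm c) * wt (c + t *\<^sub>R x) * (1 / \<bar>t\<bar>)" by linarith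
    moreover have "p * (1 + u) * w = p * w + p * w * u" for p u w :: real by (simp add: algebra_simps)
    ultimately show ?thesis by simp
  qed
qed (auto simp: t)

text \<open>A Gaussian of width 1/t is inserted as a convergence factor. The multiplication formula
  moves the transform onto it, and the limits of both sides as t tends to 0 are found by dominated
  convergence.\<close>

lemma Finv_Four_inverse:
  fixes f :: "'a::euclidean_space \<Rightarrow> complex"
  assumes f: "f \<in> Schwartz"
  shows "Finv (Four f) = f"
proof
  fix x :: 'a
  define c0 where "c0 = complex_of_real (sqrt (2 * pi) ^ DIM('a))"
  define t where "t m = inverse (real (Suc m))" for m
  have t: "t m > 0" for m by (simp add: t_def)
  have t0: "t \<longlonglongrightarrow> 0" unfolding t_def by (rule LIMSEQ_inverse_real_of_nat)
  define k where "k m \<xi> = cis (x \<bullet> \<xi>) * gauss (t m *\<^sub>R \<xi>)" for m \<xi>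
  have gS: "(\<lambda>\<xi>. gauss (t m *\<^sub>R \<xi>)) \<in> Schwartz" for m
    using Schwartz_dilate[OF gauss_Schwartz, of "t m" 0] t[of m] by simp
  have kS: "k m \<in> Schwartz" for m unfolding k_def by (rule Schwartz_cis[OF gS])
  \<comment> \<open>The factor t^n is exactly the Jacobian of y = x + t w, so the rescaled transform
    of the kernel no longer depends on m.\<close>
  have Fk: "complex_of_real (t m ^ DIM('a)) * Four (k m) (x + t m *\<^sub>R w) = Four gauss w" for m w
  proof -
    have m: "(\<lambda>\<xi>. cis (- (\<xi> \<bullet> w)) * gauss \<xi>) \<in> borel_measurable lborel"
      by (rule borel_measurable_integrable[OF Four_integrable[OF gauss_Schwartz]])
    have "Four gauss w = (\<integral>\<xi>. cis (- (\<xi> \<bullet> w)) * gauss \<xi> \<partial>lborel)" by (simp add: Four_def)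
    also have "\<dots> = complex_of_real (\<bar>t m\<bar> ^ DIM('a)) * (\<integral>\<xi>. cis (- ((0 + t m *\<^sub>R \<xi>) \<bullet> w)) * gauss (0 + t m *\<^sub>R \<xi>) \<partial>lborel)"
      by (rule integral_affine[OF m]) (use t[of m] in simp)
    also have "(\<lambda>\<xi>. cis (- ((0 + t m *\<^sub>R \<xi>) \<bullet> w)) * gauss (0 + t m *\<^sub>R \<xi>)) = (\<lambda>\<xi>. cis (- (\<xi> \<bullet> (x + t m *\<^sub>R w))) * k m \<xi>)"
      by (simp add: k_def mult.assoc[symmetric] cis_mult inner_add_right inner_commute fun_eq_iff)
    finally show ?thesis using t[of m] by (simp add: Four_def)
  qed
  have A: "(\<integral>\<xi>. Four f \<xi> * k m \<xi> \<partial>lborel) = (\<integral>w. f (x + t m *\<^sub>R w) * Four gauss w \<partial>lborel)" for m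
  proof -
    have m: "(\<lambda>y. f y * Four (k m) y) \<in> borel_measurable lborel"
      by (intro borel_measurable_times Schwartz_measurable f Four_Schwartz kS)
    have "(\<integral>\<xi>. Four f \<xi> * k m \<xi> \<partial>lborel) = (\<integral>y. f y * Four (k m) y \<partial>lborel)"
      by (rule Four_mult_formula[OF f kS])
    also have "\<dots> = complex_of_real (\<bar>t m\<bar> ^ DIM('a)) * (\<integral>w. f (x + t m *\<^sub>R w) * Four (k m) (x + t m *\<^sub>R w) \<partial>lborel)"
      by (rule integral_affine[OF m]) (use t[of m] in simp)
    also have "\<dots> = (\<integral>w. f (x + t m *\<^sub>R w) * (complex_of_real (t m ^ DIM('a)) * Four (k m) (x + t m *\<^sub>R w)) \<partial>lborel)"
      using t[of m] by (simp add: mult.left_commute)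
    finally show ?thesis by (simp only: Fk)
  qed
  have FF: "Four f \<in> Schwartz" "Four gauss \<in> (Schwartz :: ('a \<Rightarrow> complex) set)"
    by (intro Four_Schwartz f gauss_Schwartz)+
  have L1: "(\<lambda>m. \<integral>\<xi>. Four f \<xi> * k m \<xi> \<partial>lborel) \<longlonglongrightarrow> (\<integral>\<xi>. Four f \<xi> * cis (x \<bullet> \<xi>) \<partial>lborel)"
  proof (rule integral_dominated_convergence[where w = "\<lambda>\<xi>. norm (Four f \<xi>)"])
    show "(\<lambda>\<xi>. Four f \<xi> * k m \<xi>) \<in> borel_measurable lborel" for m
      by (intro borel_measurable_times Schwartz_measurable FF kS)
    show "(\<lambda>\<xi>. Four f \<xi> * cis (x \<bullet> \<xi>)) \<in> borel_measurable lborel"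
      using Schwartz_measurable[OF Schwartz_cis[OF FF(1), of x]] by (simp add: mult.commute)
    show "integrable lborel (\<lambda>\<xi>. norm (Four f \<xi>))" by (intro integrable_norm Schwartz_integrable FF)
    show "AE \<xi> in lborel. norm (Four f \<xi> * k m \<xi>) \<le> norm (Four f \<xi>)" for m
      by (intro AE_I2) (simp add: norm_mult k_def gauss_def mult_left_le)
    show "AE \<xi> in lborel. (\<lambda>m. Four f \<xi> * k m \<xi>) \<longlonglongrightarrow> Four f \<xi> * cis (x \<bullet> \<xi>)"
    proof (intro AE_I2 tendsto_mult tendsto_const)
      fix \<xi> :: 'a
      have "(\<lambda>m. cis (x \<bullet> \<xi>) * gauss (t m *\<^sub>R \<xi>)) \<longlonglongrightarrow> cis (x \<bullet> \<xi>) * gauss (0 *\<^sub>R \<xi>)"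
        by (intro tendsto_mult tendsto_const continuous_on_tendsto_compose[OF Schwartz_continuous[OF gauss_Schwartz, of UNIV]] tendsto_scaleR t0) auto
      then show "(\<lambda>m. k m \<xi>) \<longlonglongrightarrow> cis (x \<bullet> \<xi>)" by (simp add: k_def gauss_def)
    qed
  qed
  have L2: "(\<lambda>m. \<integral>w. f (x + t m *\<^sub>R w) * Four gauss w \<partial>lborel) \<longlonglongrightarrow> (\<integral>w. f x * Four gauss (w::'a) \<partial>lborel)"
  proof -
    obtain C where C: "C \<ge> 0" "\<And>x. wt x ^ 0 * norm (f x) \<le> C" using Schwartz_RDq_bound[OF f] by blast
    show "(\<lambda>m. \<integral>w. f (x + t m *\<^sub>R w) * Four gauss w \<partial>lborel) \<longlonglongrightarrow> (\<integral>w. f x * Four gauss (w::'a) \<partial>lborel)"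
    proof (rule integral_dominated_convergence[where w = "\<lambda>w::'a. C * norm (Four gauss w)"])
      show "(\<lambda>w. f (x + t m *\<^sub>R w) * Four gauss w) \<in> borel_measurable lborel" for m
        using t[of m] by (intro borel_measurable_times Schwartz_measurable FF Schwartz_dilate f) auto
      show "(\<lambda>w::'a. f x * Four gauss w) \<in> borel_measurable lborel"
        by (intro borel_measurable_times borel_measurable_const Schwartz_measurable FF)
      show "integrable lborel (\<lambda>w::'a. C * norm (Four gauss w))" by (intro integrable_mult_right integrable_norm Schwartz_integrable FF)
      show "AE w in lborel. norm (f (x + t m *\<^sub>R w) * Four gauss w) \<le> C * norm (Four gauss w)" for m
        using C(2) by (intro AE_I2) (auto simp: norm_mult intro!: mult_right_mono)
      show "AE w in lborel. (\<lambda>m. f (x + t m *\<^sub>R w) * Four gauss w) \<longlonglongrightarrow> f x * Four gauss w"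
      proof (intro AE_I2 tendsto_mult tendsto_const)
        fix w :: 'a
        have "(\<lambda>m. f (x + t m *\<^sub>R w)) \<longlonglongrightarrow> f (x + 0 *\<^sub>R w)"
          by (intro continuous_on_tendsto_compose[OF Schwartz_continuous[OF f, of UNIV]] tendsto_add tendsto_const tendsto_scaleR t0) auto
        then show "(\<lambda>m. f (x + t m *\<^sub>R w)) \<longlonglongrightarrow> f x" by simp
      qed
    qed
  qed
  have "(\<integral>\<xi>. Four f \<xi> * cis (x \<bullet> \<xi>) \<partial>lborel) = (\<integral>w. f x * Four gauss (w::'a) \<partial>lborel)"
    by (rule LIMSEQ_unique[OF L1]) (unfold A, rule L2)
  also have "\<dots> = f x * (c0 * c0)"
    unfolding Four_gauss using integral_gauss[where 'a = 'a] by (simp add: c0_def)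
  finally have "(\<integral>\<xi>. cis (x \<bullet> \<xi>) * Four f \<xi> \<partial>lborel) = f x * (c0 * c0)" by (simp add: mult.commute)
  then have "Finv (Four f) x = f x * (fconst TYPE('a) * (c0 * c0))" unfolding Finv_def by simp
  then show "Finv (Four f) x = f x" unfolding c0_def fconst_gauss by simp
qed

text \<open>The reflection x to -x exchanges the two transforms up to the constant, which reduces
  this composition to the other one.\<close>

lemma Four_Finv_inverse:
  fixes f :: "'a::euclidean_space \<Rightarrow> complex"
  assumes f: "f \<in> Schwartz"
  shows "Four (Finv f) = f"
proof
  fix \<xi> :: 'a
  have m: "(\<lambda>x. cis (- (x \<bullet> \<xi>)) * Finv f x) \<in> borel_measurable lborel"
    by (rule borel_measurable_integrable[OF Four_integrable[OF Finv_Schwartz[OF f]]])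
  have "Four (Finv f) \<xi> = complex_of_real (\<bar>- 1\<bar> ^ DIM('a)) * (\<integral>x. cis (- ((0 + (- 1) *\<^sub>R x) \<bullet> \<xi>)) * Finv f (0 + (- 1) *\<^sub>R x) \<partial>lborel)"
    unfolding Four_def by (rule integral_affine[OF m]) simp
  also have "(\<lambda>x. cis (- ((0 + (- 1) *\<^sub>R x) \<bullet> \<xi>)) * Finv f (0 + (- 1) *\<^sub>R x)) = (\<lambda>x. fconst TYPE('a) * (cis (\<xi> \<bullet> x) * Four f x))"
    by (simp add: Finv_Four inner_commute mult.left_commute fun_eq_iff)
  also have "complex_of_real (\<bar>- 1\<bar> ^ DIM('a)) * (\<integral>x. fconst TYPE('a) * (cis (\<xi> \<bullet> x) * Four f x) \<partial>lborel) = Finv (Four f) \<xi>"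
    by (simp add: Finv_def)
  finally show "Four (Finv f) \<xi> = f \<xi>" by (simp add: Finv_Four_inverse[OF f])
qed

lemma Finv_mult_formula:
  fixes f g :: "'a::euclidean_space \<Rightarrow> complex"
  assumes f: "f \<in> Schwartz" and g: "g \<in> Schwartz"
  shows "(\<integral>\<xi>. Finv f \<xi> * g \<xi> \<partial>lborel) = (\<integral>x. f x * Finv g x \<partial>lborel)"
  using Four_mult_formula[OF Finv_Schwartz[OF f] Finv_Schwartz[OF g]]
  by (simp add: Four_Finv_inverse f g)

section \<open>Interchanging tempered distributions and integrals\<close>

lemma pd_fst_section:
  fixes F :: "'a::euclidean_space \<times> 'a \<Rightarrow> complex"
  assumes "\<And>z. F differentiable (at z)"
  shows "pd v (\<lambda>x. F (x, \<zeta>)) = (\<lambda>x. pd (v, 0) F (x, \<zeta>))" "(\<lambda>x. F (x, \<zeta>)) differentiable (at x)"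
proof -
  have *: "((\<lambda>x. F ((0, \<zeta>) + (x, 0))) has_derivative (\<lambda>v. pd (v, 0) F ((0, \<zeta>) + (x, 0)))) (at x)" for x
    by (rule has_derivative_affine[OF linear_Pair0(1) assms])
  then have **: "((\<lambda>x. F (x, \<zeta>)) has_derivative (\<lambda>v. pd (v, 0) F (x, \<zeta>))) (at x)" for x by simp
  show "pd v (\<lambda>x. F (x, \<zeta>)) = (\<lambda>x. pd (v, 0) F (x, \<zeta>))" by (rule pd_eqI[OF **])
  show "(\<lambda>x. F (x, \<zeta>)) differentiable (at x)" unfolding differentiable_def by (rule exI, rule **)
qed

lemma pd_snd_section:
  fixes F :: "'a::euclidean_space \<times> 'a \<Rightarrow> complex"
  assumes "\<And>z. F differentiable (at z)"
  shows "pd v (\<lambda>\<zeta>. F (x, \<zeta>)) = (\<lambda>\<zeta>. pd (0, v) F (x, \<zeta>))"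
proof -
  have *: "((\<lambda>\<zeta>. F ((x, 0) + (0, \<zeta>))) has_derivative (\<lambda>v. pd (0, v) F ((x, 0) + (0, \<zeta>)))) (at \<zeta>)" for \<zeta>
    by (rule has_derivative_affine[OF linear_Pair0(2) assms])
  then have **: "((\<lambda>\<zeta>. F (x, \<zeta>)) has_derivative (\<lambda>v. pd (0, v) F (x, \<zeta>))) (at \<zeta>)" for \<zeta> by simp
  show ?thesis by (rule pd_eqI[OF **])
qed

lemma smooth_Dlist_differentiable: "smooth f \<Longrightarrow> vs \<in> lists Basis \<Longrightarrow> Dlist vs f differentiable (at x)"
  unfolding smooth_def by blast

lemma Dlist_snd_section:
  fixes F :: "'a::euclidean_space \<times> 'a \<Rightarrow> complex"
  assumes "smooth F" "vs \<in> lists Basis"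
  shows "Dlist vs (\<lambda>\<zeta>. F (x, \<zeta>)) = (\<lambda>\<zeta>. Dlist (map (Pair 0) vs) F (x, \<zeta>)) \<and> map (Pair 0) vs \<in> lists (Basis :: ('a \<times> 'a) set)"
  using assms(2)
proof (induction vs)
  case (Cons v vs)
  then have IH: "Dlist vs (\<lambda>\<zeta>. F (x, \<zeta>)) = (\<lambda>\<zeta>. Dlist (map (Pair 0) vs) F (x, \<zeta>))"
    and l: "map (Pair 0) vs \<in> lists (Basis :: ('a \<times> 'a) set)" and v: "v \<in> Basis" by auto
  have "pd v (\<lambda>\<zeta>. Dlist (map (Pair 0) vs) F (x, \<zeta>)) = (\<lambda>\<zeta>. pd (0, v) (Dlist (map (Pair 0) vs) F) (x, \<zeta>))"
    by (rule pd_snd_section[OF smooth_Dlist_differentiable[OF assms(1) l]])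
  then show ?case using IH l v by (simp add: Basis_prod_def)
qed simp

lemma Dlist_cmult_diff:
  assumes "smooth f" "smooth g" "vs \<in> lists Basis"
  shows "Dlist vs (\<lambda>x. c * (f x - g x)) = (\<lambda>x. c * (Dlist vs f x - Dlist vs g x))"
  using assms(3)
proof (induction vs)
  case (Cons v vs)
  have d: "Dlist vs f differentiable (at x)" "Dlist vs g differentiable (at x)" for x
    using Cons smooth_Dlist_differentiable assms by auto
  have "((\<lambda>x. c * (Dlist vs f x - Dlist vs g x)) has_derivative (\<lambda>v. c * (pd v (Dlist vs f) x - pd v (Dlist vs g) x))) (at x)" for x
    by (intro has_derivative_mult_right has_derivative_diff pd_has_derivative d)
  from pd_eqI[OF this] Cons show ?case by simp
qed simp

lemma Dlist_translate:
  fixes f :: "'a::euclidean_space \<Rightarrow> complex"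
  assumes "smooth f" "vs \<in> lists Basis"
  shows "Dlist vs (\<lambda>x. f (c + x)) = (\<lambda>x. Dlist vs f (c + x))"
  using assms(2)
proof (induction vs)
  case (Cons v vs)
  have d: "Dlist vs f differentiable (at x)" for x
    using Cons smooth_Dlist_differentiable assms by auto
  have "((\<lambda>x. Dlist vs f (c + x)) has_derivative (\<lambda>v. pd v (Dlist vs f) (c + x))) (at x)" for x
    by (rule has_derivative_affine[OF linear_ident d])
  from pd_eqI[OF this] Cons show ?case by simp
qed simp

lemma smooth_translate:
  fixes f :: "'a::euclidean_space \<Rightarrow> complex"
  assumes "smooth f"
  shows "smooth (\<lambda>x. f (c + x))"
  unfolding smooth_iff_fam
  by (rule fam_affine[where f = "\<lambda>_. f" and c = "\<lambda>_. c" and L = "\<lambda>_ x. x" and M = 1, OF assms[unfolded smooth_iff_fam]])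
     (auto simp: linear_ident)

lemma smooth_continuous_Dlist: "smooth f \<Longrightarrow> vs \<in> lists Basis \<Longrightarrow> continuous_on S (Dlist vs f)"
  by (meson continuous_at_imp_continuous_on differentiable_imp_continuous_within smooth_Dlist_differentiable)

lemma smooth_continuous: "smooth f \<Longrightarrow> continuous_on S f"
  by (meson continuous_at_imp_continuous_on differentiable_imp_continuous_within smooth_differentiable)

lemma shift_bound:
  fixes F :: "'a::euclidean_space \<times> 'a \<Rightarrow> complex"
  assumes "\<And>z. F differentiable (at z)" "\<And>b x. b \<in> Basis \<Longrightarrow> norm (pd (b, 0) F (x, snd z)) \<le> M"
  shows "norm (F ((w, 0) + z) - F z) \<le> real DIM('a) * M * norm w"
proof -
  have "norm ((\<lambda>x. F (x, snd z)) (w + fst z) - (\<lambda>x. F (x, snd z)) (fst z)) \<le> real DIM('a) * M * norm (w + fst z - fst z)"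
  proof (rule lipschitz_pd[OF convex_UNIV pd_fst_section(2)[OF assms(1)]])
    show "norm (pd b (\<lambda>x. F (x, snd z)) x) \<le> M" if "b \<in> Basis" for x b
      unfolding pd_fst_section(1)[OF assms(1)] by (rule assms(2)[OF that])
  qed auto
  moreover have "(w, 0) + z = (w + fst z, snd z)" by (cases z) simp
  ultimately show ?thesis by simp
qed

text \<open>At \<open>w = 0\<close> the difference quotient is \<open>0\<close> by the convention \<open>x / 0 = 0\<close>.\<close>

lemma fam_shift_quotient:
  fixes F :: "'i \<Rightarrow> 'a::euclidean_space \<times> 'a \<Rightarrow> complex"
  assumes F: "fam Q F"
    and Qest: "\<And>F. fam Q F \<Longrightarrow> Q' (\<lambda>(i, w) z. complex_of_real (1 / norm w) * (F i ((w, 0) + z) - F i z))"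
  shows "fam Q' (\<lambda>(i, w) z. complex_of_real (1 / norm (w :: 'a)) * (F i ((w, 0) + z) - F i z))"
proof (rule fam_coinduct[where X = "\<lambda>h. \<exists>F. fam Q F \<and> h = (\<lambda>(i, w) z. complex_of_real (1 / norm (w :: 'a)) * (F i ((w, 0) + z) - F i z))"])
  show "\<exists>F'. fam Q F' \<and> (\<lambda>(i, w) z. complex_of_real (1 / norm (w :: 'a)) * (F i ((w, 0) + z) - F i z))
     = (\<lambda>(i, w) z. complex_of_real (1 / norm (w :: 'a)) * (F' i ((w, 0) + z) - F' i z))"
    by (intro exI conjI, rule F, rule refl)
  fix h assume "\<exists>F. fam Q F \<and> h = (\<lambda>((i::'i), w) z. complex_of_real (1 / norm (w :: 'a)) * (F i ((w, 0) + z) - F i z))"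
  then obtain F :: "'i \<Rightarrow> 'a \<times> 'a \<Rightarrow> complex" where F: "fam Q F"
    and h: "h = (\<lambda>(i, w) z. complex_of_real (1 / norm w) * (F i ((w, 0) + z) - F i z))" by blast
  show "Q' h" unfolding h by (rule Qest[OF F])
  have hd: "((\<lambda>z. complex_of_real (1 / norm w) * (F i ((w, 0) + z) - F i z)) has_derivative
     (\<lambda>v. complex_of_real (1 / norm w) * (pd v (F i) ((w, 0) + z) - pd v (F i) z))) (at z)" for i z and w :: 'a
    by (intro has_derivative_mult_right has_derivative_diff pd_has_derivative fam_differentiable[OF F]
        has_derivative_affine[OF linear_ident fam_differentiable[OF F]])
  show "h j differentiable (at z)" for j z
    unfolding h differentiable_def by (cases j) (simp only: prod.case, rule exI, rule hd)
  fix v :: "'a \<times> 'a" assume v: "v \<in> Basis"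
  have "(\<lambda>j. pd v (h j)) = (\<lambda>(i, w) z. complex_of_real (1 / norm w) * (pd v (F i) ((w, 0) + z) - pd v (F i) z))"
    unfolding h using pd_eqI[OF hd] by (simp add: fun_eq_iff)
  then show "\<exists>F. fam Q F \<and> (\<lambda>j. pd v (h j)) = (\<lambda>(i, w) z. complex_of_real (1 / norm w) * (F i ((w, 0) + z) - F i z))"
    by (intro exI conjI) (rule fam_pd[OF F v], assumption)
qed

lemma shift_quotient_le:
  fixes F :: "'a::euclidean_space \<times> 'a \<Rightarrow> complex"
  assumes "\<And>z. F differentiable (at z)" "\<And>b x. b \<in> Basis \<Longrightarrow> norm (pd (b, 0) F (x, snd z)) \<le> M" "0 \<le> M"
  shows "norm (complex_of_real (1 / norm w) * (F ((w, 0) + z) - F z)) \<le> real DIM('a) * M"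
proof (cases "w = 0")
  case False
  then show ?thesis using shift_bound[of F z M w, OF assms(1,2)] by (simp add: norm_mult norm_divide field_simps)
qed (use assms(3) in simp)

text \<open>The mean value inequality moves only the first variable, to which \<open>wt2\<close> is
  blind. The decay of the x-derivatives therefore carries over, uniformly in the shift
  \<open>w\<close>, however large it is.\<close>

lemma RD_shift_quotient:
  fixes F :: "'i \<Rightarrow> 'a::euclidean_space \<times> 'a \<Rightarrow> complex"
  assumes F: "RD wt2 F"
  shows "RD wt2 (\<lambda>(i, w) z. complex_of_real (1 / norm (w :: 'a)) * (F i ((w, 0) + z) - F i z))"
proof (rule fam_shift_quotient[OF F])
  fix F :: "'i \<Rightarrow> 'a \<times> 'a \<Rightarrow> complex" assume F: "RD wt2 F"
  show "RDq wt2 (\<lambda>(i, w) z. complex_of_real (1 / norm (w :: 'a)) * (F i ((w, 0) + z) - F i z))"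
  proof (rule RDqI)
    fix k
    have "\<exists>C. \<forall>i z. wt2 z ^ k * norm (pd (b, 0) (F i) z) \<le> C" if "b \<in> Basis" for b
    proof -
      have "(b, 0) \<in> Basis" using that by (simp add: Basis_prod_def)
      from fam_Q[OF fam_pd[OF F this]] show ?thesis unfolding RDq_def by blast
    qed
    then obtain C where C: "\<And>b i z. b \<in> Basis \<Longrightarrow> wt2 z ^ k * norm (pd (b, 0) (F i) z) \<le> C b" by metis
    define K where "K = (\<Sum>b\<in>Basis. \<bar>C b\<bar>)"
    have "wt2 z ^ k * norm ((case j of (i, w) \<Rightarrow> \<lambda>z. complex_of_real (1 / norm (w :: 'a)) * (F i ((w, 0) + z) - F i z)) z) \<le> real DIM('a) * K" for j z
    proof -
      obtain i w where j: "j = (i, w)" by fastforce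
      have pos: "0 < wt2 z ^ k" by (simp add: add_pos_nonneg)
      have "norm (complex_of_real (1 / norm w) * (F i ((w, 0) + z) - F i z)) \<le> real DIM('a) * (K / wt2 z ^ k)"
      proof (rule shift_quotient_le[OF fam_differentiable[OF F]])
        show "norm (pd (b, 0) (F i) (x, snd z)) \<le> K / wt2 z ^ k" if "b \<in> Basis" for b x
        proof -
          have "\<bar>C b\<bar> \<le> K" unfolding K_def using that by (intro member_le_sum) auto
          then have "wt2 z ^ k * norm (pd (b, 0) (F i) (x, snd z)) \<le> K" using C[OF that, of "(x, snd z)" i] by simp
          then show ?thesis using pos by (simp add: field_simps)
        qed
        show "0 \<le> K / wt2 z ^ k" using pos by (simp add: K_def sum_nonneg)
      qed
      then show ?thesis unfolding j prod.case using pos by (simp add: field_simps)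
    qed
    then show "\<exists>C. \<forall>j z. wt2 z ^ k * norm ((case j of (i, w) \<Rightarrow> \<lambda>z. complex_of_real (1 / norm (w :: 'a)) * (F i ((w, 0) + z) - F i z)) z) \<le> C" by blast
  qed
qed

lemma OM_shift_quotient:
  fixes F :: "'i \<Rightarrow> 'a::euclidean_space \<times> 'a \<Rightarrow> complex"
  assumes F: "OM wt2 F"
  shows "OM wt2 (\<lambda>(i, w) z. complex_of_real (1 / norm (w :: 'a)) * (F i ((w, 0) + z) - F i z))"
proof (rule fam_shift_quotient[OF F])
  fix F :: "'i \<Rightarrow> 'a \<times> 'a \<Rightarrow> complex" assume F: "OM wt2 F"
  have "\<exists>N C. \<forall>i z. norm (pd (b, 0) (F i) z) \<le> C * wt2 z ^ N" if "b \<in> Basis" for b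
  proof -
    have "(b, 0) \<in> Basis" using that by (simp add: Basis_prod_def)
    from fam_Q[OF fam_pd[OF F this]] show ?thesis unfolding OMq_def by blast
  qed
  then obtain N C where C: "\<And>b i z. b \<in> Basis \<Longrightarrow> norm (pd (b, 0) (F i) z) \<le> C b * wt2 z ^ N b" by metis
  define K where "K = (\<Sum>b\<in>Basis. \<bar>C b\<bar>)"
  define M where "M = (\<Sum>b\<in>Basis. N b)"
  show "OMq wt2 (\<lambda>(i, w) z. complex_of_real (1 / norm (w :: 'a)) * (F i ((w, 0) + z) - F i z))"
  proof (rule OMqI)
    fix j :: "'i \<times> 'a" and z :: "'a \<times> 'a"
    obtain i w where j: "j = (i, w)" by fastforce
    have "norm (complex_of_real (1 / norm w) * (F i ((w, 0) + z) - F i z)) \<le> real DIM('a) * (K * wt2 z ^ M)"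
    proof (rule shift_quotient_le[OF fam_differentiable[OF F]])
      show "norm (pd (b, 0) (F i) (x, snd z)) \<le> K * wt2 z ^ M" if b: "b \<in> Basis" for b x
      proof -
        have 1: "\<bar>C b\<bar> \<le> K" unfolding K_def using b by (intro member_le_sum) auto
        have 2: "N b \<le> M" unfolding M_def using b by (intro member_le_sum) auto
        have "norm (pd (b, 0) (F i) (x, snd z)) \<le> \<bar>C b\<bar> * wt2 z ^ N b"
          using C[OF b, of i "(x, snd z)"] by (simp add: order_trans[OF _ mult_right_mono[OF abs_ge_self]])
        also have "\<dots> \<le> K * wt2 z ^ M"
          using 1 2 by (intro mult_mono power_increasing) auto
        finally show ?thesis .
      qed
      show "0 \<le> K * wt2 z ^ M" by (simp add: K_def sum_nonneg)
    qed
    then show "norm ((case j of (i, w) \<Rightarrow> \<lambda>z. complex_of_real (1 / norm (w :: 'a)) * (F i ((w, 0) + z) - F i z)) z) \<le> (real DIM('a) * K) * wt2 z ^ M"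
      unfolding j prod.case by (simp add: mult.assoc)
  qed
qed

section \<open>Dyadic grids and Riemann sums\<close>

definition grid :: "nat \<Rightarrow> 'a::euclidean_space \<Rightarrow> 'a" where
  "grid l x = (\<Sum>b\<in>Basis. (of_int \<lfloor>2 ^ l * (x \<bullet> b)\<rfloor> / 2 ^ l) *\<^sub>R b)"

lemma grid_measurable: "grid l \<in> borel_measurable borel"
  unfolding grid_def by measurable

lemma grid_dist: "norm (grid l x - x) \<le> real DIM('a) / 2 ^ l" for x :: "'a::euclidean_space"
proof -
  have "norm (grid l x - x) \<le> (\<Sum>b\<in>Basis. \<bar>(grid l x - x) \<bullet> b\<bar>)" by (rule norm_le_l1)
  also have "\<dots> \<le> (\<Sum>b\<in>(Basis :: 'a set). 1 / 2 ^ l)"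
  proof (rule sum_mono)
    fix b :: 'a assume b: "b \<in> Basis"
    have g: "grid l x \<bullet> b = of_int \<lfloor>2 ^ l * (x \<bullet> b)\<rfloor> / 2 ^ l"
      unfolding grid_def using b by (simp add: inner_sum_left_Basis)
    have "\<bar>of_int \<lfloor>2 ^ l * (x \<bullet> b)\<rfloor> - 2 ^ l * (x \<bullet> b)\<bar> \<le> 1" by linarith
    then have "\<bar>(of_int \<lfloor>2 ^ l * (x \<bullet> b)\<rfloor> - 2 ^ l * (x \<bullet> b)) / 2 ^ l\<bar> \<le> 1 / 2 ^ l"
      unfolding abs_divide by (simp add: divide_right_mono)
    moreover have "(of_int \<lfloor>2 ^ l * (x \<bullet> b)\<rfloor> - 2 ^ l * (x \<bullet> b)) / 2 ^ l = (grid l x - x) \<bullet> b"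
      unfolding inner_diff_left g by (simp add: field_simps)
    ultimately show "\<bar>(grid l x - x) \<bullet> b\<bar> \<le> 1 / 2 ^ l" by simp
  qed
  also have "\<dots> = real DIM('a) / 2 ^ l" by simp
  finally show ?thesis .
qed

lemma grid_finite: "finite (grid l ` cball (0::'a::euclidean_space) \<rho>)"
proof -
  let ?M = "\<lceil>2 ^ l * \<bar>\<rho>\<bar> + 1\<rceil>"
  have "grid l ` cball (0::'a) \<rho> \<subseteq> (\<lambda>f. \<Sum>b\<in>Basis. (of_int (f b) / 2 ^ l) *\<^sub>R b) ` (PiE Basis (\<lambda>_. {- ?M..?M}))"
  proof
    fix y assume "y \<in> grid l ` cball (0::'a) \<rho>"
    then obtain x :: 'a where x: "norm x \<le> \<rho>" and y: "y = grid l x" by auto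
    have "\<lfloor>2 ^ l * (x \<bullet> b)\<rfloor> \<in> {- ?M..?M}" if "b \<in> Basis" for b
    proof -
      have "\<bar>x \<bullet> b\<bar> \<le> \<bar>\<rho>\<bar>" using Basis_le_norm[OF that, of x] x by linarith
      then have "\<bar>2 ^ l * (x \<bullet> b)\<bar> \<le> 2 ^ l * \<bar>\<rho>\<bar>" by (simp add: abs_mult)
      then show ?thesis by (simp, linarith)
    qed
    then have "restrict (\<lambda>b. \<lfloor>2 ^ l * (x \<bullet> b)\<rfloor>) Basis \<in> PiE Basis (\<lambda>_. {- ?M..?M})" by auto
    moreover have "y = (\<Sum>b\<in>Basis. (of_int (restrict (\<lambda>b. \<lfloor>2 ^ l * (x \<bullet> b)\<rfloor>) Basis b) / 2 ^ l) *\<^sub>R b)"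
      unfolding y grid_def by (intro sum.cong) auto
    ultimately show "y \<in> (\<lambda>f. \<Sum>b\<in>Basis. (of_int (f b) / 2 ^ l) *\<^sub>R b) ` (PiE Basis (\<lambda>_. {- ?M..?M}))" by blast
  qed
  moreover have "finite (PiE (Basis :: 'a set) (\<lambda>_. {- ?M..?M}))" by (intro finite_PiE) auto
  ultimately show ?thesis using finite_subset by blast
qed

text \<open>On the ball the rounded argument takes finitely many values, so the integral is a finite
  sum over cells. A linear functional commutes with such a sum.\<close>

lemma integral_grid:
  fixes F :: "'a::euclidean_space \<Rightarrow> complex"
  shows "(\<integral>x. indicator (cball 0 \<rho>) x * F (grid l x) \<partial>lborel) =
    (\<Sum>p\<in>grid l ` cball 0 \<rho>. complex_of_real (measure lborel (cball 0 \<rho> \<inter> grid l -` {p})) * F p)"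
proof -
  let ?B = "cball (0::'a) \<rho>"
  let ?A = "\<lambda>p. ?B \<inter> grid l -` {p}"
  have A: "?A p \<in> sets lborel" for p
    using measurable_sets[OF grid_measurable, of "{p}" l] by auto
  have fA: "emeasure lborel (?A p) < \<infinity>" for p
    using emeasure_mono[of "?A p" ?B lborel] emeasure_bounded_finite[OF bounded_cball, of 0 \<rho>] by (auto intro: le_less_trans)
  have i: "integrable lborel (\<lambda>x. indicator (?A p) x *\<^sub>R F p)" for p
    using A fA by (intro integrable_scaleR_left integrable_real_indicator)
  have "indicator ?B x * F (grid l x) = (\<Sum>p\<in>grid l ` ?B. indicator (?A p) x *\<^sub>R F p)" for x
  proof (cases "x \<in> ?B")
    case True
    have "(\<Sum>p\<in>grid l ` ?B. indicator (?A p) x *\<^sub>R F p) = (\<Sum>p\<in>{grid l x}. indicator (?A p) x *\<^sub>R F p)"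
      by (rule sum.mono_neutral_right[OF grid_finite]) (use True in \<open>auto simp: indicator_def\<close>)
    then show ?thesis using True by (simp add: indicator_def)
  qed (simp add: indicator_def)
  then have "(\<integral>x. indicator ?B x * F (grid l x) \<partial>lborel) = (\<integral>x. (\<Sum>p\<in>grid l ` ?B. indicator (?A p) x *\<^sub>R F p) \<partial>lborel)" by simp
  also have "\<dots> = (\<Sum>p\<in>grid l ` ?B. \<integral>x. indicator (?A p) x *\<^sub>R F p \<partial>lborel)"
    by (rule Bochner_Integration.integral_sum) (rule i)
  also have "\<dots> = (\<Sum>p\<in>grid l ` ?B. complex_of_real (measure lborel (?A p)) * F p)"
    by (intro sum.cong refl) (simp add: scaleR_conv_of_real)
  finally show ?thesis .
qed

text \<open>\<open>T\<close> commutes with Riemann sums over the dyadic grid. Their error multiplied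
  by 2^l is a bounded family of Schwartz functions, so after applying \<open>T\<close> it is
  O(2^-l), while the scalar Riemann sums of the images converge because these are Lipschitz in
  x.\<close>

lemma tempered_integral:
  fixes G :: "'a::euclidean_space \<times> 'a \<Rightarrow> complex"
  assumes T: "tempered T" and G: "RD wt2 (\<lambda>_::unit. G)" and supp: "\<And>x \<eta>. \<rho> < norm x \<Longrightarrow> G (x, \<eta>) = 0"
  shows "(\<lambda>\<eta>. \<integral>x. G (x, \<eta>) \<partial>lborel) \<in> Schwartz"
    and "(\<integral>x. T (\<lambda>\<eta>. G (x, \<eta>)) \<partial>lborel) = T (\<lambda>\<eta>. \<integral>x. G (x, \<eta>) \<partial>lborel)"
    and "integrable lborel (\<lambda>x. T (\<lambda>\<eta>. G (x, \<eta>)))"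
proof -
  let ?B = "cball (0::'a) \<rho>"
  let ?k = "indicator ?B :: 'a \<Rightarrow> complex"
  define U where "U x = T (\<lambda>\<eta>. G (x, \<eta>))" for x
  have smG: "smooth G" using G by (rule fam_smooth)
  have Gx: "(\<lambda>\<eta>. G (x, \<eta>)) \<in> Schwartz" for x by (rule Schwartz_section[OF G])
  have fB: "emeasure lborel ?B < \<infinity>" by (rule emeasure_bounded_finite) simp
  have kr: "?k = (\<lambda>x. complex_of_real (indicator ?B x))" by (auto simp: indicator_def fun_eq_iff)
  have ik: "integrable lborel ?k" unfolding kr by (rule integrable_of_real, rule integrable_real_indicator) (use fB in auto)
  have mk: "?k \<in> borel_measurable borel" using borel_measurable_integrable[OF ik] by simp
  have quot: "RD wt (\<lambda>(x, w) \<eta>. complex_of_real (1 / norm w) * (G (w + x, \<eta>) - G (x, \<eta>)))"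
  proof -
    show ?thesis
      using RD_reindex[OF RD_section[OF RD_shift_quotient[OF G]], of "\<lambda>(x, w). (((), w), x)"]
      by (simp add: case_prod_unfold)
  qed
  \<comment> \<open>The bound for \<open>T\<close> on the difference quotients of \<open>G\<close>
    is a Lipschitz constant of \<open>U\<close>. It makes \<open>U\<close> continuous, hence
    measurable, and controls the Riemann sums.\<close>
  obtain L where L: "\<And>x w. norm (T (\<lambda>\<eta>. complex_of_real (1 / norm w) * (G (w + x, \<eta>) - G (x, \<eta>)))) \<le> L"
  proof -
    obtain L where L: "\<And>j. norm (T ((\<lambda>(x, w) \<eta>. complex_of_real (1 / norm w) * (G (w + x, \<eta>) - G (x, \<eta>))) j)) \<le> L"
      using tempered_bounded[OF T quot] by blast
    show ?thesis
    proof (rule that[of L])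
      show "norm (T (\<lambda>\<eta>. complex_of_real (1 / norm w) * (G (w + x, \<eta>) - G (x, \<eta>)))) \<le> L" for x w
        using L[of "(x, w)"] unfolding prod.case .
    qed
  qed
  have lip: "norm (U y - U x) \<le> L * norm (y - x)" for x y
  proof (cases "y = x")
    case False
    have "T (\<lambda>\<eta>. complex_of_real (1 / norm (y - x)) * (G ((y - x) + x, \<eta>) - G (x, \<eta>))) = complex_of_real (1 / norm (y - x)) * (U y - U x)"
      by (simp only: diff_add_cancel tempered_cmult[OF T Schwartz_diff[OF Gx[of y] Gx[of x]]] tempered_diff[OF T Gx[of y] Gx[of x]] U_def)
    with L[of "y - x" x] have "norm (complex_of_real (1 / norm (y - x)) * (U y - U x)) \<le> L" by simp
    then show ?thesis using False by (simp add: norm_mult norm_divide field_simps)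
  qed simp
  have "0 \<le> L" using L[of 0 0] norm_ge_zero order_trans by blast
  have contU: "continuous_on UNIV U"
    by (rule lipschitz_on_continuous_on[of L]) (auto intro!: lipschitz_onI lip \<open>0 \<le> L\<close> simp: dist_norm)
  have mU: "U \<in> borel_measurable borel" using contU by (rule borel_measurable_continuous_onI)
  obtain K where K: "\<And>x. norm (U x) \<le> K"
  proof -
    obtain K where K: "\<And>j. norm (T ((\<lambda>(i::unit, x) \<eta>. G (x, \<eta>)) j)) \<le> K"
      using tempered_bounded[OF T RD_section[OF G]] by blast
    show ?thesis
    proof (rule that[of K])
      show "norm (U x) \<le> K" for x using K[of "((), x)"] unfolding prod.case U_def .
    qed
  qed
  have ikU: "integrable lborel (\<lambda>x. ?k x * U (f x))" if f: "f \<in> borel_measurable borel" for f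
  proof (rule Bochner_Integration.integrable_bound[where f = "\<lambda>x. norm (?k x) * K"])
    show "integrable lborel (\<lambda>x. norm (?k x) * K)" using ik by simp
    show "(\<lambda>x. ?k x * U (f x)) \<in> borel_measurable lborel"
      using borel_measurable_times[OF mk measurable_compose[OF f mU]] by simp
    show "AE x in lborel. norm (?k x * U (f x)) \<le> norm (norm (?k x) * K)"
      using K order_trans[OF norm_ge_zero K] by (intro AE_I2) (auto simp: norm_mult abs_mult intro!: mult_left_mono order_trans[OF K])
  qed
  have Dm: "(\<lambda>x. Dlist vs (\<lambda>\<eta>. G (f x, \<eta>)) \<eta>) \<in> borel_measurable borel"
    if f: "f \<in> borel_measurable borel" and vs: "vs \<in> lists Basis" for f :: "'a \<Rightarrow> 'a" and vs \<eta>
  proof -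
    have c: "continuous_on UNIV (\<lambda>x. Dlist (map (Pair 0) vs) G (x, \<eta>))"
      by (rule continuous_on_compose2[OF smooth_continuous_Dlist[OF smG, of _ UNIV]])
         (use Dlist_snd_section[OF smG vs] in \<open>auto intro!: continuous_intros\<close>)
    have "(\<lambda>x. Dlist (map (Pair 0) vs) G (f x, \<eta>)) \<in> borel_measurable borel"
      using measurable_compose[OF f borel_measurable_continuous_onI[OF c]] by simp
    then show ?thesis using Dlist_snd_section[OF smG vs] by simp
  qed
  have kn: "(\<integral>x. norm (?k x) \<partial>lborel) \<le> measure lborel ?B" by (simp add: kr)
  have RDint: "RD wt (\<lambda>i \<eta>. \<integral>x. ?k x * g (i, x) \<eta> \<partial>lborel)" if "RD wt g"
    "\<And>i vs \<eta>. vs \<in> lists Basis \<Longrightarrow> (\<lambda>x. Dlist vs (g (i, x)) \<eta>) \<in> borel_measurable lborel" for g :: "'j \<times> 'a \<Rightarrow> 'a \<Rightarrow> complex"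
    by (rule RD_integral[OF that(1) ik kn that(2) _ wt_local]) auto
  have "RD wt (\<lambda>(i::unit, x) \<eta>. G (x, \<eta>))" by (rule RD_section[OF G])
  from RDint[OF this] have S0: "RD wt (\<lambda>(i::unit) \<eta>. \<integral>x. ?k x * G (x, \<eta>) \<partial>lborel)"
    using Dm[of "\<lambda>x. x"] by simp
  have kG: "?k x * G (x, \<eta>) = G (x, \<eta>)" for x \<eta>
    by (cases "\<rho> < norm x") (auto simp: indicator_def supp)
  have I0: "(\<lambda>\<eta>. \<integral>x. G (x, \<eta>) \<partial>lborel) \<in> Schwartz" using S0 by (simp add: kG Schwartz_RD)
  then show "(\<lambda>\<eta>. \<integral>x. G (x, \<eta>) \<partial>lborel) \<in> Schwartz" .
  have mg: "grid l \<in> borel_measurable borel" for l by (rule grid_measurable)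
  \<comment> \<open>The error of the Riemann sum scaled by 2^l, to be shown bounded as a family in
    l.\<close>
  define E where "E l \<eta> = (\<integral>x. ?k x * (complex_of_real (2 ^ l) * (G (grid l x, \<eta>) - G (x, \<eta>))) \<partial>lborel)" for l \<eta>
  have RDE: "RD wt E"
  proof -
    \<comment> \<open>The scaled difference is the scalar 2^l |grid - x|, bounded by the dimension
      through \<open>grid_dist\<close>, times the difference quotient at that shift. For a zero
      shift both sides vanish.\<close>
    have "RD wt (\<lambda>j \<eta>. complex_of_real (2 ^ fst j * norm (grid (fst j) (snd j) - snd j)) *
        (case (snd j, grid (fst j) (snd j) - snd j) of (x, w) \<Rightarrow> \<lambda>\<eta>. complex_of_real (1 / norm w) * (G (w + x, \<eta>) - G (x, \<eta>))) \<eta>)"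
    proof (rule RD_cmult[OF RD_reindex[OF quot], where M = "real DIM('a)"])
      fix j :: "nat \<times> 'a"
      show "norm (complex_of_real (2 ^ fst j * norm (grid (fst j) (snd j) - snd j))) \<le> real DIM('a)"
        using mult_left_mono[OF grid_dist[of "fst j" "snd j"], of "2 ^ fst j"] by (simp add: norm_mult norm_power)
    qed simp
    also have "(\<lambda>j \<eta>. complex_of_real (2 ^ fst j * norm (grid (fst j) (snd j) - snd j)) *
        (case (snd j, grid (fst j) (snd j) - snd j) of (x, w) \<Rightarrow> \<lambda>\<eta>. complex_of_real (1 / norm w) * (G (w + x, \<eta>) - G (x, \<eta>))) \<eta>)
       = (\<lambda>j \<eta>. complex_of_real (2 ^ fst j) * (G (grid (fst j) (snd j), \<eta>) - G (snd j, \<eta>)))"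
      by (auto simp: fun_eq_iff)
    finally have R: "RD wt (\<lambda>j \<eta>. complex_of_real (2 ^ fst j) * (G (grid (fst j) (snd j), \<eta>) - G (snd j, \<eta>)))" .
    have "RD wt (\<lambda>l \<eta>. \<integral>x. ?k x * (complex_of_real (2 ^ fst (l, x)) * (G (grid (fst (l, x)) (snd (l, x)), \<eta>) - G (snd (l, x), \<eta>))) \<partial>lborel)"
    proof (rule RDint[OF R])
      fix l :: nat and vs :: "'a list" and \<eta> assume vs: "vs \<in> lists Basis"
      have sm: "smooth (\<lambda>\<eta>. G (x, \<eta>))" for x by (rule Schwartz_smooth[OF Gx])
      show "(\<lambda>x. Dlist vs (\<lambda>\<eta>. complex_of_real (2 ^ fst (l, x)) * (G (grid (fst (l, x)) (snd (l, x)), \<eta>) - G (snd (l, x), \<eta>))) \<eta>) \<in> borel_measurable lborel"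
        unfolding fst_conv snd_conv Dlist_cmult_diff[OF sm sm vs]
        using Dm[OF mg vs, of l \<eta>] Dm[of "\<lambda>x. x" vs \<eta>] vs by simp
    qed
    then show ?thesis by (simp add: E_def[abs_def])
  qed
  obtain CE where CE: "\<And>l. norm (T (E l)) \<le> CE" using tempered_bounded[OF T RDE] by blast
  define R where "R l = (\<integral>x. ?k x * U (grid l x) \<partial>lborel)" for l
  have gS: "(\<lambda>\<eta>. \<integral>x. ?k x * G (grid l x, \<eta>) \<partial>lborel) \<in> Schwartz \<and> T (\<lambda>\<eta>. \<integral>x. ?k x * G (grid l x, \<eta>) \<partial>lborel) = R l" for l
  proof -
    let ?m = "\<lambda>p. complex_of_real (measure lborel (?B \<inter> grid l -` {p}))"
    have e: "(\<lambda>\<eta>. \<integral>x. ?k x * G (grid l x, \<eta>) \<partial>lborel) = (\<lambda>\<eta>. \<Sum>p\<in>grid l ` ?B. ?m p * G (p, \<eta>))"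
      by (intro ext integral_grid)
    have "R l = (\<Sum>p\<in>grid l ` ?B. ?m p * U p)" unfolding R_def by (rule integral_grid)
    then show ?thesis unfolding e
      using tempered_sum[OF T grid_finite, of l \<rho> "\<lambda>p \<eta>. ?m p * G (p, \<eta>)"] Schwartz_cmult[OF Gx] tempered_cmult[OF T Gx]
      by (simp add: U_def)
  qed
  have ikG: "integrable lborel (\<lambda>x. ?k x * G (f x, \<eta>))" if f: "f \<in> borel_measurable borel" for f \<eta>
  proof -
    obtain C where C: "\<And>i z. wt2 z ^ 0 * norm (G z) \<le> C" using RDqE[OF fam_Q[OF G]] by metis
    have m: "(\<lambda>x. G (f x, \<eta>)) \<in> borel_measurable borel" using Dm[OF f, of "[]" \<eta>] by simp
    show ?thesis
    proof (rule Bochner_Integration.integrable_bound[where f = "\<lambda>x. norm (?k x) * C"])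
      show "integrable lborel (\<lambda>x. norm (?k x) * C)" using ik by simp
      show "(\<lambda>x. ?k x * G (f x, \<eta>)) \<in> borel_measurable lborel"
        using borel_measurable_times[OF mk m] by simp
      show "AE x in lborel. norm (?k x * G (f x, \<eta>)) \<le> norm (norm (?k x) * C)"
        using C by (intro AE_I2) (auto simp: norm_mult abs_mult intro!: mult_left_mono intro: order_trans[OF _ abs_ge_self])
    qed
  qed
  have RT: "R l - T (\<lambda>\<eta>. \<integral>x. G (x, \<eta>) \<partial>lborel) = complex_of_real (1 / 2 ^ l) * T (E l)" for l
  proof -
    have "E l = (\<lambda>\<eta>. complex_of_real (2 ^ l) * ((\<integral>x. ?k x * G (grid l x, \<eta>) \<partial>lborel) - (\<integral>x. G (x, \<eta>) \<partial>lborel)))"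
    proof
      fix \<eta>
      have "E l \<eta> = (\<integral>x. complex_of_real (2 ^ l) * (?k x * G (grid l x, \<eta>) - ?k x * G (x, \<eta>)) \<partial>lborel)"
        unfolding E_def by (simp add: algebra_simps)
      also have "\<dots> = complex_of_real (2 ^ l) * (\<integral>x. ?k x * G (grid l x, \<eta>) - ?k x * G (x, \<eta>) \<partial>lborel)"
        by (rule integral_mult_right_zero)
      also have "(\<integral>x. ?k x * G (grid l x, \<eta>) - ?k x * G (x, \<eta>) \<partial>lborel) = (\<integral>x. ?k x * G (grid l x, \<eta>) \<partial>lborel) - (\<integral>x. ?k x * G (x, \<eta>) \<partial>lborel)"
        by (rule Bochner_Integration.integral_diff[OF ikG[OF mg] ikG]) simp
      finally show "E l \<eta> = complex_of_real (2 ^ l) * ((\<integral>x. ?k x * G (grid l x, \<eta>) \<partial>lborel) - (\<integral>x. G (x, \<eta>) \<partial>lborel))" unfolding kG .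
    qed
    then have "T (E l) = complex_of_real (2 ^ l) * (R l - T (\<lambda>\<eta>. \<integral>x. G (x, \<eta>) \<partial>lborel))"
      using tempered_cmult[OF T Schwartz_diff[OF conjunct1[OF gS] I0]] tempered_diff[OF T conjunct1[OF gS] I0] gS by simp
    then show ?thesis by simp
  qed
  have z: "(\<lambda>l. C * (1 / 2) ^ l) \<longlonglongrightarrow> 0" for C :: real
    using tendsto_mult_right_zero[OF LIMSEQ_power_zero[of "1/2::real"]] by simp
  have lim1: "R \<longlonglongrightarrow> T (\<lambda>\<eta>. \<integral>x. G (x, \<eta>) \<partial>lborel)"
  proof (rule LIM_zero_cancel, rule Lim_null_comparison[OF _ z[of CE]], intro always_eventually allI)
    show "norm (R l - T (\<lambda>\<eta>. \<integral>x. G (x, \<eta>) \<partial>lborel)) \<le> CE * (1 / 2) ^ l" for l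
      unfolding RT norm_mult using CE[of l] by (simp add: norm_divide norm_power power_divide divide_right_mono)
  qed
  have lim2: "R \<longlonglongrightarrow> (\<integral>x. ?k x * U x \<partial>lborel)"
  proof (rule LIM_zero_cancel, rule Lim_null_comparison[OF _ z[of "measure lborel ?B * (L * real DIM('a))"]], intro always_eventually allI)
    fix l
    have e: "R l - (\<integral>x. ?k x * U x \<partial>lborel) = (\<integral>x. ?k x * (U (grid l x) - U x) \<partial>lborel)"
      unfolding R_def using Bochner_Integration.integral_diff[OF ikU[OF mg[of l]] ikU[of "\<lambda>x. x"]] by (simp add: algebra_simps)
    have "norm (\<integral>x. ?k x * (U (grid l x) - U x) \<partial>lborel) \<le> measure lborel ?B * (L * (real DIM('a) / 2 ^ l))"
    proof (rule norm_integral_mult_le[OF ik _ _ kn])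
      show "integrable lborel (\<lambda>x. ?k x * (U (grid l x) - U x))"
        using Bochner_Integration.integrable_diff[OF ikU[OF mg[of l]] ikU[of "\<lambda>x. x"]] by (simp add: algebra_simps)
      show "norm (U (grid l x) - U x) \<le> L * (real DIM('a) / 2 ^ l)" for x
        by (rule order_trans[OF lip mult_left_mono[OF grid_dist \<open>0 \<le> L\<close>]])
      show "0 \<le> L * (real DIM('a) / 2 ^ l)" using \<open>0 \<le> L\<close> by simp
    qed
    then show "norm (R l - (\<integral>x. ?k x * U x \<partial>lborel)) \<le> measure lborel ?B * (L * real DIM('a)) * (1 / 2) ^ l"
      unfolding e by (simp add: power_divide)
  qed
  have "?k x * U x = U x" for x
  proof (cases "x \<in> ?B")
    case False
    then have "(\<lambda>\<eta>. G (x, \<eta>)) = (\<lambda>\<eta>. 0)" using supp[of x] by auto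
    then show ?thesis using tempered_zero[OF T] by (simp add: U_def)
  next
    case True
    then show ?thesis by simp
  qed
  then have kU: "(\<lambda>x. ?k x * U x) = U" by (rule ext)
  show "integrable lborel (\<lambda>x. T (\<lambda>\<eta>. G (x, \<eta>)))"
    using ikU[of "\<lambda>x. x"] unfolding kU by (simp add: U_def[abs_def])
  have "(\<integral>x. U x \<partial>lborel) = T (\<lambda>\<eta>. \<integral>x. G (x, \<eta>) \<partial>lborel)"
    using LIMSEQ_unique[OF lim2 lim1] unfolding kU .
  then show "(\<integral>x. T (\<lambda>\<eta>. G (x, \<eta>)) \<partial>lborel) = T (\<lambda>\<eta>. \<integral>x. G (x, \<eta>) \<partial>lborel)" unfolding U_def .
qed

section \<open>Transposed symbols\<close>

text \<open>The form in which the symbol estimates enter the analysis: for each derivative,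
  polynomial growth in \<eta> that is uniform in x, and hence compatible with translation and
  averaging in x.\<close>

abbreviation Sym :: "('a::euclidean_space \<times> 'a \<Rightarrow> complex) \<Rightarrow> bool" where
  "Sym a \<equiv> OM wt2 (\<lambda>_::unit. a)"

lemma Sym_bound:
  assumes "Sym a"
  obtains C N where "C \<ge> 0" "\<And>z. norm (a z) \<le> C * wt2 z ^ N"
proof -
  obtain C N where C: "0 \<le> C" "\<And>N' (j::unit) z. N \<le> N' \<Longrightarrow> norm (a z) \<le> C * wt2 z ^ N'"
    by (rule OMqE[OF fam_Q[OF assms]], simp, rule that)
  show ?thesis by (rule that[OF C(1) C(2)]) auto
qed

lemma Sym_smooth: "Sym a \<Longrightarrow> smooth a"
  by (rule fam_smooth)

text \<open>Substituting -\<eta> for the integration variable shows that this is the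
  pseudo-differential operator with symbol c(x, -\<eta>) acting on \<phi>. The sign is built in so
  that transposition involves no reflection of \<open>c\<close>.\<close>

definition Qop :: "('a::euclidean_space \<times> 'a \<Rightarrow> complex) \<Rightarrow> ('a \<Rightarrow> complex) \<Rightarrow> 'a \<Rightarrow> complex" where
  "Qop c \<phi> = osc (-1) (\<lambda>z. c z * Finv \<phi> (snd z))"

lemma RD_Qop:
  assumes "OM wt2 c" "RD wt \<phi>"
  shows "RD wt (\<lambda>i. Qop (c i) (\<phi> i))"
  unfolding Qop_def by (rule RD_osc[OF RD_mult[OF assms(1) RD_snd[OF RD_Finv[OF assms(2)]]]]) auto

lemma Qop_Schwartz: "Sym c \<Longrightarrow> \<phi> \<in> Schwartz \<Longrightarrow> Qop c \<phi> \<in> Schwartz"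
  unfolding Schwartz_RD by (rule RD_Qop)

lemma RDq_imp_OMq_any: "RDq q f \<Longrightarrow> OMq p f"
proof -
  assume "RDq q f"
  then obtain C where "\<And>i x. q x ^ 0 * norm (f i x) \<le> C" using RDqE by metis
  then show ?thesis by (intro OMqI[where N = 0 and C = C]) auto
qed

text \<open>Each factor decays in its own variable and is merely bounded with respect to the weight
  of the other; the two decays combine through \<open>RD_combine_weights\<close>.\<close>

lemma RD_tensor:
  fixes f g :: "'a::euclidean_space \<Rightarrow> complex"
  assumes f: "f \<in> Schwartz" and g: "g \<in> Schwartz"
  shows "RD wt (\<lambda>_::unit. \<lambda>z::'a \<times> 'a. f (fst z) * g (snd z))"
proof -
  let ?w1 = "\<lambda>z::'a \<times> 'a. 1 + norm (fst z)"
  have "RD ?w1 (\<lambda>_::unit. \<lambda>z. f (0 + fst z))"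
    by (rule RD_affine[where c = "\<lambda>_. 0" and L = "\<lambda>_ z. fst z" and M = 1 and K = 1 and q = wt, OF Schwartz_RD_const[OF f]])
       (auto simp: linear_iff Basis_prod_def)
  then have F: "RD ?w1 (\<lambda>_::unit. \<lambda>z. f (fst z))" by simp
  have G: "RD wt2 (\<lambda>_::unit. \<lambda>z::'a \<times> 'a. g (snd z))" by (rule RD_snd[OF Schwartz_RD_const[OF g]])
  have "RD ?w1 (\<lambda>_::unit. \<lambda>z. g (snd z) * f (fst z))"
    by (rule RD_mult[OF fam_mono[OF G RDq_imp_OMq_any] F]) auto
  then have 1: "RD ?w1 (\<lambda>_::unit. \<lambda>z. f (fst z) * g (snd z))" by (simp add: mult.commute)
  have 2: "RD wt2 (\<lambda>_::unit. \<lambda>z::'a \<times> 'a. f (fst z) * g (snd z))"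
    by (rule RD_mult[OF fam_mono[OF F RDq_imp_OMq_any] G]) auto
  have "RD (\<lambda>z. ?w1 z * wt2 z) (\<lambda>_::unit. \<lambda>z. f (fst z) * g (snd z))"
    by (rule RD_combine_weights[OF 1 2]) auto
  then show ?thesis
  proof (rule RD_weight[where K = 1])
    show "1 \<le> ?w1 z * wt2 z" for z by (rule order_trans[OF _ mult_mono[of 1 _ 1]]) auto
    show "wt z \<le> 1 * (?w1 z * wt2 z)" for z :: "'a \<times> 'a"
    proof -
      have "norm z \<le> norm (fst z) + norm (snd z)" using norm_Pair_le[of "fst z" "snd z"] by simp
      moreover have "0 \<le> norm (fst z) * norm (snd z)" by simp
      moreover have "?w1 z * wt2 z = 1 + norm (fst z) + norm (snd z) + norm (fst z) * norm (snd z)" by (simp add: algebra_simps)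
      ultimately show ?thesis by linarith
    qed
  qed simp
qed

definition Ham :: "real \<Rightarrow> ('a::euclidean_space \<times> 'a \<Rightarrow> complex) \<Rightarrow> ('a \<Rightarrow> complex) \<Rightarrow> ('a \<Rightarrow> complex) \<Rightarrow> 'a \<times> 'a \<Rightarrow> complex" where
  "Ham s a f g z = cis (s * (fst z \<bullet> snd z)) * (a z * (f (fst z) * g (snd z)))"

text \<open>For s = 1 and \<open>g\<close> the Fourier transform of v this is, up to the constant
  \<open>fconst\<close>, the integral of f times a(x,D)v. For s = -1 and \<open>g\<close> an inverse
  transform it is the transposed expression.\<close>

definition pairing :: "real \<Rightarrow> ('a::euclidean_space \<times> 'a \<Rightarrow> complex) \<Rightarrow> ('a \<Rightarrow> complex) \<Rightarrow> ('a \<Rightarrow> complex) \<Rightarrow> complex" where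
  "pairing s a f g = (\<integral>z. Ham s a f g z \<partial>lborel)"

lemma OM_inner_prod: "OM wt (\<lambda>_::unit. \<lambda>z::'a::euclidean_space \<times> 'a. complex_of_real (fst z \<bullet> snd z))"
proof -
  have "OM wt (\<lambda>_::unit. \<lambda>z::'a \<times> 'a. \<Sum>b\<in>Basis. complex_of_real (z \<bullet> (b, 0)) * complex_of_real (z \<bullet> (0, b)))"
  proof (rule OM_sum[OF finite_Basis])
    fix b :: 'a assume b: "b \<in> Basis"
    show "OM wt (\<lambda>_::unit. \<lambda>z::'a \<times> 'a. complex_of_real (z \<bullet> (b, 0)) * complex_of_real (z \<bullet> (0, b)))"
      by (rule OM_mult[OF OM_inner[where K = 1] OM_inner[where K = 1]]) (use b in auto)
  qed simp
  moreover have "(\<Sum>b\<in>Basis. complex_of_real (z \<bullet> (b, 0)) * complex_of_real (z \<bullet> (0, b))) = complex_of_real (fst z \<bullet> snd z)" for z :: "'a \<times> 'a"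
    unfolding euclidean_inner[of "fst z" "snd z"] of_real_sum by (cases z) simp
  ultimately show ?thesis by simp
qed

lemma OM_wt2_wt: "OM wt2 a \<Longrightarrow> OM wt a"
  by (rule OM_weight[where K = 1 and q = wt2]) (auto simp: norm_snd_le order_trans[OF norm_snd_le] case_prod_unfold norm_prod_def real_le_rsqrt)

lemma Ham_RD:
  assumes a: "Sym a" and f: "f \<in> Schwartz" and g: "g \<in> Schwartz"
  shows "RD wt (\<lambda>_::unit. Ham s a f g)"
proof -
  have "OM wt (\<lambda>_::unit. \<lambda>z::'a \<times> 'a. 1 * cis (s * (fst z \<bullet> snd z)))"
  proof (rule OM_cis[OF OM_const[where M = 1]])
    have "OM wt (\<lambda>_::unit. \<lambda>z::'a \<times> 'a. complex_of_real s * complex_of_real (fst z \<bullet> snd z))"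
      by (rule OM_cmult[OF OM_inner_prod, where M = "\<bar>s\<bar>"]) auto
    then show "OM wt (\<lambda>_::unit. \<lambda>z::'a \<times> 'a. complex_of_real (s * (fst z \<bullet> snd z)))" by simp
  qed auto
  then have c: "OM wt (\<lambda>_::unit. \<lambda>z::'a \<times> 'a. cis (s * (fst z \<bullet> snd z)))" by simp
  show ?thesis unfolding Ham_def[abs_def]
    by (rule RD_mult[OF c RD_mult[OF OM_wt2_wt[OF a] RD_tensor[OF f g]]]) auto
qed

lemma Ham_Schwartz: "Sym a \<Longrightarrow> f \<in> Schwartz \<Longrightarrow> g \<in> Schwartz \<Longrightarrow> Ham s a f g \<in> Schwartz"
  using Ham_RD Schwartz_RD by blast

lemma Schwartz_prod_bound:
  fixes H :: "'a::euclidean_space \<times> 'b::euclidean_space \<Rightarrow> complex"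
  assumes H: "H \<in> Schwartz"
  shows "\<exists>C. \<forall>x y. wt x ^ k * (wt y ^ l * norm (H (x, y))) \<le> C"
proof -
  obtain C where C: "C \<ge> 0" "\<And>z. wt z ^ (k + l) * norm (H z) \<le> C" using Schwartz_RDq_bound[OF H] by blast
  have "wt x ^ k * (wt y ^ l * norm (H (x, y))) \<le> C" for x y
  proof -
    have "wt x ^ k * (wt y ^ l * norm (H (x, y))) \<le> wt (x, y) ^ k * (wt (x, y) ^ l * norm (H (x, y)))"
      using norm_fst_le[of x y] norm_snd_le[of y x] by (intro mult_mono power_mono mult_nonneg_nonneg) auto
    also have "\<dots> \<le> C" using C(2)[of "(x, y)"] by (simp add: power_add mult.assoc)
    finally show ?thesis .
  qed
  then show ?thesis by blast
qed

lemma Fubini_Schwartz: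
  fixes H :: "'a::euclidean_space \<times> 'b::euclidean_space \<Rightarrow> complex"
  assumes H: "H \<in> Schwartz"
  shows "(\<integral>x. \<integral>y. H (x, y) \<partial>lborel \<partial>lborel) = (\<integral>z. H z \<partial>lborel)"
    and "(\<integral>y. \<integral>x. H (x, y) \<partial>lborel \<partial>lborel) = (\<integral>z. H z \<partial>lborel)"
proof -
  obtain C where C: "\<And>x y. wt x ^ (2 * DIM('a)) * (wt y ^ (2 * DIM('b)) * norm (H (x, y))) \<le> C"
    using Schwartz_prod_bound[OF H] by blast
  show "(\<integral>x. \<integral>y. H (x, y) \<partial>lborel \<partial>lborel) = (\<integral>z. H z \<partial>lborel)"
    "(\<integral>y. \<integral>x. H (x, y) \<partial>lborel \<partial>lborel) = (\<integral>z. H z \<partial>lborel)"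
    by (rule Fubini_decay(2)[OF Schwartz_measurable[OF H] C], rule Fubini_decay(3)[OF Schwartz_measurable[OF H] C])
qed

lemma pairing_Qop:
  assumes c: "Sym c" and g: "g \<in> Schwartz" and f: "f \<in> Schwartz"
  shows "pairing (-1) c g (Finv f) = (\<integral>x. g x * Qop c f x \<partial>lborel)"
proof -
  have "pairing (-1) c g (Finv f) = (\<integral>x. \<integral>y. Ham (-1) c g (Finv f) (x, y) \<partial>lborel \<partial>lborel)"
    unfolding pairing_def by (rule Fubini_Schwartz(1)[OF Ham_Schwartz[OF c g Finv_Schwartz[OF f]], symmetric])
  also have "\<dots> = (\<integral>x. g x * Qop c f x \<partial>lborel)"
  proof (rule Bochner_Integration.integral_cong[OF refl])
    fix x
    have "(\<integral>y. Ham (-1) c g (Finv f) (x, y) \<partial>lborel) = (\<integral>y. g x * (cis (-1 * (x \<bullet> y)) * (c (x, y) * Finv f y)) \<partial>lborel)"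
      by (rule Bochner_Integration.integral_cong[OF refl]) (simp add: Ham_def mult_ac)
    also have "\<dots> = g x * Qop c f x" unfolding Qop_def osc_def snd_conv by (rule integral_mult_right_zero)
    finally show "(\<integral>y. Ham (-1) c g (Finv f) (x, y) \<partial>lborel) = g x * Qop c f x" .
  qed
  finally show ?thesis .
qed

text \<open>The operator \<open>f \<mapsto> Qop c f\<close> is the transpose of \<open>a(x,D)\<close>; equivalently, \<open>cnj c\<close> is the adjoint symbol of \<open>a\<close>.\<close>

definition dual :: "('a::euclidean_space \<times> 'a \<Rightarrow> complex) \<Rightarrow> ('a \<times> 'a \<Rightarrow> complex) \<Rightarrow> bool" where
  "dual a c \<longleftrightarrow> Sym a \<and> Sym c \<and> (\<forall>f\<in>Schwartz. \<forall>g\<in>Schwartz.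
     fconst TYPE('a) * pairing 1 a f (Four g) = pairing (-1) c g (Finv f))"

lemma cnj_Four_cnj: "fconst TYPE('a) * cnj (Four (\<lambda>x. cnj (f x)) \<xi>) = Finv f \<xi>" for \<xi> :: "'a::euclidean_space"
  unfolding Four_def Finv_def by (simp add: Bochner_Integration.integral_cnj[symmetric] cis_cnj inner_commute del: Bochner_Integration.integral_cnj)

lemma cnj_Finv_cnj: "cnj (Finv (\<lambda>x. cnj (f x)) \<xi>) = fconst TYPE('a) * Four f \<xi>" for \<xi> :: "'a::euclidean_space"
  unfolding Four_def Finv_def by (simp add: Bochner_Integration.integral_cnj[symmetric] cis_cnj inner_commute del: Bochner_Integration.integral_cnj)

lemma pairing_cnj: "cnj (pairing s a f g) = pairing (-s) (\<lambda>z. cnj (a z)) (\<lambda>x. cnj (f x)) (\<lambda>x. cnj (g x))"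
  unfolding pairing_def Ham_def by (simp add: Bochner_Integration.integral_cnj[symmetric] cis_cnj del: Bochner_Integration.integral_cnj)

lemma pairing_cmult: "pairing s a f (\<lambda>x. k * g x) = k * pairing s a f g"
proof -
  have "Ham s a f (\<lambda>x. k * g x) = (\<lambda>z. k * Ham s a f g z)" by (simp add: Ham_def fun_eq_iff mult_ac)
  then show ?thesis unfolding pairing_def by simp
qed

text \<open>Conjugating the defining identity exchanges its two sides: the adjoint of the adjoint is
  the original operator. This makes the theory applicable to the adjoint symbol itself.\<close>

lemma dual_cnj:
  assumes "dual a c"
  shows "dual (\<lambda>z. cnj (c z)) (\<lambda>z. cnj (a z))"
  unfolding dual_def
proof (intro conjI ballI)
  show "Sym (\<lambda>z. cnj (c z))" "Sym (\<lambda>z. cnj (a z))" using assms OM_cnj unfolding dual_def by auto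
  fix f g :: "'a \<Rightarrow> complex" assume f: "f \<in> Schwartz" and g: "g \<in> Schwartz"
  have "fconst TYPE('a) * pairing 1 a (\<lambda>x. cnj (g x)) (Four (\<lambda>x. cnj (f x))) = pairing (-1) c (\<lambda>x. cnj (f x)) (Finv (\<lambda>x. cnj (g x)))"
    using assms Schwartz_cnj[OF f] Schwartz_cnj[OF g] unfolding dual_def by blast
  from arg_cong[OF this, of cnj]
  have "fconst TYPE('a) * pairing (-1) (\<lambda>z. cnj (a z)) g (\<lambda>x. cnj (Four (\<lambda>x. cnj (f x)) x))
      = pairing 1 (\<lambda>z. cnj (c z)) f (\<lambda>x. cnj (Finv (\<lambda>x. cnj (g x)) x))"
    by (simp add: pairing_cnj)
  then show "fconst TYPE('a) * pairing 1 (\<lambda>z. cnj (c z)) f (Four g) = pairing (-1) (\<lambda>z. cnj (a z)) g (Finv f)"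
    by (simp only: pairing_cmult[symmetric] cnj_Four_cnj cnj_Finv_cnj)
qed

lemma integral_norm_sq_zero:
  fixes v :: "'a::euclidean_space \<Rightarrow> complex"
  assumes v: "v \<in> Schwartz" and 0: "(\<integral>x. v x * cnj (v x) \<partial>lborel) = 0"
  shows "v x = 0"
proof (rule ccontr)
  assume nz: "v x \<noteq> 0"
  obtain C where C: "C \<ge> 0" "\<And>x. wt x ^ (2 * DIM('a)) * norm (v x) \<le> C" using Schwartz_RDq_bound[OF v] by blast
  obtain D where D: "D \<ge> 0" "\<And>x. wt x ^ 0 * norm (v x) \<le> D" using Schwartz_RDq_bound[OF v] by blast
  have m: "(\<lambda>x. v x * cnj (v x)) \<in> borel_measurable lborel"
    by (rule continuous_measurable) (intro continuous_intros Schwartz_continuous[OF v])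
  have i: "integrable lborel (\<lambda>x. v x * cnj (v x))"
  proof (rule integrable_dominated(1)[OF m])
    fix x
    have "wt x ^ (2 * DIM('a)) * norm (v x * cnj (v x)) = (wt x ^ (2 * DIM('a)) * norm (v x)) * norm (v x)" by (simp add: norm_mult)
    also have "\<dots> \<le> C * D" using C(1) C(2)[of x] D(2)[of x] by (intro mult_mono) auto
    finally show "wt x ^ (2 * DIM('a)) * norm (v x * cnj (v x)) \<le> C * D" .
  qed
  have eq: "(\<lambda>x. v x * cnj (v x)) = (\<lambda>x. complex_of_real ((norm (v x))\<^sup>2))"
    by (rule ext) (rule complex_norm_square[symmetric])
  have ir: "integrable lborel (\<lambda>x. (norm (v x))\<^sup>2)"
    using integrable_Re[OF i[unfolded eq]] unfolding Re_complex_of_real .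
  have "(\<integral>x. (norm (v x))\<^sup>2 \<partial>lborel) = 0"
    using 0 unfolding eq integral_complex_of_real by simp
  then have "AE x in lborel. (norm (v x))\<^sup>2 = 0"
    using integral_nonneg_eq_0_iff_AE[OF ir] by simp
  then have ae: "AE x in lborel. v x = 0" by simp
  have op: "open {x. v x \<noteq> 0}"
    by (rule open_Collect_neq[OF Schwartz_continuous[OF v] continuous_on_const])
  have "{x. v x \<noteq> 0} \<in> null_sets lborel"
    using ae op by (subst AE_iff_null_sets) auto
  then have "negligible {x. v x \<noteq> 0}" by (simp add: negligible_iff_null_sets null_sets_completionI)
  with op nz show False using open_not_negligible by blast
qed

text \<open>Written out, the left side integrates over x the values of the transform of
  \<open>u\<close> on sections of one function \<open>G\<close>. \<open>tempered_integral\<close>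
  moves the functional outside, and duality identifies the remaining x-integral of
  \<open>G\<close>.\<close>

lemma OP_dual:
  fixes a :: "'a::euclidean_space \<times> 'a \<Rightarrow> complex"
  assumes ac: "dual a c" and u: "tempered u" and w: "w \<in> Schwartz" and \<phi>: "\<phi> \<in> test"
    and Fd: "tempered (Four_dist u)"
  shows "OP (\<lambda>z. a z * w (snd z)) u \<phi> = u (Four (\<lambda>\<eta>. w \<eta> * Finv (Qop c \<phi>) \<eta>))"
    and "(\<lambda>\<eta>. cis (x \<bullet> \<eta>) * (a (x, \<eta>) * w \<eta>)) \<in> Schwartz"
    and "integrable lborel (\<lambda>x. OPfun (\<lambda>z. a z * w (snd z)) u x * \<phi> x)"
proof -
  have a: "Sym a" and c: "Sym c" using ac unfolding dual_def by auto
  have \<phi>S: "\<phi> \<in> Schwartz" by (rule test_Schwartz[OF \<phi>])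
  obtain \<rho> where \<rho>: "\<rho> > 0" "\<And>x. \<rho> < norm x \<Longrightarrow> \<phi> x = 0" using test_support[OF \<phi>] by blast
  define G where "G z = fconst TYPE('a) * Ham 1 a \<phi> w z" for z
  have GR: "RD wt2 (\<lambda>_::unit. G)"
  proof -
    have "RD wt (\<lambda>_::unit. G)" unfolding G_def[abs_def]
      by (rule RD_cmult[OF Ham_RD[OF a \<phi>S w], where M = "norm (fconst TYPE('a))"]) auto
    then show ?thesis
      by (rule RD_weight[where K = 1]) (auto simp: norm_prod_def real_le_rsqrt)
  qed
  have Gs: "G (x, \<eta>) = 0" if "\<rho> < norm x" for x \<eta> using \<rho>(2)[OF that] by (simp add: G_def Ham_def)
  let ?v = "Four_dist u"
  have sec: "(\<lambda>\<eta>. cis (x \<bullet> \<eta>) * (a (x, \<eta>) * w \<eta>)) \<in> Schwartz" for x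
  proof -
    have "RD wt2 (\<lambda>_::unit. \<lambda>z. a z * w (snd z))" by (rule RD_mult[OF a RD_snd[OF Schwartz_RD_const[OF w]]]) auto
    from Schwartz_cis[OF Schwartz_section[OF this, where x = x]] show ?thesis by simp
  qed
  have "OPfun (\<lambda>z. a z * w (snd z)) u x * \<phi> x = ?v (\<lambda>\<eta>. G (x, \<eta>))" for x
  proof -
    have "(\<lambda>\<eta>. G (x, \<eta>)) = (\<lambda>\<eta>. (fconst TYPE('a) * \<phi> x) * (cis (x \<bullet> \<eta>) * (a (x, \<eta>) * w \<eta>)))"
      by (simp add: G_def Ham_def fun_eq_iff mult_ac)
    then show ?thesis unfolding OPfun_def using tempered_cmult[OF Fd sec[of x], of "fconst TYPE('a) * \<phi> x"] by simp
  qed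
  then have OPG: "(\<lambda>x. OPfun (\<lambda>z. a z * w (snd z)) u x * \<phi> x) = (\<lambda>x. ?v (\<lambda>\<eta>. G (x, \<eta>)))" by (rule ext)
  show "(\<lambda>\<eta>. cis (x \<bullet> \<eta>) * (a (x, \<eta>) * w \<eta>)) \<in> Schwartz" by (rule sec)
  show "integrable lborel (\<lambda>x. OPfun (\<lambda>z. a z * w (snd z)) u x * \<phi> x)"
    unfolding OPG by (rule tempered_integral(3)[OF Fd GR Gs])
  have "OP (\<lambda>z. a z * w (snd z)) u \<phi> = (\<integral>x. ?v (\<lambda>\<eta>. G (x, \<eta>)) \<partial>lborel)"
    using \<phi> by (simp add: OP_def OPG)
  also have "\<dots> = ?v (\<lambda>\<eta>. \<integral>x. G (x, \<eta>) \<partial>lborel)" by (rule tempered_integral(2)[OF Fd GR Gs])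
  also have "(\<lambda>\<eta>. \<integral>x. G (x, \<eta>) \<partial>lborel) = (\<lambda>\<eta>. w \<eta> * Finv (Qop c \<phi>) \<eta>)"
  proof -
    let ?I = "\<lambda>\<eta>. \<integral>x. G (x, \<eta>) \<partial>lborel" and ?Q = "Qop c \<phi>"
    have I: "?I \<in> Schwartz" by (rule tempered_integral(1)[OF Fd GR Gs])
    have QS: "?Q \<in> Schwartz" by (rule Qop_Schwartz[OF c \<phi>S])
    have prodS: "(\<lambda>\<eta>. f \<eta> * g \<eta>) \<in> Schwartz" if "f \<in> Schwartz" "g \<in> Schwartz" for f g :: "'a \<Rightarrow> complex"
      unfolding Schwartz_RD by (rule RD_mult[OF Schwartz_OM[OF that(1)] Schwartz_RD_const[OF that(2)]]) auto
    have wQ: "(\<lambda>\<eta>. w \<eta> * Finv ?Q \<eta>) \<in> Schwartz" by (rule prodS[OF w Finv_Schwartz[OF QS]])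
    \<comment> \<open>Duality is an identity between integrals, so the two functions of \<eta> are
      compared weakly, against an arbitrary Schwartz function \<open>k\<close>.\<close>
    have test_eq: "(\<integral>\<eta>. ?I \<eta> * k \<eta> \<partial>lborel) = (\<integral>\<eta>. (w \<eta> * Finv ?Q \<eta>) * k \<eta> \<partial>lborel)" if k: "k \<in> Schwartz" for k
    proof -
      let ?wk = "\<lambda>\<eta>. w \<eta> * k \<eta>"
      have wk: "?wk \<in> Schwartz" by (rule prodS[OF w k])
      have g: "Finv ?wk \<in> Schwartz" by (rule Finv_Schwartz[OF wk])
      have H: "Ham 1 a \<phi> ?wk \<in> Schwartz" by (rule Ham_Schwartz[OF a \<phi>S wk])
      have "(\<integral>\<eta>. ?I \<eta> * k \<eta> \<partial>lborel) = (\<integral>\<eta>. fconst TYPE('a) * (\<integral>x. Ham 1 a \<phi> ?wk (x, \<eta>) \<partial>lborel) \<partial>lborel)"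
      proof (rule Bochner_Integration.integral_cong[OF refl])
        fix \<eta>
        have "?I \<eta> * k \<eta> = (\<integral>x. G (x, \<eta>) * k \<eta> \<partial>lborel)" by (rule integral_mult_left_zero[symmetric])
        also have "\<dots> = (\<integral>x. fconst TYPE('a) * Ham 1 a \<phi> ?wk (x, \<eta>) \<partial>lborel)"
          by (rule Bochner_Integration.integral_cong[OF refl]) (simp add: G_def Ham_def mult_ac)
        also have "\<dots> = fconst TYPE('a) * (\<integral>x. Ham 1 a \<phi> ?wk (x, \<eta>) \<partial>lborel)" by (rule integral_mult_right_zero)
        finally show "?I \<eta> * k \<eta> = fconst TYPE('a) * (\<integral>x. Ham 1 a \<phi> ?wk (x, \<eta>) \<partial>lborel)" .
      qed
      also have "\<dots> = fconst TYPE('a) * (\<integral>\<eta>. \<integral>x. Ham 1 a \<phi> ?wk (x, \<eta>) \<partial>lborel \<partial>lborel)" by (rule integral_mult_right_zero)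
      also have "\<dots> = fconst TYPE('a) * pairing 1 a \<phi> ?wk" unfolding pairing_def Fubini_Schwartz(2)[OF H] ..
      \<comment> \<open>The defining identity of \<open>dual\<close> asks for a Fourier transform in
        this slot; the product of \<open>w\<close> and \<open>k\<close> is rewritten as one.\<close>
      also have "\<dots> = fconst TYPE('a) * pairing 1 a \<phi> (Four (Finv ?wk))" by (simp only: Four_Finv_inverse[OF wk])
      also have "\<dots> = pairing (-1) c (Finv ?wk) (Finv \<phi>)" using ac \<phi>S g unfolding dual_def by blast
      also have "\<dots> = (\<integral>x. Finv ?wk x * ?Q x \<partial>lborel)" by (rule pairing_Qop[OF c g \<phi>S])
      also have "\<dots> = (\<integral>\<eta>. ?wk \<eta> * Finv ?Q \<eta> \<partial>lborel)" by (rule Finv_mult_formula[OF wk QS])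
      also have "\<dots> = (\<integral>\<eta>. (w \<eta> * Finv ?Q \<eta>) * k \<eta> \<partial>lborel)"
        by (rule Bochner_Integration.integral_cong[OF refl]) (simp add: mult_ac)
      finally show ?thesis .
    qed
    \<comment> \<open>Testing with the conjugate of the difference makes its square norm vanish, and
      a continuous function with this property is zero.\<close>
    let ?d = "\<lambda>\<eta>. ?I \<eta> - w \<eta> * Finv ?Q \<eta>"
    have d: "?d \<in> Schwartz" by (rule Schwartz_diff[OF I wQ])
    have cd: "(\<lambda>\<eta>. cnj (?d \<eta>)) \<in> Schwartz" by (rule Schwartz_cnj[OF d])
    have "(\<integral>\<eta>. ?d \<eta> * cnj (?d \<eta>) \<partial>lborel) = (\<integral>\<eta>. ?I \<eta> * cnj (?d \<eta>) - (w \<eta> * Finv ?Q \<eta>) * cnj (?d \<eta>) \<partial>lborel)"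
      by (simp only: left_diff_distrib)
    also have "\<dots> = (\<integral>\<eta>. ?I \<eta> * cnj (?d \<eta>) \<partial>lborel) - (\<integral>\<eta>. (w \<eta> * Finv ?Q \<eta>) * cnj (?d \<eta>) \<partial>lborel)"
      by (rule Bochner_Integration.integral_diff[OF Schwartz_integrable[OF prodS[OF I cd]] Schwartz_integrable[OF prodS[OF wQ cd]]])
    also have "\<dots> = 0" using test_eq[OF cd] by simp
    finally have "?d \<eta> = 0" for \<eta> by (rule integral_norm_sq_zero[OF d])
    then show ?thesis by (simp add: fun_eq_iff)
  qed
  also have "?v (\<lambda>\<eta>. w \<eta> * Finv (Qop c \<phi>) \<eta>) = u (Four (\<lambda>\<eta>. w \<eta> * Finv (Qop c \<phi>) \<eta>))"
  proof -
    have "(\<lambda>\<eta>. w \<eta> * Finv (Qop c \<phi>) \<eta>) \<in> Schwartz"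
      unfolding Schwartz_RD
      by (rule RD_mult[OF Schwartz_OM[OF w] Schwartz_RD_const[OF Finv_Schwartz[OF Qop_Schwartz[OF c \<phi>S]]]]) auto
    then show ?thesis by (simp add: Four_dist_def)
  qed
  finally show "OP (\<lambda>z. a z * w (snd z)) u \<phi> = u (Four (\<lambda>\<eta>. w \<eta> * Finv (Qop c \<phi>) \<eta>))" .
qed

lemma tempered_Four_dist:
  assumes "tempered u"
  shows "tempered (Four_dist u)"
proof (rule temperedI)
  show "Four_dist u \<phi> = 0" if "\<phi> \<notin> Schwartz" for \<phi> using that by (simp add: Four_dist_def)
  show "Four_dist u (\<lambda>x. \<phi> x + g x) = Four_dist u \<phi> + Four_dist u g" if "\<phi> \<in> Schwartz" "g \<in> Schwartz" for \<phi> g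
    using that by (simp add: Four_dist_def Schwartz_add Four_add tempered_add[OF assms] Four_Schwartz)
  show "Four_dist u (\<lambda>x. c * \<phi> x) = c * Four_dist u \<phi>" if "\<phi> \<in> Schwartz" for \<phi> c
    using that by (simp add: Four_dist_def Schwartz_cmult Four_cmult tempered_cmult[OF assms] Four_Schwartz)
  fix f :: "nat \<Rightarrow> 'a \<Rightarrow> complex" assume f: "RD wt f"
  have "Four_dist u (f i) = u (Four (f i))" for i using RD_Schwartz[OF f] by (simp add: Four_dist_def)
  then show "\<exists>C. \<forall>i. norm (Four_dist u (f i)) \<le> C" using tempered_bounded[OF assms RD_Four[OF f]] by metis
qed

section \<open>Averaging a symbol over translations\<close>

text \<open>For \<open>\<kappa> = Finv m\<close> this is \<open>xmult (dilate t m) b\<close>. The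
  dilation sits in the translation and the kernel stays fixed, so that estimates come out uniform in
  \<open>t\<close>.\<close>

definition conv :: "('a::euclidean_space \<Rightarrow> complex) \<Rightarrow> real \<Rightarrow> ('a \<times> 'a \<Rightarrow> complex) \<Rightarrow> 'a \<times> 'a \<Rightarrow> complex" where
  "conv \<kappa> t b z = (\<integral>y. \<kappa> y * b ((- (t *\<^sub>R y), 0) + z) \<partial>lborel)"

lemma continuous_shift:
  fixes b :: "'a::euclidean_space \<times> 'a \<Rightarrow> complex"
  assumes "continuous_on UNIV b"
  shows "continuous_on UNIV (\<lambda>y. b ((- (t *\<^sub>R y), 0) + z))"
  by (rule continuous_on_compose2[OF assms]) (auto intro!: continuous_intros)

lemma conv_integrable:
  assumes k: "\<kappa> \<in> Schwartz" and b: "Sym b"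
  shows "integrable lborel (\<lambda>y. \<kappa> y * b ((- (t *\<^sub>R y), 0) + z))"
proof -
  obtain C N where C: "C \<ge> 0" "\<And>z. norm (b z) \<le> C * wt2 z ^ N" using Sym_bound[OF b] by blast
  show ?thesis
  proof (rule Bochner_Integration.integrable_bound)
    show "integrable lborel (\<lambda>y. norm (\<kappa> y) * (C * wt2 z ^ N))"
      by (intro integrable_mult_left integrable_norm Schwartz_integrable k)
    show "(\<lambda>y. \<kappa> y * b ((- (t *\<^sub>R y), 0) + z)) \<in> borel_measurable lborel"
      by (intro borel_measurable_times Schwartz_measurable k continuous_measurable continuous_shift smooth_continuous Sym_smooth b)
    show "AE y in lborel. norm (\<kappa> y * b ((- (t *\<^sub>R y), 0) + z)) \<le> norm (norm (\<kappa> y) * (C * wt2 z ^ N))"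
    proof (rule AE_I2)
      fix y
      have "norm (b ((- (t *\<^sub>R y), 0) + z)) \<le> C * wt2 z ^ N" using C(2)[of "(- (t *\<^sub>R y), 0) + z"] by simp
      then show "norm (\<kappa> y * b ((- (t *\<^sub>R y), 0) + z)) \<le> norm (norm (\<kappa> y) * (C * wt2 z ^ N))"
        using C(1) by (simp add: norm_mult abs_mult mult_left_mono)
    qed
  qed
qed

lemma Schwartz_wt_integrable:
  fixes \<kappa> :: "'a::euclidean_space \<Rightarrow> complex"
  assumes k: "\<kappa> \<in> Schwartz"
  shows "integrable lborel (\<lambda>y. \<kappa> y * complex_of_real (wt y))"
proof -
  obtain C where C: "\<And>x. wt x ^ (2 * DIM('a) + 1) * norm (\<kappa> x) \<le> C" using Schwartz_RDq_bound[OF k] by blast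
  show ?thesis
  proof (rule integrable_dominated(1))
    show "(\<lambda>y. \<kappa> y * complex_of_real (wt y)) \<in> borel_measurable lborel"
      by (rule continuous_measurable) (intro continuous_intros Schwartz_continuous[OF k])
    fix x :: 'a
    have "norm (complex_of_real (wt x)) = wt x" unfolding norm_of_real by simp
    then show "wt x ^ (2 * DIM('a)) * norm (\<kappa> x * complex_of_real (wt x)) \<le> C"
      unfolding norm_mult using C[of x] by (simp add: mult_ac)
  qed
qed

lemma OM_conv:
  fixes b :: "'i \<Rightarrow> 'a::euclidean_space \<times> 'a \<Rightarrow> complex"
  assumes k: "\<kappa> \<in> Schwartz" and b: "OM wt2 b"
  shows "OM wt2 (\<lambda>i. conv \<kappa> (t i) (b i))"
proof -
  let ?g = "\<lambda>p z. b (fst p) ((- (t (fst p) *\<^sub>R snd p), 0) + z)"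
  have "OM wt2 (\<lambda>i z. \<integral>y. \<kappa> y * ?g (i, y) z \<partial>lborel)"
  proof (rule OM_integral[where C = "\<integral>y. norm (\<kappa> y) \<partial>lborel"])
    show "OM wt2 ?g"
      by (rule OM_affine[where c = "\<lambda>p. (- (t (fst p) *\<^sub>R snd p), 0)" and L = "\<lambda>_ z. z" and M = 1 and K = 1, OF OM_reindex[OF b, of fst]])
         (auto simp: linear_ident)
    show "integrable lborel \<kappa>" by (rule Schwartz_integrable[OF k])
    fix i and vs :: "('a \<times> 'a) list" and z assume vs: "vs \<in> lists Basis"
    have "(\<lambda>y. Dlist vs (?g (i, y)) z) = (\<lambda>y. Dlist vs (b i) ((- (t i *\<^sub>R y), 0) + z))"
      unfolding fst_conv snd_conv Dlist_translate[OF fam_smooth[OF b] vs] ..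
    then show "(\<lambda>y. Dlist vs (?g (i, y)) z) \<in> borel_measurable lborel"
      using continuous_measurable[OF continuous_shift[OF smooth_continuous_Dlist[OF fam_smooth[OF b] vs]]] by simp
  qed (auto intro: wt2_local)
  then show ?thesis by (simp add: conv_def[abs_def])
qed

lemma Sym_conv: "\<kappa> \<in> Schwartz \<Longrightarrow> Sym b \<Longrightarrow> Sym (conv \<kappa> t b)"
  by (rule OM_conv)

text \<open>As the kernel has integral 1, the difference is an average of b(x - t y, \<eta>) - b(x,
  \<eta>). Dividing by t leaves |y| times a bounded difference quotient, and the kernel has a finite
  first moment.\<close>

lemma OM_conv_diff:
  fixes b :: "'i \<Rightarrow> 'a::euclidean_space \<times> 'a \<Rightarrow> complex"
  assumes k: "\<kappa> \<in> Schwartz" and k1: "(\<integral>y. \<kappa> y \<partial>lborel) = 1" and b: "OM wt2 b" and t: "\<And>i. t i > 0"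
  shows "OM wt2 (\<lambda>i z. complex_of_real (1 / t i) * (conv \<kappa> (t i) (b i) z - b i z))"
proof -
  let ?q = "\<lambda>(i, w) z. complex_of_real (1 / norm (w :: 'a)) * (b i ((w, 0) + z) - b i z)"
  let ?w = "\<lambda>p. - (t (fst p) *\<^sub>R snd p)"
  \<comment> \<open>The unbounded factor |y| is split: \<open>wt y\<close> goes to the kernel, which
    stays integrable, and |y| / \<open>wt y\<close>, at most 1, stays with the family.\<close>
  let ?k = "\<lambda>y. \<kappa> y * complex_of_real (wt y)"
  let ?g = "\<lambda>p z. complex_of_real (norm (snd p) / wt (snd p)) * ?q (fst p, ?w p) z"
  have wpos: "wt y > 0" for y :: 'a by (simp add: add_pos_nonneg)
  have ik: "integrable lborel ?k" by (rule Schwartz_wt_integrable[OF k])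
  have main: "OM wt2 (\<lambda>i z. \<integral>y. ?k y * ?g (i, y) z \<partial>lborel)"
  proof (rule OM_integral[where C = "\<integral>y. norm (?k y) \<partial>lborel"])
    show "OM wt2 ?g"
    proof (rule OM_cmult[OF OM_reindex[OF OM_shift_quotient[OF b]], where M = 1])
      show "norm (complex_of_real (norm (snd p) / wt (snd p))) \<le> 1" for p :: "'i \<times> 'a"
        unfolding norm_of_real using wpos[of "snd p"] by simp
    qed simp
    fix i and vs :: "('a \<times> 'a) list" and z assume vs: "vs \<in> lists Basis"
    have sm: "smooth (b i)" by (rule fam_smooth[OF b])
    let ?c = "\<lambda>y. complex_of_real (norm y / wt y) * complex_of_real (1 / norm (- (t i *\<^sub>R y)))"
    have "(\<lambda>y. Dlist vs (?g (i, y)) z) = (\<lambda>y. ?c y * (Dlist vs (b i) ((- (t i *\<^sub>R y), 0) + z) - Dlist vs (b i) z))"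
    proof
      fix y
      have "?g (i, y) = (\<lambda>z. ?c y * (b i ((- (t i *\<^sub>R y), 0) + z) - b i z))" by (simp add: fun_eq_iff)
      then have "Dlist vs (?g (i, y)) = (\<lambda>z. ?c y * (Dlist vs (\<lambda>z. b i ((- (t i *\<^sub>R y), 0) + z)) z - Dlist vs (b i) z))"
        by (simp only: Dlist_cmult_diff[OF smooth_translate[OF sm] sm vs])
      then show "Dlist vs (?g (i, y)) z = ?c y * (Dlist vs (b i) ((- (t i *\<^sub>R y), 0) + z) - Dlist vs (b i) z)"
        by (simp only: Dlist_translate[OF sm vs])
    qed
    moreover have mc: "?c \<in> borel_measurable lborel" by measurable
    moreover have md: "(\<lambda>y. Dlist vs (b i) ((- (t i *\<^sub>R y), 0) + z)) \<in> borel_measurable lborel"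
      by (rule continuous_measurable[OF continuous_shift[OF smooth_continuous_Dlist[OF sm vs]]])
    ultimately show "(\<lambda>y. Dlist vs (?g (i, y)) z) \<in> borel_measurable lborel"
      using borel_measurable_times[OF mc borel_measurable_diff[OF md borel_measurable_const]] by (simp only:)
  qed (use ik wt2_local in auto)
  have "(\<integral>y. ?k y * ?g (i, y) z \<partial>lborel) = complex_of_real (1 / t i) * (conv \<kappa> (t i) (b i) z - b i z)" for i z
  proof -
    have bi: "Sym (b i)" by (rule OM_reindex[OF b])
    have "(\<integral>y. ?k y * ?g (i, y) z \<partial>lborel) = (\<integral>y. complex_of_real (1 / t i) * (\<kappa> y * b i ((- (t i *\<^sub>R y), 0) + z) - \<kappa> y * b i z) \<partial>lborel)"
    proof (rule Bochner_Integration.integral_cong[OF refl])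
      fix y
      show "?k y * ?g (i, y) z = complex_of_real (1 / t i) * (\<kappa> y * b i ((- (t i *\<^sub>R y), 0) + z) - \<kappa> y * b i z)"
      proof (cases "y = 0")
        case False
        have s: "complex_of_real (wt y) * (complex_of_real (norm y / wt y) * complex_of_real (1 / norm (- (t i *\<^sub>R y)))) = complex_of_real (1 / t i)"
          unfolding of_real_mult[symmetric] using False wpos[of y] t[of i] by simp
        have "?k y * ?g (i, y) z = (complex_of_real (wt y) * (complex_of_real (norm y / wt y) * complex_of_real (1 / norm (- (t i *\<^sub>R y))))) * (\<kappa> y * (b i ((- (t i *\<^sub>R y), 0) + z) - b i z))"
          unfolding fst_conv snd_conv prod.case by (simp only: mult_ac)
        then show ?thesis unfolding s by (simp only: right_diff_distrib)
      qed (simp add: zero_prod_def[symmetric])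
    qed
    also have "\<dots> = complex_of_real (1 / t i) * (\<integral>y. \<kappa> y * b i ((- (t i *\<^sub>R y), 0) + z) - \<kappa> y * b i z \<partial>lborel)"
      by (rule integral_mult_right_zero)
    also have "(\<integral>y. \<kappa> y * b i ((- (t i *\<^sub>R y), 0) + z) - \<kappa> y * b i z \<partial>lborel) = conv \<kappa> (t i) (b i) z - (\<integral>y. \<kappa> y * b i z \<partial>lborel)"
      unfolding conv_def
      by (rule Bochner_Integration.integral_diff[OF conv_integrable[OF k bi]]) (intro integrable_mult_left Schwartz_integrable k)
    also have "(\<integral>y. \<kappa> y * b i z \<partial>lborel) = b i z" using k1 by simp
    finally show ?thesis .
  qed
  with main show ?thesis by simp
qed

lemma integral_Finv: "m \<in> Schwartz \<Longrightarrow> (\<integral>y. Finv m y \<partial>lborel) = m 0"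
  using fun_cong[OF Four_Finv_inverse[of m], of 0] by (simp add: Four_def cis_zero)

lemma xmult_dilate:
  fixes b :: "'a::euclidean_space \<times> 'a \<Rightarrow> complex"
  assumes m: "m \<in> Schwartz" and b: "Sym b" and t: "t > 0"
  shows "xmult (dilate t m) b = conv (Finv m) t b"
proof
  fix z :: "'a \<times> 'a"
  have dS: "dilate t m \<in> Schwartz" using Schwartz_dilate[OF m, of t 0] t by (simp add: dilate_def)
  have F: "complex_of_real (t ^ DIM('a)) * Finv (dilate t m) (t *\<^sub>R y) = Finv m y" for y
  proof -
    have me: "(\<lambda>\<xi>. cis (y \<bullet> \<xi>) * m \<xi>) \<in> borel_measurable lborel" by (rule Schwartz_measurable[OF Schwartz_cis[OF m]])
    have "(\<integral>\<xi>. cis (y \<bullet> \<xi>) * m \<xi> \<partial>lborel) = complex_of_real (\<bar>t\<bar> ^ DIM('a)) * (\<integral>\<xi>. cis (y \<bullet> (0 + t *\<^sub>R \<xi>)) * m (0 + t *\<^sub>R \<xi>) \<partial>lborel)"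
      by (rule integral_affine[OF me]) (use t in simp)
    then show ?thesis using t by (simp add: Finv_def dilate_def)
  qed
  let ?f = "\<lambda>y. Finv (dilate t m) y * b (fst z - y, snd z)"
  have "continuous_on UNIV (\<lambda>y. b (fst z - y, snd z))"
    by (rule continuous_on_compose2[OF smooth_continuous[OF Sym_smooth[OF b], of UNIV]]) (auto intro!: continuous_intros)
  then have me: "?f \<in> borel_measurable lborel"
    by (intro borel_measurable_times Schwartz_measurable Finv_Schwartz dS continuous_measurable)
  have "xmult (dilate t m) b z = (\<integral>y. ?f y \<partial>lborel)" by (simp add: xmult_def)
  also have "\<dots> = complex_of_real (\<bar>t\<bar> ^ DIM('a)) * (\<integral>y. ?f (0 + t *\<^sub>R y) \<partial>lborel)"
    by (rule integral_affine[OF me]) (use t in simp)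
  also have "\<dots> = (\<integral>y. complex_of_real (\<bar>t\<bar> ^ DIM('a)) * ?f (0 + t *\<^sub>R y) \<partial>lborel)"
    by (rule integral_mult_right_zero[symmetric])
  also have "(\<lambda>y. complex_of_real (\<bar>t\<bar> ^ DIM('a)) * ?f (0 + t *\<^sub>R y)) = (\<lambda>y. Finv m y * b ((- (t *\<^sub>R y), 0) + z))"
  proof
    fix y
    have "(- (t *\<^sub>R y), 0) + z = (fst z - t *\<^sub>R y, snd z)" by (cases z) simp
    then show "complex_of_real (\<bar>t\<bar> ^ DIM('a)) * ?f (0 + t *\<^sub>R y) = Finv m y * b ((- (t *\<^sub>R y), 0) + z)"
      using t F[of y] by (simp add: mult.assoc[symmetric])
  qed
  finally show "xmult (dilate t m) b z = conv (Finv m) t b z" by (simp add: conv_def)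
qed

lemma dilate_1: "dilate 1 m = m"
  by (simp add: dilate_def)

lemma xmult_conv: "m \<in> Schwartz \<Longrightarrow> Sym b \<Longrightarrow> xmult m b = conv (Finv m) 1 b"
  using xmult_dilate[of m b 1] by (simp add: dilate_1)

text \<open>The convolution of two inverse transforms is governed by the product of the multipliers.
  The multiplication formula, applied to a reflected translate of the second kernel, brings out this
  product directly.\<close>

lemma convolution_zero:
  fixes m1 m2 :: "'a::euclidean_space \<Rightarrow> complex"
  assumes m1: "m1 \<in> Schwartz" and m2: "m2 \<in> Schwartz" and z: "\<And>\<xi>. m1 \<xi> * m2 \<xi> = 0"
  shows "(\<integral>y. Finv m1 y * Finv m2 (v - y) \<partial>lborel) = 0"
proof -
  let ?k = "\<lambda>y. Finv m2 (v - y)"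
  have kS: "?k \<in> Schwartz" using Schwartz_dilate[OF Finv_Schwartz[OF m2], of "-1" v] by simp
  have Fk: "Finv ?k \<xi> = fconst TYPE('a) * cis (v \<bullet> \<xi>) * m2 \<xi>" for \<xi>
  proof -
    let ?F = "\<lambda>x. cis (- (x \<bullet> \<xi>)) * Finv m2 x"
    have "m2 \<xi> = (\<integral>x. ?F x \<partial>lborel)" using fun_cong[OF Four_Finv_inverse[OF m2], of \<xi>] by (simp add: Four_def)
    also have "\<dots> = complex_of_real (\<bar>-1\<bar> ^ DIM('a)) * (\<integral>y. ?F (v + (-1) *\<^sub>R y) \<partial>lborel)"
      by (rule integral_affine[OF borel_measurable_integrable[OF Four_integrable[OF Finv_Schwartz[OF m2]]]]) simp
    also have "(\<lambda>y. ?F (v + (-1) *\<^sub>R y)) = (\<lambda>y. cis (- (v \<bullet> \<xi>)) * (cis (\<xi> \<bullet> y) * ?k y))"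
      by (simp add: fun_eq_iff mult.assoc[symmetric] cis_mult inner_diff_left inner_diff_right inner_commute)
    also have "complex_of_real (\<bar>-1\<bar> ^ DIM('a)) * (\<integral>y. cis (- (v \<bullet> \<xi>)) * (cis (\<xi> \<bullet> y) * ?k y) \<partial>lborel) = cis (- (v \<bullet> \<xi>)) * (\<integral>y. cis (\<xi> \<bullet> y) * ?k y \<partial>lborel)"
      by simp
    finally have "cis (v \<bullet> \<xi>) * m2 \<xi> = (cis (v \<bullet> \<xi>) * cis (- (v \<bullet> \<xi>))) * (\<integral>y. cis (\<xi> \<bullet> y) * ?k y \<partial>lborel)"
      by (simp add: mult.assoc)
    then have "cis (v \<bullet> \<xi>) * m2 \<xi> = (\<integral>y. cis (\<xi> \<bullet> y) * ?k y \<partial>lborel)" by (simp add: cis_mult)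
    then show ?thesis unfolding Finv_def[of ?k] by (simp add: mult.assoc)
  qed
  have "(\<integral>y. Finv m1 y * ?k y \<partial>lborel) = (\<integral>\<xi>. m1 \<xi> * Finv ?k \<xi> \<partial>lborel)" by (rule Finv_mult_formula[OF m1 kS])
  also have "\<dots> = (\<integral>\<xi>. 0 \<partial>(lborel :: 'a measure))"
  proof (rule Bochner_Integration.integral_cong[OF refl])
    fix \<xi>
    have "m1 \<xi> * Finv ?k \<xi> = fconst TYPE('a) * cis (v \<bullet> \<xi>) * (m1 \<xi> * m2 \<xi>)" unfolding Fk by (simp only: mult_ac)
    then show "m1 \<xi> * Finv ?k \<xi> = 0" using z[of \<xi>] by simp
  qed
  finally show ?thesis by simp
qed

lemma wt_triangle: "wt v \<le> wt y * wt (v - y)"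
proof -
  have "norm v \<le> norm y + norm (v - y)" by (rule norm_triangle_sub)
  moreover have "0 \<le> norm y * norm (v - y)" by simp
  moreover have "wt y * wt (v - y) = 1 + norm y + norm (v - y) + norm y * norm (v - y)" by (simp add: algebra_simps)
  ultimately show ?thesis by linarith
qed

text \<open>Two successive averages at the same scale amount to one average with the convolved
  kernel, which vanishes when the multipliers have product zero.\<close>

lemma conv_conv_zero:
  fixes b :: "'a::euclidean_space \<times> 'a \<Rightarrow> complex"
  assumes m1: "m1 \<in> Schwartz" and m2: "m2 \<in> Schwartz" and z: "\<And>\<xi>. m1 \<xi> * m2 \<xi> = 0" and b: "Sym b"
  shows "conv (Finv m1) t (conv (Finv m2) t b) z = 0"
proof -
  let ?k1 = "Finv m1" and ?k2 = "Finv m2" and ?n = "2 * DIM('a)"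
  define \<beta> where "\<beta> v = b ((- (t *\<^sub>R v), 0) + z)" for v
  have cb: "continuous_on UNIV \<beta>" unfolding \<beta>_def by (rule continuous_shift[OF smooth_continuous[OF Sym_smooth[OF b]]])
  obtain C0 N where C0: "C0 \<ge> 0" "\<And>z. norm (b z) \<le> C0 * wt2 z ^ N" using Sym_bound[OF b] by blast
  define B where "B = C0 * wt2 z ^ N"
  have B: "norm (\<beta> v) \<le> B" for v using C0(2)[of "(- (t *\<^sub>R v), 0) + z"] by (simp add: \<beta>_def B_def)
  have k1: "?k1 \<in> Schwartz" and k2: "?k2 \<in> Schwartz" by (intro Finv_Schwartz m1 m2)+
  have ck2: "continuous_on UNIV (\<lambda>v. ?k2 (v - y))" for y
    by (rule continuous_on_compose2[OF Schwartz_continuous[OF k2, of UNIV]]) (auto intro!: continuous_intros)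
  have inner: "conv ?k2 t b ((- (t *\<^sub>R y), 0) + z) = (\<integral>v. ?k2 (v - y) * \<beta> v \<partial>lborel)" for y
  proof -
    have "conv ?k2 t b ((- (t *\<^sub>R y), 0) + z) = (\<integral>x. ?k2 ((y + x) - y) * \<beta> (y + x) \<partial>lborel)"
      unfolding conv_def \<beta>_def by (cases z) (simp add: algebra_simps)
    also have "\<dots> = (\<integral>v. ?k2 (v - y) * \<beta> v \<partial>lborel)"
      by (rule integral_translate) (intro borel_measurable_times continuous_measurable ck2 cb)
    finally show ?thesis .
  qed
  let ?H = "\<lambda>p. ?k1 (fst p) * (?k2 (snd p - fst p) * \<beta> (snd p))"
  have cH: "continuous_on UNIV ?H"
    by (intro continuous_intros continuous_on_compose2[OF Schwartz_continuous[OF k1, of UNIV]]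
        continuous_on_compose2[OF Schwartz_continuous[OF k2, of UNIV]] continuous_on_compose2[OF cb]) auto
  \<comment> \<open>The first kernel is given twice the usual decay, because
    \<open>wt v <= wt y * wt (v - y)\<close> charges it for half of the decay in
    \<open>v\<close>.\<close>
  obtain C where C: "C \<ge> 0" "\<And>x. wt x ^ (?n + ?n) * norm (?k1 x) \<le> C" using Schwartz_RDq_bound[OF k1] by blast
  obtain D where D: "D \<ge> 0" "\<And>x. wt x ^ ?n * norm (?k2 x) \<le> D" using Schwartz_RDq_bound[OF k2] by blast
  have bound: "wt y ^ ?n * (wt v ^ ?n * norm (?H (y, v))) \<le> C * (D * B)" for y v
  proof -
    have "wt y ^ ?n * (wt v ^ ?n * norm (?H (y, v))) \<le> wt y ^ ?n * ((wt y * wt (v - y)) ^ ?n * norm (?H (y, v)))"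
      by (intro mult_left_mono mult_right_mono power_mono wt_triangle) auto
    also have "\<dots> = (wt y ^ (?n + ?n) * norm (?k1 y)) * ((wt (v - y) ^ ?n * norm (?k2 (v - y))) * norm (\<beta> v))"
      unfolding fst_conv snd_conv norm_mult power_mult_distrib power_add by (simp only: mult_ac)
    also have "\<dots> \<le> C * (D * B)" using C(1) C(2)[of y] D(1) D(2)[of "v - y"] B[of v]
      by (intro mult_mono mult_nonneg_nonneg) auto
    finally show ?thesis .
  qed
  have "conv ?k1 t (conv ?k2 t b) z = (\<integral>y. \<integral>v. ?H (y, v) \<partial>lborel \<partial>lborel)"
    unfolding conv_def[of ?k1] inner by simp
  also have "\<dots> = (\<integral>v. \<integral>y. ?H (y, v) \<partial>lborel \<partial>lborel)"
    by (rule Fubini_decay(4)[OF continuous_measurable[OF cH] bound])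
  also have "\<dots> = (\<integral>v. (\<integral>y. ?k1 y * ?k2 (v - y) \<partial>lborel) * \<beta> v \<partial>lborel)"
    by (simp add: mult.assoc[symmetric])
  also have "\<dots> = 0" unfolding convolution_zero[OF m1 m2 z] by simp
  finally show ?thesis .
qed

lemma conv_cmult_diff:
  assumes k: "\<kappa> \<in> Schwartz" and b: "Sym b" and d: "Sym d"
  shows "conv \<kappa> t (\<lambda>z. s * (b z - d z)) z = s * (conv \<kappa> t b z - conv \<kappa> t d z)"
proof -
  have "conv \<kappa> t (\<lambda>z. s * (b z - d z)) z = (\<integral>y. s * (\<kappa> y * b ((- (t *\<^sub>R y), 0) + z) - \<kappa> y * d ((- (t *\<^sub>R y), 0) + z)) \<partial>lborel)"
    unfolding conv_def by (rule Bochner_Integration.integral_cong[OF refl]) (simp add: algebra_simps)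
  also have "\<dots> = s * (\<integral>y. \<kappa> y * b ((- (t *\<^sub>R y), 0) + z) - \<kappa> y * d ((- (t *\<^sub>R y), 0) + z) \<partial>lborel)"
    by (rule integral_mult_right_zero)
  also have "\<dots> = s * (conv \<kappa> t b z - conv \<kappa> t d z)"
    unfolding conv_def Bochner_Integration.integral_diff[OF conv_integrable[OF k b] conv_integrable[OF k d]] ..
  finally show ?thesis .
qed

text \<open>With a cutoff \<open>\<theta>\<close> equal to \<open>1\<close> near \<open>0\<close> and \<open>\<theta> \<phi> = 0\<close>, averaging with \<open>Finv \<phi>\<close> annihilates the average with
  \<open>Finv \<theta>\<close>; hence \<open>c\<close> may be replaced by \<open>c\<close> minus the latter, which gains a factor \<open>2\<^sup>-\<^sup>j\<close>. Iterating gives any power.\<close>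

lemma OM_conv_rapid:
  fixes \<phi> :: "'a::euclidean_space \<Rightarrow> complex"
  assumes \<phi>: "\<phi> \<in> Schwartz" and \<epsilon>: "0 < \<epsilon>" and supp: "\<And>\<xi>. norm \<xi> < \<epsilon> \<Longrightarrow> \<phi> \<xi> = 0"
    and c: "OM wt2 c"
  shows "OM wt2 (\<lambda>j z. complex_of_real (2 powr (real j * real N)) * conv (Finv \<phi>) (2 powr - real j) (c j) z)"
proof -
  obtain \<rho> :: "'a \<Rightarrow> real" where \<rho>: "smooth (\<lambda>x. complex_of_real (\<rho> x))"
    "\<And>x. norm x \<le> \<epsilon> / 2 \<Longrightarrow> \<rho> x = 1" "\<And>x. 2 * (\<epsilon> / 2) \<le> norm x \<Longrightarrow> \<rho> x = 0"
    using cutoff_exists[of "\<epsilon> / 2"] \<epsilon> by (metis half_gt_zero)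
  define \<theta> where "\<theta> x = complex_of_real (\<rho> x)" for x
  have \<theta>: "\<theta> \<in> Schwartz" unfolding \<theta>_def by (rule supp_Schwartz[OF \<rho>(1), of \<epsilon>]) (use \<rho>(3) in auto)
  have \<theta>0: "\<theta> 0 = 1" using \<rho>(2)[of 0] \<epsilon> by (simp add: \<theta>_def)
  have z: "\<phi> \<xi> * \<theta> \<xi> = 0" for \<xi> using supp[of \<xi>] \<rho>(3)[of \<xi>] by (cases "norm \<xi> < \<epsilon>") (auto simp: \<theta>_def)
  let ?k = "Finv \<phi>" and ?t = "\<lambda>j. 2 powr - real j"
  have k: "?k \<in> Schwartz" by (rule Finv_Schwartz[OF \<phi>])
  show ?thesis using c
  \<comment> \<open>The corrected symbol depends on \<open>j\<close>; this is why \<open>c\<close>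
    is a family from the start and is generalised here.\<close>
  proof (induction N arbitrary: c)
    case 0
    then show ?case using OM_conv[OF k, of c ?t] by simp
  next
    case (Suc N)
    define c' where "c' j z = complex_of_real (1 / ?t j) * (conv (Finv \<theta>) (?t j) (c j) z - c j z)" for j z
    have c': "OM wt2 c'" unfolding c'_def[abs_def]
      by (rule OM_conv_diff[OF Finv_Schwartz[OF \<theta>] _ Suc.prems]) (simp_all add: integral_Finv[OF \<theta>] \<theta>0)
    have "OM wt2 (\<lambda>j z. (-1) * (complex_of_real (2 powr (real j * real N)) * conv ?k (?t j) (c' j) z))"
      by (rule OM_cmult[OF Suc.IH[OF c'], where M = 1]) auto
    moreover have "(-1) * (complex_of_real (2 powr (real j * real N)) * conv ?k (?t j) (c' j) z)
      = complex_of_real (2 powr (real j * real (Suc N))) * conv ?k (?t j) (c j) z" for j z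
    proof -
      have cj: "Sym (c j)" by (rule OM_reindex[OF Suc.prems])
      have "conv ?k (?t j) (c' j) z = complex_of_real (1 / ?t j) * (conv ?k (?t j) (conv (Finv \<theta>) (?t j) (c j)) z - conv ?k (?t j) (c j) z)"
        unfolding c'_def[abs_def] by (rule conv_cmult_diff[OF k Sym_conv[OF Finv_Schwartz[OF \<theta>] cj] cj])
      also have "\<dots> = - (complex_of_real (2 powr real j) * conv ?k (?t j) (c j) z)"
      proof -
        have tj: "1 / ?t j = 2 powr real j" by (simp add: powr_minus divide_inverse)
        show ?thesis unfolding conv_conv_zero[OF \<phi> \<theta> z cj] tj by simp
      qed
      finally have e: "conv ?k (?t j) (c' j) z = - (complex_of_real (2 powr real j) * conv ?k (?t j) (c j) z)" .
      have "2 powr (real j * real (Suc N)) = 2 powr (real j * real N) * 2 powr real j"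
        by (simp add: powr_add[symmetric] algebra_simps)
      then show ?thesis unfolding e by simp
    qed
    ultimately show ?case by simp
  qed
qed

section \<open>Duality under translation and averaging\<close>

lemma pairing_translate:
  fixes a :: "'a::euclidean_space \<times> 'a \<Rightarrow> complex"
  assumes a: "Sym a" and f: "f \<in> Schwartz" and g: "g \<in> Schwartz"
  shows "pairing s (\<lambda>z. a ((- w, 0) + z)) f g = pairing s a (\<lambda>x. f (w + x)) (\<lambda>\<eta>. cis (s * (w \<bullet> \<eta>)) * g \<eta>)"
proof -
  let ?F = "Ham s (\<lambda>z. a ((- w, 0) + z)) f g"
  have aS: "Sym (\<lambda>z. a ((- w, 0) + z))"
    by (rule OM_affine[where c = "\<lambda>_. (- w, 0)" and L = "\<lambda>_ z. z" and M = 1 and K = 1, OF a]) (auto simp: linear_ident)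
  have "pairing s (\<lambda>z. a ((- w, 0) + z)) f g = (\<integral>z. ?F ((w, 0) + z) \<partial>lborel)"
    unfolding pairing_def by (rule integral_translate[OF Schwartz_measurable[OF Ham_Schwartz[OF aS f g]], symmetric])
  also have "(\<lambda>z. ?F ((w, 0) + z)) = Ham s a (\<lambda>x. f (w + x)) (\<lambda>\<eta>. cis (s * (w \<bullet> \<eta>)) * g \<eta>)"
  proof
    fix z :: "'a \<times> 'a"
    have "(- w, 0) + ((w, 0) + z) = z" by (cases z) simp
    then have aa: "a ((- w, 0) + ((w, 0) + z)) = a z" by (rule arg_cong)
    have cc: "cis (s * ((w + fst z) \<bullet> snd z)) = cis (s * (fst z \<bullet> snd z)) * cis (s * (w \<bullet> snd z))"
      by (simp add: cis_mult inner_add_left algebra_simps)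
    show "?F ((w, 0) + z) = Ham s a (\<lambda>x. f (w + x)) (\<lambda>\<eta>. cis (s * (w \<bullet> \<eta>)) * g \<eta>) z"
      by (simp only: Ham_def aa fst_add snd_add fst_conv snd_conv add_0 cc mult_ac)
  qed
  finally show ?thesis by (simp add: pairing_def)
qed

lemma Four_translate:
  assumes "g \<in> Schwartz"
  shows "Four (\<lambda>x. g (w + x)) = (\<lambda>\<eta>. cis (w \<bullet> \<eta>) * Four g \<eta>)"
proof
  fix \<eta>
  let ?F = "\<lambda>x. cis (w \<bullet> \<eta>) * (cis (- (x \<bullet> \<eta>)) * g x)"
  have "Four (\<lambda>x. g (w + x)) \<eta> = (\<integral>x. ?F (w + x) \<partial>lborel)"
    unfolding Four_def by (simp add: mult.assoc[symmetric] cis_mult inner_add_left)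
  also have "\<dots> = (\<integral>x. ?F x \<partial>lborel)"
    by (rule integral_translate[OF borel_measurable_times[OF borel_measurable_const borel_measurable_integrable[OF Four_integrable[OF assms]]]])
  also have "\<dots> = cis (w \<bullet> \<eta>) * Four g \<eta>" unfolding Four_def by (rule integral_mult_right_zero)
  finally show "Four (\<lambda>x. g (w + x)) \<eta> = cis (w \<bullet> \<eta>) * Four g \<eta>" .
qed

lemma Finv_translate:
  fixes f :: "'a::euclidean_space \<Rightarrow> complex"
  assumes "f \<in> Schwartz"
  shows "Finv (\<lambda>x. f (w + x)) = (\<lambda>\<eta>. cis (- (w \<bullet> \<eta>)) * Finv f \<eta>)"
  unfolding Finv_Four fun_eq_iff Four_translate[OF assms] by (simp add: mult_ac)

lemma Schwartz_translate: "f \<in> Schwartz \<Longrightarrow> (\<lambda>x. f (w + x)) \<in> Schwartz"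
  using Schwartz_dilate[of f 1 w] by simp

text \<open>Translating the symbol in x amounts to translating one argument and modulating the
  other. Modulation of a transform is translation of the function, so both sides become the original
  duality for the translated pair.\<close>

lemma dual_translate:
  fixes a :: "'a::euclidean_space \<times> 'a \<Rightarrow> complex"
  assumes ac: "dual a c" and f: "f \<in> Schwartz" and g: "g \<in> Schwartz"
  shows "fconst TYPE('a) * pairing 1 (\<lambda>z. a ((- w, 0) + z)) f (Four g) = pairing (-1) (\<lambda>z. c ((- w, 0) + z)) g (Finv f)"
proof -
  have a: "Sym a" and c: "Sym c" using ac unfolding dual_def by auto
  have "pairing 1 (\<lambda>z. a ((- w, 0) + z)) f (Four g) = pairing 1 a (\<lambda>x. f (w + x)) (Four (\<lambda>x. g (w + x)))"
    using pairing_translate[OF a f Four_Schwartz[OF g], of 1 w] by (simp add: Four_translate[OF g])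
  moreover have "pairing (-1) (\<lambda>z. c ((- w, 0) + z)) g (Finv f) = pairing (-1) c (\<lambda>x. g (w + x)) (Finv (\<lambda>x. f (w + x)))"
    using pairing_translate[OF c g Finv_Schwartz[OF f], of "-1" w] by (simp add: Finv_translate[OF f])
  ultimately show ?thesis using ac Schwartz_translate[OF f] Schwartz_translate[OF g] unfolding dual_def by simp
qed

lemma pairing_conv:
  fixes a :: "'a::euclidean_space \<times> 'a \<Rightarrow> complex"
  assumes a: "Sym a" and k: "\<kappa> \<in> Schwartz" and f: "f \<in> Schwartz" and g: "g \<in> Schwartz"
  shows "pairing s (conv \<kappa> t a) f g = (\<integral>y. \<kappa> y * pairing s (\<lambda>z. a ((- (t *\<^sub>R y), 0) + z)) f g \<partial>lborel)"
proof -
  let ?n = "2 * DIM('a \<times> 'a)" and ?k = "2 * DIM('a)"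
  let ?T = "\<lambda>z. f (fst z) * g (snd z)"
  let ?H = "\<lambda>p. \<kappa> (snd p) * (cis (s * (fst (fst p) \<bullet> snd (fst p))) * (a ((- (t *\<^sub>R snd p), 0) + fst p) * ?T (fst p)))"
  have ca: "continuous_on UNIV a" by (rule smooth_continuous[OF Sym_smooth[OF a]])
  have cH: "continuous_on UNIV ?H"
    by (intro continuous_intros continuous_on_cis continuous_on_compose2[OF Schwartz_continuous[OF k, of UNIV]]
        continuous_on_compose2[OF Schwartz_continuous[OF f, of UNIV]] continuous_on_compose2[OF Schwartz_continuous[OF g, of UNIV]] continuous_on_compose2[OF ca]) auto
  have TS: "?T \<in> Schwartz" using RD_tensor[OF f g] Schwartz_RD by blast
  obtain C N where C: "C \<ge> 0" "\<And>z. norm (a z) \<le> C * wt2 z ^ N" using Sym_bound[OF a] by blast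
  obtain D where D: "D \<ge> 0" "\<And>z. wt z ^ (?n + N) * norm (?T z) \<le> D" using Schwartz_RDq_bound[OF TS] by blast
  obtain E where E: "E \<ge> 0" "\<And>y. wt y ^ ?k * norm (\<kappa> y) \<le> E" using Schwartz_RDq_bound[OF k] by blast
  have bound: "wt z ^ ?n * (wt y ^ ?k * norm (?H (z, y))) \<le> E * (C * D)" for z y
  proof -
    have w: "wt2 z \<le> wt z" using norm_snd_le[of "snd z" "fst z"] by simp
    have "norm (a ((- (t *\<^sub>R y), 0) + z)) \<le> C * wt2 z ^ N" using C(2)[of "(- (t *\<^sub>R y), 0) + z"] by simp
    also have "\<dots> \<le> C * wt z ^ N" by (intro mult_left_mono power_mono w C) auto
    finally have 1: "norm (a ((- (t *\<^sub>R y), 0) + z)) \<le> C * wt z ^ N" .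
    have "wt z ^ ?n * (wt y ^ ?k * norm (?H (z, y))) = (wt y ^ ?k * norm (\<kappa> y)) * (norm (a ((- (t *\<^sub>R y), 0) + z)) * (wt z ^ ?n * norm (?T z)))"
      unfolding fst_conv snd_conv norm_mult norm_cis by (simp only: mult_ac mult_1)
    also have "\<dots> \<le> E * ((C * wt z ^ N) * (wt z ^ ?n * norm (?T z)))"
      using E(1) E(2)[of y] by (intro mult_mono mult_right_mono 1 mult_nonneg_nonneg) auto
    also have "\<dots> = E * (C * (wt z ^ (?n + N) * norm (?T z)))" by (simp only: power_add mult_ac)
    also have "\<dots> \<le> E * (C * D)" by (intro mult_left_mono D C E)
    finally show ?thesis .
  qed
  have "Ham s (conv \<kappa> t a) f g z = (\<integral>y. ?H (z, y) \<partial>lborel)" for z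
  proof -
    let ?e = "cis (s * (fst z \<bullet> snd z)) * ?T z"
    have "Ham s (conv \<kappa> t a) f g z = ?e * conv \<kappa> t a z" by (simp add: Ham_def mult_ac)
    also have "\<dots> = (\<integral>y. ?e * (\<kappa> y * a ((- (t *\<^sub>R y), 0) + z)) \<partial>lborel)" unfolding conv_def by (rule integral_mult_right_zero[symmetric])
    finally show ?thesis by (simp add: mult_ac)
  qed
  then have "pairing s (conv \<kappa> t a) f g = (\<integral>z. \<integral>y. ?H (z, y) \<partial>lborel \<partial>lborel)" by (simp add: pairing_def)
  also have "\<dots> = (\<integral>y. \<integral>z. ?H (z, y) \<partial>lborel \<partial>lborel)"
    by (rule Fubini_decay(4)[OF continuous_measurable[OF cH] bound])
  also have "\<dots> = (\<integral>y. \<kappa> y * pairing s (\<lambda>z. a ((- (t *\<^sub>R y), 0) + z)) f g \<partial>lborel)"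
    by (simp add: pairing_def Ham_def)
  finally show ?thesis .
qed

lemma dual_conv:
  fixes a :: "'a::euclidean_space \<times> 'a \<Rightarrow> complex"
  assumes ac: "dual a c" and k: "\<kappa> \<in> Schwartz"
  shows "dual (conv \<kappa> t a) (conv \<kappa> t c)"
  unfolding dual_def
proof (intro conjI ballI)
  have a: "Sym a" and c: "Sym c" using ac unfolding dual_def by auto
  show "Sym (conv \<kappa> t a)" "Sym (conv \<kappa> t c)" by (intro Sym_conv k a c)+
  fix f g :: "'a \<Rightarrow> complex" assume f: "f \<in> Schwartz" and g: "g \<in> Schwartz"
  have "fconst TYPE('a) * pairing 1 (conv \<kappa> t a) f (Four g) = (\<integral>y. \<kappa> y * (fconst TYPE('a) * pairing 1 (\<lambda>z. a ((- (t *\<^sub>R y), 0) + z)) f (Four g)) \<partial>lborel)"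
    unfolding pairing_conv[OF a k f Four_Schwartz[OF g]] integral_mult_right_zero[symmetric] by (simp only: mult_ac)
  also have "\<dots> = pairing (-1) (conv \<kappa> t c) g (Finv f)"
    unfolding dual_translate[OF ac f g] pairing_conv[OF c k g Finv_Schwartz[OF f]] ..
  finally show "fconst TYPE('a) * pairing 1 (conv \<kappa> t a) f (Four g) = pairing (-1) (conv \<kappa> t c) g (Finv f)" .
qed

section \<open>Adjoint symbols\<close>

lemma S11_Sym:
  assumes "a \<in> S11 d"
  shows "Sym a"
  unfolding fam_def
proof (intro conjI allI ballI)
  show "smooth a" using assms unfolding S11_def by blast
  fix vs :: "('a \<times> 'a) list" assume vs: "vs \<in> lists Basis"
  let ?e = "d - real (neta vs) + real (nx vs)"
  obtain C where C: "\<And>x \<eta>. norm (Dlist vs a (x, \<eta>)) \<le> C * (1 + norm \<eta>) powr ?e"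
    using assms vs unfolding S11_def by blast
  show "OMq wt2 (\<lambda>_::unit. Dlist vs a)"
  proof (rule OMqI)
    fix z :: "'a \<times> 'a"
    have "norm (Dlist vs a z) \<le> C * wt2 z powr ?e" using C[of "fst z" "snd z"] by simp
    also have "\<dots> \<le> \<bar>C\<bar> * wt2 z powr real (nat \<lceil>\<bar>?e\<bar>\<rceil>)"
      by (intro mult_mono powr_mono) (auto, linarith)
    also have "wt2 z powr real (nat \<lceil>\<bar>?e\<bar>\<rceil>) = wt2 z ^ nat \<lceil>\<bar>?e\<bar>\<rceil>"
      by (rule powr_realpow) (simp add: add_pos_nonneg)
    finally show "norm (Dlist vs a z) \<le> \<bar>C\<bar> * wt2 z ^ nat \<lceil>\<bar>?e\<bar>\<rceil>" .
  qed
qed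

text \<open>The definition of the adjoint symbol is an equality of distributions on the product
  space. It is tested on one function whose image under the multiplier cis(\<xi> \<bullet> \<theta>)
  is explicit, and conjugating the result yields the two pairings in \<open>dual\<close>.\<close>

lemma dual_of_adjoint:
  fixes a b :: "'a::euclidean_space \<times> 'a \<Rightarrow> complex"
  assumes a: "Sym a" and b: "Sym b" and adj: "is_adjoint_symbol a b"
  shows "dual a (\<lambda>z. cnj (b z))"
  unfolding dual_def
proof (intro conjI ballI)
  show "Sym a" by (rule a)
  show "Sym (\<lambda>z. cnj (b z))" by (rule OM_cnj[OF b])
  fix f g :: "'a \<Rightarrow> complex" assume f: "f \<in> Schwartz" and g: "g \<in> Schwartz"
  define F where "F x = cnj (f x)" for x
  define G where "G x = cnj (g x)" for x
  define h where "h \<eta> = cnj (Four g \<eta>)" for \<eta>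
  have FS: "F \<in> Schwartz" and GS: "G \<in> Schwartz" and hS: "h \<in> Schwartz"
    unfolding F_def G_def h_def by (intro Schwartz_cnj f g Four_Schwartz)+
  have one: "Sym (\<lambda>_::'a \<times> 'a. 1)" by (rule OM_const[where M = 1]) auto
  \<comment> \<open>Up to the constant, the conjugate of \<open>\<Phi>\<close> times that of
    \<open>b\<close> is the integrand on the right side of \<open>dual\<close>; the conjugate of
    \<open>\<Theta>\<close> times \<open>a\<close> is the one on the left.\<close>
  define \<Phi> where "\<Phi> = Ham 1 (\<lambda>_. 1) G (Four F)"
  define \<Theta> where "\<Theta> = Ham (-1) (\<lambda>_. 1) F h"
  have \<Phi>S: "\<Phi> \<in> Schwartz" unfolding \<Phi>_def by (rule Ham_Schwartz[OF one GS Four_Schwartz[OF FS]])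
  have \<Theta>S: "\<Theta> \<in> Schwartz" unfolding \<Theta>_def by (rule Ham_Schwartz[OF one FS hS])
  have Gh: "(\<integral>x. cis (x \<bullet> \<zeta>) * G x \<partial>lborel) = h \<zeta>" for \<zeta>
    unfolding h_def G_def Four_def by (simp add: Bochner_Integration.integral_cnj[symmetric] cis_cnj del: Bochner_Integration.integral_cnj)
  have eF: "Finv \<Theta> w = cis (fst w \<bullet> snd w) * Finv \<Phi> w" for w
  proof -
    obtain \<xi> \<theta> where w: "w = (\<xi>, \<theta>)" by fastforce
    let ?T = "\<lambda>z. cis (w \<bullet> z) * \<Theta> z" and ?P = "\<lambda>z. cis (w \<bullet> z) * \<Phi> z"
    have TS: "?T \<in> Schwartz" and PS: "?P \<in> Schwartz" by (intro Schwartz_cis \<Theta>S \<Phi>S)+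
    let ?K = "\<lambda>\<eta>. cis (\<theta> \<bullet> \<eta>) * (h \<eta> * Four F (\<eta> - \<xi>))"
    have "(\<integral>z. ?T z \<partial>lborel) = (\<integral>\<eta>. \<integral>x. ?T (x, \<eta>) \<partial>lborel \<partial>lborel)" by (rule Fubini_Schwartz(2)[OF TS, symmetric])
    also have "\<dots> = (\<integral>\<eta>. ?K \<eta> \<partial>lborel)"
    proof (rule Bochner_Integration.integral_cong[OF refl])
      fix \<eta>
      have "(\<lambda>x. ?T (x, \<eta>)) = (\<lambda>x. (cis (\<theta> \<bullet> \<eta>) * h \<eta>) * (cis (- (x \<bullet> (\<eta> - \<xi>))) * F x))"
      proof
        fix x
        have "cis (w \<bullet> (x, \<eta>)) * cis (-1 * (x \<bullet> \<eta>)) = cis (\<theta> \<bullet> \<eta>) * cis (- (x \<bullet> (\<eta> - \<xi>)))"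
          by (simp add: w cis_mult inner_diff_right inner_commute algebra_simps)
        then show "?T (x, \<eta>) = (cis (\<theta> \<bullet> \<eta>) * h \<eta>) * (cis (- (x \<bullet> (\<eta> - \<xi>))) * F x)"
          unfolding \<Theta>_def Ham_def fst_conv snd_conv mult_1 mult.assoc[symmetric] by (simp only: mult_ac)
      qed
      then have "(\<integral>x. ?T (x, \<eta>) \<partial>lborel) = (cis (\<theta> \<bullet> \<eta>) * h \<eta>) * Four F (\<eta> - \<xi>)"
        unfolding Four_def by (simp only: integral_mult_right_zero)
      then show "(\<integral>x. ?T (x, \<eta>) \<partial>lborel) = ?K \<eta>" by (simp only: mult.assoc)
    qed
    \<comment> \<open>After the x-integration, \<open>\<Theta>\<close> and \<open>\<Phi>\<close>
      differ by the shift \<xi> in \<eta>. Under the outer phase cis(\<theta> \<bullet> \<eta>) this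
      shift is precisely the factor cis(\<xi> \<bullet> \<theta>) of the adjoint multiplier.\<close>
    also have "\<dots> = (\<integral>\<eta>. ?K (\<xi> + \<eta>) \<partial>lborel)"
    proof (rule integral_translate[symmetric])
      have "(\<lambda>\<eta>. Four F (\<eta> - \<xi>)) \<in> Schwartz" using Schwartz_translate[OF Four_Schwartz[OF FS], of "- \<xi>"] by simp
      then have "(\<lambda>\<eta>. h \<eta> * Four F (\<eta> - \<xi>)) \<in> Schwartz"
        unfolding Schwartz_RD by (rule RD_mult[OF Schwartz_OM[OF hS]]) auto
      then show "?K \<in> borel_measurable lborel" by (intro Schwartz_measurable Schwartz_cis)
    qed
    also have "\<dots> = cis (\<xi> \<bullet> \<theta>) * (\<integral>\<eta>. cis (\<theta> \<bullet> \<eta>) * (Four F \<eta> * h (\<xi> + \<eta>)) \<partial>lborel)"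
    proof -
      have "(\<lambda>\<eta>. ?K (\<xi> + \<eta>)) = (\<lambda>\<eta>. cis (\<xi> \<bullet> \<theta>) * (cis (\<theta> \<bullet> \<eta>) * (Four F \<eta> * h (\<xi> + \<eta>))))"
        by (simp add: fun_eq_iff inner_add_right cis_mult[symmetric] inner_commute mult_ac)
      then show ?thesis by (simp only: integral_mult_right_zero)
    qed
    also have "(\<integral>\<eta>. cis (\<theta> \<bullet> \<eta>) * (Four F \<eta> * h (\<xi> + \<eta>)) \<partial>lborel) = (\<integral>\<eta>. \<integral>x. ?P (x, \<eta>) \<partial>lborel \<partial>lborel)"
    proof (rule Bochner_Integration.integral_cong[OF refl])
      fix \<eta>
      have "(\<lambda>x. ?P (x, \<eta>)) = (\<lambda>x. (cis (\<theta> \<bullet> \<eta>) * Four F \<eta>) * (cis (x \<bullet> (\<xi> + \<eta>)) * G x))"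
      proof
        fix x
        have "cis (w \<bullet> (x, \<eta>)) * cis (1 * (x \<bullet> \<eta>)) = cis (\<theta> \<bullet> \<eta>) * cis (x \<bullet> (\<xi> + \<eta>))"
          by (simp add: w cis_mult inner_add_right inner_commute algebra_simps)
        then show "?P (x, \<eta>) = (cis (\<theta> \<bullet> \<eta>) * Four F \<eta>) * (cis (x \<bullet> (\<xi> + \<eta>)) * G x)"
          unfolding \<Phi>_def Ham_def fst_conv snd_conv mult_1 mult.assoc[symmetric] by (simp only: mult_ac)
      qed
      then have "(\<integral>x. ?P (x, \<eta>) \<partial>lborel) = (cis (\<theta> \<bullet> \<eta>) * Four F \<eta>) * h (\<xi> + \<eta>)"
        by (simp only: integral_mult_right_zero Gh)
      then show "cis (\<theta> \<bullet> \<eta>) * (Four F \<eta> * h (\<xi> + \<eta>)) = (\<integral>x. ?P (x, \<eta>) \<partial>lborel)" by (simp only: mult.assoc)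
    qed
    also have "\<dots> = (\<integral>z. ?P z \<partial>lborel)" by (rule Fubini_Schwartz(2)[OF PS])
    finally show ?thesis unfolding Finv_def w fst_conv snd_conv by (simp add: mult.left_commute)
  qed
  have e: "(\<lambda>w. cis (fst w \<bullet> snd w) * Finv \<Phi> w) = Finv \<Theta>" by (simp add: eF fun_eq_iff)
  have "fdist b \<Phi> = fmult (\<lambda>w. cis (fst w \<bullet> snd w)) (fdist (\<lambda>z. cnj (a z))) \<Phi>"
    using adj unfolding is_adjoint_symbol_def by simp
  then have "(\<integral>z. b z * \<Phi> z \<partial>lborel) = (\<integral>z. cnj (a z) * \<Theta> z \<partial>lborel)"
    by (simp add: fdist_def fmult_def Finv_dist_def mult_dist_def Four_dist_def e \<Phi>S \<Theta>S Finv_Schwartz Four_Schwartz Four_Finv_inverse)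
  from arg_cong[OF this, of cnj]
  have key: "(\<integral>z. cnj (b z) * cnj (\<Phi> z) \<partial>lborel) = (\<integral>z. a z * cnj (\<Theta> z) \<partial>lborel)"
    by (simp add: Bochner_Integration.integral_cnj[symmetric] del: Bochner_Integration.integral_cnj)
  have 1: "(\<lambda>z. a z * cnj (\<Theta> z)) = Ham 1 a f (Four g)"
    by (simp add: \<Theta>_def Ham_def fun_eq_iff F_def h_def cis_cnj mult_ac)
  have 2: "(\<lambda>z. fconst TYPE('a) * (cnj (b z) * cnj (\<Phi> z))) = Ham (-1) (\<lambda>z. cnj (b z)) g (Finv f)"
    by (simp add: \<Phi>_def Ham_def fun_eq_iff G_def cis_cnj mult_ac cnj_Four_cnj[symmetric] F_def[abs_def])
  have "fconst TYPE('a) * pairing 1 a f (Four g) = fconst TYPE('a) * (\<integral>z. cnj (b z) * cnj (\<Phi> z) \<partial>lborel)"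
    unfolding pairing_def 1[symmetric] key ..
  also have "\<dots> = (\<integral>z. fconst TYPE('a) * (cnj (b z) * cnj (\<Phi> z)) \<partial>lborel)" by (rule integral_mult_right_zero[symmetric])
  finally show "fconst TYPE('a) * pairing 1 a f (Four g) = pairing (-1) (\<lambda>z. cnj (b z)) g (Finv f)"
    unfolding 2 pairing_def .
qed

section \<open>Extension of functionals from test functions\<close>

text \<open>Type 1,1-operators return functionals that are zero off \<open>test\<close>. In this
  normalisation \<open>res\<close> is the passage from S' to D', and \<open>text_ext\<close> inverts
  it.\<close>

definition res :: "(('a::euclidean_space \<Rightarrow> complex) \<Rightarrow> complex) \<Rightarrow> ('a \<Rightarrow> complex) \<Rightarrow> complex" where
  "res T = (\<lambda>\<phi>. if \<phi> \<in> test then T \<phi> else 0)"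

lemma cutoffD:
  assumes "\<Psi> \<in> cutoffs"
  shows "\<Psi> \<in> test" "\<Psi> \<in> Schwartz" "\<Psi> 0 = 1"
proof -
  show t: "\<Psi> \<in> test" using assms unfolding cutoffs_def by blast
  show "\<Psi> \<in> Schwartz" by (rule test_Schwartz[OF t])
  obtain \<epsilon> where "\<epsilon> > 0" "\<And>\<xi>. norm \<xi> < \<epsilon> \<Longrightarrow> \<Psi> \<xi> = 1" using assms unfolding cutoffs_def by blast
  then show "\<Psi> 0 = 1" by simp
qed

lemma Schwartz_mult: "OM wt (\<lambda>_::unit. w) \<Longrightarrow> f \<in> Schwartz \<Longrightarrow> (\<lambda>x. w x * f x) \<in> Schwartz"
  unfolding Schwartz_RD by (rule RD_mult) auto

lemma Mul_Schwartz: "w \<in> Schwartz \<Longrightarrow> OM wt (\<lambda>_::unit. w)"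
  by (rule Schwartz_OM)

lemma norm_le_half_pow:
  fixes x :: "'b::real_normed_vector"
  assumes "norm (complex_of_real (2 powr real m)) * norm x \<le> C"
  shows "norm x \<le> C * (1 / 2) ^ m"
proof -
  have "2 ^ m * norm x \<le> C" using assms by (simp add: powr_realpow norm_power)
  then show ?thesis by (simp add: power_divide field_simps)
qed

lemma half_pow_tendsto_0: "(\<lambda>l. C * (1 / 2) ^ l) \<longlonglongrightarrow> (0::real)"
  using tendsto_mult_right_zero[OF LIMSEQ_power_zero[of "1/2::real"]] by simp

lemma half_pow_limit:
  fixes f :: "nat \<Rightarrow> 'b::real_normed_vector"
  assumes "\<And>m. norm (f m - l) \<le> C * (1 / 2) ^ m"
  shows "f \<longlonglongrightarrow> l"
proof (rule LIM_zero_cancel, rule Lim_null_comparison[OF _ half_pow_tendsto_0[of C]])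
  show "\<forall>\<^sub>F m in sequentially. norm (f m - l) \<le> C * (1 / 2) ^ m" by (rule always_eventually) (rule allI, rule assms)
qed

lemma dilated_cutoff_test:
  fixes \<Psi> :: "'a::euclidean_space \<Rightarrow> complex"
  assumes "\<Psi> \<in> test" "smooth \<phi>"
  shows "(\<lambda>x. \<Psi> ((2 powr - real m) *\<^sub>R x) * \<phi> x) \<in> test"
proof -
  obtain r where r: "r > 0" "\<And>x. r < norm x \<Longrightarrow> \<Psi> x = 0" using test_support[OF assms(1)] by blast
  have "smooth (\<lambda>x. \<Psi> ((2 powr - real m) *\<^sub>R x))" using assms(1) smooth_dilate unfolding test_def by blast
  from smooth_mult[OF this assms(2)] show ?thesis
  proof (rule testI[where r = "r * 2 powr real m"])
    fix x :: 'a assume "r * 2 powr real m < norm x"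
    then have "r < norm ((2 powr - real m) *\<^sub>R x)" by (simp add: powr_minus field_simps)
    then show "\<Psi> ((2 powr - real m) *\<^sub>R x) * \<phi> x = 0" using r(2) by simp
  qed
qed

text \<open>Density of the test functions in the weak form needed: 2^m times the difference is a
  bounded family by \<open>OM_dilate_diff\<close>. Hence a tempered distribution is determined by
  its values on \<open>test\<close>.\<close>

lemma cutoff_approx:
  assumes T: "tempered T" and \<Psi>: "\<Psi> \<in> cutoffs" and \<phi>: "\<phi> \<in> Schwartz"
  shows "(\<lambda>m. T (\<lambda>x. \<Psi> ((2 powr - real m) *\<^sub>R x) * \<phi> x)) \<longlonglongrightarrow> T \<phi>"
proof -
  let ?P = "\<lambda>m x. \<Psi> ((2 powr - real m) *\<^sub>R x)"
  have R: "RD wt (\<lambda>m x. (complex_of_real (2 powr real m) * (?P m x - 1)) * \<phi> x)"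
    by (rule RD_mult[OF OM_dilate_diff[OF cutoffD(2,3)[OF \<Psi>]] Schwartz_RD_const[OF \<phi>]]) auto
  obtain C where C: "\<And>m. norm (T (\<lambda>x. (complex_of_real (2 powr real m) * (?P m x - 1)) * \<phi> x)) \<le> C"
    using tempered_bounded[OF T R] by blast
  have P\<phi>: "(\<lambda>x. ?P m x * \<phi> x) \<in> Schwartz" for m
    by (rule test_Schwartz[OF dilated_cutoff_test[OF cutoffD(1)[OF \<Psi>] Schwartz_smooth[OF \<phi>]]])
  have "T (\<lambda>x. (complex_of_real (2 powr real m) * (?P m x - 1)) * \<phi> x) = complex_of_real (2 powr real m) * (T (\<lambda>x. ?P m x * \<phi> x) - T \<phi>)" for m
  proof -
    have "(\<lambda>x. (complex_of_real (2 powr real m) * (?P m x - 1)) * \<phi> x) = (\<lambda>x. complex_of_real (2 powr real m) * (?P m x * \<phi> x - \<phi> x))"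
      by (simp add: fun_eq_iff algebra_simps)
    then show ?thesis by (simp only: tempered_cmult[OF T Schwartz_diff[OF P\<phi> \<phi>]] tempered_diff[OF T P\<phi> \<phi>])
  qed
  then have "norm (complex_of_real (2 powr real m)) * norm (T (\<lambda>x. ?P m x * \<phi> x) - T \<phi>) \<le> C" for m
    using C[of m] by (simp only: norm_mult)
  then have "norm (T (\<lambda>x. ?P m x * \<phi> x) - T \<phi>) \<le> C * (1 / 2) ^ m" for m by (rule norm_le_half_pow)
  then show ?thesis by (rule half_pow_limit)
qed

lemma tempered_ext:
  fixes S T :: "('a::euclidean_space \<Rightarrow> complex) \<Rightarrow> complex"
  assumes S: "tempered S" and T: "tempered T" and eq: "\<And>\<phi>. \<phi> \<in> test \<Longrightarrow> S \<phi> = T \<phi>"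
  shows "S = T"
proof
  fix \<phi> :: "'a \<Rightarrow> complex"
  obtain \<Psi> :: "'a \<Rightarrow> complex" where \<Psi>: "\<Psi> \<in> cutoffs" using cutoffs_nonempty by blast
  show "S \<phi> = T \<phi>"
  proof (cases "\<phi> \<in> Schwartz")
    case True
    have "S (\<lambda>x. \<Psi> ((2 powr - real m) *\<^sub>R x) * \<phi> x) = T (\<lambda>x. \<Psi> ((2 powr - real m) *\<^sub>R x) * \<phi> x)" for m
      by (rule eq[OF dilated_cutoff_test[OF cutoffD(1)[OF \<Psi>] Schwartz_smooth[OF True]]])
    then show ?thesis using LIMSEQ_unique[OF cutoff_approx[OF S \<Psi> True]] cutoff_approx[OF T \<Psi> True] by simp
  qed (simp add: tempered_off[OF S] tempered_off[OF T])
qed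

lemma extends_res: "tempered T \<Longrightarrow> extends_to (res T) T"
  by (simp add: extends_to_def res_def)

lemma text_ext_res: "tempered T \<Longrightarrow> text_ext (res T) = T"
  unfolding text_ext_def
proof (rule the_equality)
  assume T: "tempered T"
  show "extends_to (res T) T" by (rule extends_res[OF T])
  fix S assume "extends_to (res T) S"
  then show "S = T" unfolding extends_to_def res_def using tempered_ext[OF _ T, of S] by simp
qed

text \<open>The value of a description operator is pinned down by uniqueness of limits. This needs
  one actual cutoff, since over an empty set of cutoffs every functional would qualify.\<close>

lemma typ11I:
  fixes u :: "('a::euclidean_space \<Rightarrow> complex) \<Rightarrow> complex"
  assumes u: "tempered u"
    and lim: "\<And>\<Psi> \<phi>. \<Psi> \<in> cutoffs \<Longrightarrow> \<phi> \<in> test \<Longrightarrow> (\<lambda>m. OP (regsym \<Psi> m b) u \<phi>) \<longlonglongrightarrow> T \<phi>"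
  shows "u \<in> dom11 b" "typ11 b u = res T"
proof -
  show "u \<in> dom11 b" unfolding dom11_def using u lim by blast
  obtain \<Psi>0 :: "'a \<Rightarrow> complex" where \<Psi>0: "\<Psi>0 \<in> cutoffs" using cutoffs_nonempty by blast
  show "typ11 b u = res T" unfolding typ11_def
  proof (rule the_equality)
    show "(\<forall>\<phi>. \<phi> \<notin> test \<longrightarrow> res T \<phi> = 0) \<and> (\<forall>\<Psi>\<in>cutoffs. \<forall>\<phi>\<in>test. (\<lambda>m. OP (regsym \<Psi> m b) u \<phi>) \<longlonglongrightarrow> res T \<phi>)"
      using lim by (simp add: res_def)
    fix S assume S: "(\<forall>\<phi>. \<phi> \<notin> test \<longrightarrow> S \<phi> = 0) \<and> (\<forall>\<Psi>\<in>cutoffs. \<forall>\<phi>\<in>test. (\<lambda>m. OP (regsym \<Psi> m b) u \<phi>) \<longlonglongrightarrow> S \<phi>)"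
    show "S = res T"
    proof
      fix \<phi>
      show "S \<phi> = res T \<phi>"
      proof (cases "\<phi> \<in> test")
        case True
        then have "(\<lambda>m. OP (regsym \<Psi>0 m b) u \<phi>) \<longlonglongrightarrow> S \<phi>" using S \<Psi>0 by blast
        from LIMSEQ_unique[OF this lim[OF \<Psi>0 True]] show ?thesis using True by (simp add: res_def)
      qed (use S in \<open>simp add: res_def\<close>)
    qed
  qed
qed

section \<open>The transposed operator with frequency localisation\<close>

text \<open>\<open>Four (w * Finv v)\<close> is the transpose of the multiplier w(D) applied to v,
  so this is the transposed operator followed by that of w(D). The value 0 off the Schwartz space is
  the normalisation in \<open>tempered\<close>.\<close>

definition transp :: "(('a::euclidean_space \<Rightarrow> complex) \<Rightarrow> complex) \<Rightarrow> ('a \<Rightarrow> complex) \<Rightarrow> ('a \<times> 'a \<Rightarrow> complex) \<Rightarrow> ('a \<Rightarrow> complex) \<Rightarrow> complex" where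
  "transp u w c \<phi> = (if \<phi> \<in> Schwartz then u (Four (\<lambda>\<eta>. w \<eta> * Finv (Qop c \<phi>) \<eta>)) else 0)"

abbreviation Mul :: "('a::euclidean_space \<Rightarrow> complex) \<Rightarrow> bool" where
  "Mul w \<equiv> OM wt (\<lambda>_::unit. w)"

lemma core_Schwartz:
  assumes "Mul w" "Sym c" "\<phi> \<in> Schwartz"
  shows "(\<lambda>\<eta>. w \<eta> * Finv (Qop c \<phi>) \<eta>) \<in> Schwartz"
  by (rule Schwartz_mult[OF assms(1) Finv_Schwartz[OF Qop_Schwartz[OF assms(2,3)]]])

text \<open>Joint boundedness in multiplier, symbol and argument. Together with linearity in each
  slot it replaces a topology on symbols: every limit below is read off from it.\<close>

lemma transp_bounded:
  assumes u: "tempered u" and w: "OM wt w" and c: "OM wt2 c" and \<phi>: "RD wt \<phi>"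
  obtains C where "\<And>i. norm (transp u (w i) (c i) (\<phi> i)) \<le> C"
proof -
  have "RD wt (\<lambda>i. Four (\<lambda>\<eta>. w i \<eta> * Finv (Qop (c i) (\<phi> i)) \<eta>))"
    by (rule RD_Four[OF RD_mult[OF w RD_Finv[OF RD_Qop[OF c \<phi>]]]]) auto
  from tempered_bounded[OF u this] obtain C where C: "\<And>i. norm (u (Four (\<lambda>\<eta>. w i \<eta> * Finv (Qop (c i) (\<phi> i)) \<eta>))) \<le> C" by blast
  show ?thesis
  proof (rule that[of C])
    show "norm (transp u (w i) (c i) (\<phi> i)) \<le> C" for i using C[of i] RD_Schwartz[OF \<phi>, of i] by (simp add: transp_def)
  qed
qed

lemma transp_lin_w:
  assumes u: "tempered u" and w: "Mul w" and w': "Mul w'" and c: "Sym c"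
  shows "transp u (\<lambda>\<eta>. s * (w \<eta> - w' \<eta>)) c \<phi> = s * (transp u w c \<phi> - transp u w' c \<phi>)"
proof (cases "\<phi> \<in> Schwartz")
  case \<phi>: True
  let ?f = "\<lambda>w \<eta>. w \<eta> * Finv (Qop c \<phi>) \<eta>"
  have S: "?f w \<in> Schwartz" "?f w' \<in> Schwartz" by (intro core_Schwartz w w' c \<phi>)+
  have "Four (?f (\<lambda>\<eta>. s * (w \<eta> - w' \<eta>))) = (\<lambda>\<xi>. s * (Four (?f w) \<xi> - Four (?f w') \<xi>))"
    using Four_cmult[of s "\<lambda>\<eta>. ?f w \<eta> - ?f w' \<eta>"] Four_diff[OF S] by (simp add: algebra_simps)
  then show ?thesis using \<phi>
    by (simp add: transp_def tempered_cmult[OF u Schwartz_diff] tempered_diff[OF u] Four_Schwartz S)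
qed (simp add: transp_def)

lemma Qop_lin:
  assumes c: "Sym c" and c': "Sym c'" and \<phi>: "\<phi> \<in> Schwartz"
  shows "Qop (\<lambda>z. s * (c z - c' z)) \<phi> x = s * (Qop c \<phi> x - Qop c' \<phi> x)"
proof -
  let ?i = "\<lambda>c \<zeta>. cis (-1 * (x \<bullet> \<zeta>)) * (c (x, \<zeta>) * Finv \<phi> \<zeta>)"
  have i: "integrable lborel (?i c)" if "Sym c" for c
  proof -
    have "RD wt2 (\<lambda>_::unit. \<lambda>z. c z * Finv \<phi> (snd z))"
      by (rule RD_mult[OF that RD_snd[OF Schwartz_RD_const[OF Finv_Schwartz[OF \<phi>]]]]) auto
    from osc_integrable[OF this, of "-1" x] show ?thesis by simp
  qed
  have "Qop (\<lambda>z. s * (c z - c' z)) \<phi> x = (\<integral>\<zeta>. s * (?i c \<zeta> - ?i c' \<zeta>) \<partial>lborel)"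
    unfolding Qop_def osc_def by (rule Bochner_Integration.integral_cong[OF refl]) (simp add: algebra_simps)
  also have "\<dots> = s * ((\<integral>\<zeta>. ?i c \<zeta> \<partial>lborel) - (\<integral>\<zeta>. ?i c' \<zeta> \<partial>lborel))"
    unfolding integral_mult_right_zero Bochner_Integration.integral_diff[OF i[OF c] i[OF c']] ..
  finally show ?thesis by (simp add: Qop_def osc_def)
qed

lemma transp_lin_c:
  assumes u: "tempered u" and w: "Mul w" and c: "Sym c" and c': "Sym c'"
  shows "transp u w (\<lambda>z. s * (c z - c' z)) \<phi> = s * (transp u w c \<phi> - transp u w c' \<phi>)"
proof (cases "\<phi> \<in> Schwartz")
  case \<phi>: True
  let ?f = "\<lambda>c \<eta>. w \<eta> * Finv (Qop c \<phi>) \<eta>"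
  have Q: "Qop c \<phi> \<in> Schwartz" "Qop c' \<phi> \<in> Schwartz" by (intro Qop_Schwartz c c' \<phi>)+
  have S: "?f c \<in> Schwartz" "?f c' \<in> Schwartz" by (intro core_Schwartz w c c' \<phi>)+
  have "Finv (Qop (\<lambda>z. s * (c z - c' z)) \<phi>) = (\<lambda>\<eta>. s * (Finv (Qop c \<phi>) \<eta> - Finv (Qop c' \<phi>) \<eta>))"
    unfolding Qop_lin[OF c c' \<phi>, THEN ext] Finv_cmult Finv_diff[OF Q] ..
  then have "Four (?f (\<lambda>z. s * (c z - c' z))) = (\<lambda>\<xi>. s * (Four (?f c) \<xi> - Four (?f c') \<xi>))"
    using Four_cmult[of s "\<lambda>\<eta>. ?f c \<eta> - ?f c' \<eta>"] Four_diff[OF S] by (simp add: algebra_simps)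
  then show ?thesis using \<phi>
    by (simp add: transp_def tempered_cmult[OF u Schwartz_diff] tempered_diff[OF u] Four_Schwartz S)
qed (simp add: transp_def)

lemma transp_scale_w: "tempered u \<Longrightarrow> Mul w \<Longrightarrow> Sym c \<Longrightarrow> transp u (\<lambda>\<eta>. s * w \<eta>) c \<phi> = s * transp u w c \<phi>"
  using transp_lin_w[of u w "\<lambda>_. 0" c s \<phi>] transp_lin_w[of u "\<lambda>_. 0" "\<lambda>_. 0" c 0 \<phi>] fam_zero[of "OMq wt", OF OMq_zero]
  by simp

lemma Sym_zero: "Sym (\<lambda>_. 0)"
  by (rule fam_zero, rule OMq_zero)

lemma transp_scale_c: "tempered u \<Longrightarrow> Mul w \<Longrightarrow> Sym c \<Longrightarrow> transp u w (\<lambda>z. s * c z) \<phi> = s * transp u w c \<phi>"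
  using transp_lin_c[of u w c "\<lambda>_. 0" s \<phi>] transp_lin_c[of u w "\<lambda>_. 0" "\<lambda>_. 0" 0 \<phi>] Sym_zero
  by simp

lemma transp_lin_\<phi>:
  assumes u: "tempered u" and w: "Mul w" and c: "Sym c" and \<phi>: "\<phi> \<in> Schwartz" and g: "g \<in> Schwartz"
  shows "transp u w c (\<lambda>x. \<phi> x + g x) = transp u w c \<phi> + transp u w c g" "transp u w c (\<lambda>x. s * \<phi> x) = s * transp u w c \<phi>"
proof -
  let ?f = "\<lambda>\<phi> \<eta>. w \<eta> * Finv (Qop c \<phi>) \<eta>"
  let ?i = "\<lambda>\<phi> x \<zeta>. cis (-1 * (x \<bullet> \<zeta>)) * (c (x, \<zeta>) * Finv \<phi> \<zeta>)"
  have i: "integrable lborel (?i \<phi> x)" if "\<phi> \<in> Schwartz" for \<phi> x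
  proof -
    have "RD wt2 (\<lambda>_::unit. \<lambda>z. c z * Finv \<phi> (snd z))"
      by (rule RD_mult[OF c RD_snd[OF Schwartz_RD_const[OF Finv_Schwartz[OF that]]]]) auto
    from osc_integrable[OF this, of "-1" x] show ?thesis by simp
  qed
  have S: "?f \<phi> \<in> Schwartz" "?f g \<in> Schwartz" by (intro core_Schwartz w c \<phi> g)+
  have Q: "Qop c \<phi> \<in> Schwartz" "Qop c g \<in> Schwartz" by (intro Qop_Schwartz c \<phi> g)+
  have "Qop c (\<lambda>x. \<phi> x + g x) = (\<lambda>x. Qop c \<phi> x + Qop c g x)"
  proof
    fix x
    have "Qop c (\<lambda>x. \<phi> x + g x) x = (\<integral>\<zeta>. ?i \<phi> x \<zeta> + ?i g x \<zeta> \<partial>lborel)"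
      unfolding Qop_def osc_def Finv_add[OF \<phi> g] by (rule Bochner_Integration.integral_cong[OF refl]) (simp add: algebra_simps)
    also have "\<dots> = Qop c \<phi> x + Qop c g x"
      unfolding Bochner_Integration.integral_add[OF i[OF \<phi>] i[OF g]] by (simp add: Qop_def osc_def)
    finally show "Qop c (\<lambda>x. \<phi> x + g x) x = Qop c \<phi> x + Qop c g x" .
  qed
  then have "?f (\<lambda>x. \<phi> x + g x) = (\<lambda>\<eta>. ?f \<phi> \<eta> + ?f g \<eta>)" by (simp add: Finv_add[OF Q] distrib_left)
  then show "transp u w c (\<lambda>x. \<phi> x + g x) = transp u w c \<phi> + transp u w c g"
    by (simp add: transp_def \<phi> g Schwartz_add Four_add[OF S] tempered_add[OF u Four_Schwartz Four_Schwartz] S)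
  have "Qop c (\<lambda>x. s * \<phi> x) = (\<lambda>x. s * Qop c \<phi> x)"
  proof
    fix x
    have "Qop c (\<lambda>x. s * \<phi> x) x = (\<integral>\<zeta>. s * ?i \<phi> x \<zeta> \<partial>lborel)"
      unfolding Qop_def osc_def Finv_cmult by (rule Bochner_Integration.integral_cong[OF refl]) (simp add: mult_ac)
    also have "\<dots> = s * Qop c \<phi> x" unfolding integral_mult_right_zero by (simp add: Qop_def osc_def)
    finally show "Qop c (\<lambda>x. s * \<phi> x) x = s * Qop c \<phi> x" .
  qed
  then have "?f (\<lambda>x. s * \<phi> x) = (\<lambda>\<eta>. s * ?f \<phi> \<eta>)" by (simp add: Finv_cmult mult.left_commute)
  then show "transp u w c (\<lambda>x. s * \<phi> x) = s * transp u w c \<phi>"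
    by (simp add: transp_def \<phi> Schwartz_cmult Four_cmult tempered_cmult[OF u Four_Schwartz] S)
qed

lemma tempered_transp:
  assumes u: "tempered u" and w: "Mul w" and c: "Sym c"
  shows "tempered (transp u w c)"
proof (rule temperedI)
  fix f :: "nat \<Rightarrow> 'a \<Rightarrow> complex" assume "RD wt f"
  from transp_bounded[OF u OM_const_index[OF w] OM_const_index[OF c] this]
  show "\<exists>C. \<forall>i. norm (transp u w c (f i)) \<le> C" by blast
next
  show "transp u w c \<phi> = 0" if "\<phi> \<notin> Schwartz" for \<phi> using that by (simp add: transp_def)
  show "transp u w c (\<lambda>x. \<phi> x + g x) = transp u w c \<phi> + transp u w c g" if "\<phi> \<in> Schwartz" "g \<in> Schwartz" for \<phi> g
    by (rule transp_lin_\<phi>(1)[OF u w c that])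
  show "transp u w c (\<lambda>x. s * \<phi> x) = s * transp u w c \<phi>" if "\<phi> \<in> Schwartz" for \<phi> s
    by (rule transp_lin_\<phi>(2)[OF u w c that that])
qed

lemma Mul_one: "Mul (\<lambda>_. 1)"
  by (rule OM_const[where M = 1]) auto

lemma transp_one: "tempered u \<Longrightarrow> Sym c \<Longrightarrow> \<phi> \<in> Schwartz \<Longrightarrow> transp u (\<lambda>_. 1) c \<phi> = u (Qop c \<phi>)"
  by (simp add: transp_def Four_Finv_inverse[OF Qop_Schwartz])

lemma Mul_dilate: "\<Psi> \<in> Schwartz \<Longrightarrow> OM wt (\<lambda>m x. \<Psi> ((2 powr - real m) *\<^sub>R x))"
  by (rule OM_dilate[OF Schwartz_OM two_powr_minus_le1])

text \<open>The error is split by changing first the symbol and then the multiplier. Multiplied by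
  2^m, each part is a bounded family, by \<open>OM_conv_diff\<close> and
  \<open>OM_dilate_diff\<close> respectively.\<close>

lemma transp_limit:
  assumes u: "tempered u" and w: "Mul w" and c: "Sym c" and \<Psi>: "\<Psi> \<in> cutoffs" and \<phi>: "\<phi> \<in> Schwartz"
  shows "(\<lambda>m. transp u (\<lambda>\<eta>. \<Psi> ((2 powr - real m) *\<^sub>R \<eta>) * w \<eta>) (conv (Finv \<Psi>) (2 powr - real m) c) \<phi>) \<longlonglongrightarrow> transp u w c \<phi>"
proof -
  let ?P = "\<lambda>m \<eta>. \<Psi> ((2 powr - real m) *\<^sub>R \<eta>)" and ?c = "\<lambda>m. conv (Finv \<Psi>) (2 powr - real m) c"
  let ?s = "\<lambda>m. complex_of_real (2 powr real m)"
  note \<Psi>' = cutoffD[OF \<Psi>]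
  have k: "Finv \<Psi> \<in> Schwartz" by (rule Finv_Schwartz[OF \<Psi>'(2)])
  have cm: "Sym (?c m)" for m by (rule Sym_conv[OF k c])
  have Pm: "OM wt (\<lambda>m \<eta>. ?P m \<eta> * w \<eta>)" by (rule OM_mult[OF Mul_dilate[OF \<Psi>'(2)] OM_const_index[OF w]]) auto
  have Pw: "Mul (\<lambda>\<eta>. ?P m \<eta> * w \<eta>)" for m using OM_reindex[OF Pm, of "\<lambda>_::unit. m"] .
  have "OM wt2 (\<lambda>m z. complex_of_real (1 / (2 powr - real m)) * (?c m z - c z))"
    by (rule OM_conv_diff[OF k _ OM_const_index[OF c]]) (simp_all add: integral_Finv[OF \<Psi>'(2)] \<Psi>'(3))
  moreover have "1 / (2 powr - real m) = 2 powr real m" for m by (simp add: powr_minus divide_inverse)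
  ultimately have "OM wt2 (\<lambda>m z. ?s m * (?c m z - c z))" by simp
  from transp_bounded[OF u Pm this Schwartz_RD_const[OF \<phi>]]
  obtain C1 where C1: "\<And>m. norm (transp u (\<lambda>\<eta>. ?P m \<eta> * w \<eta>) (\<lambda>z. ?s m * (?c m z - c z)) \<phi>) \<le> C1" by blast
  have "OM wt (\<lambda>m \<eta>. (?s m * (?P m \<eta> - 1)) * w \<eta>)"
    by (rule OM_mult[OF OM_dilate_diff[OF \<Psi>'(2,3)] OM_const_index[OF w]]) auto
  then have "OM wt (\<lambda>m \<eta>. ?s m * (?P m \<eta> * w \<eta> - w \<eta>))" by (simp add: algebra_simps)
  from transp_bounded[OF u this OM_const_index[OF c] Schwartz_RD_const[OF \<phi>]]
  obtain C2 where C2: "\<And>m. norm (transp u (\<lambda>\<eta>. ?s m * (?P m \<eta> * w \<eta> - w \<eta>)) c \<phi>) \<le> C2" by blast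
  let ?d = "\<lambda>m. transp u (\<lambda>\<eta>. ?P m \<eta> * w \<eta>) (?c m) \<phi> - transp u w c \<phi>"
  have "norm (?s m) * norm (?d m) \<le> C1 + C2" for m
  proof -
    have "?s m * ?d m = transp u (\<lambda>\<eta>. ?P m \<eta> * w \<eta>) (\<lambda>z. ?s m * (?c m z - c z)) \<phi> + transp u (\<lambda>\<eta>. ?s m * (?P m \<eta> * w \<eta> - w \<eta>)) c \<phi>"
      unfolding transp_lin_c[OF u Pw cm c] transp_lin_w[OF u Pw w c] by (simp add: algebra_simps)
    then have "norm (?s m * ?d m) \<le> C1 + C2"
      by (simp only:) (rule norm_triangle_le[OF add_mono[OF C1 C2]])
    then show ?thesis by (simp only: norm_mult)
  qed
  then have "norm (?d m) \<le> (C1 + C2) * (1 / 2) ^ m" for m by (rule norm_le_half_pow)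
  then show ?thesis by (rule half_pow_limit)
qed

text \<open>\<open>OP\<close> is not linear in arbitrary symbols: \<open>Four_dist\<close> is 0
  outside the Schwartz space, and a nonintegrable function has integral 0. These conditions exclude
  both default values.\<close>

definition nice :: "(('a::euclidean_space \<Rightarrow> complex) \<Rightarrow> complex) \<Rightarrow> ('a \<times> 'a \<Rightarrow> complex) \<Rightarrow> bool" where
  "nice u b \<longleftrightarrow> (\<forall>x. (\<lambda>\<eta>. cis (x \<bullet> \<eta>) * b (x, \<eta>)) \<in> Schwartz) \<and> (\<forall>\<phi>\<in>test. integrable lborel (\<lambda>x. OPfun b u x * \<phi> x))"

lemma nice_lin:
  assumes u: "tempered u" and b: "nice u b" and b': "nice u b'"
  shows "nice u (\<lambda>z. b z + s * b' z)" "\<phi> \<in> test \<Longrightarrow> OP (\<lambda>z. b z + s * b' z) u \<phi> = OP b u \<phi> + s * OP b' u \<phi>"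
proof -
  note Fd = tempered_Four_dist[OF u]
  have S: "(\<lambda>\<eta>. cis (x \<bullet> \<eta>) * b (x, \<eta>)) \<in> Schwartz" "(\<lambda>\<eta>. cis (x \<bullet> \<eta>) * b' (x, \<eta>)) \<in> Schwartz" for x
    using b b' unfolding nice_def by auto
  have e: "(\<lambda>\<eta>. cis (x \<bullet> \<eta>) * (b (x, \<eta>) + s * b' (x, \<eta>))) = (\<lambda>\<eta>. cis (x \<bullet> \<eta>) * b (x, \<eta>) + s * (cis (x \<bullet> \<eta>) * b' (x, \<eta>)))" for x
    by (simp add: fun_eq_iff algebra_simps)
  have f: "OPfun (\<lambda>z. b z + s * b' z) u x = OPfun b u x + s * OPfun b' u x" for x
    unfolding OPfun_def e tempered_add[OF Fd S(1) Schwartz_cmult[OF S(2)]] tempered_cmult[OF Fd S(2)] by (simp add: algebra_simps)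
  have g: "(\<lambda>x. OPfun (\<lambda>z. b z + s * b' z) u x * \<phi> x) = (\<lambda>x. OPfun b u x * \<phi> x + s * (OPfun b' u x * \<phi> x))" for \<phi>
    unfolding f by (simp add: fun_eq_iff algebra_simps)
  have i: "integrable lborel (\<lambda>x. OPfun b u x * \<phi> x)" "integrable lborel (\<lambda>x. s * (OPfun b' u x * \<phi> x))" if "\<phi> \<in> test" for \<phi>
    using b b' that unfolding nice_def by (auto intro!: integrable_mult_right)
  show "nice u (\<lambda>z. b z + s * b' z)"
    unfolding nice_def e g using Schwartz_add[OF S(1) Schwartz_cmult[OF S(2)]] Bochner_Integration.integrable_add[OF i] by blast
  show "OP (\<lambda>z. b z + s * b' z) u \<phi> = OP b u \<phi> + s * OP b' u \<phi>" if "\<phi> \<in> test"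
    unfolding OP_def using that by (simp only: g if_True Bochner_Integration.integral_add[OF i] integral_mult_right_zero)
qed

lemma nice_zero: "tempered u \<Longrightarrow> nice u (\<lambda>z. 0)" "tempered u \<Longrightarrow> OP (\<lambda>z. 0) u \<phi> = 0"
proof -
  assume u: "tempered u"
  have "OPfun (\<lambda>z. 0) u x = 0" for x :: 'a
    unfolding OPfun_def using tempered_zero[OF tempered_Four_dist[OF u]] by simp
  then show "nice u (\<lambda>z. 0)" "OP (\<lambda>z. 0) u \<phi> = 0" by (simp_all add: nice_def Schwartz_zero OP_def)
qed

lemma nice_sum:
  assumes u: "tempered u" and "finite S" "\<And>k. k \<in> S \<Longrightarrow> nice u (b k)" and \<phi>: "\<phi> \<in> test"
  shows "nice u (\<lambda>z. \<Sum>k\<in>S. b k z) \<and> OP (\<lambda>z. \<Sum>k\<in>S. b k z) u \<phi> = (\<Sum>k\<in>S. OP (b k) u \<phi>)"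
  using assms(2,3)
proof (induction S rule: finite_induct)
  case empty
  show ?case using nice_zero[OF u] by simp
next
  case (insert k S)
  have n: "nice u (b k)" "nice u (\<lambda>z. \<Sum>k\<in>S. b k z)" and e: "OP (\<lambda>z. \<Sum>k\<in>S. b k z) u \<phi> = (\<Sum>k\<in>S. OP (b k) u \<phi>)"
    using insert by auto
  have "(\<lambda>z. \<Sum>k\<in>insert k S. b k z) = (\<lambda>z. b k z + 1 * (\<Sum>k\<in>S. b k z))" using insert.hyps by simp
  then show ?case using nice_lin(1)[OF u n, of 1] nice_lin(2)[OF u n \<phi>, of 1] e insert.hyps by simp
qed

lemma regsym_conv:
  assumes "\<Psi> \<in> cutoffs" "Sym a"
  shows "regsym \<Psi> m a z = conv (Finv \<Psi>) (2 powr - real m) a z * \<Psi> ((2 powr - real m) *\<^sub>R snd z)"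
  unfolding regsym_def using xmult_dilate[OF cutoffD(2)[OF assms(1)] assms(2), of "2 powr - real m"] by simp

text \<open>A regularised symbol is an averaged symbol times a cutoff in \<eta>, and averaged
  symbols remain dual. \<open>OP_dual\<close> thus applies with the product of the cutoff and
  \<open>w\<close> as its multiplier.\<close>

lemma OP_regsym:
  fixes a :: "'a::euclidean_space \<times> 'a \<Rightarrow> complex"
  assumes ac: "dual a c" and u: "tempered u" and \<Psi>: "\<Psi> \<in> cutoffs" and w: "Mul w"
  shows "nice u (\<lambda>z. regsym \<Psi> m a z * w (snd z))"
    and "\<phi> \<in> test \<Longrightarrow> OP (\<lambda>z. regsym \<Psi> m a z * w (snd z)) u \<phi> = transp u (\<lambda>\<eta>. \<Psi> ((2 powr - real m) *\<^sub>R \<eta>) * w \<eta>) (conv (Finv \<Psi>) (2 powr - real m) c) \<phi>"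
proof -
  let ?t = "2 powr - real m"
  have a: "Sym a" using ac unfolding dual_def by blast
  have k: "Finv \<Psi> \<in> Schwartz" by (rule Finv_Schwartz[OF cutoffD(2)[OF \<Psi>]])
  have PS: "(\<lambda>\<eta>. \<Psi> (?t *\<^sub>R \<eta>)) \<in> Schwartz" using Schwartz_dilate[OF cutoffD(2)[OF \<Psi>], of ?t 0] by simp
  have wS: "(\<lambda>\<eta>. \<Psi> (?t *\<^sub>R \<eta>) * w \<eta>) \<in> Schwartz" using Schwartz_mult[OF w PS] by (simp add: mult.commute)
  have e: "(\<lambda>z. regsym \<Psi> m a z * w (snd z)) = (\<lambda>z. conv (Finv \<Psi>) ?t a z * (\<lambda>\<eta>. \<Psi> (?t *\<^sub>R \<eta>) * w \<eta>) (snd z))"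
    unfolding regsym_conv[OF \<Psi> a] by (simp add: mult.assoc)
  note D = OP_dual[OF dual_conv[OF ac k] u wS _ tempered_Four_dist[OF u]]
  obtain \<phi>0 :: "'a \<Rightarrow> complex" where \<phi>0: "\<phi>0 \<in> test" using cutoffs_nonempty cutoffD(1) by blast
  show "nice u (\<lambda>z. regsym \<Psi> m a z * w (snd z))"
    unfolding nice_def e using D(2)[OF \<phi>0] D(3) by simp
  show "OP (\<lambda>z. regsym \<Psi> m a z * w (snd z)) u \<phi> = transp u (\<lambda>\<eta>. \<Psi> (?t *\<^sub>R \<eta>) * w \<eta>) (conv (Finv \<Psi>) ?t c) \<phi>" if "\<phi> \<in> test"
    unfolding e D(1)[OF that] by (simp add: transp_def test_Schwartz[OF that])
qed

lemma dual_typ11: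
  fixes a :: "'a::euclidean_space \<times> 'a \<Rightarrow> complex"
  assumes ac: "dual a c" and u: "tempered u"
  shows "u \<in> dom11 a" "typ11 a u = res (transp u (\<lambda>_. 1) c)"
    and "\<Psi> \<in> cutoffs \<Longrightarrow> nice u (regsym \<Psi> m a)"
    and "\<Psi> \<in> cutoffs \<Longrightarrow> \<phi> \<in> test \<Longrightarrow> (\<lambda>m. OP (regsym \<Psi> m a) u \<phi>) \<longlonglongrightarrow> transp u (\<lambda>_. 1) c \<phi>"
proof -
  have c: "Sym c" using ac unfolding dual_def by blast
  have lim: "(\<lambda>m. OP (regsym \<Psi> m a) u \<phi>) \<longlonglongrightarrow> transp u (\<lambda>_. 1) c \<phi>" if "\<Psi> \<in> cutoffs" "\<phi> \<in> test" for \<Psi> \<phi>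
    using transp_limit[OF u Mul_one c that(1) test_Schwartz[OF that(2)]] OP_regsym(2)[OF ac u that(1) Mul_one that(2)] by simp
  show "u \<in> dom11 a" "typ11 a u = res (transp u (\<lambda>_. 1) c)"
    using typ11I[where T = "transp u (\<lambda>_. 1) c", OF u lim] by auto
  show "\<Psi> \<in> cutoffs \<Longrightarrow> nice u (regsym \<Psi> m a)" using OP_regsym(1)[OF ac u _ Mul_one] by simp
  show "\<Psi> \<in> cutoffs \<Longrightarrow> \<phi> \<in> test \<Longrightarrow> (\<lambda>m. OP (regsym \<Psi> m a) u \<phi>) \<longlonglongrightarrow> transp u (\<lambda>_. 1) c \<phi>" by (rule lim)
qed

lemma fmult_apply:
  assumes "Mul m" "\<phi> \<in> Schwartz"
  shows "fmult m u \<phi> = u (Four (\<lambda>x. m x * Finv \<phi> x))"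
  using assms by (simp add: fmult_def Finv_dist_def mult_dist_def Four_dist_def Finv_Schwartz Schwartz_mult)

lemma tempered_fmult:
  assumes u: "tempered u" and m: "Mul m"
  shows "tempered (fmult m u)"
proof (rule temperedI)
  have S: "(\<lambda>x. m x * Finv \<phi> x) \<in> Schwartz" if "\<phi> \<in> Schwartz" for \<phi>
    by (rule Schwartz_mult[OF m Finv_Schwartz[OF that]])
  show "fmult m u \<phi> = 0" if "\<phi> \<notin> Schwartz" for \<phi> using that by (simp add: fmult_def Finv_dist_def)
  show "fmult m u (\<lambda>x. \<phi> x + g x) = fmult m u \<phi> + fmult m u g" if "\<phi> \<in> Schwartz" "g \<in> Schwartz" for \<phi> g
    using that by (simp add: fmult_apply[OF m] Schwartz_add Finv_add distrib_left Four_add S tempered_add[OF u] Four_Schwartz)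
  show "fmult m u (\<lambda>x. c * \<phi> x) = c * fmult m u \<phi>" if "\<phi> \<in> Schwartz" for \<phi> c
    using that by (simp add: fmult_apply[OF m] Schwartz_cmult Finv_cmult mult.left_commute Four_cmult S tempered_cmult[OF u] Four_Schwartz)
  fix f :: "nat \<Rightarrow> 'a \<Rightarrow> complex" assume f: "RD wt f"
  have "RD wt (\<lambda>i. Four (\<lambda>x. m x * Finv (f i) x))"
    by (rule RD_Four[OF RD_mult[OF OM_const_index[OF m] RD_Finv[OF f]]]) auto
  from tempered_bounded[OF u this] obtain C where "\<And>i. norm (u (Four (\<lambda>x. m x * Finv (f i) x))) \<le> C" by blast
  then show "\<exists>C. \<forall>i. norm (fmult m u (f i)) \<le> C" using RD_Schwartz[OF f] by (auto simp: fmult_apply[OF m])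
qed

lemma transp_fmult:
  assumes "tempered u" "Mul m" "Sym c"
  shows "transp (fmult m u) (\<lambda>_. 1) c = transp u m c"
proof
  fix \<phi>
  show "transp (fmult m u) (\<lambda>_. 1) c \<phi> = transp u m c \<phi>"
    using transp_one[OF tempered_fmult[OF assms(1,2)] assms(3), of \<phi>] fmult_apply[OF assms(2) Qop_Schwartz[OF assms(3)], of \<phi> u]
    by (cases "\<phi> \<in> Schwartz") (simp_all add: transp_def)
qed

text \<open>Every term of the three series has this form, which turns it into an expression linear
  in \<open>w\<close> and in \<open>m\<close> separately.\<close>

lemma typ11_fmult:
  assumes ac: "dual a c" and u: "tempered u" and w: "Mul w" and m: "m \<in> Schwartz"
  shows "fmult w u \<in> dom11 (xmult m a)" "typ11 (xmult m a) (fmult w u) = res (transp u w (conv (Finv m) 1 c))"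
proof -
  have a: "Sym a" and c: "Sym c" using ac unfolding dual_def by auto
  have d: "dual (xmult m a) (conv (Finv m) 1 c)"
    unfolding xmult_conv[OF m a] by (rule dual_conv[OF ac Finv_Schwartz[OF m]])
  show "fmult w u \<in> dom11 (xmult m a)" by (rule dual_typ11(1)[OF d tempered_fmult[OF u w]])
  show "typ11 (xmult m a) (fmult w u) = res (transp u w (conv (Finv m) 1 c))"
    using dual_typ11(2)[OF d tempered_fmult[OF u w]] transp_fmult[OF u w Sym_conv[OF Finv_Schwartz[OF m] c]] by simp
qed

section \<open>Rapidly convergent series\<close>

text \<open>By linearity in each slot the growing factor \<open>q j\<close> may be attached to the
  multiplier or to the symbol, whichever of them can absorb it.\<close>

lemma transp_weighted:
  assumes u: "tempered u" and w: "\<And>j. Mul (w j)" and C: "\<And>j. Sym (C j)" and \<phi>: "RD wt \<phi>"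
    and q: "(OM wt (\<lambda>j \<eta>. complex_of_real (q j) * w j \<eta>) \<and> OM wt2 C) \<or> (OM wt w \<and> OM wt2 (\<lambda>j z. complex_of_real (q j) * C j z))"
  shows "\<exists>K. \<forall>j. \<bar>q j\<bar> * norm (transp u (w j) (C j) (\<phi> j)) \<le> K"
  using q
proof
  assume a: "OM wt (\<lambda>j \<eta>. complex_of_real (q j) * w j \<eta>) \<and> OM wt2 C"
  obtain K where "\<And>j. norm (transp u (\<lambda>\<eta>. complex_of_real (q j) * w j \<eta>) (C j) (\<phi> j)) \<le> K"
    using transp_bounded[OF u conjunct1[OF a] conjunct2[OF a] \<phi>] by blast
  then show ?thesis unfolding transp_scale_w[OF u w C] norm_mult norm_of_real by blast
next
  assume a: "OM wt w \<and> OM wt2 (\<lambda>j z. complex_of_real (q j) * C j z)"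
  obtain K where "\<And>j. norm (transp u (w j) (\<lambda>z. complex_of_real (q j) * C j z) (\<phi> j)) \<le> K"
    using transp_bounded[OF u conjunct1[OF a] conjunct2[OF a] \<phi>] by blast
  then show ?thesis unfolding transp_scale_c[OF u w C] norm_mult norm_of_real by blast
qed

text \<open>The small factor sits in the multiplier of \<open>u\<close> for the first series and in
  the symbol for the third; the disjunction lets one argument serve both.\<close>

definition rapid_pair :: "(nat \<Rightarrow> 'a::euclidean_space \<Rightarrow> complex) \<Rightarrow> (nat \<Rightarrow> 'a \<times> 'a \<Rightarrow> complex) \<Rightarrow> bool" where
  "rapid_pair w C \<longleftrightarrow> OM wt w \<and> OM wt2 C \<and>
     ((\<forall>N::nat. OM wt (\<lambda>k \<eta>. complex_of_real (2 powr (real k * real N)) * w k \<eta>)) \<or>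
      (\<forall>N::nat. OM wt2 (\<lambda>k z. complex_of_real (2 powr (real k * real N)) * C k z)))"

lemma conv_cmult: "conv \<kappa> t (\<lambda>z. s * b z) = (\<lambda>z. s * conv \<kappa> t b z)"
  unfolding conv_def by (simp add: mult.left_commute)

lemma rapid_pair_bound:
  fixes \<phi> :: "'i \<Rightarrow> 'a::euclidean_space \<Rightarrow> complex"
  assumes rp: "rapid_pair w C" and u: "tempered u" and \<phi>: "RD wt \<phi>"
  shows "\<exists>K. \<forall>k i. 2 powr (real k * real N) * norm (transp u (w k) (C k) (\<phi> i)) \<le> K"
proof -
  have w: "OM wt w" and C: "OM wt2 C" using rp unfolding rapid_pair_def by auto
  have "\<exists>K. \<forall>j. \<bar>2 powr (real (fst j) * real N)\<bar> * norm (transp u (w (fst j)) (C (fst j)) (\<phi> (snd j))) \<le> K"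
  proof (rule transp_weighted[OF u])
    show "Mul (w (fst j))" "Sym (C (fst j))" for j :: "nat \<times> 'i" by (rule OM_reindex[OF w], rule OM_reindex[OF C])
    show "RD wt (\<lambda>j. \<phi> (snd j))" by (rule RD_reindex[OF \<phi>])
    show "(OM wt (\<lambda>j \<eta>. complex_of_real (2 powr (real (fst j) * real N)) * w (fst j) \<eta>) \<and> OM wt2 (\<lambda>j. C (fst j))) \<or>
      (OM wt (\<lambda>j. w (fst j)) \<and> OM wt2 (\<lambda>j z. complex_of_real (2 powr (real (fst j) * real N)) * C (fst j) z))"
      using rp OM_reindex[OF w, of fst] OM_reindex[OF C, of fst]
        OM_reindex[of wt "\<lambda>k \<eta>. complex_of_real (2 powr (real k * real N)) * w k \<eta>" fst]
        OM_reindex[of wt2 "\<lambda>k z. complex_of_real (2 powr (real k * real N)) * C k z" fst]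
      unfolding rapid_pair_def by blast
  qed
  then obtain K where K: "\<And>j. \<bar>2 powr (real (fst j) * real N)\<bar> * norm (transp u (w (fst j)) (C (fst j)) (\<phi> (snd j))) \<le> K" by blast
  have "2 powr (real k * real N) * norm (transp u (w k) (C k) (\<phi> i)) \<le> K" for k i using K[of "(k, i)"] by simp
  then show ?thesis by blast
qed

text \<open>The geometric bound is uniform in the regularisation index m, because the cutoffs and
  the averages over x are bounded operations. It is the majorant for exchanging the limit in m with
  the sum over k; the first power of 2^k suffices.\<close>

lemma rapid_pair_reg_bound:
  fixes w :: "nat \<Rightarrow> 'a::euclidean_space \<Rightarrow> complex"
  assumes rp: "rapid_pair w C" and u: "tempered u" and \<phi>: "\<phi> \<in> Schwartz" and v: "OM wt v" and k: "\<kappa> \<in> Schwartz"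
  shows "\<exists>K. \<forall>k m. norm (transp u (\<lambda>\<eta>. v m \<eta> * w k \<eta>) (conv \<kappa> (2 powr - real m) (C k)) \<phi>) \<le> K * (1 / 2) ^ k"
proof -
  have w: "OM wt w" and C: "OM wt2 C" using rp unfolding rapid_pair_def by auto
  let ?w = "\<lambda>j \<eta>. v (snd j) \<eta> * w (fst j) \<eta>" and ?C = "\<lambda>j. conv \<kappa> (2 powr - real (snd j)) (C (fst j))"
  let ?q = "\<lambda>j. 2 powr (real (fst j) * real 1)"
  have W: "OM wt ?w" by (rule OM_mult[OF OM_reindex[OF v] OM_reindex[OF w]]) auto
  have CC: "OM wt2 ?C" by (rule OM_conv[OF k OM_reindex[OF C]])
  have "\<exists>K. \<forall>j. \<bar>?q j\<bar> * norm (transp u (?w j) (?C j) ((\<lambda>_. \<phi>) j)) \<le> K"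
  proof (rule transp_weighted[OF u _ _ Schwartz_RD_const[OF \<phi>]])
    show "Mul (?w j)" "Sym (?C j)" for j by (rule OM_reindex[OF W], rule OM_reindex[OF CC])
    from rp consider (1) "OM wt (\<lambda>k \<eta>. complex_of_real (2 powr (real k * real 1)) * w k \<eta>)"
      | (2) "OM wt2 (\<lambda>k z. complex_of_real (2 powr (real k * real 1)) * C k z)"
      unfolding rapid_pair_def by blast
    then show "(OM wt (\<lambda>j \<eta>. complex_of_real (?q j) * ?w j \<eta>) \<and> OM wt2 ?C) \<or> (OM wt ?w \<and> OM wt2 (\<lambda>j z. complex_of_real (?q j) * ?C j z))"
    proof cases
      case 1
      have "OM wt (\<lambda>j \<eta>. v (snd j) \<eta> * (complex_of_real (?q j) * w (fst j) \<eta>))"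
        by (rule OM_mult[OF OM_reindex[OF v] OM_reindex[OF 1]]) auto
      then have "OM wt (\<lambda>j \<eta>. complex_of_real (?q j) * ?w j \<eta>)" by (simp add: mult.left_commute)
      with CC show ?thesis by blast
    next
      case 2
      have "OM wt2 (\<lambda>j. conv \<kappa> (2 powr - real (snd j)) (\<lambda>z. complex_of_real (?q j) * C (fst j) z))"
        by (rule OM_conv[OF k OM_reindex[OF 2]])
      then have "OM wt2 (\<lambda>j z. complex_of_real (?q j) * ?C j z)" by (simp add: conv_cmult)
      with W show ?thesis by blast
    qed
  qed
  then obtain K where K: "\<And>j. \<bar>?q j\<bar> * norm (transp u (?w j) (?C j) \<phi>) \<le> K" by blast
  have "norm (transp u (\<lambda>\<eta>. v m \<eta> * w k \<eta>) (conv \<kappa> (2 powr - real m) (C k)) \<phi>) \<le> K * (1 / 2) ^ k" for k m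
    by (rule norm_le_half_pow) (use K[of "(k, m)"] in simp)
  then show ?thesis by blast
qed

text \<open>Applied to the symbols themselves rather than to their duals, this gives convergence of
  the symbol series and its integrability against the averaging kernels.\<close>

lemma rapid_pair_pointwise:
  fixes w :: "nat \<Rightarrow> 'a::euclidean_space \<Rightarrow> complex"
  assumes rp: "rapid_pair w A"
  obtains K N where "K \<ge> 0" "\<And>k z. norm (A k z * w k (snd z)) \<le> K * wt2 z ^ N * (1 / 2) ^ k"
proof -
  have w: "OM wt w" and A: "OM wt2 A" using rp unfolding rapid_pair_def by auto
  let ?q = "\<lambda>k. complex_of_real (2 powr (real k * real 1))"
  have "OM wt2 (\<lambda>k z. ?q k * (A k z * w k (snd z)))"
    using rp unfolding rapid_pair_def
  proof (elim conjE disjE)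
    assume "\<forall>N::nat. OM wt (\<lambda>k \<eta>. complex_of_real (2 powr (real k * real N)) * w k \<eta>)"
    then have "OM wt (\<lambda>k \<eta>. ?q k * w k \<eta>)" by blast
    from OM_mult[OF A OM_snd[OF this]] show ?thesis by (simp add: mult.left_commute)
  next
    assume "\<forall>N::nat. OM wt2 (\<lambda>k z. complex_of_real (2 powr (real k * real N)) * A k z)"
    then have "OM wt2 (\<lambda>k z. ?q k * A k z)" by blast
    from OM_mult[OF this OM_snd[OF w]] show ?thesis by (simp add: mult.assoc)
  qed
  then have Q: "OMq wt2 (\<lambda>k z. ?q k * (A k z * w k (snd z)))" by (rule fam_Q)
  obtain K N where K: "0 \<le> K" "\<And>N' k z. N \<le> N' \<Longrightarrow> norm (?q k * (A k z * w k (snd z))) \<le> K * wt2 z ^ N'"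
    by (rule OMqE[OF Q], simp, rule that)
  show ?thesis
  proof (rule that[of K N])
    show "norm (A k z * w k (snd z)) \<le> K * wt2 z ^ N * (1 / 2) ^ k" for k z
      by (rule norm_le_half_pow) (use K(2)[OF order_refl, of k z] in \<open>simp add: norm_mult\<close>)
  qed (rule K(1))
qed

text \<open>For fixed m the regularised series has only finitely many nonzero terms, so
  \<open>OP\<close> may be applied termwise without any convergence question. The limit in m is then
  exchanged with the sum.\<close>

lemma series_symbol:
  fixes u :: "('a::euclidean_space \<Rightarrow> complex) \<Rightarrow> complex" and A C :: "nat \<Rightarrow> 'a \<times> 'a \<Rightarrow> complex"
    and w :: "nat \<Rightarrow> 'a \<Rightarrow> complex" and \<Psi> \<phi> :: "'a \<Rightarrow> complex" and m :: nat
  assumes u: "tempered u" and ac: "\<And>k. dual (A k) (C k)" and rC: "rapid_pair w C" and rA: "rapid_pair w A"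
    and fin: "\<And>\<Psi> m. \<Psi> \<in> cutoffs \<Longrightarrow> \<exists>K. \<forall>k\<ge>K. \<forall>z. regsym \<Psi> m (A k) z * w k (snd z) = 0"
    and \<Psi>: "\<Psi> \<in> cutoffs" and sg_def: "sg = (\<lambda>z. \<Sum>k. A k z * w k (snd z))"
  shows "integrable lborel (\<lambda>y. Finv (dilate (2 powr - real m) \<Psi>) y * sg (fst z - y, snd z))"
    and "nice u (regsym \<Psi> m sg)"
    and "\<phi> \<in> test \<Longrightarrow> (\<lambda>m. OP (regsym \<Psi> m sg) u \<phi>) \<longlonglongrightarrow> (\<Sum>k. transp u (w k) (C k) \<phi>)"
proof -
  have A: "Sym (A k)" and C: "Sym (C k)" for k using ac unfolding dual_def by auto
  have w: "Mul (w k)" for k using rC OM_reindex[of wt w "\<lambda>_::unit. k"] unfolding rapid_pair_def by auto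
  obtain K N where K: "K \<ge> 0" "\<And>k z. norm (A k z * w k (snd z)) \<le> K * wt2 z ^ N * (1 / 2) ^ k"
    using rapid_pair_pointwise[OF rA] by blast
  have gs: "summable (\<lambda>k. c * (1 / 2 :: real) ^ k)" for c by (intro summable_mult summable_geometric) simp
  \<comment> \<open>Averaging in x is an integral, so its exchange with the symbol series is a
    theorem on integrating series, here with a geometric majorant.\<close>
  have xm: "integrable lborel (\<lambda>y. Finv (dilate (2 powr - real m) \<Psi>) y * sg (fst z - y, snd z)) \<and>
     (\<lambda>k. xmult (dilate (2 powr - real m) \<Psi>) (A k) z * w k (snd z)) sums xmult (dilate (2 powr - real m) \<Psi>) sg z" for m z
  proof -
    let ?k = "Finv (dilate (2 powr - real m) \<Psi>)"
    have dS: "dilate (2 powr - real m) \<Psi> \<in> Schwartz"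
      using Schwartz_dilate[OF cutoffD(2)[OF \<Psi>], of "2 powr - real m" 0] by (simp add: dilate_def)
    have k: "?k \<in> Schwartz" by (rule Finv_Schwartz[OF dS])
    let ?f = "\<lambda>k y. ?k y * (A k (fst z - y, snd z) * w k (snd z))"
    have b: "norm (A k (fst z - y, snd z) * w k (snd z)) \<le> K * wt2 z ^ N * (1 / 2) ^ k" for k y
      using K(2)[of k "(fst z - y, snd z)"] by simp
    have bf: "norm (?f k y) \<le> norm (?k y) * (K * wt2 z ^ N * (1 / 2) ^ k)" for k y
      unfolding norm_mult[of "?k y"] by (rule mult_left_mono[OF b]) simp
    have i: "integrable lborel (?f k)" for k
    proof (rule Bochner_Integration.integrable_bound)
      show "integrable lborel (\<lambda>y. norm (?k y) * (K * wt2 z ^ N * (1 / 2) ^ k))"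
        by (intro integrable_mult_left integrable_norm Schwartz_integrable k)
      have "continuous_on UNIV (\<lambda>y. A k (fst z - y, snd z))"
        by (rule continuous_on_compose2[OF smooth_continuous[OF Sym_smooth[OF A], of UNIV]]) (auto intro!: continuous_intros)
      then show "?f k \<in> borel_measurable lborel"
        by (intro borel_measurable_times borel_measurable_const Schwartz_measurable k continuous_measurable)
      show "AE y in lborel. norm (?f k y) \<le> norm (norm (?k y) * (K * wt2 z ^ N * (1 / 2) ^ k))"
        by (rule AE_I2) (rule order_trans[OF bf], simp)
    qed
    have s1: "AE y in lborel. summable (\<lambda>k. norm (?f k y))"
    proof (rule AE_I2)
      fix y
      have "summable (\<lambda>k. (norm (?k y) * (K * wt2 z ^ N)) * (1 / 2) ^ k)" by (rule gs)
      then show "summable (\<lambda>k. norm (?f k y))"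
        by (rule summable_comparison_test'[where N = 0]) (use bf[where y = y] in \<open>simp add: mult.assoc\<close>)
    qed
    have s2: "summable (\<lambda>k. \<integral>y. norm (?f k y) \<partial>lborel)"
    proof (rule summable_comparison_test'[where N = 0])
      show "summable (\<lambda>k. ((\<integral>y. norm (?k y) \<partial>lborel) * (K * wt2 z ^ N)) * (1 / 2) ^ k)" by (rule gs)
      fix k :: nat
      have "(\<integral>y. norm (?f k y) \<partial>lborel) \<le> (\<integral>y. norm (?k y) * (K * wt2 z ^ N * (1 / 2) ^ k) \<partial>lborel)"
        by (rule integral_mono[OF integrable_norm[OF i] integrable_mult_left[OF integrable_norm[OF Schwartz_integrable[OF k]]] bf])
      then show "norm (\<integral>y. norm (?f k y) \<partial>lborel) \<le> ((\<integral>y. norm (?k y) \<partial>lborel) * (K * wt2 z ^ N)) * (1 / 2) ^ k"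
        by (simp add: mult.assoc)
    qed
    have ss: "summable (\<lambda>k. A k z' * w k (snd z'))" for z'
      by (rule summable_comparison_test'[OF gs[of "K * wt2 z' ^ N"], where N = 0]) (rule K(2))
    have e: "(\<lambda>y. \<Sum>k. ?f k y) = (\<lambda>y. ?k y * sg (fst z - y, snd z))"
    proof
      fix y
      show "(\<Sum>k. ?f k y) = ?k y * sg (fst z - y, snd z)"
        unfolding sg_def using suminf_mult[OF ss[of "(fst z - y, snd z)"], of "?k y"] by simp
    qed
    have "integral\<^sup>L lborel (?f k) = xmult (dilate (2 powr - real m) \<Psi>) (A k) z * w k (snd z)" for k
      unfolding xmult_def by (simp add: mult.assoc[symmetric])
    then show ?thesis
      using integrable_suminf[OF i s1 s2] sums_integral[OF i s1 s2] unfolding e by (simp add: xmult_def)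
  qed
  then show "integrable lborel (\<lambda>y. Finv (dilate (2 powr - real m) \<Psi>) y * sg (fst z - y, snd z))" by blast
  let ?r = "\<lambda>m k z. regsym \<Psi> m (A k) z * w k (snd z)"
  \<comment> \<open>The number of surviving terms depends on m, which is why a majorant uniform in m
    is still needed below.\<close>
  have reg: "\<exists>n. regsym \<Psi> m sg = (\<lambda>z. \<Sum>k<n. ?r m k z) \<and> (\<forall>k\<ge>n. ?r m k = (\<lambda>z. 0))" for m
  proof -
    obtain n where n: "\<And>k z. k \<ge> n \<Longrightarrow> ?r m k z = 0" using fin[OF \<Psi>, of m] by blast
    have "regsym \<Psi> m sg z = (\<Sum>k<n. ?r m k z)" for z
    proof -
      let ?p = "\<Psi> ((2 powr - real m) *\<^sub>R snd z)"
      have "(\<lambda>k. (xmult (dilate (2 powr - real m) \<Psi>) (A k) z * w k (snd z)) * ?p) sums (xmult (dilate (2 powr - real m) \<Psi>) sg z * ?p)"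
        using xm[of m z] by (intro sums_mult2) blast
      then have "(\<lambda>k. ?r m k z) sums regsym \<Psi> m sg z" by (simp add: regsym_def mult_ac)
      moreover have "(\<lambda>k. ?r m k z) sums (\<Sum>k<n. ?r m k z)" by (rule sums_finite) (use n in auto)
      ultimately show ?thesis by (rule sums_unique2)
    qed
    then show ?thesis using n by (intro exI[of _ n]) auto
  qed
  have nr: "nice u (?r m k)" for m k by (rule OP_regsym(1)[OF ac u \<Psi> w])
  obtain \<phi>0 :: "'a \<Rightarrow> complex" where \<phi>0: "\<phi>0 \<in> test" using cutoffD(1)[OF \<Psi>] by blast
  show "nice u (regsym \<Psi> m sg)"
  proof -
    obtain n where "regsym \<Psi> m sg = (\<lambda>z. \<Sum>k<n. ?r m k z)" using reg by blast
    then show ?thesis using nice_sum[OF u finite_lessThan nr \<phi>0] by simp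
  qed
  assume \<phi>: "\<phi> \<in> test"
  let ?e = "\<lambda>k m. transp u (\<lambda>\<eta>. \<Psi> ((2 powr - real m) *\<^sub>R \<eta>) * w k \<eta>) (conv (Finv \<Psi>) (2 powr - real m) (C k)) \<phi>"
  have OPs: "OP (regsym \<Psi> m sg) u \<phi> = (\<Sum>k. ?e k m)" for m
  proof -
    obtain n where n: "regsym \<Psi> m sg = (\<lambda>z. \<Sum>k<n. ?r m k z)" "\<And>k. k \<ge> n \<Longrightarrow> ?r m k = (\<lambda>z. 0)" using reg[of m] by blast
    have e: "?e k m = OP (?r m k) u \<phi>" for k by (rule OP_regsym(2)[OF ac u \<Psi> w \<phi>, symmetric])
    have "?e k m = 0" if "k \<notin> {..<n}" for k unfolding e using n(2)[of k] that nice_zero(2)[OF u] by simp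
    then have "(\<Sum>k. ?e k m) = (\<Sum>k<n. ?e k m)" by (intro suminf_finite) auto
    also have "\<dots> = OP (regsym \<Psi> m sg) u \<phi>"
      unfolding e n(1) using nice_sum[OF u finite_lessThan nr \<phi>] by simp
    finally show ?thesis by simp
  qed
  obtain B where B: "\<And>k m. norm (?e k m) \<le> B * (1 / 2) ^ k"
    using rapid_pair_reg_bound[OF rC u test_Schwartz[OF \<phi>] Mul_dilate[OF cutoffD(2)[OF \<Psi>]] Finv_Schwartz[OF cutoffD(2)[OF \<Psi>]]] by blast
  \<comment> \<open>Tannery's theorem with the majorant B 2^-k; each single term converges by
    \<open>transp_limit\<close>.\<close>
  have "(\<lambda>m. \<Sum>k. ?e k m) \<longlonglongrightarrow> (\<Sum>k. transp u (w k) (C k) \<phi>)"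
  proof (rule conjunct2[OF conjunct2[OF tannerys_theorem[OF _ _ gs[of B]]]])
    show "(\<lambda>m. ?e k m) \<longlonglongrightarrow> transp u (w k) (C k) \<phi>" for k by (rule transp_limit[OF u w C \<Psi> test_Schwartz[OF \<phi>]])
    show "\<forall>\<^sub>F (k, m) in sequentially \<times>\<^sub>F sequentially. norm (?e k m) \<le> B * (1 / 2) ^ k"
      by (rule always_eventually) (use B in auto)
  qed simp
  then show "(\<lambda>m. OP (regsym \<Psi> m sg) u \<phi>) \<longlonglongrightarrow> (\<Sum>k. transp u (w k) (C k) \<phi>)" unfolding OPs .
qed

lemma rapid_bound_summable:
  fixes x :: "nat \<Rightarrow> complex"
  assumes "\<And>k. 2 powr (real k * real 1) * norm (x k) \<le> K"
  shows "summable x" "norm (\<Sum>k. x k) \<le> 2 * K"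
proof -
  have b: "norm (x k) \<le> K * (1 / 2) ^ k" for k by (rule norm_le_half_pow) (use assms[of k] in simp)
  have g: "(\<lambda>k. K * (1 / 2 :: real) ^ k) sums (K * 2)"
    using sums_mult[OF geometric_sums[of "1/2 :: real"], of K] by simp
  show "summable x" by (rule summable_comparison_test'[OF sums_summable[OF g], where N = 0]) (rule b)
  have "norm (\<Sum>k. x k) \<le> (\<Sum>k. K * (1 / 2) ^ k)" by (rule norm_suminf_le[OF b sums_summable[OF g]])
  then show "norm (\<Sum>k. x k) \<le> 2 * K" using sums_unique[OF g] by simp
qed

text \<open>The geometric bound holds with one constant along a whole bounded sequence of Schwartz
  functions, so the sum is bounded there and \<open>temperedI\<close> applies.\<close>

lemma tempered_series:
  assumes u: "tempered u" and rp: "rapid_pair w C"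
  shows "tempered (\<lambda>\<phi>. \<Sum>k. transp u (w k) (C k) \<phi>)" "\<phi> \<in> Schwartz \<Longrightarrow> summable (\<lambda>k. transp u (w k) (C k) \<phi>)"
proof -
  have w: "Mul (w k)" and C: "Sym (C k)" for k
    using rp OM_reindex[of wt w "\<lambda>_::unit. k"] OM_reindex[of wt2 C "\<lambda>_::unit. k"] unfolding rapid_pair_def by auto
  have s: "summable (\<lambda>k. transp u (w k) (C k) \<phi>)" if \<phi>: "\<phi> \<in> Schwartz" for \<phi>
  proof -
    obtain K where K: "\<And>k (i::unit). 2 powr (real k * real 1) * norm (transp u (w k) (C k) \<phi>) \<le> K"
      using rapid_pair_bound[OF rp u Schwartz_RD_const[OF \<phi>], of 1] by blast
    show ?thesis by (rule rapid_bound_summable(1)[OF K])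
  qed
  then show "\<phi> \<in> Schwartz \<Longrightarrow> summable (\<lambda>k. transp u (w k) (C k) \<phi>)" by blast
  note T = tempered_transp[OF u w C]
  show "tempered (\<lambda>\<phi>. \<Sum>k. transp u (w k) (C k) \<phi>)"
  proof (rule temperedI)
    show "(\<Sum>k. transp u (w k) (C k) \<phi>) = 0" if "\<phi> \<notin> Schwartz" for \<phi> using that by (simp add: transp_def)
    show "(\<Sum>k. transp u (w k) (C k) (\<lambda>x. \<phi> x + g x)) = (\<Sum>k. transp u (w k) (C k) \<phi>) + (\<Sum>k. transp u (w k) (C k) g)"
      if "\<phi> \<in> Schwartz" "g \<in> Schwartz" for \<phi> g
      unfolding tempered_add[OF T that] by (rule suminf_add[OF s s, symmetric]) (rule that)+
    show "(\<Sum>k. transp u (w k) (C k) (\<lambda>x. c * \<phi> x)) = c * (\<Sum>k. transp u (w k) (C k) \<phi>)" if "\<phi> \<in> Schwartz" for \<phi> c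
      unfolding tempered_cmult[OF T that] by (rule suminf_mult[OF s[OF that]])
    fix f :: "nat \<Rightarrow> 'a \<Rightarrow> complex" assume f: "RD wt f"
    obtain K where K: "\<And>k i. 2 powr (real k * real 1) * norm (transp u (w k) (C k) (f i)) \<le> K"
      using rapid_pair_bound[OF rp u f, of 1] by blast
    have "norm (\<Sum>k. transp u (w k) (C k) (f i)) \<le> 2 * K" for i by (rule rapid_bound_summable(2)[OF K])
    then show "\<exists>C'. \<forall>i. norm (\<Sum>k. transp u (w k) (C k) (f i)) \<le> C'" by blast
  qed
qed

lemma rapid_convI:
  fixes T :: "('a::euclidean_space \<Rightarrow> complex) \<Rightarrow> complex"
  assumes D: "\<And>k. tempered (D k)" and T: "tempered T"
    and bd: "\<And>\<phi> N. \<phi> \<in> Schwartz \<Longrightarrow> \<exists>K. \<forall>k. 2 powr (real k * real N) * norm (D k \<phi>) \<le> K"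
    and sums: "\<And>\<phi>. \<phi> \<in> Schwartz \<Longrightarrow> (\<lambda>k. D k \<phi>) sums T \<phi>"
  shows "rapid_conv (\<lambda>k. res (D k)) (res T)"
  unfolding rapid_conv_def text_ext_res[OF D] text_ext_res[OF T]
proof (intro conjI allI ballI impI)
  show "\<exists>S. extends_to (res (D k)) S" for k using extends_res[OF D] by blast
  show "\<exists>S. extends_to (res T) S" using extends_res[OF T] by blast
  fix \<phi> :: "'a \<Rightarrow> complex" assume \<phi>: "\<phi> \<in> Schwartz"
  show "(\<lambda>k. D k \<phi>) sums T \<phi>" by (rule sums[OF \<phi>])
  fix N :: real assume N: "N > 0"
  \<comment> \<open>The exponent is at least \<open>N\<close>, which gives the decay of the tail in
    k, and at least 1, which leaves 2^-j for summing over j.\<close>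
  define n where "n = nat \<lceil>N\<rceil>"
  have n: "real n \<ge> N" "real n \<ge> 1" unfolding n_def using N by (linarith, simp add: Suc_le_eq)
  obtain K where K: "\<And>k. 2 powr (real k * real n) * norm (D k \<phi>) \<le> K" using bd[OF \<phi>, of n] by blast
  have "norm (\<Sum>j. D (j + k) \<phi>) \<le> (2 * K) * 2 powr (- (real k * N))" for k
  proof -
    have b: "norm (D (j + k) \<phi>) \<le> K * 2 powr (- (real k * N)) * (1 / 2) ^ j" for j
    proof (rule norm_le_half_pow)
      have "real j + real k * N \<le> real (j + k) * real n"
        using mult_mono[of 1 "real n" "real j" "real j"] mult_left_mono[OF n(1), of "real k"] n(2) by (simp add: algebra_simps)
      then have "2 powr (real j + real k * N) * norm (D (j + k) \<phi>) \<le> 2 powr (real (j + k) * real n) * norm (D (j + k) \<phi>)"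
        by (intro mult_right_mono powr_mono) auto
      also have "\<dots> \<le> K" by (rule K)
      finally have "2 powr real j * norm (D (j + k) \<phi>) * 2 powr (real k * N) \<le> K" by (simp add: powr_add mult_ac)
      then have "2 powr real j * norm (D (j + k) \<phi>) \<le> K / 2 powr (real k * N)" by (simp add: pos_le_divide_eq)
      then show "norm (complex_of_real (2 powr real j)) * norm (D (j + k) \<phi>) \<le> K * 2 powr (- (real k * N))"
        by (simp add: powr_minus divide_inverse)
    qed
    have g: "(\<lambda>j. K * 2 powr (- (real k * N)) * (1 / 2 :: real) ^ j) sums (K * 2 powr (- (real k * N)) * 2)"
      using sums_mult[OF geometric_sums[of "1/2 :: real"], of "K * 2 powr (- (real k * N))"] by simp
    have "norm (\<Sum>j. D (j + k) \<phi>) \<le> (\<Sum>j. K * 2 powr (- (real k * N)) * (1 / 2) ^ j)"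
      by (rule norm_suminf_le[OF b sums_summable[OF g]])
    then show ?thesis using sums_unique[OF g] by simp
  qed
  then show "\<exists>C. \<forall>k. norm (\<Sum>j. D (j + k) \<phi>) \<le> C * 2 powr (- (real k * N))" by blast
qed

section \<open>Littlewood--Paley pieces\<close>

text \<open>The index is an integer, so that k - 1 and k - h may be negative; the value 0 there
  encodes the convention that such pieces vanish.\<close>

definition lowpass :: "('a::euclidean_space \<Rightarrow> complex) \<Rightarrow> int \<Rightarrow> 'a \<Rightarrow> complex" where
  "lowpass \<psi> k = (if k < 0 then (\<lambda>_. 0) else dilate (2 powr - real_of_int k) \<psi>)"

text \<open>As a difference of consecutive low passes it yields \<psi> at index 0 and dilates of
  \<open>phi \<psi>\<close> at positive indices in one formula, and telescoping sums need no case
  distinction.\<close>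

definition bandpass :: "('a::euclidean_space \<Rightarrow> complex) \<Rightarrow> int \<Rightarrow> 'a \<Rightarrow> complex" where
  "bandpass \<psi> k = (\<lambda>\<xi>. lowpass \<psi> k \<xi> - lowpass \<psi> (k - 1) \<xi>)"

lemma dilate_Schwartz: "\<psi> \<in> Schwartz \<Longrightarrow> t \<noteq> 0 \<Longrightarrow> dilate t \<psi> \<in> Schwartz"
  using Schwartz_dilate[of \<psi> t 0] by (simp add: dilate_def)

lemma lowpass_Schwartz: "\<psi> \<in> Schwartz \<Longrightarrow> lowpass \<psi> k \<in> Schwartz"
  by (cases "k < 0") (simp_all add: lowpass_def Schwartz_zero dilate_Schwartz)

lemma bandpass_Schwartz: "\<psi> \<in> Schwartz \<Longrightarrow> bandpass \<psi> k \<in> Schwartz"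
  unfolding bandpass_def by (intro Schwartz_diff lowpass_Schwartz)

lemma bandpass_pos: "k > 0 \<Longrightarrow> bandpass \<psi> k = dilate (2 powr - real_of_int k) (phi \<psi>)"
proof -
  assume k: "k > 0"
  have "2 powr - real_of_int (k - 1) = 2 * 2 powr - real_of_int k"
    using powr_add[of 2 1 "- real_of_int k"] by simp
  then show ?thesis using k by (simp add: bandpass_def lowpass_def dilate_def phi_def fun_eq_iff)
qed

lemma bandpass_zero: "bandpass \<psi> 0 = \<psi>"
  by (simp add: bandpass_def lowpass_def dilate_def)

lemma bandpass_neg: "k < 0 \<Longrightarrow> bandpass \<psi> k = (\<lambda>_. 0)"
  by (simp add: bandpass_def lowpass_def)

lemma xmult_zero: "xmult (\<lambda>_. 0) a = (\<lambda>z. 0)"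
  by (simp add: xmult_def Finv_def)

lemma fmult_zero: "tempered u \<Longrightarrow> fmult (\<lambda>_. 0) u = dzero"
  using tempered_zero[of u]
  by (auto simp: fun_eq_iff fmult_def Finv_dist_def mult_dist_def Four_dist_def dzero_def Schwartz_zero Four_def[abs_def] Finv_Schwartz)

lemma sym_up_lowpass: "sym_up \<psi> a k = xmult (lowpass \<psi> k) a"
  by (simp add: sym_up_def lowpass_def xmult_zero)

lemma sym_low_bandpass: "sym_low \<psi> a k = xmult (bandpass \<psi> k) a"
proof -
  consider "k < 0" | "k = 0" | "k > 0" by linarith
  then show ?thesis by cases (simp_all add: sym_low_def bandpass_neg bandpass_zero bandpass_pos xmult_zero)
qed

lemma dist_up_lowpass: "tempered u \<Longrightarrow> dist_up \<psi> u k = fmult (lowpass \<psi> k) u"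
  by (simp add: dist_up_def lowpass_def fmult_zero)

lemma dist_low_bandpass: "tempered u \<Longrightarrow> dist_low \<psi> u k = fmult (bandpass \<psi> k) u"
proof -
  assume u: "tempered u"
  consider "k < 0" | "k = 0" | "k > 0" by linarith
  then show ?thesis by cases (simp_all add: dist_low_def bandpass_neg bandpass_zero bandpass_pos fmult_zero[OF u])
qed

lemma conv_Finv_dilate: "m \<in> Schwartz \<Longrightarrow> Sym b \<Longrightarrow> t > 0 \<Longrightarrow> conv (Finv (dilate t m)) 1 b = conv (Finv m) t b"
  using xmult_dilate[of m b t] xmult_conv[OF dilate_Schwartz[of m t], of b] by simp

lemma conv_Finv_zero: "conv (Finv (\<lambda>_. 0)) t b = (\<lambda>z. 0)"
  by (simp add: conv_def Finv_def fun_eq_iff)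

lemma conv_Finv_diff:
  assumes "m \<in> Schwartz" "m' \<in> Schwartz" "Sym b"
  shows "conv (Finv (\<lambda>\<xi>. m \<xi> - m' \<xi>)) t b = (\<lambda>z. conv (Finv m) t b z - conv (Finv m') t b z)"
  unfolding conv_def fun_eq_iff Finv_diff[OF assms(1,2)] left_diff_distrib
  using Bochner_Integration.integral_diff[OF conv_integrable[OF Finv_Schwartz[OF assms(1)] assms(3)] conv_integrable[OF Finv_Schwartz[OF assms(2)] assms(3)]] by blast

lemma OM_zero: "OM p (\<lambda>i x. 0)"
  by (rule fam_zero, rule OMq_zero)

lemma OM_lowpass:
  assumes \<psi>: "\<psi> \<in> Schwartz"
  shows "OM wt (lowpass \<psi>)"
proof -
  have "OM wt (\<lambda>k::int. if k < 0 then (\<lambda>_. 0) else (\<lambda>x. \<psi> ((2 powr - real (nat k)) *\<^sub>R x)))"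
    by (rule OM_if[OF OM_zero OM_reindex[OF Mul_dilate[OF \<psi>]]]) simp
  also have "(\<lambda>k::int. if k < 0 then (\<lambda>_. 0) else (\<lambda>x. \<psi> ((2 powr - real (nat k)) *\<^sub>R x))) = lowpass \<psi>"
    by (auto simp: lowpass_def dilate_def fun_eq_iff)
  finally show ?thesis .
qed

lemma OM_conv_lowpass:
  assumes \<psi>: "\<psi> \<in> Schwartz" and c: "Sym c"
  shows "OM wt2 (\<lambda>k. conv (Finv (lowpass \<psi> k)) 1 c)"
proof -
  have "OM wt2 (\<lambda>k::int. if k < 0 then (\<lambda>_. 0) else conv (Finv \<psi>) (2 powr - real_of_int k) c)"
    by (rule OM_if[OF OM_zero OM_conv[OF Finv_Schwartz[OF \<psi>] OM_const_index[OF c]]]) simp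
  also have "(\<lambda>k::int. if k < 0 then (\<lambda>_. 0) else conv (Finv \<psi>) (2 powr - real_of_int k) c) = (\<lambda>k. conv (Finv (lowpass \<psi> k)) 1 c)"
    by (auto simp: lowpass_def conv_Finv_zero conv_Finv_dilate[OF \<psi> c])
  finally show ?thesis .
qed

lemma modulationD:
  assumes "modulation \<psi> r R"
  shows "\<psi> \<in> cutoffs" "\<psi> \<in> Schwartz" "smooth (phi \<psi>)" "phi \<psi> \<in> Schwartz"
    "\<And>\<xi>. R < norm \<xi> \<Longrightarrow> phi \<psi> \<xi> = 0" "\<And>\<xi>. norm \<xi> < r / 2 \<Longrightarrow> phi \<psi> \<xi> = 0" "0 < r"
proof -
  have m: "\<psi> \<in> test" "0 < r" "r < R" "1 \<le> R" "\<And>\<xi>. norm \<xi> \<le> r \<Longrightarrow> \<psi> \<xi> = 1" "\<And>\<xi>. norm \<xi> \<ge> R \<Longrightarrow> \<psi> \<xi> = 0"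
    using assms unfolding modulation_def by auto
  show "\<psi> \<in> cutoffs" unfolding cutoffs_def using m by (intro CollectI conjI exI[of _ r]) auto
  show S: "\<psi> \<in> Schwartz" by (rule test_Schwartz[OF m(1)])
  have "(\<lambda>\<xi>. \<psi> \<xi> - dilate 2 \<psi> \<xi>) \<in> Schwartz" by (intro Schwartz_diff S dilate_Schwartz) auto
  then show P: "phi \<psi> \<in> Schwartz" by (simp add: phi_def dilate_def)
  then show "smooth (phi \<psi>)" by (rule Schwartz_smooth)
  show "phi \<psi> \<xi> = 0" if "R < norm \<xi>" for \<xi> using m(6)[of \<xi>] m(6)[of "2 *\<^sub>R \<xi>"] that norm_ge_zero[of \<xi>] by (simp add: phi_def)
  show "phi \<psi> \<xi> = 0" if "norm \<xi> < r / 2" for \<xi> using m(5)[of \<xi>] m(5)[of "2 *\<^sub>R \<xi>"] that m(2) by (simp add: phi_def)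
  show "0 < r" by (rule m(2))
qed

text \<open>For k > 0 the profile \<open>phi \<psi>\<close> vanishes for |\<xi>| < r/2, so
  \<open>OM_dilate_rapid\<close> applies. At k = 0 the profile \<psi> does not vanish near 0, but
  there the factor is 1.\<close>

lemma OM_bandpass_rapid:
  assumes mod: "modulation \<psi> r R"
  shows "OM wt (\<lambda>k \<eta>. complex_of_real (2 powr (real_of_int k * real N)) * bandpass \<psi> k \<eta>)"
proof -
  note M = modulationD[OF mod]
  have "OM wt (\<lambda>k \<xi>. complex_of_real (2 powr (real k * real N)) * phi \<psi> ((2 powr - real k) *\<^sub>R \<xi>))"
    by (rule OM_dilate_rapid[where r = R and \<epsilon> = "r / 2", OF M(3,5,6)]) (use M(7) in auto)
  then have 1: "OM wt (\<lambda>k::int. \<lambda>\<xi>. complex_of_real (2 powr (real (nat k) * real N)) * phi \<psi> ((2 powr - real (nat k)) *\<^sub>R \<xi>))"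
    by (rule OM_reindex[where r = nat])
  have "OM wt (\<lambda>k::int. if k < 0 then (\<lambda>_. 0) else if k = 0 then \<psi> else
      (\<lambda>\<xi>. complex_of_real (2 powr (real (nat k) * real N)) * phi \<psi> ((2 powr - real (nat k)) *\<^sub>R \<xi>)))"
    by (rule OM_if[OF OM_zero OM_if[OF Schwartz_OM[OF M(2)] 1]]) auto
  also have "(\<lambda>k::int. if k < 0 then (\<lambda>_. 0) else if k = 0 then \<psi> else
      (\<lambda>\<xi>. complex_of_real (2 powr (real (nat k) * real N)) * phi \<psi> ((2 powr - real (nat k)) *\<^sub>R \<xi>)))
    = (\<lambda>k \<eta>. complex_of_real (2 powr (real_of_int k * real N)) * bandpass \<psi> k \<eta>)"
    by (intro ext) (auto simp: bandpass_neg bandpass_zero bandpass_pos dilate_def)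
  finally show ?thesis .
qed

text \<open>The counterpart in the x-frequency, with \<open>OM_conv_rapid\<close> in place of
  \<open>OM_dilate_rapid\<close>; again index 0 carries the factor 1.\<close>

lemma OM_conv_bandpass_rapid:
  assumes mod: "modulation \<psi> r R" and c: "Sym c"
  shows "OM wt2 (\<lambda>k z. complex_of_real (2 powr (real_of_int k * real N)) * conv (Finv (bandpass \<psi> k)) 1 c z)"
proof -
  note M = modulationD[OF mod]
  have "OM wt2 (\<lambda>k z. complex_of_real (2 powr (real k * real N)) * conv (Finv (phi \<psi>)) (2 powr - real k) c z)"
    by (rule OM_conv_rapid[where \<epsilon> = "r / 2", OF M(4) _ M(6) OM_const_index[OF c]]) (use M(7) in auto)
  then have 1: "OM wt2 (\<lambda>k::int. \<lambda>z. complex_of_real (2 powr (real (nat k) * real N)) * conv (Finv (phi \<psi>)) (2 powr - real (nat k)) c z)"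
    by (rule OM_reindex[where r = nat])
  have "OM wt2 (\<lambda>k::int. if k < 0 then (\<lambda>_. 0) else if k = 0 then conv (Finv \<psi>) 1 c else
      (\<lambda>z. complex_of_real (2 powr (real (nat k) * real N)) * conv (Finv (phi \<psi>)) (2 powr - real (nat k)) c z))"
    by (rule OM_if[OF OM_zero OM_if[OF OM_const_index[OF Sym_conv[OF Finv_Schwartz[OF M(2)] c]] 1]]) auto
  also have "(\<lambda>k::int. if k < 0 then (\<lambda>_. 0) else if k = 0 then conv (Finv \<psi>) 1 c else
      (\<lambda>z. complex_of_real (2 powr (real (nat k) * real N)) * conv (Finv (phi \<psi>)) (2 powr - real (nat k)) c z))
    = (\<lambda>k z. complex_of_real (2 powr (real_of_int k * real N)) * conv (Finv (bandpass \<psi> k)) 1 c z)"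
    by (intro ext) (auto simp: bandpass_neg bandpass_zero bandpass_pos conv_Finv_zero conv_Finv_dilate[OF M(4) c])
  finally show ?thesis .
qed

text \<open>The dilated cutoff lives in |\<xi>| <= \<rho> 2^m and the band of index k in |\<xi>| >=
  2^k r/2.\<close>

lemma bandpass_cutoff_disjoint:
  fixes \<psi> :: "'a::euclidean_space \<Rightarrow> complex"
  assumes mod: "modulation \<psi> r R" and \<Psi>: "\<Psi> \<in> cutoffs"
  shows "\<exists>K. \<forall>k\<ge>K. \<forall>\<xi>. \<Psi> ((2 powr - real m) *\<^sub>R \<xi>) * bandpass \<psi> (int k) \<xi> = 0"
proof -
  note M = modulationD[OF mod]
  obtain \<rho> where \<rho>: "\<rho> > 0" "\<And>x. \<rho> < norm x \<Longrightarrow> \<Psi> x = 0" using test_support[OF cutoffD(1)[OF \<Psi>]] by blast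
  obtain K where K: "2 ^ K > \<rho> * 2 ^ m / (r / 2)" using real_arch_pow[of 2] by auto
  \<comment> \<open>\<open>Suc K\<close> rather than \<open>K\<close> ensures a positive index,
    where the band is a dilate of \<open>phi \<psi>\<close>.\<close>
  have "\<Psi> ((2 powr - real m) *\<^sub>R \<xi>) * bandpass \<psi> (int k) \<xi> = 0" if k: "k \<ge> Suc K" for k \<xi>
  proof (cases "\<rho> < norm ((2 powr - real m) *\<^sub>R \<xi>)")
    case False
    then have "norm \<xi> \<le> \<rho> * 2 ^ m" by (simp add: powr_minus powr_realpow field_simps)
    also have "\<dots> < 2 ^ K * (r / 2)" using K M(7) by (simp add: field_simps)
    also have "\<dots> \<le> 2 ^ k * (r / 2)" using k M(7) by (intro mult_right_mono power_increasing) auto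
    finally have "norm ((2 powr - real k) *\<^sub>R \<xi>) < r / 2" by (simp add: powr_minus powr_realpow field_simps)
    then have "phi \<psi> ((2 powr - real k) *\<^sub>R \<xi>) = 0" by (rule M(6))
    then show ?thesis using k by (simp add: bandpass_pos dilate_def)
  qed (simp add: \<rho>(2))
  then show ?thesis by blast
qed

lemma Mul_lowpass: "\<psi> \<in> Schwartz \<Longrightarrow> Mul (lowpass \<psi> k)"
  by (rule Mul_Schwartz[OF lowpass_Schwartz])

lemma fmult_diff:
  assumes u: "tempered u" and m: "Mul m" and m': "Mul m'"
  shows "ddiff (fmult m u) (fmult m' u) = fmult (\<lambda>\<xi>. m \<xi> - m' \<xi>) u"
proof
  fix \<phi>
  have mm: "Mul (\<lambda>\<xi>. m \<xi> - m' \<xi>)" by (rule OM_diff[OF m m']) auto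
  show "ddiff (fmult m u) (fmult m' u) \<phi> = fmult (\<lambda>\<xi>. m \<xi> - m' \<xi>) u \<phi>"
  proof (cases "\<phi> \<in> Schwartz")
    case True
    have S: "(\<lambda>x. m x * Finv \<phi> x) \<in> Schwartz" "(\<lambda>x. m' x * Finv \<phi> x) \<in> Schwartz"
      by (intro Schwartz_mult m m' Finv_Schwartz True)+
    show ?thesis unfolding ddiff_def fmult_apply[OF m True] fmult_apply[OF m' True] fmult_apply[OF mm True] left_diff_distrib Four_diff[OF S]
      by (rule tempered_diff[OF u Four_Schwartz[OF S(1)] Four_Schwartz[OF S(2)], symmetric])
  qed (simp add: ddiff_def fmult_def Finv_dist_def)
qed

lemma transp_diff_w: "tempered u \<Longrightarrow> Mul w \<Longrightarrow> Mul w' \<Longrightarrow> Sym c \<Longrightarrow> transp u (\<lambda>\<eta>. w \<eta> - w' \<eta>) c \<phi> = transp u w c \<phi> - transp u w' c \<phi>"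
  using transp_lin_w[of u w w' c 1 \<phi>] by simp

lemma transp_diff_c: "tempered u \<Longrightarrow> Mul w \<Longrightarrow> Sym c \<Longrightarrow> Sym c' \<Longrightarrow> transp u w (\<lambda>z. c z - c' z) \<phi> = transp u w c \<phi> - transp u w c' \<phi>"
  using transp_lin_c[of u w c c' 1 \<phi>] by simp

lemma transp_zero_w: "tempered u \<Longrightarrow> Sym c \<Longrightarrow> transp u (\<lambda>_. 0) c \<phi> = 0"
  using transp_scale_w[of u "\<lambda>_. 0" c 0 \<phi>] OM_zero[of wt] by simp

lemma transp_zero_c: "tempered u \<Longrightarrow> Mul w \<Longrightarrow> transp u w (\<lambda>_. 0) \<phi> = 0"
  using transp_scale_c[of u w "\<lambda>_. 0" 0 \<phi>] Sym_zero by simp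

section \<open>The paradifferential decomposition\<close>

text \<open>The tempered form of m(D_x)a applied to w(D)u. It is linear in \<open>w\<close> and in
  \<open>m\<close> separately, which is what the telescoping argument uses.\<close>

definition piece :: "(('a::euclidean_space \<Rightarrow> complex) \<Rightarrow> complex) \<Rightarrow> ('a \<times> 'a \<Rightarrow> complex) \<Rightarrow> ('a \<Rightarrow> complex) \<Rightarrow> ('a \<Rightarrow> complex) \<Rightarrow> ('a \<Rightarrow> complex) \<Rightarrow> complex" where
  "piece u c w m = transp u w (conv (Finv m) 1 c)"

lemma Sym_conv_Finv: "m \<in> Schwartz \<Longrightarrow> Sym c \<Longrightarrow> Sym (conv (Finv m) t c)"
  by (rule Sym_conv[OF Finv_Schwartz])

lemma tempered_piece: "tempered u \<Longrightarrow> Sym c \<Longrightarrow> w \<in> Schwartz \<Longrightarrow> m \<in> Schwartz \<Longrightarrow> tempered (piece u c w m)"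
  unfolding piece_def by (intro tempered_transp Mul_Schwartz Sym_conv_Finv)

lemma piece_diff_w:
  "tempered u \<Longrightarrow> Sym c \<Longrightarrow> w \<in> Schwartz \<Longrightarrow> w' \<in> Schwartz \<Longrightarrow> m \<in> Schwartz \<Longrightarrow>
   piece u c (\<lambda>\<eta>. w \<eta> - w' \<eta>) m \<phi> = piece u c w m \<phi> - piece u c w' m \<phi>"
  unfolding piece_def by (intro transp_diff_w Mul_Schwartz Sym_conv_Finv)

lemma piece_diff_m:
  assumes u: "tempered u" and c: "Sym c" and w: "w \<in> Schwartz" and m: "m \<in> Schwartz" and m': "m' \<in> Schwartz"
  shows "piece u c w (\<lambda>\<eta>. m \<eta> - m' \<eta>) \<phi> = piece u c w m \<phi> - piece u c w m' \<phi>"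
  unfolding piece_def conv_Finv_diff[OF m m' c]
  by (rule transp_diff_c[OF u Mul_Schwartz[OF w] Sym_conv_Finv[OF m c] Sym_conv_Finv[OF m' c]])

lemma piece_zero_w: "tempered u \<Longrightarrow> Sym c \<Longrightarrow> m \<in> Schwartz \<Longrightarrow> piece u c (\<lambda>_. 0) m \<phi> = 0"
  unfolding piece_def by (intro transp_zero_w Sym_conv_Finv)

lemma piece_zero_m: "tempered u \<Longrightarrow> w \<in> Schwartz \<Longrightarrow> piece u c w (\<lambda>_. 0) \<phi> = 0"
  unfolding piece_def conv_Finv_zero by (intro transp_zero_c Mul_Schwartz)

lemma tempered_fdist:
  fixes f :: "'a::euclidean_space \<Rightarrow> complex"
  assumes f: "f \<in> Schwartz"
  shows "tempered (fdist f)"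
proof (rule temperedI)
  have i: "integrable lborel (\<lambda>x. f x * \<phi> x)" if "\<phi> \<in> Schwartz" for \<phi>
    by (rule Schwartz_integrable[OF Schwartz_mult[OF Mul_Schwartz[OF f] that]])
  show "fdist f (\<lambda>x. \<phi> x + g x) = fdist f \<phi> + fdist f g" if "\<phi> \<in> Schwartz" "g \<in> Schwartz" for \<phi> g
    using Bochner_Integration.integral_add[OF i[OF that(1)] i[OF that(2)]] Schwartz_add[OF that] that
    by (simp add: fdist_def distrib_left)
  show "fdist f (\<lambda>x. c * \<phi> x) = c * fdist f \<phi>" if "\<phi> \<in> Schwartz" for \<phi> c
    using that Schwartz_cmult[OF that] by (simp add: fdist_def mult.left_commute)
  fix g :: "nat \<Rightarrow> 'a \<Rightarrow> complex" assume g: "RD wt g"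
  have "RD wt (\<lambda>i x. f x * g i x)" by (rule RD_mult[OF Schwartz_OM[OF f] g]) simp
  \<comment> \<open>A pairing is the value at frequency 0 of a Fourier transform, so the uniform
    bound for transforms of a bounded family bounds all pairings.\<close>
  then obtain C where C: "\<And>i x. wt x ^ 0 * norm (Four (\<lambda>x. f x * g i x) x) \<le> C"
    using RDqE[OF fam_Q[OF RD_Four], where k = 0] by blast
  have "norm (fdist f (g i)) \<le> C" for i
    using C[of 0 i] RD_Schwartz[OF g, of i] by (simp add: fdist_def Four_def)
  then show "\<exists>C. \<forall>i. norm (fdist f (g i)) \<le> C" by blast
qed (simp add: fdist_def)

text \<open>Conjugating \<open>Qop c\<close> on both sides gives the ordinary operator with symbol
  \<open>b\<close>, so \<open>g\<close> is b(x,D)\<phi>. The duality for \<open>b\<close> provided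
  by \<open>dual_cnj\<close> shows that the type 1,1-definition yields the same function.\<close>

lemma typ11_dual_test:
  assumes ac: "dual a c" and \<phi>: "\<phi> \<in> Schwartz"
  defines "b \<equiv> \<lambda>z. cnj (c z)" and "g \<equiv> \<lambda>x. cnj (Qop c (\<lambda>x. cnj (\<phi> x)) x)"
  shows "g \<in> Schwartz" "fdist \<phi> \<in> dom11 b" "extends_to (typ11 b (fdist \<phi>)) (fdist g)"
    and "tempered u \<Longrightarrow> text_ext (typ11 a u) (\<lambda>x. cnj (\<phi> x)) = u (\<lambda>x. cnj (g x))"
proof -
  have c: "Sym c" and a: "Sym a" using ac unfolding dual_def by auto
  let ?ca = "\<lambda>z. cnj (a z)"
  have ca: "Sym ?ca" by (rule OM_cnj[OF a])
  have d: "dual b ?ca" unfolding b_def by (rule dual_cnj[OF ac])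
  note p = Schwartz_cnj[OF \<phi>]
  note t = tempered_fdist[OF \<phi>]
  show g: "g \<in> Schwartz" unfolding g_def by (intro Schwartz_cnj Qop_Schwartz c p)
  show "fdist \<phi> \<in> dom11 b" by (rule dual_typ11(1)[OF d t])
  have "fdist \<phi> (Qop ?ca \<omega>) = fdist g \<omega>" if \<omega>: "\<omega> \<in> Schwartz" for \<omega>
  proof -
    have "fdist \<phi> (Qop ?ca \<omega>) = pairing (-1) ?ca \<phi> (Finv \<omega>)"
      using pairing_Qop[OF ca \<phi> \<omega>] Qop_Schwartz[OF ca \<omega>] by (simp add: fdist_def)
    also have "\<dots> = fconst TYPE('a) * pairing 1 b \<omega> (Four \<phi>)"
      using d \<omega> \<phi> unfolding dual_def by simp
    also have "\<dots> = pairing 1 b \<omega> (\<lambda>\<xi>. cnj (Finv (\<lambda>x. cnj (\<phi> x)) \<xi>))"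
      unfolding cnj_Finv_cnj pairing_cmult ..
    also have "\<dots> = cnj (pairing (-1) c (\<lambda>x. cnj (\<omega> x)) (Finv (\<lambda>x. cnj (\<phi> x))))"
      unfolding pairing_cnj b_def by simp
    also have "\<dots> = cnj (\<integral>x. cnj (\<omega> x) * Qop c (\<lambda>x. cnj (\<phi> x)) x \<partial>lborel)"
      unfolding pairing_Qop[OF c Schwartz_cnj[OF \<omega>] p] ..
    also have "\<dots> = fdist g \<omega>"
      using \<omega> unfolding fdist_def g_def Bochner_Integration.integral_cnj[symmetric] by (simp add: mult.commute)
    finally show ?thesis .
  qed
  then have "transp (fdist \<phi>) (\<lambda>_. 1) ?ca = fdist g"
    using transp_one[OF t ca] by (intro ext) (auto simp: transp_def fdist_def)
  then have "typ11 b (fdist \<phi>) = res (fdist g)" using dual_typ11(2)[OF d t] by simp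
  then show "extends_to (typ11 b (fdist \<phi>)) (fdist g)" using extends_res[OF tempered_fdist[OF g]] by simp
  assume u: "tempered u"
  show "text_ext (typ11 a u) (\<lambda>x. cnj (\<phi> x)) = u (\<lambda>x. cnj (g x))"
    unfolding dual_typ11(2)[OF ac u] text_ext_res[OF tempered_transp[OF u Mul_one c]] transp_one[OF u c p] by (simp add: g_def)
qed

lemma xmult_diff:
  assumes "m \<in> Schwartz" "m' \<in> Schwartz" "Sym a"
  shows "sym_diff (xmult m a) (xmult m' a) = xmult (\<lambda>\<xi>. m \<xi> - m' \<xi>) a"
  unfolding sym_diff_def xmult_conv[OF Schwartz_diff[OF assms(1,2)] assms(3)] conv_Finv_diff[OF assms]
    xmult_conv[OF assms(1,3)] xmult_conv[OF assms(2,3)] ..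

lemma res_zero: "(\<And>\<phi>. T \<phi> = 0) \<Longrightarrow> res T = dzero"
  by (simp add: res_def dzero_def fun_eq_iff)

lemma res_add: "dadd (res S) (res T) = res (\<lambda>\<phi>. S \<phi> + T \<phi>)"
  by (simp add: res_def dadd_def fun_eq_iff)

lemma tempered_plus: "tempered S \<Longrightarrow> tempered T \<Longrightarrow> tempered (\<lambda>\<phi>. S \<phi> + s * T \<phi>)"
proof -
  assume S: "tempered S" and T: "tempered T"
  show ?thesis
  proof (rule temperedI)
    fix f :: "nat \<Rightarrow> 'a \<Rightarrow> complex" assume f: "RD wt f"
    obtain A where A: "\<And>i. norm (S (f i)) \<le> A" using tempered_bounded[OF S f] by blast
    obtain B where B: "\<And>i. norm (T (f i)) \<le> B" using tempered_bounded[OF T f] by blast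
    have "norm (S (f i) + s * T (f i)) \<le> A + norm s * B" for i
      by (rule norm_triangle_le) (simp add: norm_mult add_mono A B mult_left_mono)
    then show "\<exists>C. \<forall>i. norm (S (f i) + s * T (f i)) \<le> C" by blast
  qed (simp_all add: tempered_off[OF S] tempered_off[OF T] tempered_add[OF S] tempered_add[OF T]
      tempered_cmult[OF S] tempered_cmult[OF T] algebra_simps)
qed

lemma rapid_pair_bandpass:
  assumes mod: "modulation \<psi> r R" and C: "OM wt2 C"
  shows "rapid_pair (\<lambda>k. bandpass \<psi> (int k)) C"
  unfolding rapid_pair_def
proof (intro conjI C disjI1 allI)
  have "OM wt (\<lambda>k \<eta>. complex_of_real (2 powr (real_of_int (int k) * real N)) * bandpass \<psi> (int k) \<eta>)" for N
    by (rule OM_reindex[OF OM_bandpass_rapid[OF mod]])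
  note * = this[simplified]
  show "OM wt (\<lambda>k \<eta>. complex_of_real (2 powr (real k * real N)) * bandpass \<psi> (int k) \<eta>)" for N by (rule *)
  show "OM wt (\<lambda>k. bandpass \<psi> (int k))" using *[of 0] by simp
qed

lemma rapid_pair_conv_bandpass:
  assumes mod: "modulation \<psi> r R" and c: "Sym c" and w: "OM wt w"
  shows "rapid_pair w (\<lambda>k. conv (Finv (bandpass \<psi> (int k))) 1 c)"
  unfolding rapid_pair_def
proof (intro conjI w disjI2 allI)
  have "OM wt2 (\<lambda>k z. complex_of_real (2 powr (real_of_int (int k) * real N)) * conv (Finv (bandpass \<psi> (int k))) 1 c z)" for N
    by (rule OM_reindex[OF OM_conv_bandpass_rapid[OF mod c]])
  note * = this[simplified]
  show "OM wt2 (\<lambda>k z. complex_of_real (2 powr (real k * real N)) * conv (Finv (bandpass \<psi> (int k))) 1 c z)" for N by (rule *)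
  show "OM wt2 (\<lambda>k. conv (Finv (bandpass \<psi> (int k))) 1 c)" using *[of 0] by simp
qed

text \<open>For h = 0 the condition would read 2R < r, against r < R. Positivity of h makes every k
  >= h a positive index, where the band multiplier is a dilate of \<open>phi \<psi>\<close>.\<close>

lemma modulation_h_pos:
  assumes "modulation \<psi> r R" "2 * R < r * 2 ^ h"
  shows "0 < h"
  using assms by (cases h) (auto simp: modulation_def)

text \<open>The restriction h <= k in the definition is absorbed by the low pass, which is zero at
  negative indices.\<close>

lemma sym1_series:
  assumes \<psi>: "\<psi> \<in> Schwartz" and a: "Sym a" and h: "0 < h"
  shows "sym1 \<psi> h a = (\<lambda>z. \<Sum>k. conv (Finv (lowpass \<psi> (int k - int h))) 1 a z * bandpass \<psi> (int k) (snd z))"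
proof -
  have "(if h \<le> k then sym_up \<psi> a (int k - int h) z * phi \<psi> ((2 powr - real k) *\<^sub>R snd z) else 0)
    = conv (Finv (lowpass \<psi> (int k - int h))) 1 a z * bandpass \<psi> (int k) (snd z)" for k z
  proof (cases "h \<le> k")
    case True
    then show ?thesis using h by (simp add: sym_up_lowpass xmult_conv[OF lowpass_Schwartz[OF \<psi>] a] bandpass_pos dilate_def)
  next
    case False
    then have "lowpass \<psi> (int k - int h) = (\<lambda>_. 0)" by (simp add: lowpass_def)
    then show ?thesis using False by (simp add: conv_Finv_zero)
  qed
  then show ?thesis unfolding sym1_def by simp
qed

lemma sym3_series:
  assumes \<psi>: "\<psi> \<in> Schwartz" and a: "Sym a"
  shows "sym3 \<psi> h a = (\<lambda>z. \<Sum>k. conv (Finv (bandpass \<psi> (int k))) 1 a z * lowpass \<psi> (int k - int h) (snd z))"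
proof -
  have "(if h \<le> k then sym_low \<psi> a (int k) z * \<psi> ((2 powr - real (k - h)) *\<^sub>R snd z) else 0)
    = conv (Finv (bandpass \<psi> (int k))) 1 a z * lowpass \<psi> (int k - int h) (snd z)" for k z
  proof (cases "h \<le> k")
    case True
    then show ?thesis by (simp add: sym_low_bandpass xmult_conv[OF bandpass_Schwartz[OF \<psi>] a] lowpass_def dilate_def of_nat_diff)
  qed (simp add: lowpass_def)
  then show ?thesis unfolding sym3_def by simp
qed

text \<open>Two different mechanisms: in the first series the cutoff in \<eta> annihilates high
  bands, in the third it is the cutoff in the x-frequency, through
  \<open>conv_conv_zero\<close>.\<close>

lemma regsym_disjoint:
  assumes mod: "modulation \<psi> r R" and a: "Sym a" and \<Psi>: "\<Psi> \<in> cutoffs"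
  shows "\<exists>K. \<forall>k\<ge>K. \<forall>z. regsym \<Psi> m (A k) z * bandpass \<psi> (int k) (snd z) = 0"
    and "\<exists>K. \<forall>k\<ge>K. \<forall>z. regsym \<Psi> m (conv (Finv (bandpass \<psi> (int k))) 1 a) z * w k (snd z) = 0"
proof -
  obtain K where K: "\<And>k \<xi>. k \<ge> K \<Longrightarrow> \<Psi> ((2 powr - real m) *\<^sub>R \<xi>) * bandpass \<psi> (int k) \<xi> = 0"
    using bandpass_cutoff_disjoint[OF mod \<Psi>, of m] by blast
  show "\<exists>K. \<forall>k\<ge>K. \<forall>z. regsym \<Psi> m (A k) z * bandpass \<psi> (int k) (snd z) = 0"
    using K unfolding regsym_def by (intro exI[of _ K] allI impI) (simp add: mult.assoc)
  have "regsym \<Psi> m (conv (Finv (bandpass \<psi> (int k))) 1 a) z = 0" if "k \<ge> K" for k z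
  proof -
    note S = modulationD(2)[OF mod] and P = cutoffD(2)[OF \<Psi>]
    have "conv (Finv (dilate (2 powr - real m) \<Psi>)) 1 (conv (Finv (bandpass \<psi> (int k))) 1 a) z = 0"
      by (rule conv_conv_zero[OF dilate_Schwartz[OF P] bandpass_Schwartz[OF S] _ a]) (use K[OF that] in \<open>simp_all add: dilate_def\<close>)
    then show ?thesis
      unfolding regsym_conv[OF \<Psi> Sym_conv_Finv[OF bandpass_Schwartz[OF S] a]]
      using conv_Finv_dilate[OF P Sym_conv_Finv[OF bandpass_Schwartz[OF S] a, of k 1], of "2 powr - real m"] by simp
  qed
  then show "\<exists>K. \<forall>k\<ge>K. \<forall>z. regsym \<Psi> m (conv (Finv (bandpass \<psi> (int k))) 1 a) z * w k (snd z) = 0" by auto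
qed

text \<open>The series symbols \<open>b1\<close> and \<open>b3\<close> are not known to satisfy
  \<open>Sym\<close>. Integrability and \<open>nice\<close> are therefore supplied as separate
  hypotheses, to make averaging and \<open>OP\<close> additive.\<close>

lemma OP_regsym_diff:
  fixes a b1 b3 :: "'a::euclidean_space \<times> 'a \<Rightarrow> complex"
  assumes u: "tempered u" and a: "Sym a" and \<Psi>: "\<Psi> \<in> cutoffs" and \<phi>: "\<phi> \<in> test"
    and i1: "\<And>z. integrable lborel (\<lambda>y. Finv (dilate (2 powr - real m) \<Psi>) y * b1 (fst z - y, snd z))"
    and i3: "\<And>z. integrable lborel (\<lambda>y. Finv (dilate (2 powr - real m) \<Psi>) y * b3 (fst z - y, snd z))"
    and n: "nice u (regsym \<Psi> m a)" "nice u (regsym \<Psi> m b1)" "nice u (regsym \<Psi> m b3)"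
  shows "OP (regsym \<Psi> m (\<lambda>z. a z - b1 z - b3 z)) u \<phi>
    = OP (regsym \<Psi> m a) u \<phi> - OP (regsym \<Psi> m b1) u \<phi> - OP (regsym \<Psi> m b3) u \<phi>"
proof -
  let ?k = "Finv (dilate (2 powr - real m) \<Psi>)"
  have "?k \<in> Schwartz" by (intro Finv_Schwartz dilate_Schwartz cutoffD(2)[OF \<Psi>]) simp
  from conv_integrable[OF this a, where t = 1]
  have ia: "integrable lborel (\<lambda>y. ?k y * a (fst z - y, snd z))" for z
    by (simp add: plus_prod_def)
  have xd: "xmult (dilate (2 powr - real m) \<Psi>) (\<lambda>z. a z - b1 z - b3 z) z
    = xmult (dilate (2 powr - real m) \<Psi>) a z - xmult (dilate (2 powr - real m) \<Psi>) b1 z - xmult (dilate (2 powr - real m) \<Psi>) b3 z" for z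
    unfolding xmult_def
    using Bochner_Integration.integral_diff[OF Bochner_Integration.integrable_diff[OF ia[of z] i1[of z]] i3[of z]]
      Bochner_Integration.integral_diff[OF ia[of z] i1[of z]] by (simp add: right_diff_distrib)
  have e: "regsym \<Psi> m (\<lambda>z. a z - b1 z - b3 z) = (\<lambda>z. (regsym \<Psi> m a z + (-1) * regsym \<Psi> m b1 z) + (-1) * regsym \<Psi> m b3 z)"
    unfolding regsym_def xd by (simp add: fun_eq_iff algebra_simps)
  show ?thesis
    unfolding e nice_lin(2)[OF u nice_lin(1)[OF u n(1,2)] n(3) \<phi>] nice_lin(2)[OF u n(1,2) \<phi>] by simp
qed

text \<open>Every term is a \<open>piece\<close> with one multiplier on \<open>u\<close> and one on
  the symbol. The first and third series are rapid pairs and are treated by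
  \<open>series_symbol\<close>. The second operator is the difference of the whole and the other
  two, and that its own series has this sum follows by telescoping.\<close>

lemma paradifferential_decomposition:
  fixes a :: "'a::euclidean_space \<times> 'a \<Rightarrow> complex"
  assumes ac: "dual a c" and u: "tempered u" and mod: "modulation \<psi> r R" and h: "0 < h"
  shows "series_terms_defined \<psi> h a u \<and>
    u \<in> dom11 (sym1 \<psi> h a) \<and> u \<in> dom11 (sym2 \<psi> h a) \<and> u \<in> dom11 (sym3 \<psi> h a) \<and>
    rapid_conv (series1 \<psi> h a u) (typ11 (sym1 \<psi> h a) u) \<and>
    rapid_conv (series2 \<psi> h a u) (typ11 (sym2 \<psi> h a) u) \<and>
    rapid_conv (series3 \<psi> h a u) (typ11 (sym3 \<psi> h a) u) \<and>
    typ11 a u = dadd (dadd (typ11 (sym1 \<psi> h a) u) (typ11 (sym2 \<psi> h a) u)) (typ11 (sym3 \<psi> h a) u)"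
proof -
  have a: "Sym a" and c: "Sym c" using ac unfolding dual_def by auto
  note \<psi> = modulationD(2)[OF mod]
  note US = lowpass_Schwartz[OF \<psi>] and LS = bandpass_Schwartz[OF \<psi>]
  define l where "l k = bandpass \<psi> (int k)" for k
  define v where "v k = lowpass \<psi> (int k)" for k
  define s where "s k = lowpass \<psi> (int k - int h)" for k
  define p where "p k = lowpass \<psi> (int k - 1)" for k
  have S: "l k \<in> Schwartz" "v k \<in> Schwartz" "s k \<in> Schwartz" "p k \<in> Schwartz" for k
    unfolding l_def v_def s_def p_def by (rule LS US)+
  let ?vs = "\<lambda>k \<xi>. v k \<xi> - s k \<xi>" and ?ps = "\<lambda>k \<xi>. p k \<xi> - s k \<xi>"
  have S2: "?vs k \<in> Schwartz" "?ps k \<in> Schwartz" for k by (intro Schwartz_diff S)+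
  have ld: "l k = (\<lambda>\<xi>. v k \<xi> - p k \<xi>)" for k by (simp add: l_def v_def p_def bandpass_def)
  note td = typ11_fmult[OF ac u Mul_Schwartz]
  have sd: "sym_diff (sym_up \<psi> a (int k)) (sym_up \<psi> a (int k - int h)) = xmult (?vs k) a" for k
    unfolding sym_up_lowpass xmult_diff[OF US US a] v_def s_def ..
  have dd: "ddiff (dist_up \<psi> u (int k - 1)) (dist_up \<psi> u (int k - int h)) = fmult (?ps k) u" for k
    unfolding dist_up_lowpass[OF u] fmult_diff[OF u Mul_lowpass[OF \<psi>] Mul_lowpass[OF \<psi>]] p_def s_def ..
  have e: "sym_up \<psi> a (int k - int h) = xmult (s k) a" "dist_low \<psi> u (int k) = fmult (l k) u"
    "sym_low \<psi> a (int k) = xmult (l k) a" "dist_up \<psi> u (int k - int h) = fmult (s k) u" for k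
    by (simp_all add: sym_up_lowpass sym_low_bandpass dist_low_bandpass[OF u] dist_up_lowpass[OF u] s_def l_def)
  have terms: "series_terms_defined \<psi> h a u"
    unfolding series_terms_defined_def sd dd unfolding e by (intro conjI allI impI td(1) S S2)

  let ?P = "piece u c"
  define D1 where "D1 k = ?P (l k) (s k)" for k
  define D2 where "D2 k \<phi> = ?P (l k) (?vs k) \<phi> + ?P (?ps k) (l k) \<phi>" for k \<phi>
  define D3 where "D3 k = ?P (s k) (l k)" for k
  \<comment> \<open>For k < h the pieces of the first and third series vanish, in agreement with the
    value \<open>dzero\<close> in their definitions.\<close>
  have s0: "s k = (\<lambda>_. 0)" if "k < h" for k using that by (simp add: s_def lowpass_def)
  have ser1: "series1 \<psi> h a u = (\<lambda>k. res (D1 k))"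
  proof
    fix k show "series1 \<psi> h a u k = res (D1 k)"
    proof (cases "k < h")
      case True
      have "res (D1 k) = dzero" unfolding D1_def s0[OF True] by (rule res_zero[OF piece_zero_m[OF u S(1)]])
      with True show ?thesis by (simp add: series1_def)
    next
      case False
      with td(2)[OF S(1) S(3), of k k] show ?thesis by (simp add: series1_def e D1_def piece_def)
    qed
  qed
  have ser3: "series3 \<psi> h a u = (\<lambda>k. res (D3 k))"
  proof
    fix k show "series3 \<psi> h a u k = res (D3 k)"
    proof (cases "k < h")
      case True
      have "res (D3 k) = dzero" unfolding D3_def s0[OF True] by (rule res_zero[OF piece_zero_w[OF u c S(1)]])
      with True show ?thesis by (simp add: series3_def)
    next
      case False
      with td(2)[OF S(3) S(1), of k k] show ?thesis by (simp add: series3_def e D3_def piece_def)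
    qed
  qed
  have ser2: "series2 \<psi> h a u = (\<lambda>k. res (D2 k))"
    unfolding series2_def sd dd unfolding e td(2)[OF S(1) S2(1)] td(2)[OF S2(2) S(1)] res_add D2_def[abs_def] piece_def ..

  have Os: "OM wt s" unfolding s_def by (rule OM_reindex[OF OM_lowpass[OF \<psi>]])
  have Ops: "OM wt ?ps" unfolding s_def p_def
    by (rule OM_diff[OF OM_reindex[OF OM_lowpass[OF \<psi>], where r = "\<lambda>k. int k - 1"] OM_reindex[OF OM_lowpass[OF \<psi>], where r = "\<lambda>k. int k - int h"]]) simp
  have Cs: "OM wt2 (\<lambda>k. conv (Finv (s k)) 1 b)" if "Sym b" for b
    unfolding s_def by (rule OM_reindex[OF OM_conv_lowpass[OF \<psi> that]])
  have Cv: "OM wt2 (\<lambda>k. conv (Finv (v k)) 1 c)"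
    unfolding v_def by (rule OM_reindex[OF OM_conv_lowpass[OF \<psi> c]])
  have Cvs: "OM wt2 (\<lambda>k. conv (Finv (?vs k)) 1 c)"
    unfolding conv_Finv_diff[OF S(2) S(3) c] by (rule OM_diff[OF Cv Cs[OF c]]) simp
  have rp1: "rapid_pair l (\<lambda>k. conv (Finv (s k)) 1 b)" if "Sym b" for b
    unfolding l_def[abs_def] by (rule rapid_pair_bandpass[OF mod Cs[OF that]])
  have rp3: "rapid_pair s (\<lambda>k. conv (Finv (l k)) 1 b)" if "Sym b" for b
    unfolding l_def[abs_def] by (rule rapid_pair_conv_bandpass[OF mod that Os])
  have rp2: "rapid_pair l (\<lambda>k. conv (Finv (?vs k)) 1 c)"
    unfolding l_def[abs_def] by (rule rapid_pair_bandpass[OF mod Cvs])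
  have rp2': "rapid_pair ?ps (\<lambda>k. conv (Finv (l k)) 1 c)"
    unfolding l_def[abs_def] by (rule rapid_pair_conv_bandpass[OF mod c Ops])

  define T1 where "T1 \<phi> = (\<Sum>k. D1 k \<phi>)" for \<phi>
  define T3 where "T3 \<phi> = (\<Sum>k. D3 k \<phi>)" for \<phi>
  define Ta where "Ta = transp u (\<lambda>_. 1) c"
  \<comment> \<open>Forced by the definition of the second symbol as a difference.\<close>
  define T2 where "T2 \<phi> = Ta \<phi> - T1 \<phi> - T3 \<phi>" for \<phi>
  have T1: "tempered T1" and s1: "\<And>\<phi>. \<phi> \<in> Schwartz \<Longrightarrow> (\<lambda>k. D1 k \<phi>) sums T1 \<phi>"
    unfolding T1_def D1_def piece_def using tempered_series[OF u rp1[OF c]] by (auto intro: summable_sums)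
  have T3: "tempered T3" and s3: "\<And>\<phi>. \<phi> \<in> Schwartz \<Longrightarrow> (\<lambda>k. D3 k \<phi>) sums T3 \<phi>"
    unfolding T3_def D3_def piece_def using tempered_series[OF u rp3[OF c]] by (auto intro: summable_sums)
  have Ta: "tempered Ta" unfolding Ta_def by (rule tempered_transp[OF u Mul_one c])
  have T2: "tempered T2"
    using tempered_plus[OF tempered_plus[OF Ta T1, of "-1"] T3, of "-1"] unfolding T2_def by simp

  have dS: "dual (conv (Finv (s k)) 1 a) (conv (Finv (s k)) 1 c)" "dual (conv (Finv (l k)) 1 a) (conv (Finv (l k)) 1 c)" for k
    by (intro dual_conv[OF ac] Finv_Schwartz S)+
  have y1: "sym1 \<psi> h a = (\<lambda>z. \<Sum>k. conv (Finv (s k)) 1 a z * l k (snd z))"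
    unfolding s_def l_def by (rule sym1_series[OF \<psi> a h])
  have y3: "sym3 \<psi> h a = (\<lambda>z. \<Sum>k. conv (Finv (l k)) 1 a z * s k (snd z))"
    unfolding s_def l_def by (rule sym3_series[OF \<psi> a])
  have f1: "\<exists>K. \<forall>k\<ge>K. \<forall>z. regsym \<Psi> m (conv (Finv (s k)) 1 a) z * l k (snd z) = 0" if "\<Psi> \<in> cutoffs" for \<Psi> m
    unfolding l_def by (rule regsym_disjoint(1)[OF mod a that])
  have f3: "\<exists>K. \<forall>k\<ge>K. \<forall>z. regsym \<Psi> m (conv (Finv (l k)) 1 a) z * s k (snd z) = 0" if "\<Psi> \<in> cutoffs" for \<Psi> m
    unfolding l_def by (rule regsym_disjoint(2)[OF mod a that])
  note Q1 = series_symbol[OF u dS(1) rp1[OF c] rp1[OF a] f1 _ y1]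
  note Q3 = series_symbol[OF u dS(2) rp3[OF c] rp3[OF a] f3 _ y3]
  have lim1: "(\<lambda>m. OP (regsym \<Psi> m (sym1 \<psi> h a)) u \<phi>) \<longlonglongrightarrow> T1 \<phi>"
    and lim3: "(\<lambda>m. OP (regsym \<Psi> m (sym3 \<psi> h a)) u \<phi>) \<longlonglongrightarrow> T3 \<phi>"
    and lim2: "(\<lambda>m. OP (regsym \<Psi> m (sym2 \<psi> h a)) u \<phi>) \<longlonglongrightarrow> T2 \<phi>" if \<Psi>: "\<Psi> \<in> cutoffs" and \<phi>: "\<phi> \<in> test" for \<Psi> \<phi>
  proof -
    show l1: "(\<lambda>m. OP (regsym \<Psi> m (sym1 \<psi> h a)) u \<phi>) \<longlonglongrightarrow> T1 \<phi>"
      unfolding T1_def D1_def piece_def by (rule Q1(3)[OF _ \<Psi> \<phi>])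
    show l3: "(\<lambda>m. OP (regsym \<Psi> m (sym3 \<psi> h a)) u \<phi>) \<longlonglongrightarrow> T3 \<phi>"
      unfolding T3_def D3_def piece_def by (rule Q3(3)[OF _ \<Psi> \<phi>])
    have eq: "OP (regsym \<Psi> m (sym2 \<psi> h a)) u \<phi> = OP (regsym \<Psi> m a) u \<phi> - OP (regsym \<Psi> m (sym1 \<psi> h a)) u \<phi> - OP (regsym \<Psi> m (sym3 \<psi> h a)) u \<phi>" for m
      unfolding sym2_def
      by (rule OP_regsym_diff[OF u a \<Psi> \<phi> Q1(1)[OF _ \<Psi>] Q3(1)[OF _ \<Psi>] dual_typ11(3)[OF ac u \<Psi>] Q1(2)[OF _ \<Psi>] Q3(2)[OF _ \<Psi>]])
    show "(\<lambda>m. OP (regsym \<Psi> m (sym2 \<psi> h a)) u \<phi>) \<longlonglongrightarrow> T2 \<phi>"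
      unfolding eq T2_def Ta_def by (intro tendsto_diff l1 l3 dual_typ11(4)[OF ac u \<Psi> \<phi>])
  qed
  have t1: "u \<in> dom11 (sym1 \<psi> h a)" "typ11 (sym1 \<psi> h a) u = res T1"
    by (rule typ11I[OF u], erule (1) lim1)+
  have t2: "u \<in> dom11 (sym2 \<psi> h a)" "typ11 (sym2 \<psi> h a) u = res T2"
    by (rule typ11I[OF u], erule (1) lim2)+
  have t3: "u \<in> dom11 (sym3 \<psi> h a)" "typ11 (sym3 \<psi> h a) u = res T3"
    by (rule typ11I[OF u], erule (1) lim3)+

  have s2: "(\<lambda>k. D2 k \<phi>) sums T2 \<phi>" if \<phi>: "\<phi> \<in> Schwartz" for \<phi>
  proof -
    \<comment> \<open>The parts containing \<open>s\<close> cancel: \<open>D1\<close> restores the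
      symbol multiplier from v - s to v, and \<open>D3\<close> the multiplier on \<open>u\<close>
      from p - s to p. What remains is a difference of products, P(v,v) - P(p,p).\<close>
    have tel: "(\<Sum>k<n. D1 k \<phi> + D2 k \<phi> + D3 k \<phi>) = ?P (p n) (p n) \<phi>" for n
    proof (induction n)
      case 0
      have "p 0 = (\<lambda>_. 0)" by (simp add: p_def lowpass_def)
      then show ?case using piece_zero_w[OF u c Schwartz_zero, of \<phi>] by simp
    next
      case (Suc n)
      have "D1 n \<phi> + D2 n \<phi> + D3 n \<phi> = ?P (l n) (v n) \<phi> + ?P (p n) (l n) \<phi>"
        unfolding D1_def D2_def D3_def piece_diff_m[OF u c S(1) S(2) S(3)] piece_diff_w[OF u c S(4) S(3) S(1)] by simp
      also have "\<dots> = ?P (v n) (v n) \<phi> - ?P (p n) (p n) \<phi>"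
        unfolding ld piece_diff_w[OF u c S(2) S(4) S(2)] piece_diff_m[OF u c S(4) S(2) S(4)] by simp
      finally show ?case using Suc.IH by (simp add: p_def v_def)
    qed
    \<comment> \<open>This is the regularisation of a(x,D)u with the modulation function itself as
      the cutoff, so \<open>transp_limit\<close> identifies the limit.\<close>
    have "(\<lambda>n. ?P (v n) (v n) \<phi>) \<longlonglongrightarrow> Ta \<phi>"
      using transp_limit[OF u Mul_one c modulationD(1)[OF mod] \<phi>]
      by (simp add: v_def[abs_def] lowpass_def dilate_def[abs_def] piece_def Ta_def conv_Finv_dilate[OF \<psi> c, unfolded dilate_def])
    \<comment> \<open>The low pass \<open>p\<close> lags one index behind \<open>v\<close>, whence
      the shift by one in the partial sums.\<close>
    then have "(\<lambda>n. ?P (p (Suc n)) (p (Suc n)) \<phi>) \<longlonglongrightarrow> Ta \<phi>" by (simp add: p_def v_def)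
    then have "(\<lambda>k. D1 k \<phi> + D2 k \<phi> + D3 k \<phi>) sums Ta \<phi>"
      unfolding sums_def tel by (rule LIMSEQ_imp_Suc)
    from sums_diff[OF sums_diff[OF this s1[OF \<phi>]] s3[OF \<phi>]] show ?thesis unfolding T2_def by simp
  qed

  have r1: "rapid_conv (series1 \<psi> h a u) (typ11 (sym1 \<psi> h a) u)"
    unfolding ser1 t1(2)
  proof (rule rapid_convI[OF _ T1 _ s1])
    show "tempered (D1 k)" for k unfolding D1_def by (rule tempered_piece[OF u c S(1) S(3)])
    show "\<exists>K. \<forall>k. 2 powr (real k * real N) * norm (D1 k \<phi>) \<le> K" if "\<phi> \<in> Schwartz" for \<phi> N
      unfolding D1_def piece_def using rapid_pair_bound[OF rp1[OF c] u Schwartz_RD_const[OF that], of N] by auto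
  qed
  have r3: "rapid_conv (series3 \<psi> h a u) (typ11 (sym3 \<psi> h a) u)"
    unfolding ser3 t3(2)
  proof (rule rapid_convI[OF _ T3 _ s3])
    show "tempered (D3 k)" for k unfolding D3_def by (rule tempered_piece[OF u c S(3) S(1)])
    show "\<exists>K. \<forall>k. 2 powr (real k * real N) * norm (D3 k \<phi>) \<le> K" if "\<phi> \<in> Schwartz" for \<phi> N
      unfolding D3_def piece_def using rapid_pair_bound[OF rp3[OF c] u Schwartz_RD_const[OF that], of N] by auto
  qed
  have r2: "rapid_conv (series2 \<psi> h a u) (typ11 (sym2 \<psi> h a) u)"
    unfolding ser2 t2(2)
  proof (rule rapid_convI[OF _ T2 _ s2])
    show "tempered (D2 k)" for k
      using tempered_plus[OF tempered_piece[OF u c S(1) S2(1)] tempered_piece[OF u c S2(2) S(1)], of k k 1 k] 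
      unfolding D2_def by simp
    show "\<exists>K. \<forall>k. 2 powr (real k * real N) * norm (D2 k \<phi>) \<le> K" if \<phi>: "\<phi> \<in> Schwartz" for \<phi> N
    proof -
      obtain K where K: "\<And>k. 2 powr (real k * real N) * norm (?P (l k) (?vs k) \<phi>) \<le> K"
        using rapid_pair_bound[OF rp2 u Schwartz_RD_const[OF \<phi>], of N] unfolding piece_def by auto
      obtain K' where K': "\<And>k. 2 powr (real k * real N) * norm (?P (?ps k) (l k) \<phi>) \<le> K'"
        using rapid_pair_bound[OF rp2' u Schwartz_RD_const[OF \<phi>], of N] unfolding piece_def by auto
      have "2 powr (real k * real N) * norm (D2 k \<phi>) \<le> K + K'" for k
      proof -
        have "2 powr (real k * real N) * norm (D2 k \<phi>)
          \<le> 2 powr (real k * real N) * (norm (?P (l k) (?vs k) \<phi>) + norm (?P (?ps k) (l k) \<phi>))"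
          unfolding D2_def by (intro mult_left_mono norm_triangle_ineq) simp
        also have "\<dots> \<le> K + K'" using add_mono[OF K[of k] K'[of k]] by (simp add: distrib_left)
        finally show ?thesis .
      qed
      then show ?thesis by blast
    qed
  qed
  have "typ11 a u = res Ta" unfolding Ta_def by (rule dual_typ11(2)[OF ac u])
  also have "\<dots> = dadd (dadd (res T1) (res T2)) (res T3)"
    unfolding res_add by (simp add: T2_def)
  finally have total: "typ11 a u = dadd (dadd (typ11 (sym1 \<psi> h a) u) (typ11 (sym2 \<psi> h a) u)) (typ11 (sym3 \<psi> h a) u)"
    unfolding t1(2) t2(2) t3(2) .
  show ?thesis by (intro conjI terms t1(1) t2(1) t3(1) r1 r2 r3 total)
qed

theorem mainTheorem16:
  fixes a :: "((real^'n) \<times> (real^'n)) \<Rightarrow> complex" and d :: real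
  assumes "a \<in> tS11 d"
  shows "dom11 a = {u. tempered u}
    \<and> (\<forall>u. tempered u \<longrightarrow> (\<exists>S. extends_to (typ11 a u) S))
    \<and> (\<forall>us u. (\<forall>m. tempered (us m)) \<longrightarrow> tempered u \<longrightarrow>
          (\<forall>\<phi>\<in>Schwartz. (\<lambda>m. us m \<phi>) \<longlonglongrightarrow> u \<phi>) \<longrightarrow>
          (\<forall>\<phi>\<in>Schwartz. (\<lambda>m. text_ext (typ11 a (us m)) \<phi>) \<longlonglongrightarrow> text_ext (typ11 a u) \<phi>))
    \<and> (\<exists>b \<in> S11 d. \<forall>\<phi>\<in>Schwartz. \<exists>g\<in>Schwartz.
          fdist \<phi> \<in> dom11 b \<and> extends_to (typ11 b (fdist \<phi>)) (fdist g) \<and>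
          (\<forall>u. tempered u \<longrightarrow>
             text_ext (typ11 a u) (\<lambda>x. cnj (\<phi> x)) = u (\<lambda>x. cnj (g x))))
    \<and> (\<forall>(\<psi> :: (real^'n) \<Rightarrow> complex) r R h. modulation \<psi> r R \<and> 2 * R < r * 2 ^ h \<longrightarrow>
         (\<forall>u. tempered u \<longrightarrow>
            series_terms_defined \<psi> h a u \<and>
            u \<in> dom11 (sym1 \<psi> h a) \<and> u \<in> dom11 (sym2 \<psi> h a) \<and> u \<in> dom11 (sym3 \<psi> h a) \<and>
            rapid_conv (series1 \<psi> h a u) (typ11 (sym1 \<psi> h a) u) \<and>
            rapid_conv (series2 \<psi> h a u) (typ11 (sym2 \<psi> h a) u) \<and>
            rapid_conv (series3 \<psi> h a u) (typ11 (sym3 \<psi> h a) u) \<and>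
            typ11 a u = dadd (dadd (typ11 (sym1 \<psi> h a) u) (typ11 (sym2 \<psi> h a) u))
                             (typ11 (sym3 \<psi> h a) u)))"
proof -
  obtain b where aS: "a \<in> S11 d" and bS: "b \<in> S11 d" and adj: "is_adjoint_symbol a b"
    using assms unfolding tS11_def by blast
  define c where "c z = cnj (b z)" for z
  have ac: "dual a c" unfolding c_def by (rule dual_of_adjoint[OF S11_Sym[OF aS] S11_Sym[OF bS] adj])
  then have c: "Sym c" unfolding dual_def by blast
  have b: "b = (\<lambda>z. cnj (c z))" by (simp add: c_def)
  \<comment> \<open>Continuity becomes immediate: the value is \<open>u\<close> at a Schwartz
    function that does not depend on \<open>u\<close>.\<close>
  have ext: "text_ext (typ11 a u) \<phi> = u (Qop c \<phi>)" if "tempered u" "\<phi> \<in> Schwartz" for u \<phi>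
    unfolding dual_typ11(2)[OF ac that(1)] text_ext_res[OF tempered_transp[OF that(1) Mul_one c]] by (rule transp_one[OF that(1) c that(2)])
  show ?thesis
  proof (intro conjI)
    show "dom11 a = {u. tempered u}" using dual_typ11(1)[OF ac] by (auto simp: dom11_def[of a])
    show "\<forall>u. tempered u \<longrightarrow> (\<exists>S. extends_to (typ11 a u) S)"
    proof (intro allI impI)
      fix u :: "(real^'n \<Rightarrow> complex) \<Rightarrow> complex" assume u: "tempered u"
      show "\<exists>S. extends_to (typ11 a u) S"
        unfolding dual_typ11(2)[OF ac u] using extends_res[OF tempered_transp[OF u Mul_one c]] by blast
    qed
    show "\<forall>us u. (\<forall>m. tempered (us m)) \<longrightarrow> tempered u \<longrightarrow>
          (\<forall>\<phi>\<in>Schwartz. (\<lambda>m. us m \<phi>) \<longlonglongrightarrow> u \<phi>) \<longrightarrow>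
          (\<forall>\<phi>\<in>Schwartz. (\<lambda>m. text_ext (typ11 a (us m)) \<phi>) \<longlonglongrightarrow> text_ext (typ11 a u) \<phi>)"
    proof (intro allI impI ballI)
      fix us :: "nat \<Rightarrow> (real^'n \<Rightarrow> complex) \<Rightarrow> complex" and u :: "(real^'n \<Rightarrow> complex) \<Rightarrow> complex" and \<phi> :: "real^'n \<Rightarrow> complex"
      assume us: "\<forall>m. tempered (us m)" and u: "tempered u" and lim: "\<forall>\<phi>\<in>Schwartz. (\<lambda>m. us m \<phi>) \<longlonglongrightarrow> u \<phi>" and \<phi>: "\<phi> \<in> Schwartz"
      show "(\<lambda>m. text_ext (typ11 a (us m)) \<phi>) \<longlonglongrightarrow> text_ext (typ11 a u) \<phi>"
        unfolding ext[OF spec[OF us] \<phi>] ext[OF u \<phi>] by (rule bspec[OF lim Qop_Schwartz[OF c \<phi>]])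
    qed
    show "\<exists>b \<in> S11 d. \<forall>\<phi>\<in>Schwartz. \<exists>g\<in>Schwartz.
          fdist \<phi> \<in> dom11 b \<and> extends_to (typ11 b (fdist \<phi>)) (fdist g) \<and>
          (\<forall>u. tempered u \<longrightarrow> text_ext (typ11 a u) (\<lambda>x. cnj (\<phi> x)) = u (\<lambda>x. cnj (g x)))"
    \<comment> \<open>The adjoint symbol of the hypothesis is itself the symbol of the adjoint
      operator.\<close>
    proof (rule bexI[OF _ bS], rule ballI)
      fix \<phi> :: "real^'n \<Rightarrow> complex" assume \<phi>: "\<phi> \<in> Schwartz"
      note D = typ11_dual_test[OF ac \<phi>, folded b]
      show "\<exists>g\<in>Schwartz. fdist \<phi> \<in> dom11 b \<and> extends_to (typ11 b (fdist \<phi>)) (fdist g) \<and>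
          (\<forall>u. tempered u \<longrightarrow> text_ext (typ11 a u) (\<lambda>x. cnj (\<phi> x)) = u (\<lambda>x. cnj (g x)))"
        by (rule bexI[OF _ D(1)]) (intro conjI allI impI D(2-4))
    qed
  qed (intro allI impI paradifferential_decomposition[OF ac], auto dest: modulation_h_pos)
qed

end
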